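(* Let $Z$ be an integral scheme. Any locally quaternion $\mathcal{O}_Z$-algebra is quaternion. Any locally even Clifford $\mathcal{O}_Z$-algebra of rank four is quaternion.
   Context: All schemes are noetherian and over a field $k$ of characteristic not $2$. An $\mathcal{O}_Z$-algebra $A$ is quaternion if it is locally free of rank four and there is a linear map $\mathrm{tr}:A\to\mathcal{O}_Z$ such that $\frac12\mathrm{tr}$ splits the inclusion $\mathcal{O}_Z\to A$ and any section $a\in A$ satisfies $a^2-\mathrm{tr}(a)a+g=0$ for some $g\in\mathcal{O}_Z$. Even Clifford algebra: for a quadratic form $Q:\mathrm{Sym}^2V\to\mathcal{L}$ on a vector bundle $V$ with values in a line bundle $\mathcal{L}$ ($\mathrm{Sym}^2V\subset V\otimes V$ being the symmetric tensors, with $\frac12(v\otimes w+w\otimes v)\mapsto Q(v,w)$), $Cl_\bullet(Q)$ is the quotient of $T(V)\otimes_Z(\bigoplus_{j\in\mathbb{Z}}\mathcal{L}^j)$ by the two-sided ideal generated by $t-Q(t)$, $t\in\mathrm{Sym}^2V$; it is $\mathbb{Z}$-graded with $V$ in degree $1$ and $\mathcal{L}$ in degree $2$, and $Cl_0(Q)$ is its degree $0$ part. It has rank $4$ when $V$ has rank $3$. An algebra $A$ is locally quaternion (respectively locally even Clifford) if the localization of $A$ at any point of $Z$ is quaternion (respectively isomorphic to an even Clifford algebra $Cl_0(Q)$).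
   Formalization: The algebra is also assumed of finite type as an O_Z-module; otherwise the first claim fails on the affine line over an infinite field for O+M+O+O, last three summands multiplying to zero, M generated by all 1/(x-a). *)

theory Defs
  imports
    "HOL-Analysis.Abstract_Topology"
    "HOL-Algebra.QuotRing"
    "HOL-Algebra.Ring_Divisibility"
begin

section \<open>Modules and associative algebras over a commutative ring\<close>

definition with_smult :: "('b, 'm) ring_scheme \<Rightarrow> ('a \<Rightarrow> 'b \<Rightarrow> 'b) \<Rightarrow> ('a, 'b) module" where
  "with_smult R s =
    \<lparr>carrier = carrier R, mult = mult R, one = one R, zero = zero R, add = add R, smult = s\<rparr>"

text \<open>The locale \<open>algebra\<close> of the library is restricted to commutative algebras.\<close>

definition assoc_algebra :: "('r, 'm) ring_scheme \<Rightarrow> ('r, 'a, 'n) module_scheme \<Rightarrow> bool" where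
  "assoc_algebra R A \<longleftrightarrow> Module.module R A \<and> ring A \<and>
    (\<forall>r\<in>carrier R. \<forall>x\<in>carrier A. \<forall>y\<in>carrier A.
       (r \<odot>\<^bsub>A\<^esub> x) \<otimes>\<^bsub>A\<^esub> y = r \<odot>\<^bsub>A\<^esub> (x \<otimes>\<^bsub>A\<^esub> y) \<and>
       x \<otimes>\<^bsub>A\<^esub> (r \<odot>\<^bsub>A\<^esub> y) = r \<odot>\<^bsub>A\<^esub> (x \<otimes>\<^bsub>A\<^esub> y))"

definition algebra_iso ::
  "('r, 'm) ring_scheme \<Rightarrow> ('r, 'a, 'n) module_scheme \<Rightarrow> ('r, 'b, 'o) module_scheme \<Rightarrow> bool" where
  "algebra_iso R A B \<longleftrightarrow>
    (\<exists>h\<in>ring_iso A B. \<forall>r\<in>carrier R. \<forall>x\<in>carrier A. h (r \<odot>\<^bsub>A\<^esub> x) = r \<odot>\<^bsub>B\<^esub> h x)"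

definition is_basis ::
  "('r, 'm) ring_scheme \<Rightarrow> ('r, 'a, 'n) module_scheme \<Rightarrow> nat \<Rightarrow> (nat \<Rightarrow> 'a) \<Rightarrow> bool" where
  "is_basis R M n e \<longleftrightarrow> e \<in> {..<n} \<rightarrow> carrier M \<and>
    (\<forall>x\<in>carrier M. \<exists>!c. c \<in> {..<n} \<rightarrow>\<^sub>E carrier R \<and>
       x = finsum M (\<lambda>i. c i \<odot>\<^bsub>M\<^esub> e i) {..<n})"

definition free_of_rank ::
  "('r, 'm) ring_scheme \<Rightarrow> ('r, 'a, 'n) module_scheme \<Rightarrow> nat \<Rightarrow> bool" where
  "free_of_rank R M n \<longleftrightarrow> (\<exists>e. is_basis R M n e)"

definition linear_map ::
  "('r, 'm) ring_scheme \<Rightarrow> ('r, 'a, 'n) module_scheme \<Rightarrow> ('r, 'b, 'o) module_scheme \<Rightarrow>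
   ('a \<Rightarrow> 'b) \<Rightarrow> bool" where
  "linear_map R M N f \<longleftrightarrow> f \<in> carrier M \<rightarrow> carrier N \<and>
    (\<forall>x\<in>carrier M. \<forall>y\<in>carrier M. f (x \<oplus>\<^bsub>M\<^esub> y) = f x \<oplus>\<^bsub>N\<^esub> f y) \<and>
    (\<forall>r\<in>carrier R. \<forall>x\<in>carrier M. f (r \<odot>\<^bsub>M\<^esub> x) = r \<odot>\<^bsub>N\<^esub> f x)"

abbreviation regular_module :: "('r, 'm) ring_scheme \<Rightarrow> ('r, 'r) module" where
  "regular_module R \<equiv> with_smult R (mult R)"

abbreviation half :: "('r, 'm) ring_scheme \<Rightarrow> 'r" where
  "half R \<equiv> inv\<^bsub>R\<^esub> (\<one>\<^bsub>R\<^esub> \<oplus>\<^bsub>R\<^esub> \<one>\<^bsub>R\<^esub>)"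


section \<open>Quaternion algebras over a ring\<close>

definition quaternion_trace ::
  "('r, 'm) ring_scheme \<Rightarrow> ('r, 'a, 'n) module_scheme \<Rightarrow> ('a \<Rightarrow> 'r) \<Rightarrow> bool" where
  "quaternion_trace R A tr \<longleftrightarrow> linear_map R A (regular_module R) tr \<and>
    (\<forall>r\<in>carrier R. half R \<otimes>\<^bsub>R\<^esub> tr (r \<odot>\<^bsub>A\<^esub> \<one>\<^bsub>A\<^esub>) = r) \<and>
    (\<forall>a\<in>carrier A. \<exists>g\<in>carrier R.
       (a \<otimes>\<^bsub>A\<^esub> a) \<ominus>\<^bsub>A\<^esub> (tr a \<odot>\<^bsub>A\<^esub> a) \<oplus>\<^bsub>A\<^esub> (g \<odot>\<^bsub>A\<^esub> \<one>\<^bsub>A\<^esub>) = \<zero>\<^bsub>A\<^esub>)"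

text \<open>Used only for local rings \<open>R\<close>, over whose spectrum locally free means free.\<close>

definition quaternion_algebra :: "('r, 'm) ring_scheme \<Rightarrow> ('r, 'a, 'n) module_scheme \<Rightarrow> bool" where
  "quaternion_algebra R A \<longleftrightarrow>
    assoc_algebra R A \<and> free_of_rank R A 4 \<and> (\<exists>tr. quaternion_trace R A tr)"


section \<open>Even Clifford algebras over a ring\<close>

subsection \<open>Algebras presented as quotients of monoid algebras\<close>

definition monoid_algebra ::
  "('r, 'm) ring_scheme \<Rightarrow> ('x, 'n) monoid_scheme \<Rightarrow> ('r, 'x \<Rightarrow> 'r) module" where
  "monoid_algebra R M =
    \<lparr>carrier = {f. (\<forall>x. f x \<in> carrier R) \<and> (\<forall>x. x \<notin> carrier M \<longrightarrow> f x = \<zero>\<^bsub>R\<^esub>) \<and>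
                  finite {x. f x \<noteq> \<zero>\<^bsub>R\<^esub>}},
     mult = (\<lambda>f g x. finsum R (\<lambda>(y, z). f y \<otimes>\<^bsub>R\<^esub> g z)
                {(y, z). f y \<noteq> \<zero>\<^bsub>R\<^esub> \<and> g z \<noteq> \<zero>\<^bsub>R\<^esub> \<and> y \<otimes>\<^bsub>M\<^esub> z = x}),
     one = (\<lambda>x. if x = \<one>\<^bsub>M\<^esub> then \<one>\<^bsub>R\<^esub> else \<zero>\<^bsub>R\<^esub>),
     zero = (\<lambda>x. \<zero>\<^bsub>R\<^esub>),
     add = (\<lambda>f g x. f x \<oplus>\<^bsub>R\<^esub> g x),
     smult = (\<lambda>r f x. r \<otimes>\<^bsub>R\<^esub> f x)\<rparr>"

definition delta :: "('r, 'm) ring_scheme \<Rightarrow> 'x \<Rightarrow> 'x \<Rightarrow> 'r" where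
  "delta R m = (\<lambda>x. if x = m then \<one>\<^bsub>R\<^esub> else \<zero>\<^bsub>R\<^esub>)"

definition word_monoid :: "'x set \<Rightarrow> 'x list monoid" where
  "word_monoid X = \<lparr>carrier = lists X, mult = (@), one = []\<rparr>"

definition quot_algebra :: "('r, 'a, 'n) module_scheme \<Rightarrow> 'a set \<Rightarrow> ('r, 'a set) module" where
  "quot_algebra A I = with_smult (A Quot I) (\<lambda>r X. \<Union>x\<in>X. I +>\<^bsub>A\<^esub> (r \<odot>\<^bsub>A\<^esub> x))"

definition linearity_relations ::
  "('r, 'm) ring_scheme \<Rightarrow> ('r, 'v, 'n) module_scheme \<Rightarrow> ('r, 'a, 'o) module_scheme \<Rightarrow>
   ('v \<Rightarrow> 'a) \<Rightarrow> 'a set" where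
  "linearity_relations R N A i =
    {i (v \<oplus>\<^bsub>N\<^esub> w) \<ominus>\<^bsub>A\<^esub> (i v \<oplus>\<^bsub>A\<^esub> i w) | v w. v \<in> carrier N \<and> w \<in> carrier N} \<union>
    {i (r \<odot>\<^bsub>N\<^esub> v) \<ominus>\<^bsub>A\<^esub> (r \<odot>\<^bsub>A\<^esub> i v) | r v. r \<in> carrier R \<and> v \<in> carrier N}"

subsection \<open>The tensor algebra $T(V)$\<close>

text \<open>The free module on all words in \<open>V\<close>, modulo multilinearity; the ideal
  generated by linearity of the one-letter words expresses multilinearity of longer words.\<close>

definition tensor_ideal ::
  "('r, 'm) ring_scheme \<Rightarrow> ('r, 'v, 'n) module_scheme \<Rightarrow> ('v list \<Rightarrow> 'r) set" where
  "tensor_ideal R V = (let F = monoid_algebra R (word_monoid (carrier V)) in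
     Idl\<^bsub>F\<^esub> (linearity_relations R V F (\<lambda>v. delta R [v])))"

definition tensor_algebra ::
  "('r, 'm) ring_scheme \<Rightarrow> ('r, 'v, 'n) module_scheme \<Rightarrow> ('r, ('v list \<Rightarrow> 'r) set) module" where
  "tensor_algebra R V =
     quot_algebra (monoid_algebra R (word_monoid (carrier V))) (tensor_ideal R V)"

text \<open>The class of $v_1 \otimes \dots \otimes v_n$.\<close>

definition tensor_word ::
  "('r, 'm) ring_scheme \<Rightarrow> ('r, 'v, 'n) module_scheme \<Rightarrow> 'v list \<Rightarrow> ('v list \<Rightarrow> 'r) set" where
  "tensor_word R V vs =
     tensor_ideal R V +>\<^bsub>monoid_algebra R (word_monoid (carrier V))\<^esub> delta R vs"

subsection \<open>The algebra $\bigoplus_{j \in \mathbb{Z}} L^j$ of a line bundle\<close>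

definition dual_module ::
  "('r, 'm) ring_scheme \<Rightarrow> ('r, 'l, 'n) module_scheme \<Rightarrow> ('r, 'l \<Rightarrow> 'r) module" where
  "dual_module R L =
    \<lparr>carrier = {f \<in> extensional (carrier L). linear_map R L (regular_module R) f},
     mult = undefined, one = undefined,
     zero = (\<lambda>x\<in>carrier L. \<zero>\<^bsub>R\<^esub>),
     add = (\<lambda>f g. \<lambda>x\<in>carrier L. f x \<oplus>\<^bsub>R\<^esub> g x),
     smult = (\<lambda>r f. \<lambda>x\<in>carrier L. r \<otimes>\<^bsub>R\<^esub> f x)\<rparr>"

text \<open>As usual, $L^{j}$ is $L^{\otimes j}$ for $j \ge 0$ and $(L^\vee)^{\otimes -j}$ for $j < 0$, the
  product of powers of opposite sign being contraction.  So this algebra is the tensor algebra of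
  $L \oplus L^\vee$ made commutative, in which $\lambda \in L^\vee$ and $l \in L$
  multiply to $\lambda(l)$.  Letters \<open>Inl l\<close> are elements of $L$, letters \<open>Inr f\<close>
  elements of $L^\vee$.\<close>

definition line_letters ::
  "('r, 'm) ring_scheme \<Rightarrow> ('r, 'l, 'n) module_scheme \<Rightarrow> ('l + ('l \<Rightarrow> 'r)) set" where
  "line_letters R L = Inl ` carrier L \<union> Inr ` carrier (dual_module R L)"

definition line_ideal ::
  "('r, 'm) ring_scheme \<Rightarrow> ('r, 'l, 'n) module_scheme \<Rightarrow>
   (('l + ('l \<Rightarrow> 'r)) list \<Rightarrow> 'r) set" where
  "line_ideal R L = (let F = monoid_algebra R (word_monoid (line_letters R L)) in
     Idl\<^bsub>F\<^esub>
       (linearity_relations R L F (\<lambda>l. delta R [Inl l]) \<union>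
        linearity_relations R (dual_module R L) F (\<lambda>f. delta R [Inr f]) \<union>
        {delta R [x, y] \<ominus>\<^bsub>F\<^esub> delta R [y, x] | x y.
           x \<in> line_letters R L \<and> y \<in> line_letters R L} \<union>
        {delta R [Inr f, Inl l] \<ominus>\<^bsub>F\<^esub> (f l \<odot>\<^bsub>F\<^esub> \<one>\<^bsub>F\<^esub>) | f l.
           f \<in> carrier (dual_module R L) \<and> l \<in> carrier L}))"

definition line_algebra ::
  "('r, 'm) ring_scheme \<Rightarrow> ('r, 'l, 'n) module_scheme \<Rightarrow>
   ('r, (('l + ('l \<Rightarrow> 'r)) list \<Rightarrow> 'r) set) module" where
  "line_algebra R L =
     quot_algebra (monoid_algebra R (word_monoid (line_letters R L))) (line_ideal R L)"

definition line_word ::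
  "('r, 'm) ring_scheme \<Rightarrow> ('r, 'l, 'n) module_scheme \<Rightarrow> ('l + ('l \<Rightarrow> 'r)) list \<Rightarrow>
   (('l + ('l \<Rightarrow> 'r)) list \<Rightarrow> 'r) set" where
  "line_word R L ls =
     line_ideal R L +>\<^bsub>monoid_algebra R (word_monoid (line_letters R L))\<^esub> delta R ls"

subsection \<open>Tensor products of algebras\<close>

text \<open>The free module on $A \times B$ modulo bilinearity, with
  $(a \otimes b)(a' \otimes b') = aa' \otimes bb'$.  The submodule
  generated by the bilinearity relations is already an ideal of the monoid algebra.\<close>

definition bilinear_ideal ::
  "('r, 'm) ring_scheme \<Rightarrow> ('r, 'a, 'n) module_scheme \<Rightarrow> ('r, 'b, 'o) module_scheme \<Rightarrow>
   ('a \<times> 'b \<Rightarrow> 'r) set" where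
  "bilinear_ideal R A B = (let F = monoid_algebra R (A \<times>\<times> B) in
     Idl\<^bsub>F\<^esub>
       ((\<Union>b\<in>carrier B. linearity_relations R A F (\<lambda>a. delta R (a, b))) \<union>
        (\<Union>a\<in>carrier A. linearity_relations R B F (\<lambda>b. delta R (a, b)))))"

definition algebra_tensor ::
  "('r, 'm) ring_scheme \<Rightarrow> ('r, 'a, 'n) module_scheme \<Rightarrow> ('r, 'b, 'o) module_scheme \<Rightarrow>
   ('r, ('a \<times> 'b \<Rightarrow> 'r) set) module" where
  "algebra_tensor R A B = quot_algebra (monoid_algebra R (A \<times>\<times> B)) (bilinear_ideal R A B)"

definition pure_tensor ::
  "('r, 'm) ring_scheme \<Rightarrow> ('r, 'a, 'n) module_scheme \<Rightarrow> ('r, 'b, 'o) module_scheme \<Rightarrow>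
   'a \<Rightarrow> 'b \<Rightarrow> ('a \<times> 'b \<Rightarrow> 'r) set" where
  "pure_tensor R A B a b =
     bilinear_ideal R A B +>\<^bsub>monoid_algebra R (A \<times>\<times> B)\<^esub> delta R (a, b)"

subsection \<open>Quadratic forms and $Cl_0(Q)$\<close>

text \<open>Since 2 is invertible, a linear map on $\mathrm{Sym}^2 V$ is the same as the symmetric
  bilinear map \<open>Q v w\<close>, the value at $\frac12 (v \otimes w + w \otimes v)$.\<close>

definition quadratic_form ::
  "('r, 'm) ring_scheme \<Rightarrow> ('r, 'v, 'n) module_scheme \<Rightarrow> ('r, 'l, 'o) module_scheme \<Rightarrow>
   ('v \<Rightarrow> 'v \<Rightarrow> 'l) \<Rightarrow> bool" where
  "quadratic_form R V L Q \<longleftrightarrow>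
    (\<forall>v\<in>carrier V. linear_map R V L (Q v)) \<and>
    (\<forall>v\<in>carrier V. \<forall>w\<in>carrier V. Q v w = Q w v)"

type_synonym ('r, 'v, 'l) clifford_ambient =
  "(('v list \<Rightarrow> 'r) set \<times> (('l + ('l \<Rightarrow> 'r)) list \<Rightarrow> 'r) set \<Rightarrow> 'r) set"

definition clifford_ambient ::
  "('r, 'm) ring_scheme \<Rightarrow> ('r, 'v, 'n) module_scheme \<Rightarrow> ('r, 'l, 'o) module_scheme \<Rightarrow>
   ('r, ('r, 'v, 'l) clifford_ambient) module" where
  "clifford_ambient R V L = algebra_tensor R (tensor_algebra R V) (line_algebra R L)"

definition ambient_word ::
  "('r, 'm) ring_scheme \<Rightarrow> ('r, 'v, 'n) module_scheme \<Rightarrow> ('r, 'l, 'o) module_scheme \<Rightarrow>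
   'v list \<Rightarrow> ('l + ('l \<Rightarrow> 'r)) list \<Rightarrow> ('r, 'v, 'l) clifford_ambient" where
  "ambient_word R V L vs ls =
     pure_tensor R (tensor_algebra R V) (line_algebra R L) (tensor_word R V vs) (line_word R L ls)"

text \<open>The relations $t - Q(t)$ are imposed for $t = \frac12 (v \otimes w + w \otimes v)$; these
  \<open>t\<close> span $\mathrm{Sym}^2 V$.\<close>

definition clifford_ideal ::
  "('r, 'm) ring_scheme \<Rightarrow> ('r, 'v, 'n) module_scheme \<Rightarrow> ('r, 'l, 'o) module_scheme \<Rightarrow>
   ('v \<Rightarrow> 'v \<Rightarrow> 'l) \<Rightarrow> ('r, 'v, 'l) clifford_ambient set" where
  "clifford_ideal R V L Q = (let E = clifford_ambient R V L; word = ambient_word R V L in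
     Idl\<^bsub>E\<^esub> {(half R \<odot>\<^bsub>E\<^esub> (word [v, w] [] \<oplus>\<^bsub>E\<^esub> word [w, v] [])) \<ominus>\<^bsub>E\<^esub> word [] [Inl (Q v w)] | v w.
             v \<in> carrier V \<and> w \<in> carrier V})"

definition clifford_algebra ::
  "('r, 'm) ring_scheme \<Rightarrow> ('r, 'v, 'n) module_scheme \<Rightarrow> ('r, 'l, 'o) module_scheme \<Rightarrow>
   ('v \<Rightarrow> 'v \<Rightarrow> 'l) \<Rightarrow> ('r, ('r, 'v, 'l) clifford_ambient set) module" where
  "clifford_algebra R V L Q = quot_algebra (clifford_ambient R V L) (clifford_ideal R V L Q)"

definition word_degree :: "'v list \<Rightarrow> ('l + 'd) list \<Rightarrow> int" where
  "word_degree vs ls =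
     int (length vs) + (\<Sum>x\<leftarrow>ls. case x of Inl _ \<Rightarrow> 2 | Inr _ \<Rightarrow> - 2)"

definition clifford_part ::
  "('r, 'm) ring_scheme \<Rightarrow> ('r, 'v, 'n) module_scheme \<Rightarrow> ('r, 'l, 'o) module_scheme \<Rightarrow>
   ('v \<Rightarrow> 'v \<Rightarrow> 'l) \<Rightarrow> int \<Rightarrow> ('r, 'v, 'l) clifford_ambient set set" where
  "clifford_part R V L Q d =
     \<Inter>{N. submodule N R (clifford_algebra R V L Q) \<and>
         (\<forall>vs\<in>lists (carrier V). \<forall>ls\<in>lists (line_letters R L). word_degree vs ls = d \<longrightarrow>
            clifford_ideal R V L Q +>\<^bsub>clifford_ambient R V L\<^esub> ambient_word R V L vs ls \<in> N)}"

definition even_clifford ::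
  "('r, 'm) ring_scheme \<Rightarrow> ('r, 'v, 'n) module_scheme \<Rightarrow> ('r, 'l, 'o) module_scheme \<Rightarrow>
   ('v \<Rightarrow> 'v \<Rightarrow> 'l) \<Rightarrow> ('r, ('r, 'v, 'l) clifford_ambient set) module" where
  "even_clifford R V L Q = (clifford_algebra R V L Q)\<lparr>carrier := clifford_part R V L Q 0\<rparr>"

text \<open>Used only for local rings \<open>R\<close>, over whose spectrum vector bundles are finite free modules.
  Every finite free \<open>R\<close>-module has an isomorphic copy with elements in \<^typ>\<open>nat \<Rightarrow> 'r\<close>, so fixing
  this element type for \<open>V\<close> and \<open>L\<close> loses nothing.\<close>

definition even_clifford_algebra ::
  "('r, 'm) ring_scheme \<Rightarrow> ('r, 'a, 'n) module_scheme \<Rightarrow> bool" where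
  "even_clifford_algebra R A \<longleftrightarrow> assoc_algebra R A \<and>
    (\<exists>(V :: ('r, nat \<Rightarrow> 'r) module) n (L :: ('r, nat \<Rightarrow> 'r) module) Q.
       Module.module R V \<and> free_of_rank R V n \<and>
       Module.module R L \<and> free_of_rank R L 1 \<and>
       quadratic_form R V L Q \<and> algebra_iso R A (even_clifford R V L Q))"


section \<open>Sheaves of rings and stalks\<close>

definition sheaf_of_rings ::
  "'p topology \<Rightarrow> ('p set \<Rightarrow> ('a, 'm) ring_scheme) \<Rightarrow> ('p set \<Rightarrow> 'p set \<Rightarrow> 'a \<Rightarrow> 'a) \<Rightarrow> bool" where
  "sheaf_of_rings X F res \<longleftrightarrow>
    (\<forall>U. openin X U \<longrightarrow> ring (F U)) \<and>
    (\<forall>U V. openin X U \<and> openin X V \<and> V \<subseteq> U \<longrightarrow> res U V \<in> ring_hom (F U) (F V)) \<and>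
    (\<forall>U. openin X U \<longrightarrow> (\<forall>s\<in>carrier (F U). res U U s = s)) \<and>
    (\<forall>U V W. openin X U \<and> openin X V \<and> openin X W \<and> W \<subseteq> V \<and> V \<subseteq> U \<longrightarrow>
       (\<forall>s\<in>carrier (F U). res V W (res U V s) = res U W s)) \<and>
    (\<forall>\<U>. (\<forall>V\<in>\<U>. openin X V) \<longrightarrow>
       (\<forall>s\<in>carrier (F (\<Union>\<U>)). \<forall>t\<in>carrier (F (\<Union>\<U>)).
          (\<forall>V\<in>\<U>. res (\<Union>\<U>) V s = res (\<Union>\<U>) V t) \<longrightarrow> s = t)) \<and>
    (\<forall>\<U> f. (\<forall>V\<in>\<U>. openin X V \<and> f V \<in> carrier (F V)) \<and>
       (\<forall>V\<in>\<U>. \<forall>W\<in>\<U>. res V (V \<inter> W) (f V) = res W (V \<inter> W) (f W)) \<longrightarrow>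
       (\<exists>s\<in>carrier (F (\<Union>\<U>)). \<forall>V\<in>\<U>. res (\<Union>\<U>) V s = f V))"

definition germ_rel ::
  "'p topology \<Rightarrow> ('p set \<Rightarrow> ('a, 'm) ring_scheme) \<Rightarrow> ('p set \<Rightarrow> 'p set \<Rightarrow> 'a \<Rightarrow> 'a) \<Rightarrow> 'p \<Rightarrow>
   (('p set \<times> 'a) \<times> ('p set \<times> 'a)) set" where
  "germ_rel X F res z = {((U, s), (V, t)).
     openin X U \<and> z \<in> U \<and> s \<in> carrier (F U) \<and> openin X V \<and> z \<in> V \<and> t \<in> carrier (F V) \<and>
     (\<exists>W. openin X W \<and> z \<in> W \<and> W \<subseteq> U \<inter> V \<and> res U W s = res V W t)}"

definition germ ::
  "'p topology \<Rightarrow> ('p set \<Rightarrow> ('a, 'm) ring_scheme) \<Rightarrow> ('p set \<Rightarrow> 'p set \<Rightarrow> 'a \<Rightarrow> 'a) \<Rightarrow> 'p \<Rightarrow>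
   'p set \<Rightarrow> 'a \<Rightarrow> ('p set \<times> 'a) set" where
  "germ X F res z U s = germ_rel X F res z `` {(U, s)}"

definition stalk ::
  "'p topology \<Rightarrow> ('p set \<Rightarrow> ('a, 'm) ring_scheme) \<Rightarrow> ('p set \<Rightarrow> 'p set \<Rightarrow> 'a \<Rightarrow> 'a) \<Rightarrow> 'p \<Rightarrow>
   ('p set \<times> 'a) set ring" where
  "stalk X F res z =
    \<lparr>carrier = {germ X F res z U s | U s. openin X U \<and> z \<in> U \<and> s \<in> carrier (F U)},
     mult = (\<lambda>x y. \<Union>(U, s)\<in>x. \<Union>(V, t)\<in>y.
       germ X F res z (U \<inter> V) (res U (U \<inter> V) s \<otimes>\<^bsub>F (U \<inter> V)\<^esub> res V (U \<inter> V) t)),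
     one = germ X F res z (topspace X) \<one>\<^bsub>F (topspace X)\<^esub>,
     zero = germ X F res z (topspace X) \<zero>\<^bsub>F (topspace X)\<^esub>,
     add = (\<lambda>x y. \<Union>(U, s)\<in>x. \<Union>(V, t)\<in>y.
       germ X F res z (U \<inter> V) (res U (U \<inter> V) s \<oplus>\<^bsub>F (U \<inter> V)\<^esub> res V (U \<inter> V) t))\<rparr>"


section \<open>Ringed spaces and schemes\<close>

record ('p, 'r) ringed_space =
  topo :: "'p topology"
  sect :: "'p set \<Rightarrow> 'r ring"
  rest :: "'p set \<Rightarrow> 'p set \<Rightarrow> 'r \<Rightarrow> 'r"

definition ringed_space :: "('p, 'r) ringed_space \<Rightarrow> bool" where
  "ringed_space X \<longleftrightarrow> sheaf_of_rings (topo X) (sect X) (rest X) \<and>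
    (\<forall>U. openin (topo X) U \<longrightarrow> cring (sect X U))"

abbreviation local_ring_at :: "('p, 'r) ringed_space \<Rightarrow> 'p \<Rightarrow> ('p set \<times> 'r) set ring" where
  "local_ring_at X z \<equiv> stalk (topo X) (sect X) (rest X) z"

definition open_subspace :: "('p, 'r) ringed_space \<Rightarrow> 'p set \<Rightarrow> ('p, 'r) ringed_space" where
  "open_subspace X U = X\<lparr>topo := subtopology (topo X) U\<rparr>"

definition ringed_space_iso :: "('p, 'r) ringed_space \<Rightarrow> ('q, 's) ringed_space \<Rightarrow> bool" where
  "ringed_space_iso X Y \<longleftrightarrow>
    (\<exists>\<phi> \<psi>. homeomorphic_map (topo X) (topo Y) \<phi> \<and>
       (\<forall>U. openin (topo X) U \<longrightarrow> \<psi> U \<in> ring_iso (sect X U) (sect Y (\<phi> ` U))) \<and>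
       (\<forall>U V. openin (topo X) U \<and> openin (topo X) V \<and> V \<subseteq> U \<longrightarrow>
          (\<forall>s\<in>carrier (sect X U). \<psi> V (rest X U V s) = rest Y (\<phi> ` U) (\<phi> ` V) (\<psi> U s))))"

subsection \<open>Affine schemes\<close>

definition fraction :: "('r, 'm) ring_scheme \<Rightarrow> 'r set \<Rightarrow> 'r \<Rightarrow> 'r \<Rightarrow> ('r \<times> 'r) set" where
  "fraction R P a s = {(b, t). b \<in> carrier R \<and> t \<in> carrier R - P \<and>
     (\<exists>u\<in>carrier R - P. u \<otimes>\<^bsub>R\<^esub> ((a \<otimes>\<^bsub>R\<^esub> t) \<ominus>\<^bsub>R\<^esub> (b \<otimes>\<^bsub>R\<^esub> s)) = \<zero>\<^bsub>R\<^esub>)}"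

definition localization :: "('r, 'm) ring_scheme \<Rightarrow> 'r set \<Rightarrow> ('r \<times> 'r) set ring" where
  "localization R P =
    \<lparr>carrier = {fraction R P a s | a s. a \<in> carrier R \<and> s \<in> carrier R - P},
     mult = (\<lambda>x y. \<Union>(a, s)\<in>x. \<Union>(b, t)\<in>y. fraction R P (a \<otimes>\<^bsub>R\<^esub> b) (s \<otimes>\<^bsub>R\<^esub> t)),
     one = fraction R P \<one>\<^bsub>R\<^esub> \<one>\<^bsub>R\<^esub>,
     zero = fraction R P \<zero>\<^bsub>R\<^esub> \<one>\<^bsub>R\<^esub>,
     add = (\<lambda>x y. \<Union>(a, s)\<in>x. \<Union>(b, t)\<in>y.
       fraction R P ((a \<otimes>\<^bsub>R\<^esub> t) \<oplus>\<^bsub>R\<^esub> (b \<otimes>\<^bsub>R\<^esub> s)) (s \<otimes>\<^bsub>R\<^esub> t))\<rparr>"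

definition zariski_topology :: "('r, 'm) ring_scheme \<Rightarrow> 'r set topology" where
  "zariski_topology R = topology (\<lambda>U. \<exists>I. ideal I R \<and> U = {P. primeideal P R \<and> \<not> I \<subseteq> P})"

definition spec_sections ::
  "('r, 'm) ring_scheme \<Rightarrow> 'r set set \<Rightarrow> ('r set \<Rightarrow> ('r \<times> 'r) set) ring" where
  "spec_sections R U =
    \<lparr>carrier = {f \<in> (\<Pi>\<^sub>E P\<in>U. carrier (localization R P)).
       \<forall>P\<in>U. \<exists>W a s. openin (zariski_topology R) W \<and> P \<in> W \<and> W \<subseteq> U \<and>
         a \<in> carrier R \<and> s \<in> carrier R \<and> (\<forall>P'\<in>W. s \<notin> P' \<and> f P' = fraction R P' a s)},
     mult = (\<lambda>f g. \<lambda>P\<in>U. f P \<otimes>\<^bsub>localization R P\<^esub> g P),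
     one = (\<lambda>P\<in>U. \<one>\<^bsub>localization R P\<^esub>),
     zero = (\<lambda>P\<in>U. \<zero>\<^bsub>localization R P\<^esub>),
     add = (\<lambda>f g. \<lambda>P\<in>U. f P \<oplus>\<^bsub>localization R P\<^esub> g P)\<rparr>"

definition Spec :: "('r, 'm) ring_scheme \<Rightarrow> ('r set, 'r set \<Rightarrow> ('r \<times> 'r) set) ringed_space" where
  "Spec R = \<lparr>topo = zariski_topology R, sect = spec_sections R, rest = (\<lambda>U V f. restrict f V)\<rparr>"

subsection \<open>Schemes\<close>

text \<open>Taking \<open>R\<close> on the element type of the structure sheaf loses nothing, as
  \<open>R\<close> is isomorphic to the ring of sections over \<open>U\<close>.  The stalks of \<open>Spec R\<close> are local, so an
  isomorphism of ringed spaces is automatically one of locally ringed spaces.\<close>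

definition affine_chart :: "('p, 'r) ringed_space \<Rightarrow> 'p set \<Rightarrow> 'r ring \<Rightarrow> bool" where
  "affine_chart X U R \<longleftrightarrow>
    openin (topo X) U \<and> cring R \<and> ringed_space_iso (open_subspace X U) (Spec R)"

definition scheme :: "('p, 'r) ringed_space \<Rightarrow> bool" where
  "scheme X \<longleftrightarrow> ringed_space X \<and> (\<forall>z\<in>topspace (topo X). \<exists>U R. z \<in> U \<and> affine_chart X U R)"

definition noetherian_scheme :: "('p, 'r) ringed_space \<Rightarrow> bool" where
  "noetherian_scheme X \<longleftrightarrow> scheme X \<and>
    (\<exists>\<U>. finite \<U> \<and> \<Union>\<U> = topspace (topo X) \<and>
       (\<forall>U\<in>\<U>. \<exists>R. noetherian_ring R \<and> affine_chart X U R))"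

definition integral_scheme :: "('p, 'r) ringed_space \<Rightarrow> bool" where
  "integral_scheme X \<longleftrightarrow> scheme X \<and> topspace (topo X) \<noteq> {} \<and>
    (\<forall>U. openin (topo X) U \<and> U \<noteq> {} \<longrightarrow> domain (sect X U))"

text \<open>A morphism $X \to \mathrm{Spec}\, k$ amounts to a ring homomorphism from
  \<open>k\<close> to the global functions.\<close>

definition scheme_over :: "('k, 'm) ring_scheme \<Rightarrow> ('p, 'r) ringed_space \<Rightarrow> ('k \<Rightarrow> 'r) \<Rightarrow> bool" where
  "scheme_over k X c \<longleftrightarrow> scheme X \<and> c \<in> ring_hom k (sect X (topspace (topo X)))"


section \<open>Algebras over the structure sheaf\<close>

record ('p, 'r, 'a) sheaf_algebra =
  asect :: "'p set \<Rightarrow> ('r, 'a) module"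
  arest :: "'p set \<Rightarrow> 'p set \<Rightarrow> 'a \<Rightarrow> 'a"

definition structure_sheaf_algebra ::
  "('p, 'r) ringed_space \<Rightarrow> ('p, 'r, 'a) sheaf_algebra \<Rightarrow> bool" where
  "structure_sheaf_algebra Z A \<longleftrightarrow> sheaf_of_rings (topo Z) (asect A) (arest A) \<and>
    (\<forall>U. openin (topo Z) U \<longrightarrow> assoc_algebra (sect Z U) (asect A U)) \<and>
    (\<forall>U V. openin (topo Z) U \<and> openin (topo Z) V \<and> V \<subseteq> U \<longrightarrow>
       (\<forall>r\<in>carrier (sect Z U). \<forall>x\<in>carrier (asect A U).
          arest A U V (r \<odot>\<^bsub>asect A U\<^esub> x) = rest Z U V r \<odot>\<^bsub>asect A V\<^esub> arest A U V x))"

definition stalk_algebra ::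
  "('p, 'r) ringed_space \<Rightarrow> ('p, 'r, 'a) sheaf_algebra \<Rightarrow> 'p \<Rightarrow>
   (('p set \<times> 'r) set, ('p set \<times> 'a) set) module" where
  "stalk_algebra Z A z = with_smult (stalk (topo Z) (asect A) (arest A) z)
     (\<lambda>r x. \<Union>(U, f)\<in>r. \<Union>(V, s)\<in>x.
        germ (topo Z) (asect A) (arest A) z (U \<inter> V)
          (rest Z U (U \<inter> V) f \<odot>\<^bsub>asect A (U \<inter> V)\<^esub> arest A V (U \<inter> V) s))"

definition finite_type :: "('p, 'r) ringed_space \<Rightarrow> ('p, 'r, 'a) sheaf_algebra \<Rightarrow> bool" where
  "finite_type Z A \<longleftrightarrow>
    (\<forall>z\<in>topspace (topo Z). \<exists>U n s. openin (topo Z) U \<and> z \<in> U \<and>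
       s \<in> {..<n::nat} \<rightarrow> carrier (asect A U) \<and>
       (\<forall>V x. openin (topo Z) V \<and> V \<subseteq> U \<and> x \<in> carrier (asect A V) \<longrightarrow>
          (\<forall>y\<in>V. \<exists>W c. openin (topo Z) W \<and> y \<in> W \<and> W \<subseteq> V \<and>
             c \<in> {..<n} \<rightarrow> carrier (sect Z W) \<and>
             arest A V W x =
               finsum (asect A W) (\<lambda>i. c i \<odot>\<^bsub>asect A W\<^esub> arest A U W (s i)) {..<n})))"

definition locally_free :: "('p, 'r) ringed_space \<Rightarrow> ('p, 'r, 'a) sheaf_algebra \<Rightarrow> nat \<Rightarrow> bool" where
  "locally_free Z A n \<longleftrightarrow>
    (\<forall>z\<in>topspace (topo Z). \<exists>U e. openin (topo Z) U \<and> z \<in> U \<and>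
       e \<in> {..<n} \<rightarrow> carrier (asect A U) \<and>
       (\<forall>V. openin (topo Z) V \<and> V \<subseteq> U \<longrightarrow>
          is_basis (sect Z V) (asect A V) n (\<lambda>i. arest A U V (e i))))"

definition quaternion :: "('p, 'r) ringed_space \<Rightarrow> ('p, 'r, 'a) sheaf_algebra \<Rightarrow> bool" where
  "quaternion Z A \<longleftrightarrow> structure_sheaf_algebra Z A \<and> locally_free Z A 4 \<and>
    (\<exists>tr. (\<forall>U. openin (topo Z) U \<longrightarrow> quaternion_trace (sect Z U) (asect A U) (tr U)) \<and>
       (\<forall>U V. openin (topo Z) U \<and> openin (topo Z) V \<and> V \<subseteq> U \<longrightarrow>
          (\<forall>a\<in>carrier (asect A U). tr V (arest A U V a) = rest Z U V (tr U a))))"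

definition locally_quaternion ::
  "('p, 'r) ringed_space \<Rightarrow> ('p, 'r, 'a) sheaf_algebra \<Rightarrow> bool" where
  "locally_quaternion Z A \<longleftrightarrow>
    (\<forall>z\<in>topspace (topo Z). quaternion_algebra (local_ring_at Z z) (stalk_algebra Z A z))"

definition locally_even_clifford ::
  "('p, 'r) ringed_space \<Rightarrow> ('p, 'r, 'a) sheaf_algebra \<Rightarrow> bool" where
  "locally_even_clifford Z A \<longleftrightarrow>
    (\<forall>z\<in>topspace (topo Z). even_clifford_algebra (local_ring_at Z z) (stalk_algebra Z A z))"

text \<open>For \<open>A\<close> of finite type over an integral scheme this is equivalent to being locally free of
  rank \<open>n\<close> as a sheaf.\<close>

definition has_rank :: "('p, 'r) ringed_space \<Rightarrow> ('p, 'r, 'a) sheaf_algebra \<Rightarrow> nat \<Rightarrow> bool" where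
  "has_rank Z A n \<longleftrightarrow>
    (\<forall>z\<in>topspace (topo Z). free_of_rank (local_ring_at Z z) (stalk_algebra Z A z) n)"

end

theory Submission
  imports Defs
begin

text \<open>Over a domain in which 2 is invertible, a quaternion algebra has only one trace. A free basis
  of a stalk and its trace involve finitely many germs, so they spread out to a neighbourhood:
  since the algebra is of finite type and any four generators of a free module of rank four over a
  domain form a basis, the algebra becomes free there, and it remains quaternion. By uniqueness
  these local traces agree on overlaps, which are integral, and glue.

  Let \<open>Cl\<^sub>0(Q)\<close> be of rank four over a local domain, with \<open>V\<close> of rank \<open>n\<close>. After scaling to degree 0, it is
  generated by the products \<open>e\<^sub>i e\<^sub>j\<close>. If \<open>n \<le> 3\<close>, then \<open>1\<close> and the \<open>e\<^sub>i e\<^sub>j\<close> with \<open>i < j\<close> span it (put \<open>e\<^sub>i = 0\<close>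
  for the missing indices), hence form a basis, and \<open>tr (e\<^sub>i e\<^sub>j) = 2 q\<^sub>i\<^sub>j\<close> defines the trace. If \<open>n \<ge> 4\<close>,
  then a representation of the Clifford algebra by iterated two-by-two block matrices shows that
  \<open>1\<close> and four of the products \<open>e\<^sub>j e\<^sub>i\<close> are independent, contradicting the rank.\<close>

section \<open>Linear algebra over a domain\<close>

text \<open>The equation \<open>a\<^sup>2 = tr a a + g\<close> is not linear in \<open>a\<close>, so
  it cannot be tested on a basis. As 2 is invertible, it may be replaced by its polarisation, the
  relation \<open>polar\<close>, which is linear in each argument together with the trace. This
  serves twice: on the generators of a Clifford algebra, and in carrying a trace from a stalk to a
  neighbourhood, where only the relations between pairs of basis elements have to be spread out.
  Generators and relations bound a Clifford algebra only from above; independence of elements needs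
  a model. Over a local ring the form may be degenerate and need not have an orthogonal basis. The
  block matrices therefore rest on a triangular expansion: the part of the form involving the last
  coordinate is that coordinate times a linear form in all coordinates so far, and these two factors
  are the off-diagonal entries. Rank four is known for every stalk near a point, so generators
  spread from one stalk give bases of all neighbouring stalks; uniqueness of coefficients then
  passes from germs to sections.\<close>

lemma (in abelian_monoid) finsum_swap:
  assumes "finite I" "finite J" "\<And>i j. i \<in> I \<Longrightarrow> j \<in> J \<Longrightarrow> f i j \<in> carrier G"
  shows "(\<Oplus>i\<in>I. \<Oplus>j\<in>J. f i j) = (\<Oplus>j\<in>J. \<Oplus>i\<in>I. f i j)"
  using assms
proof (induction I)
  case empty
  then show ?case by simp
next
  case (insert i I)
  then have "(\<Oplus>i\<in>insert i I. \<Oplus>j\<in>J. f i j) = (\<Oplus>j\<in>J. f i j) \<oplus> (\<Oplus>j\<in>J. \<Oplus>i\<in>I. f i j)"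
    by (subst finsum_insert) (auto intro!: finsum_closed)
  also have "\<dots> = (\<Oplus>j\<in>J. f i j \<oplus> (\<Oplus>i\<in>I. f i j))"
    by (subst finsum_addf) (use insert in \<open>auto intro!: finsum_closed\<close>)
  also have "\<dots> = (\<Oplus>j\<in>J. \<Oplus>i\<in>insert i I. f i j)"
    by (rule finsum_cong') (use insert in \<open>auto intro!: finsum_closed simp: Pi_def\<close>)
  finally show ?case .
qed

lemma (in abelian_group) minus_unique_eq:
  "x \<in> carrier G \<Longrightarrow> y \<in> carrier G \<Longrightarrow> x \<oplus> \<ominus> y = \<zero> \<longleftrightarrow> x = y"
  by (simp add: add.inv_solve_right')

section \<open>Linear combinations with coefficient functions\<close>

lemma (in module) lincomb_closed:
  assumes "c \<in> I \<rightarrow> carrier R" "b \<in> I \<rightarrow> carrier M"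
  shows "(\<Oplus>\<^bsub>M\<^esub>i\<in>I. c i \<odot>\<^bsub>M\<^esub> b i) \<in> carrier M"
  using assms by (intro M.finsum_closed) auto

lemma (in module) lincomb_add:
  assumes "c \<in> I \<rightarrow> carrier R" "d \<in> I \<rightarrow> carrier R" "b \<in> I \<rightarrow> carrier M"
  shows "(\<Oplus>\<^bsub>M\<^esub>i\<in>I. (c i \<oplus> d i) \<odot>\<^bsub>M\<^esub> b i) =
    (\<Oplus>\<^bsub>M\<^esub>i\<in>I. c i \<odot>\<^bsub>M\<^esub> b i) \<oplus>\<^bsub>M\<^esub> (\<Oplus>\<^bsub>M\<^esub>i\<in>I. d i \<odot>\<^bsub>M\<^esub> b i)"
proof -
  have "(\<Oplus>\<^bsub>M\<^esub>i\<in>I. (c i \<oplus> d i) \<odot>\<^bsub>M\<^esub> b i) = (\<Oplus>\<^bsub>M\<^esub>i\<in>I. c i \<odot>\<^bsub>M\<^esub> b i \<oplus>\<^bsub>M\<^esub> d i \<odot>\<^bsub>M\<^esub> b i)"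
    using assms by (intro M.finsum_cong') (auto simp: smult_l_distr Pi_iff)
  also have "\<dots> = (\<Oplus>\<^bsub>M\<^esub>i\<in>I. c i \<odot>\<^bsub>M\<^esub> b i) \<oplus>\<^bsub>M\<^esub> (\<Oplus>\<^bsub>M\<^esub>i\<in>I. d i \<odot>\<^bsub>M\<^esub> b i)"
    using assms by (intro M.finsum_addf) auto
  finally show ?thesis .
qed

lemma (in module) lincomb_smult:
  assumes "finite I" "r \<in> carrier R" "c \<in> I \<rightarrow> carrier R" "b \<in> I \<rightarrow> carrier M"
  shows "(\<Oplus>\<^bsub>M\<^esub>i\<in>I. (r \<otimes> c i) \<odot>\<^bsub>M\<^esub> b i) = r \<odot>\<^bsub>M\<^esub> (\<Oplus>\<^bsub>M\<^esub>i\<in>I. c i \<odot>\<^bsub>M\<^esub> b i)"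
proof -
  have "(\<Oplus>\<^bsub>M\<^esub>i\<in>I. (r \<otimes> c i) \<odot>\<^bsub>M\<^esub> b i) = (\<Oplus>\<^bsub>M\<^esub>i\<in>I. r \<odot>\<^bsub>M\<^esub> (c i \<odot>\<^bsub>M\<^esub> b i))"
    using assms by (intro M.finsum_cong') (auto simp: smult_assoc1 Pi_iff)
  also have "\<dots> = r \<odot>\<^bsub>M\<^esub> (\<Oplus>\<^bsub>M\<^esub>i\<in>I. c i \<odot>\<^bsub>M\<^esub> b i)"
    using assms by (intro finsum_smult_ldistr[symmetric]) auto
  finally show ?thesis .
qed

lemma (in module) lincomb_zero:
  assumes "\<And>i. i \<in> I \<Longrightarrow> c i = \<zero>" "b \<in> I \<rightarrow> carrier M"
  shows "(\<Oplus>\<^bsub>M\<^esub>i\<in>I. c i \<odot>\<^bsub>M\<^esub> b i) = \<zero>\<^bsub>M\<^esub>"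
  using assms by (intro M.add.finprod_one_eqI) (auto simp: Pi_iff)

lemma (in module) finsum_smult_rdistr:
  assumes "finite I" "c \<in> I \<rightarrow> carrier R" "x \<in> carrier M"
  shows "(\<Oplus>i\<in>I. c i) \<odot>\<^bsub>M\<^esub> x = (\<Oplus>\<^bsub>M\<^esub>i\<in>I. c i \<odot>\<^bsub>M\<^esub> x)"
  using assms by (induction I) (auto simp: Pi_iff smult_l_distr)

lemma (in module) lincomb_single:
  assumes "finite I" "j \<in> I" "b \<in> I \<rightarrow> carrier M"
  shows "(\<Oplus>\<^bsub>M\<^esub>i\<in>I. (if i = j then \<one> else \<zero>) \<odot>\<^bsub>M\<^esub> b i) = b j"
proof -
  have "(\<Oplus>\<^bsub>M\<^esub>i\<in>I. (if i = j then \<one> else \<zero>) \<odot>\<^bsub>M\<^esub> b i) = (\<Oplus>\<^bsub>M\<^esub>i\<in>I. if j = i then b i else \<zero>\<^bsub>M\<^esub>)"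
    using assms by (intro M.finsum_cong') (auto simp: Pi_iff)
  also have "\<dots> = b j" using assms by (intro M.finsum_singleton) auto
  finally show ?thesis .
qed

text \<open>Fraction-free Gaussian elimination, by induction on the set \<open>I\<close> of
  equations. A pivot \<open>v j0 i0\<close> removes one equation and one unknown, so the strict
  inequality of cardinalities is preserved. Multiplying by the pivot replaces division by it, and a
  nonzero solution stays nonzero because the ring is a domain.\<close>

lemma (in domain) exists_linear_relation:
  assumes "finite I" "finite J" "card I < card J"
    and "\<And>j i. j \<in> J \<Longrightarrow> i \<in> I \<Longrightarrow> v j i \<in> carrier R"
  shows "\<exists>c\<in>J \<rightarrow> carrier R. (\<exists>j\<in>J. c j \<noteq> \<zero>) \<and> (\<forall>i\<in>I. (\<Oplus>j\<in>J. c j \<otimes> v j i) = \<zero>)"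
  using assms
proof (induction I arbitrary: J v)
  case empty
  then have "J \<noteq> {}" by auto
  then show ?case by (intro bexI[of _ "\<lambda>_. \<one>"]) auto
next
  case (insert i0 I)
  show ?case
  proof (cases "\<exists>j\<in>J. v j i0 \<noteq> \<zero>")
    case False
    have "card I < card J" using insert by simp
    then obtain c where c: "c \<in> J \<rightarrow> carrier R" "\<exists>j\<in>J. c j \<noteq> \<zero>"
      "\<forall>i\<in>I. (\<Oplus>j\<in>J. c j \<otimes> v j i) = \<zero>"
      using insert.IH[of J v] insert.prems by auto
    have "(\<Oplus>j\<in>J. c j \<otimes> v j i0) = \<zero>"
      using False c by (intro add.finprod_one_eqI) (auto simp: Pi_iff)
    then show ?thesis using c by auto
  next
    case True
    then obtain j0 where j0: "j0 \<in> J" "v j0 i0 \<noteq> \<zero>" by auto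
    define p where "p = v j0 i0"
    define K where "K = J - {j0}"
    \<comment> \<open>The row \<open>w j\<close> is \<open>p\<close> times row \<open>j\<close>
      minus \<open>v j i0\<close> times the pivot row, which makes its entry at \<open>i0\<close>
      zero.\<close>
    define w where "w = (\<lambda>j i. p \<otimes> v j i \<ominus> v j i0 \<otimes> v j0 i)"
    have J: "J = insert j0 K" "j0 \<notin> K" "finite K" using j0 insert.prems by (auto simp: K_def)
    have v: "v j i \<in> carrier R" if "j \<in> J" "i \<in> insert i0 I" for j i using insert.prems that by auto
    have p: "p \<in> carrier R" "p \<noteq> \<zero>" using v j0 by (auto simp: p_def)
    have "card I < card K" using insert J by simp
    then obtain c where c: "c \<in> K \<rightarrow> carrier R" "\<exists>j\<in>K. c j \<noteq> \<zero>"
      "\<forall>i\<in>I. (\<Oplus>j\<in>K. c j \<otimes> w j i) = \<zero>"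
      using insert.IH[of K w] J p v by (auto simp: w_def)
    have cK: "c j \<in> carrier R" if "j \<in> K" for j using c that by auto
    define s where "s = (\<Oplus>j\<in>K. c j \<otimes> v j i0)"
    have s: "s \<in> carrier R" using cK v J by (auto simp: s_def intro!: finsum_closed)
    \<comment> \<open>A combination of the reduced rows, rewritten in the original rows: each
      \<open>j\<close> in \<open>K\<close> gets \<open>p c j\<close>, and the multiples of the pivot
      row that were subtracted add up to \<open>s\<close>.\<close>
    define d where "d = (\<lambda>j. if j = j0 then \<ominus> s else p \<otimes> c j)"
    have d: "d \<in> J \<rightarrow> carrier R" using s p cK J by (auto simp: d_def)
    have main: "(\<Oplus>j\<in>J. d j \<otimes> v j i) = (\<Oplus>j\<in>K. c j \<otimes> w j i)" if i: "i \<in> insert i0 I" for i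
    proof -
      have v0: "v j0 i \<in> carrier R" using v J i by auto
      have "(\<Oplus>j\<in>J. d j \<otimes> v j i) = \<ominus> s \<otimes> v j0 i \<oplus> (\<Oplus>j\<in>K. d j \<otimes> v j i)"
        unfolding J using J(2,3) v i d v0 s
        by (subst finsum_insert) (auto simp: J d_def[of] Pi_iff)
      also have "(\<Oplus>j\<in>K. d j \<otimes> v j i) = (\<Oplus>j\<in>K. c j \<otimes> w j i \<oplus> (c j \<otimes> v j i0) \<otimes> v j0 i)"
      proof (intro finsum_cong')
        fix j assume j: "j \<in> K"
        then have "j \<noteq> j0" using J by auto
        moreover have "v j i \<in> carrier R" "v j i0 \<in> carrier R" "c j \<in> carrier R"
          using v J i j cK by auto
        ultimately show "d j \<otimes> v j i = c j \<otimes> w j i \<oplus> (c j \<otimes> v j i0) \<otimes> v j0 i"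
          using p v0 unfolding d_def w_def
          by simp algebra
      qed (use v J i cK v0 p in \<open>auto simp: w_def\<close>)
      also have "\<dots> = (\<Oplus>j\<in>K. c j \<otimes> w j i) \<oplus> (\<Oplus>j\<in>K. (c j \<otimes> v j i0) \<otimes> v j0 i)"
        using v J i cK v0 p by (intro finsum_addf) (auto simp: w_def)
      also have "(\<Oplus>j\<in>K. (c j \<otimes> v j i0) \<otimes> v j0 i) = s \<otimes> v j0 i"
        unfolding s_def using v J cK v0 by (intro finsum_ldistr[symmetric]) auto
      also have "\<ominus> s \<otimes> v j0 i \<oplus> ((\<Oplus>j\<in>K. c j \<otimes> w j i) \<oplus> s \<otimes> v j0 i) = (\<Oplus>j\<in>K. c j \<otimes> w j i)"
      proof -
        have "\<ominus> s \<otimes> v j0 i \<oplus> (x \<oplus> s \<otimes> v j0 i) = x" if "x \<in> carrier R" for x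
          using that s v0 by algebra
        then show ?thesis using v J i cK v0 p by (auto simp: w_def intro!: finsum_closed)
      qed
      finally show ?thesis .
    qed
    have "(\<Oplus>j\<in>K. c j \<otimes> w j i0) = \<zero>"
      using cK v J p by (intro add.finprod_one_eqI) (auto simp: w_def p_def[symmetric] m_ac a_minus_def r_neg)
    then have "\<forall>i\<in>insert i0 I. (\<Oplus>j\<in>J. d j \<otimes> v j i) = \<zero>" using main c(3) by auto
    moreover obtain j where "j \<in> K" "c j \<noteq> \<zero>" using c by auto
    then have "j \<in> J" "d j \<noteq> \<zero>" using J p cK by (auto simp: d_def integral_iff)
    ultimately show ?thesis using d by auto
  qed
qed

text \<open>A relation between the rows of the coefficient matrix \<open>w\<close> becomes a
  relation between the elements \<open>x j\<close> after interchanging the two sums. The family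
  \<open>b\<close> only has to span; it may itself be dependent.\<close>

lemma (in module) exists_linear_relation_span:
  assumes "domain R" "finite I" "finite J" "card I < card J"
    and b: "b \<in> I \<rightarrow> carrier M"
    and w: "\<And>j. j \<in> J \<Longrightarrow> w j \<in> I \<rightarrow> carrier R"
    and x: "\<And>j. j \<in> J \<Longrightarrow> x j = (\<Oplus>\<^bsub>M\<^esub>i\<in>I. w j i \<odot>\<^bsub>M\<^esub> b i)"
  shows "\<exists>c\<in>J \<rightarrow> carrier R. (\<exists>j\<in>J. c j \<noteq> \<zero>) \<and> (\<Oplus>\<^bsub>M\<^esub>j\<in>J. c j \<odot>\<^bsub>M\<^esub> x j) = \<zero>\<^bsub>M\<^esub>"
proof -
  interpret domain R by fact
  obtain c where c: "c \<in> J \<rightarrow> carrier R" "\<exists>j\<in>J. c j \<noteq> \<zero>"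
    "\<forall>i\<in>I. (\<Oplus>j\<in>J. c j \<otimes> w j i) = \<zero>"
    using exists_linear_relation[OF assms(2-4), of w] w by auto
  have "(\<Oplus>\<^bsub>M\<^esub>j\<in>J. c j \<odot>\<^bsub>M\<^esub> x j) = (\<Oplus>\<^bsub>M\<^esub>j\<in>J. \<Oplus>\<^bsub>M\<^esub>i\<in>I. (c j \<otimes> w j i) \<odot>\<^bsub>M\<^esub> b i)"
  proof (intro M.finsum_cong')
    fix j assume "j \<in> J"
    then show "c j \<odot>\<^bsub>M\<^esub> x j = (\<Oplus>\<^bsub>M\<^esub>i\<in>I. (c j \<otimes> w j i) \<odot>\<^bsub>M\<^esub> b i)"
      using c(1) w b x assms by (subst lincomb_smult) auto
  qed (use c(1) w b in \<open>auto intro!: M.finsum_closed simp: Pi_iff\<close>)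
  also have "\<dots> = (\<Oplus>\<^bsub>M\<^esub>i\<in>I. \<Oplus>\<^bsub>M\<^esub>j\<in>J. (c j \<otimes> w j i) \<odot>\<^bsub>M\<^esub> b i)"
    using assms c(1) by (intro M.finsum_swap) (auto simp: Pi_iff)
  also have "\<dots> = (\<Oplus>\<^bsub>M\<^esub>i\<in>I. (\<Oplus>j\<in>J. c j \<otimes> w j i) \<odot>\<^bsub>M\<^esub> b i)"
  proof (intro M.finsum_cong')
    fix i assume "i \<in> I"
    then show "(\<Oplus>\<^bsub>M\<^esub>j\<in>J. (c j \<otimes> w j i) \<odot>\<^bsub>M\<^esub> b i) = (\<Oplus>j\<in>J. c j \<otimes> w j i) \<odot>\<^bsub>M\<^esub> b i"
      using c(1) w b assms by (intro finsum_smult_rdistr[symmetric]) (auto simp: Pi_iff)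
  qed (use c(1) w b in \<open>auto intro!: finsum_closed smult_closed simp: Pi_iff\<close>)
  also have "\<dots> = \<zero>\<^bsub>M\<^esub>" using c(3) b by (intro lincomb_zero) auto
  finally show ?thesis using c by auto
qed

text \<open>\<open>is_basis\<close> asks for a unique extensional coefficient function. Existence
  follows by restricting any coefficients to \<open>{..<n}\<close>, uniqueness by applying
  \<open>ind\<close> to a difference of two coefficient functions.\<close>

lemma (in module) is_basisI:
  assumes e: "e \<in> {..<n} \<rightarrow> carrier M"
    and gen: "\<And>x. x \<in> carrier M \<Longrightarrow> \<exists>c\<in>{..<n} \<rightarrow> carrier R. x = (\<Oplus>\<^bsub>M\<^esub>i\<in>{..<n}. c i \<odot>\<^bsub>M\<^esub> e i)"
    and ind: "\<And>c i. c \<in> {..<n} \<rightarrow> carrier R \<Longrightarrow> (\<Oplus>\<^bsub>M\<^esub>i\<in>{..<n}. c i \<odot>\<^bsub>M\<^esub> e i) = \<zero>\<^bsub>M\<^esub> \<Longrightarrow>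
      i < n \<Longrightarrow> c i = \<zero>"
  shows "is_basis R M n e"
  unfolding is_basis_def
proof (intro conjI ballI)
  fix x assume x: "x \<in> carrier M"
  obtain c where c: "c \<in> {..<n} \<rightarrow> carrier R" "x = (\<Oplus>\<^bsub>M\<^esub>i\<in>{..<n}. c i \<odot>\<^bsub>M\<^esub> e i)"
    using gen[OF x] by auto
  show "\<exists>!c. c \<in> {..<n} \<rightarrow>\<^sub>E carrier R \<and> x = (\<Oplus>\<^bsub>M\<^esub>i\<in>{..<n}. c i \<odot>\<^bsub>M\<^esub> e i)"
  proof (rule ex1I[of _ "restrict c {..<n}"])
    have "(\<Oplus>\<^bsub>M\<^esub>i\<in>{..<n}. restrict c {..<n} i \<odot>\<^bsub>M\<^esub> e i) = x"
      unfolding c(2) using c e by (intro M.finsum_cong') (auto simp: Pi_iff)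
    then show "restrict c {..<n} \<in> {..<n} \<rightarrow>\<^sub>E carrier R \<and>
        x = (\<Oplus>\<^bsub>M\<^esub>i\<in>{..<n}. restrict c {..<n} i \<odot>\<^bsub>M\<^esub> e i)" using c by auto
  next
    fix d assume d: "d \<in> {..<n} \<rightarrow>\<^sub>E carrier R \<and> x = (\<Oplus>\<^bsub>M\<^esub>i\<in>{..<n}. d i \<odot>\<^bsub>M\<^esub> e i)"
    have dc: "d \<in> {..<n} \<rightarrow> carrier R" using d by auto
    \<comment> \<open>The difference is written with the factor \<open>\<ominus>\<one>\<close> so
      that the rules for sums and multiples of linear combinations apply.\<close>
    have "(\<Oplus>\<^bsub>M\<^esub>i\<in>{..<n}. (d i \<oplus> \<ominus>\<one> \<otimes> c i) \<odot>\<^bsub>M\<^esub> e i) = x \<oplus>\<^bsub>M\<^esub> \<ominus>\<one> \<odot>\<^bsub>M\<^esub> x"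
      using d dc c e by (subst lincomb_add) (auto simp: lincomb_smult simp del: smult_l_minus)
    also have "\<dots> = \<zero>\<^bsub>M\<^esub>" using x by (simp add: smult_l_minus M.r_neg)
    finally have "d i \<oplus> \<ominus>\<one> \<otimes> c i = \<zero>" if "i < n" for i
      using ind[of "\<lambda>i. d i \<oplus> \<ominus>\<one> \<otimes> c i" i] dc c(1) that by auto
    then have "d i = c i" if "i < n" for i
      using that dc c(1) R.minus_unique_eq[of "d i" "c i" for i] by (auto simp: Pi_iff R.l_minus)
    then show "d = restrict c {..<n}" using d by (auto simp: PiE_iff extensional_def)
  qed
qed (use e in auto)

lemma (in module) is_basisD:
  assumes "is_basis R M n e"
  shows "e \<in> {..<n} \<rightarrow> carrier M"
    and "\<And>x. x \<in> carrier M \<Longrightarrow> \<exists>c\<in>{..<n} \<rightarrow> carrier R. x = (\<Oplus>\<^bsub>M\<^esub>i\<in>{..<n}. c i \<odot>\<^bsub>M\<^esub> e i)"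
    and "\<And>c d i. c \<in> {..<n} \<rightarrow> carrier R \<Longrightarrow> d \<in> {..<n} \<rightarrow> carrier R \<Longrightarrow>
      (\<Oplus>\<^bsub>M\<^esub>i\<in>{..<n}. c i \<odot>\<^bsub>M\<^esub> e i) = (\<Oplus>\<^bsub>M\<^esub>i\<in>{..<n}. d i \<odot>\<^bsub>M\<^esub> e i) \<Longrightarrow> i < n \<Longrightarrow> c i = d i"
proof -
  show e: "e \<in> {..<n} \<rightarrow> carrier M" using assms by (simp add: is_basis_def)
  show "\<exists>c\<in>{..<n} \<rightarrow> carrier R. x = (\<Oplus>\<^bsub>M\<^esub>i\<in>{..<n}. c i \<odot>\<^bsub>M\<^esub> e i)" if "x \<in> carrier M" for x
  proof -
    have "\<exists>!c. c \<in> {..<n} \<rightarrow>\<^sub>E carrier R \<and> x = (\<Oplus>\<^bsub>M\<^esub>i\<in>{..<n}. c i \<odot>\<^bsub>M\<^esub> e i)"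
      using assms that unfolding is_basis_def by (elim conjE bspec)
    then obtain c where c: "c \<in> {..<n} \<rightarrow>\<^sub>E carrier R" "x = (\<Oplus>\<^bsub>M\<^esub>i\<in>{..<n}. c i \<odot>\<^bsub>M\<^esub> e i)"
      by (elim ex1E conjE)
    have "c \<in> {..<n} \<rightarrow> carrier R" using c(1) by auto
    with c(2) show ?thesis by (rule bexI[where x = c])
  qed
  fix c d i
  assume c: "c \<in> {..<n} \<rightarrow> carrier R" and d: "d \<in> {..<n} \<rightarrow> carrier R"
    and eq: "(\<Oplus>\<^bsub>M\<^esub>i\<in>{..<n}. c i \<odot>\<^bsub>M\<^esub> e i) = (\<Oplus>\<^bsub>M\<^esub>i\<in>{..<n}. d i \<odot>\<^bsub>M\<^esub> e i)" and i: "i < n"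
  let ?x = "\<Oplus>\<^bsub>M\<^esub>i\<in>{..<n}. c i \<odot>\<^bsub>M\<^esub> e i"
  have r: "(\<Oplus>\<^bsub>M\<^esub>i\<in>{..<n}. restrict f {..<n} i \<odot>\<^bsub>M\<^esub> e i) = (\<Oplus>\<^bsub>M\<^esub>i\<in>{..<n}. f i \<odot>\<^bsub>M\<^esub> e i)"
    if "f \<in> {..<n} \<rightarrow> carrier R" for f
    using e that by (intro M.finsum_cong') (auto simp: Pi_iff)
  have "?x \<in> carrier M" using c e by (rule lincomb_closed)
  then have ex1: "\<exists>!c. c \<in> {..<n} \<rightarrow>\<^sub>E carrier R \<and> ?x = (\<Oplus>\<^bsub>M\<^esub>i\<in>{..<n}. c i \<odot>\<^bsub>M\<^esub> e i)"
    using assms unfolding is_basis_def by (elim conjE bspec)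
  have "restrict c {..<n} = restrict d {..<n}"
  proof (rule Uniq_D[OF ex1[unfolded ex1_iff_ex_Uniq, THEN conjunct2]]; intro conjI)
    show "?x = (\<Oplus>\<^bsub>M\<^esub>i\<in>{..<n}. restrict c {..<n} i \<odot>\<^bsub>M\<^esub> e i)" by (rule r[OF c, symmetric])
    show "?x = (\<Oplus>\<^bsub>M\<^esub>i\<in>{..<n}. restrict d {..<n} i \<odot>\<^bsub>M\<^esub> e i)" by (rule trans[OF eq r[OF d, symmetric]])
  qed (use c d in auto)
  then show "c i = d i" using i by (metis lessThan_iff restrict_apply)
qed

lemma (in module) exists_linear_relation_basis:
  assumes "domain R" "is_basis R M n e" "finite J" "n < card J" "x \<in> J \<rightarrow> carrier M"
  shows "\<exists>c\<in>J \<rightarrow> carrier R. (\<exists>j\<in>J. c j \<noteq> \<zero>) \<and> (\<Oplus>\<^bsub>M\<^esub>j\<in>J. c j \<odot>\<^bsub>M\<^esub> x j) = \<zero>\<^bsub>M\<^esub>"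
proof -
  have "\<forall>j\<in>J. \<exists>c. c \<in> {..<n} \<rightarrow> carrier R \<and> x j = (\<Oplus>\<^bsub>M\<^esub>i\<in>{..<n}. c i \<odot>\<^bsub>M\<^esub> e i)"
  proof
    fix j assume "j \<in> J"
    then have "x j \<in> carrier M" using assms(5) by auto
    from is_basisD(2)[OF assms(2) this]
    show "\<exists>c. c \<in> {..<n} \<rightarrow> carrier R \<and> x j = (\<Oplus>\<^bsub>M\<^esub>i\<in>{..<n}. c i \<odot>\<^bsub>M\<^esub> e i)" unfolding Bex_def .
  qed
  from bchoice[OF this] obtain w
    where "\<forall>j\<in>J. w j \<in> {..<n} \<rightarrow> carrier R \<and> x j = (\<Oplus>\<^bsub>M\<^esub>i\<in>{..<n}. w j i \<odot>\<^bsub>M\<^esub> e i)" ..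
  then have "w j \<in> {..<n} \<rightarrow> carrier R" "x j = (\<Oplus>\<^bsub>M\<^esub>i\<in>{..<n}. w j i \<odot>\<^bsub>M\<^esub> e i)" if "j \<in> J" for j
    using that by simp_all
  from exists_linear_relation_span[OF assms(1) _ assms(3) _ is_basisD(1)[OF assms(2)] this]
  show ?thesis using assms(4) by simp
qed

text \<open>If \<open>\<Sum> c\<^sub>i b\<^sub>i = 0\<close> with \<open>c\<^sub>k \<noteq> 0\<close>, then \<open>c\<^sub>k M\<close> is spanned by \<open>n - 1\<close> elements, too few to
  contain the \<open>c\<^sub>k\<close>-multiples of a basis.\<close>

lemma (in module) generators_are_basis:
  assumes "domain R" and f: "is_basis R M n f"
    and b: "b \<in> {..<n} \<rightarrow> carrier M"
    and gen: "\<And>x. x \<in> carrier M \<Longrightarrow> \<exists>c\<in>{..<n} \<rightarrow> carrier R. x = (\<Oplus>\<^bsub>M\<^esub>i\<in>{..<n}. c i \<odot>\<^bsub>M\<^esub> b i)"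
  shows "is_basis R M n b"
proof (rule is_basisI[OF b gen], assumption)
  fix c k
  assume c: "c \<in> {..<n} \<rightarrow> carrier R" and c0: "(\<Oplus>\<^bsub>M\<^esub>i\<in>{..<n}. c i \<odot>\<^bsub>M\<^esub> b i) = \<zero>\<^bsub>M\<^esub>" and k: "k < n"
  interpret domain R by fact
  note fM = is_basisD(1)[OF f]
  show "c k = \<zero>"
  proof (rule ccontr)
    assume ck: "c k \<noteq> \<zero>"
    have ckR: "c k \<in> carrier R" using c k by auto
    define I where "I = {..<n} - {k}"
    have I: "finite I" "insert k I = {..<n}" "k \<notin> I" "card I < card {..<n}"
      using k by (auto simp: I_def)
    have bI: "b \<in> I \<rightarrow> carrier M" using b by (auto simp: I_def)
    have "\<forall>j\<in>{..<n}. \<exists>d. d \<in> {..<n} \<rightarrow> carrier R \<and> f j = (\<Oplus>\<^bsub>M\<^esub>i\<in>{..<n}. d i \<odot>\<^bsub>M\<^esub> b i)"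
    proof
      fix j assume "j \<in> {..<n}"
      then have "f j \<in> carrier M" using fM by auto
      from gen[OF this]
      show "\<exists>d. d \<in> {..<n} \<rightarrow> carrier R \<and> f j = (\<Oplus>\<^bsub>M\<^esub>i\<in>{..<n}. d i \<odot>\<^bsub>M\<^esub> b i)" unfolding Bex_def .
    qed
    from bchoice[OF this] obtain v where "\<forall>j\<in>{..<n}. v j \<in> {..<n} \<rightarrow> carrier R \<and>
      f j = (\<Oplus>\<^bsub>M\<^esub>i\<in>{..<n}. v j i \<odot>\<^bsub>M\<^esub> b i)" ..
    then have v: "\<And>j. j < n \<Longrightarrow> v j \<in> {..<n} \<rightarrow> carrier R"
      "\<And>j. j < n \<Longrightarrow> f j = (\<Oplus>\<^bsub>M\<^esub>i\<in>{..<n}. v j i \<odot>\<^bsub>M\<^esub> b i)" by auto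
    \<comment> \<open>These are the coordinates of \<open>c k\<close> times \<open>f j\<close>,
      corrected by \<open>v j k\<close> times the relation \<open>c\<close>. The correction leaves
      the element unchanged and makes the coordinate at \<open>k\<close> vanish.\<close>
    define w where "w = (\<lambda>j i. c k \<otimes> v j i \<oplus> \<ominus> v j k \<otimes> c i)"
    have w: "w j \<in> {..<n} \<rightarrow> carrier R" if "j < n" for j
      using v(1)[OF that] c k by (auto simp: w_def Pi_iff)
    have wk: "w j k = \<zero>" if "j < n" for j
    proof -
      have "v j k \<in> carrier R" "c k \<in> carrier R" using v(1)[OF that] c k by auto
      then show ?thesis unfolding w_def by algebra
    qed
    have x: "c k \<odot>\<^bsub>M\<^esub> f j = (\<Oplus>\<^bsub>M\<^esub>i\<in>I. w j i \<odot>\<^bsub>M\<^esub> b i)" if j: "j < n" for j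
    proof -
      have vj: "v j k \<in> carrier R" using v(1)[OF j] k by auto
      have "(\<Oplus>\<^bsub>M\<^esub>i\<in>{..<n}. w j i \<odot>\<^bsub>M\<^esub> b i) = c k \<odot>\<^bsub>M\<^esub> f j \<oplus>\<^bsub>M\<^esub> \<ominus> v j k \<odot>\<^bsub>M\<^esub> \<zero>\<^bsub>M\<^esub>"
        unfolding w_def v(2)[OF j] c0[symmetric]
        using v(1)[OF j] c ckR vj b by (subst lincomb_add) (auto simp: lincomb_smult Pi_iff)
      also have "\<dots> = c k \<odot>\<^bsub>M\<^esub> f j" using vj ckR fM j by (auto simp: Pi_iff)
      finally have "c k \<odot>\<^bsub>M\<^esub> f j = (\<Oplus>\<^bsub>M\<^esub>i\<in>insert k I. w j i \<odot>\<^bsub>M\<^esub> b i)" using I by simp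
      also have "\<dots> = w j k \<odot>\<^bsub>M\<^esub> b k \<oplus>\<^bsub>M\<^esub> (\<Oplus>\<^bsub>M\<^esub>i\<in>I. w j i \<odot>\<^bsub>M\<^esub> b i)"
        using I b w[OF j] k by (intro M.finsum_insert) (auto simp: I_def Pi_iff)
      also have "\<dots> = (\<Oplus>\<^bsub>M\<^esub>i\<in>I. w j i \<odot>\<^bsub>M\<^esub> b i)"
        using wk[OF j] b k lincomb_closed[of "w j" I b] w[OF j] bI by (auto simp: I_def Pi_iff)
      finally show ?thesis .
    qed
    have wI: "w j \<in> I \<rightarrow> carrier R" if "j \<in> {..<n}" for j
      using w that by (auto simp: I_def Pi_iff)
    have xI: "c k \<odot>\<^bsub>M\<^esub> f j = (\<Oplus>\<^bsub>M\<^esub>i\<in>I. w j i \<odot>\<^bsub>M\<^esub> b i)" if "j \<in> {..<n}" for j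
      using x that by simp
    have "\<exists>d\<in>{..<n} \<rightarrow> carrier R. (\<exists>j\<in>{..<n}. d j \<noteq> \<zero>) \<and>
        (\<Oplus>\<^bsub>M\<^esub>j\<in>{..<n}. d j \<odot>\<^bsub>M\<^esub> (c k \<odot>\<^bsub>M\<^esub> f j)) = \<zero>\<^bsub>M\<^esub>"
      by (rule exists_linear_relation_span[where I = I and w = w and b = b])
        (fact \<open>domain R\<close> I(1) finite_lessThan I(4) bI wI xI)+
    then obtain d where d1: "d \<in> {..<n} \<rightarrow> carrier R" and "(\<exists>j\<in>{..<n}. d j \<noteq> \<zero>) \<and>
        (\<Oplus>\<^bsub>M\<^esub>j\<in>{..<n}. d j \<odot>\<^bsub>M\<^esub> (c k \<odot>\<^bsub>M\<^esub> f j)) = \<zero>\<^bsub>M\<^esub>"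
      by (rule bexE)
    note d = d1 this(2)[THEN conjunct1] this(2)[THEN conjunct2]
    \<comment> \<open>The relation between the multiples of the \<open>f j\<close> is one between
      the \<open>f j\<close> themselves with coefficients \<open>c k d j\<close>. Independence of
      \<open>f\<close> and \<open>c k \<noteq> 0\<close> force all \<open>d j\<close> to
      vanish.\<close>
    have "(\<Oplus>\<^bsub>M\<^esub>j\<in>{..<n}. (c k \<otimes> d j) \<odot>\<^bsub>M\<^esub> f j) = (\<Oplus>\<^bsub>M\<^esub>j\<in>{..<n}. d j \<odot>\<^bsub>M\<^esub> (c k \<odot>\<^bsub>M\<^esub> f j))"
      using d(1) ckR fM by (intro M.finsum_cong') (auto simp: Pi_iff smult_assoc1[symmetric] m_comm)
    also have "\<dots> = (\<Oplus>\<^bsub>M\<^esub>j\<in>{..<n}. \<zero> \<odot>\<^bsub>M\<^esub> f j)" using fM d(3) by (subst lincomb_zero) auto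
    finally have eq: "(\<Oplus>\<^bsub>M\<^esub>j\<in>{..<n}. (c k \<otimes> d j) \<odot>\<^bsub>M\<^esub> f j) = (\<Oplus>\<^bsub>M\<^esub>j\<in>{..<n}. \<zero> \<odot>\<^bsub>M\<^esub> f j)" .
    have "c k \<otimes> d j = \<zero>" if "j < n" for j
      by (rule is_basisD(3)[OF f _ _ eq that]) (use d(1) ckR in auto)
    then show False using d(1,2) ck ckR by (auto simp: integral_iff Pi_iff)
  qed
qed

section \<open>Traces on associative algebras\<close>

lemma (in module) submoduleI':
  assumes "N \<subseteq> carrier M" "\<zero>\<^bsub>M\<^esub> \<in> N"
    and "\<And>x y. x \<in> N \<Longrightarrow> y \<in> N \<Longrightarrow> x \<oplus>\<^bsub>M\<^esub> y \<in> N"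
    and "\<And>r x. r \<in> carrier R \<Longrightarrow> x \<in> N \<Longrightarrow> r \<odot>\<^bsub>M\<^esub> x \<in> N"
  shows "submodule N R M"
proof (rule submoduleI)
  fix x assume "x \<in> N"
  then have "\<ominus> \<one> \<odot>\<^bsub>M\<^esub> x \<in> N" "x \<in> carrier M" using assms by auto
  then show "\<ominus>\<^bsub>M\<^esub> x \<in> N" by (simp add: smult_l_minus)
qed (use assms in auto)

lemma (in module) submodule_lincomb:
  assumes "submodule N R M" "finite I" "c \<in> I \<rightarrow> carrier R" "\<And>i. i \<in> I \<Longrightarrow> b i \<in> N"
  shows "(\<Oplus>\<^bsub>M\<^esub>i\<in>I. c i \<odot>\<^bsub>M\<^esub> b i) \<in> N"
  using assms(2-4)
proof (induction I)
  case empty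
  then show ?case using submoduleE(1,2)[OF assms(1)] submodule.smult_closed[OF assms(1), of \<zero>]
    by (metis M.finsum_empty R.zero_closed equals0I smult_l_null subset_iff)
next
  case (insert i I)
  have N: "N \<subseteq> carrier M" by (rule submoduleE[OF assms(1)])
  have b: "b i \<in> carrier M" "b \<in> I \<rightarrow> carrier M" using insert.prems N by auto
  have "(\<Oplus>\<^bsub>M\<^esub>i\<in>insert i I. c i \<odot>\<^bsub>M\<^esub> b i) = c i \<odot>\<^bsub>M\<^esub> b i \<oplus>\<^bsub>M\<^esub> (\<Oplus>\<^bsub>M\<^esub>i\<in>I. c i \<odot>\<^bsub>M\<^esub> b i)"
    using insert b by (intro M.finsum_insert) (auto simp: Pi_iff)
  also have "\<dots> \<in> N"
    using insert by (intro submoduleE(5)[OF assms(1)] submodule.smult_closed[OF assms(1)]) auto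
  finally show ?case .
qed

definition (in module) combinations :: "(nat \<Rightarrow> 'c) \<Rightarrow> nat \<Rightarrow> 'c set" where
  "combinations b n = (\<lambda>c. \<Oplus>\<^bsub>M\<^esub>i\<in>{..<n}. c i \<odot>\<^bsub>M\<^esub> b i) ` ({..<n} \<rightarrow> carrier R)"

lemma (in module) submodule_combinations:
  assumes b: "b \<in> {..<n} \<rightarrow> carrier M"
  shows "submodule (combinations b n) R M"
proof (rule submoduleI')
  show "combinations b n \<subseteq> carrier M" using b by (auto simp: combinations_def intro!: lincomb_closed)
  have "\<zero>\<^bsub>M\<^esub> = (\<Oplus>\<^bsub>M\<^esub>i\<in>{..<n}. \<zero> \<odot>\<^bsub>M\<^esub> b i)" using b by (intro lincomb_zero[symmetric]) auto
  then show "\<zero>\<^bsub>M\<^esub> \<in> combinations b n" unfolding combinations_def by (rule image_eqI[where x = "\<lambda>_. \<zero>"]) auto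
next
  fix x y assume "x \<in> combinations b n" "y \<in> combinations b n"
  then obtain c d where "c \<in> {..<n} \<rightarrow> carrier R" "x = (\<Oplus>\<^bsub>M\<^esub>i\<in>{..<n}. c i \<odot>\<^bsub>M\<^esub> b i)"
    "d \<in> {..<n} \<rightarrow> carrier R" "y = (\<Oplus>\<^bsub>M\<^esub>i\<in>{..<n}. d i \<odot>\<^bsub>M\<^esub> b i)"
    unfolding combinations_def by (elim imageE)
  moreover from this have "x \<oplus>\<^bsub>M\<^esub> y = (\<Oplus>\<^bsub>M\<^esub>i\<in>{..<n}. (c i \<oplus> d i) \<odot>\<^bsub>M\<^esub> b i)"
    using b by (simp add: lincomb_add)
  ultimately show "x \<oplus>\<^bsub>M\<^esub> y \<in> combinations b n"
    unfolding combinations_def by (intro image_eqI[of _ _ "\<lambda>i. c i \<oplus> d i"]) auto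
next
  fix r x assume r: "r \<in> carrier R" and "x \<in> combinations b n"
  then obtain c where "c \<in> {..<n} \<rightarrow> carrier R" "x = (\<Oplus>\<^bsub>M\<^esub>i\<in>{..<n}. c i \<odot>\<^bsub>M\<^esub> b i)"
    unfolding combinations_def by (elim imageE)
  moreover from this have "r \<odot>\<^bsub>M\<^esub> x = (\<Oplus>\<^bsub>M\<^esub>i\<in>{..<n}. (r \<otimes> c i) \<odot>\<^bsub>M\<^esub> b i)"
    using b r by (simp add: lincomb_smult)
  ultimately show "r \<odot>\<^bsub>M\<^esub> x \<in> combinations b n"
    unfolding combinations_def using r by (intro image_eqI[of _ _ "\<lambda>i. r \<otimes> c i"]) auto
qed

lemma (in module) generator_in_combinations:
  assumes "b \<in> {..<n} \<rightarrow> carrier M" "j < n"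
  shows "b j \<in> combinations b n"
proof -
  have "b j = (\<Oplus>\<^bsub>M\<^esub>i\<in>{..<n}. (if i = j then \<one> else \<zero>) \<odot>\<^bsub>M\<^esub> b i)"
    using assms by (intro lincomb_single[symmetric]) auto
  then show ?thesis unfolding combinations_def
    by (rule image_eqI[where x = "\<lambda>i. if i = j then \<one> else \<zero>"]) auto
qed

lemma linear_map_regular_iff:
  "linear_map R M (regular_module R) f \<longleftrightarrow> f \<in> carrier M \<rightarrow> carrier R \<and>
    (\<forall>x\<in>carrier M. \<forall>y\<in>carrier M. f (x \<oplus>\<^bsub>M\<^esub> y) = f x \<oplus>\<^bsub>R\<^esub> f y) \<and>
    (\<forall>r\<in>carrier R. \<forall>x\<in>carrier M. f (r \<odot>\<^bsub>M\<^esub> x) = r \<otimes>\<^bsub>R\<^esub> f x)"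
  by (simp add: linear_map_def with_smult_def)

lemma (in module) linear_map_lincomb:
  assumes f: "linear_map R M (regular_module R) f"
    and "finite I" "c \<in> I \<rightarrow> carrier R" "b \<in> I \<rightarrow> carrier M"
  shows "f (\<Oplus>\<^bsub>M\<^esub>i\<in>I. c i \<odot>\<^bsub>M\<^esub> b i) = (\<Oplus>i\<in>I. c i \<otimes> f (b i))"
  using assms(2-4)
proof (induction I)
  case empty
  have "f (\<zero> \<odot>\<^bsub>M\<^esub> \<zero>\<^bsub>M\<^esub>) = \<zero> \<otimes> f \<zero>\<^bsub>M\<^esub>" using f unfolding linear_map_regular_iff by blast
  moreover have "f \<zero>\<^bsub>M\<^esub> \<in> carrier R" using f unfolding linear_map_regular_iff by auto
  ultimately show ?case by simp
next
  case (insert i I)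
  have fc: "f x \<in> carrier R" if "x \<in> carrier M" for x using f that by (auto simp: linear_map_regular_iff)
  have "(\<Oplus>\<^bsub>M\<^esub>i\<in>insert i I. c i \<odot>\<^bsub>M\<^esub> b i) = c i \<odot>\<^bsub>M\<^esub> b i \<oplus>\<^bsub>M\<^esub> (\<Oplus>\<^bsub>M\<^esub>i\<in>I. c i \<odot>\<^bsub>M\<^esub> b i)"
    using insert by (intro M.finsum_insert) (auto simp: Pi_iff)
  also have "f \<dots> = c i \<otimes> f (b i) \<oplus> f (\<Oplus>\<^bsub>M\<^esub>i\<in>I. c i \<odot>\<^bsub>M\<^esub> b i)"
    using insert.prems f by (auto simp: linear_map_regular_iff Pi_iff intro!: M.finsum_closed)
  also have "\<dots> = (\<Oplus>i\<in>insert i I. c i \<otimes> f (b i))"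
    using insert fc by (subst R.finsum_insert) (auto simp: Pi_iff)
  finally show ?case .
qed

text \<open>Coordinates are chosen for each element separately; their uniqueness makes the choice
  additive and homogeneous, hence also the map built from it.\<close>

lemma (in module) exists_linear_map:
  assumes e: "is_basis R M n e" and t: "t \<in> {..<n} \<rightarrow> carrier R"
  shows "\<exists>f. linear_map R M (regular_module R) f \<and> (\<forall>i<n. f (e i) = t i)"
proof -
  note eM = is_basisD(1)[OF e]
  have "\<forall>x\<in>carrier M. \<exists>c. c \<in> {..<n} \<rightarrow> carrier R \<and> x = (\<Oplus>\<^bsub>M\<^esub>i\<in>{..<n}. c i \<odot>\<^bsub>M\<^esub> e i)"
    using is_basisD(2)[OF e] unfolding Bex_def by (intro ballI)
  from bchoice[OF this] obtain c where c': "\<forall>x\<in>carrier M. c x \<in> {..<n} \<rightarrow> carrier R \<and>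
      x = (\<Oplus>\<^bsub>M\<^esub>i\<in>{..<n}. c x i \<odot>\<^bsub>M\<^esub> e i)" ..
  then have c: "c x \<in> {..<n} \<rightarrow> carrier R" if "x \<in> carrier M" for x using that by blast
  have cx: "(\<Oplus>\<^bsub>M\<^esub>i\<in>{..<n}. c x i \<odot>\<^bsub>M\<^esub> e i) = x" if "x \<in> carrier M" for x using c' that by simp
  have cc: "c x i \<in> carrier R" if "x \<in> carrier M" "i < n" for x i using c that by auto
  have ci: "c x i = d i" if "x \<in> carrier M" "d \<in> {..<n} \<rightarrow> carrier R"
    "(\<Oplus>\<^bsub>M\<^esub>i\<in>{..<n}. d i \<odot>\<^bsub>M\<^esub> e i) = x" "i < n" for x d i
    by (rule is_basisD(3)[OF e]) (use that c cx in simp_all)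
  define f where "f = (\<lambda>x. \<Oplus>i\<in>{..<n}. c x i \<otimes> t i)"
  have "linear_map R M (regular_module R) f"
    unfolding linear_map_regular_iff
  proof (intro conjI ballI)
    show "f \<in> carrier M \<rightarrow> carrier R" using cc t by (auto simp: f_def Pi_iff intro!: R.finsum_closed)
  next
    fix x y assume x: "x \<in> carrier M" and y: "y \<in> carrier M"
    have "(\<Oplus>\<^bsub>M\<^esub>i\<in>{..<n}. (c x i \<oplus> c y i) \<odot>\<^bsub>M\<^esub> e i) = x \<oplus>\<^bsub>M\<^esub> y"
      using x y c eM by (simp add: lincomb_add cx)
    then have "c (x \<oplus>\<^bsub>M\<^esub> y) i = c x i \<oplus> c y i" if "i < n" for i
      using x y that cc by (intro ci) auto
    then have "f (x \<oplus>\<^bsub>M\<^esub> y) = (\<Oplus>i\<in>{..<n}. c x i \<otimes> t i \<oplus> c y i \<otimes> t i)"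
      unfolding f_def using x y cc t by (intro R.finsum_cong') (auto simp: R.l_distr Pi_iff)
    also have "\<dots> = f x \<oplus> f y"
      unfolding f_def using x y cc t by (intro R.finsum_addf) (auto simp: Pi_iff)
    finally show "f (x \<oplus>\<^bsub>M\<^esub> y) = f x \<oplus> f y" .
  next
    fix r x assume r: "r \<in> carrier R" and x: "x \<in> carrier M"
    have "(\<Oplus>\<^bsub>M\<^esub>i\<in>{..<n}. (r \<otimes> c x i) \<odot>\<^bsub>M\<^esub> e i) = r \<odot>\<^bsub>M\<^esub> x"
      using x r c eM by (simp add: lincomb_smult cx)
    then have "c (r \<odot>\<^bsub>M\<^esub> x) i = r \<otimes> c x i" if "i < n" for i
      using x r that cc by (intro ci) auto
    then have "f (r \<odot>\<^bsub>M\<^esub> x) = (\<Oplus>i\<in>{..<n}. r \<otimes> (c x i \<otimes> t i))"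
      unfolding f_def using x r cc t by (intro R.finsum_cong') (auto simp: R.m_assoc Pi_iff)
    also have "\<dots> = r \<otimes> f x"
      unfolding f_def using x r cc t by (intro R.finsum_rdistr[symmetric]) (auto simp: Pi_iff)
    finally show "f (r \<odot>\<^bsub>M\<^esub> x) = r \<otimes> f x" .
  qed
  moreover have "f (e j) = t j" if j: "j < n" for j
  proof -
    have "c (e j) i = (if i = j then \<one> else \<zero>)" if "i < n" for i
      using that j eM lincomb_single[of "{..<n}" j e] by (intro ci) auto
    then have "f (e j) = (\<Oplus>i\<in>{..<n}. if j = i then t i else \<zero>)"
      unfolding f_def using t by (intro R.finsum_cong') (auto simp: Pi_iff)
    also have "\<dots> = t j" using t j by (intro R.finsum_singleton) auto
    finally show ?thesis .
  qed
  ultimately show ?thesis by auto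
qed

section \<open>Associative algebras and the polarised trace identity\<close>

locale assoc_alg = module R A + A: ring A for R (structure) and A (structure) +
  assumes smult_assoc_l: "\<lbrakk>r \<in> carrier R; x \<in> carrier A; y \<in> carrier A\<rbrakk> \<Longrightarrow>
      (r \<odot>\<^bsub>A\<^esub> x) \<otimes>\<^bsub>A\<^esub> y = r \<odot>\<^bsub>A\<^esub> (x \<otimes>\<^bsub>A\<^esub> y)"
    and smult_assoc_r: "\<lbrakk>r \<in> carrier R; x \<in> carrier A; y \<in> carrier A\<rbrakk> \<Longrightarrow>
      x \<otimes>\<^bsub>A\<^esub> (r \<odot>\<^bsub>A\<^esub> y) = r \<odot>\<^bsub>A\<^esub> (x \<otimes>\<^bsub>A\<^esub> y)"

lemma assoc_algebra_iff: "assoc_algebra R A \<longleftrightarrow> assoc_alg R A"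
  unfolding assoc_algebra_def assoc_alg_def assoc_alg_axioms_def by auto

context assoc_alg
begin

lemma half_closed:
  assumes "\<one> \<oplus> \<one> \<in> Units R"
  shows "half R \<in> carrier R" "half R \<otimes> (\<one> \<oplus> \<one>) = \<one>"
  using assms by (rule R.Units_inv_closed, rule R.Units_l_inv)

lemma half_smult_double:
  assumes "\<one> \<oplus> \<one> \<in> Units R" "x \<in> carrier A"
  shows "half R \<odot>\<^bsub>A\<^esub> (x \<oplus>\<^bsub>A\<^esub> x) = x"
proof -
  have "x \<oplus>\<^bsub>A\<^esub> x = (\<one> \<oplus> \<one>) \<odot>\<^bsub>A\<^esub> x" using assms by (simp add: smult_l_distr)
  then show ?thesis using assms half_closed by (simp add: smult_assoc1[symmetric])
qed

lemma double_cancel: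
  assumes "\<one> \<oplus> \<one> \<in> Units R" "x \<in> carrier A" "y \<in> carrier A" "x \<oplus>\<^bsub>A\<^esub> x = y \<oplus>\<^bsub>A\<^esub> y"
  shows "x = y"
  using half_smult_double[OF assms(1,2)] half_smult_double[OF assms(1,3)] assms(4) by metis

text \<open>The splitting condition at \<open>r = 1\<close> says that half of \<open>tr 1\<close> is
  1, that is, \<open>tr 1 = 2\<close>. Moving \<open>g\<close> to the other side changes its sign,
  which the existential quantifier absorbs.\<close>

lemma quaternion_traceD:
  assumes tr: "quaternion_trace R A tr" and two: "\<one> \<oplus> \<one> \<in> Units R"
  shows "linear_map R A (regular_module R) tr"
    and "tr \<one>\<^bsub>A\<^esub> = \<one> \<oplus> \<one>"
    and "\<And>a. a \<in> carrier A \<Longrightarrow> \<exists>g\<in>carrier R. a \<otimes>\<^bsub>A\<^esub> a = tr a \<odot>\<^bsub>A\<^esub> a \<oplus>\<^bsub>A\<^esub> g \<odot>\<^bsub>A\<^esub> \<one>\<^bsub>A\<^esub>"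
proof -
  show lin: "linear_map R A (regular_module R) tr" using tr by (simp add: quaternion_trace_def)
  then have c: "tr x \<in> carrier R" if "x \<in> carrier A" for x using that by (auto simp: linear_map_regular_iff)
  have "half R \<otimes> tr (\<one> \<odot>\<^bsub>A\<^esub> \<one>\<^bsub>A\<^esub>) = \<one>" using tr unfolding quaternion_trace_def by blast
  then have "(\<one> \<oplus> \<one>) \<otimes> (half R \<otimes> tr \<one>\<^bsub>A\<^esub>) = \<one> \<oplus> \<one>" by simp
  then show "tr \<one>\<^bsub>A\<^esub> = \<one> \<oplus> \<one>"
    using c[of "\<one>\<^bsub>A\<^esub>"] half_closed[OF two] by (simp add: R.m_assoc[symmetric] R.m_comm[of "\<one> \<oplus> \<one>"] del: Units_r_inv Units_l_inv)
  fix a assume a: "a \<in> carrier A"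
  then obtain g where g: "g \<in> carrier R"
    "(a \<otimes>\<^bsub>A\<^esub> a) \<ominus>\<^bsub>A\<^esub> (tr a \<odot>\<^bsub>A\<^esub> a) \<oplus>\<^bsub>A\<^esub> (g \<odot>\<^bsub>A\<^esub> \<one>\<^bsub>A\<^esub>) = \<zero>\<^bsub>A\<^esub>"
    using tr unfolding quaternion_trace_def by blast
  have "x = y \<oplus>\<^bsub>A\<^esub> \<ominus>\<^bsub>A\<^esub> z" if "x \<ominus>\<^bsub>A\<^esub> y \<oplus>\<^bsub>A\<^esub> z = \<zero>\<^bsub>A\<^esub>" "x \<in> carrier A" "y \<in> carrier A" "z \<in> carrier A" for x y z
  proof -
    have "x = (x \<ominus>\<^bsub>A\<^esub> y \<oplus>\<^bsub>A\<^esub> z) \<oplus>\<^bsub>A\<^esub> (y \<oplus>\<^bsub>A\<^esub> \<ominus>\<^bsub>A\<^esub> z)" using that(2-4) by algebra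
    then show ?thesis using that by simp
  qed
  from this[OF g(2)] have "a \<otimes>\<^bsub>A\<^esub> a = tr a \<odot>\<^bsub>A\<^esub> a \<oplus>\<^bsub>A\<^esub> (\<ominus> g) \<odot>\<^bsub>A\<^esub> \<one>\<^bsub>A\<^esub>"
    using a c g(1) by (simp add: smult_l_minus)
  then show "\<exists>g\<in>carrier R. a \<otimes>\<^bsub>A\<^esub> a = tr a \<odot>\<^bsub>A\<^esub> a \<oplus>\<^bsub>A\<^esub> g \<odot>\<^bsub>A\<^esub> \<one>\<^bsub>A\<^esub>"
    using g(1) by auto
qed

lemma quaternion_traceI:
  assumes two: "\<one> \<oplus> \<one> \<in> Units R" and lin: "linear_map R A (regular_module R) tr"
    and one: "tr \<one>\<^bsub>A\<^esub> = \<one> \<oplus> \<one>"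
    and sq: "\<And>a. a \<in> carrier A \<Longrightarrow> \<exists>g\<in>carrier R. a \<otimes>\<^bsub>A\<^esub> a = tr a \<odot>\<^bsub>A\<^esub> a \<oplus>\<^bsub>A\<^esub> g \<odot>\<^bsub>A\<^esub> \<one>\<^bsub>A\<^esub>"
  shows "quaternion_trace R A tr"
  unfolding quaternion_trace_def
proof (intro conjI ballI lin)
  fix r assume r: "r \<in> carrier R"
  have "half R \<otimes> (r \<otimes> (\<one> \<oplus> \<one>)) = r \<otimes> (half R \<otimes> (\<one> \<oplus> \<one>))"
    using r half_closed(1)[OF two] by (intro R.m_lcomm) auto
  moreover have "tr (r \<odot>\<^bsub>A\<^esub> \<one>\<^bsub>A\<^esub>) = r \<otimes> (\<one> \<oplus> \<one>)" using r lin one by (auto simp: linear_map_regular_iff)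
  ultimately show "half R \<otimes> tr (r \<odot>\<^bsub>A\<^esub> \<one>\<^bsub>A\<^esub>) = r" using r half_closed(2)[OF two] by simp
next
  fix a assume a: "a \<in> carrier A"
  obtain g where g: "g \<in> carrier R" "a \<otimes>\<^bsub>A\<^esub> a = tr a \<odot>\<^bsub>A\<^esub> a \<oplus>\<^bsub>A\<^esub> g \<odot>\<^bsub>A\<^esub> \<one>\<^bsub>A\<^esub>" using sq[OF a] by auto
  have "(y \<oplus>\<^bsub>A\<^esub> z) \<ominus>\<^bsub>A\<^esub> y \<oplus>\<^bsub>A\<^esub> \<ominus>\<^bsub>A\<^esub> z = \<zero>\<^bsub>A\<^esub>" if "y \<in> carrier A" "z \<in> carrier A" for y z
    using that by algebra
  moreover have "tr a \<in> carrier R" using lin a by (auto simp: linear_map_regular_iff)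
  ultimately have "(a \<otimes>\<^bsub>A\<^esub> a) \<ominus>\<^bsub>A\<^esub> (tr a \<odot>\<^bsub>A\<^esub> a) \<oplus>\<^bsub>A\<^esub> (\<ominus> g \<odot>\<^bsub>A\<^esub> \<one>\<^bsub>A\<^esub>) = \<zero>\<^bsub>A\<^esub>"
    unfolding g(2) using a g(1) by (simp add: smult_l_minus)
  then show "\<exists>g\<in>carrier R. (a \<otimes>\<^bsub>A\<^esub> a) \<ominus>\<^bsub>A\<^esub> (tr a \<odot>\<^bsub>A\<^esub> a) \<oplus>\<^bsub>A\<^esub> (g \<odot>\<^bsub>A\<^esub> \<one>\<^bsub>A\<^esub>) = \<zero>\<^bsub>A\<^esub>"
    using g(1) by (intro bexI[of _ "\<ominus> g"]) auto
qed

text \<open>Subtracting the two quadratic equations of \<open>a\<close> gives \<open>(tr a - tr' a) a = r\<close> with \<open>r\<close> a scalar;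
  both traces of this element are \<open>2r\<close>, hence \<open>(tr a - tr' a)\<^sup>2 = 0\<close>.\<close>

lemma quaternion_trace_unique:
  assumes "domain R" and two: "\<one> \<oplus> \<one> \<in> Units R"
    and tr: "quaternion_trace R A tr" and tr': "quaternion_trace R A tr'"
    and a: "a \<in> carrier A"
  shows "tr a = tr' a"
proof -
  interpret domain R by fact
  note D = quaternion_traceD[OF tr two] and D' = quaternion_traceD[OF tr' two]
  have c: "tr x \<in> carrier R" "tr' x \<in> carrier R" if "x \<in> carrier A" for x
    using D(1) D'(1) that by (auto simp: linear_map_regular_iff)
  obtain g g' where g: "g \<in> carrier R" "a \<otimes>\<^bsub>A\<^esub> a = tr a \<odot>\<^bsub>A\<^esub> a \<oplus>\<^bsub>A\<^esub> g \<odot>\<^bsub>A\<^esub> \<one>\<^bsub>A\<^esub>"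
    and g': "g' \<in> carrier R" "a \<otimes>\<^bsub>A\<^esub> a = tr' a \<odot>\<^bsub>A\<^esub> a \<oplus>\<^bsub>A\<^esub> g' \<odot>\<^bsub>A\<^esub> \<one>\<^bsub>A\<^esub>"
    using D(3)[OF a] D'(3)[OF a] by blast
  define d where "d = tr a \<oplus> \<ominus> tr' a"
  define r where "r = g' \<oplus> \<ominus> g"
  have dr: "d \<in> carrier R" "r \<in> carrier R" using c a g g' by (auto simp: d_def r_def)
  have "x \<oplus>\<^bsub>A\<^esub> \<ominus>\<^bsub>A\<^esub> y = w \<oplus>\<^bsub>A\<^esub> \<ominus>\<^bsub>A\<^esub> z" if "x \<oplus>\<^bsub>A\<^esub> z = y \<oplus>\<^bsub>A\<^esub> w"
    "x \<in> carrier A" "y \<in> carrier A" "z \<in> carrier A" "w \<in> carrier A" for x y z w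
  proof -
    have "x \<oplus>\<^bsub>A\<^esub> \<ominus>\<^bsub>A\<^esub> y = (x \<oplus>\<^bsub>A\<^esub> z) \<oplus>\<^bsub>A\<^esub> (\<ominus>\<^bsub>A\<^esub> y \<oplus>\<^bsub>A\<^esub> \<ominus>\<^bsub>A\<^esub> z)" using that(2-) by algebra
    also have "\<dots> = w \<oplus>\<^bsub>A\<^esub> \<ominus>\<^bsub>A\<^esub> z" unfolding that(1) using that(2-) by algebra
    finally show ?thesis .
  qed
  from this[OF trans[OF g(2)[symmetric] g'(2)]]
  have da: "d \<odot>\<^bsub>A\<^esub> a = r \<odot>\<^bsub>A\<^esub> \<one>\<^bsub>A\<^esub>"
    using a c g(1) g'(1) by (simp add: d_def r_def smult_l_distr smult_l_minus)
  have "d \<otimes> tr a = tr (d \<odot>\<^bsub>A\<^esub> a)" "d \<otimes> tr' a = tr' (d \<odot>\<^bsub>A\<^esub> a)"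
    using D(1) D'(1) a dr by (auto simp: linear_map_regular_iff)
  moreover have "tr (r \<odot>\<^bsub>A\<^esub> \<one>\<^bsub>A\<^esub>) = r \<otimes> (\<one> \<oplus> \<one>)" "tr' (r \<odot>\<^bsub>A\<^esub> \<one>\<^bsub>A\<^esub>) = r \<otimes> (\<one> \<oplus> \<one>)"
    using D(1,2) D'(1,2) dr by (auto simp: linear_map_regular_iff)
  ultimately have eq: "d \<otimes> tr a = d \<otimes> tr' a" unfolding da by simp
  have "d \<otimes> d = d \<otimes> tr a \<oplus> \<ominus> (d \<otimes> tr' a)" using c a unfolding d_def by algebra
  then have "d \<otimes> d = \<zero>" using eq c a dr by (simp add: R.r_neg)
  then have "d = \<zero>" using dr integral by blast
  then show ?thesis using c a by (simp add: d_def R.minus_unique_eq)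
qed

text \<open>The linearisation of the square equation: comparing the equations of \<open>a\<close>,
  \<open>b\<close> and \<open>a + b\<close> leaves this relation, with \<open>s\<close> and
  \<open>t\<close> in the place of the traces of \<open>a\<close> and \<open>b\<close>. The scalar
  \<open>g\<close> stays unspecified, being the polarised norm up to sign.\<close>

definition polar :: "'a \<Rightarrow> 'c \<Rightarrow> 'a \<Rightarrow> 'c \<Rightarrow> bool" where
  "polar s a t b \<longleftrightarrow> (\<exists>g\<in>carrier R.
     a \<otimes>\<^bsub>A\<^esub> b \<oplus>\<^bsub>A\<^esub> b \<otimes>\<^bsub>A\<^esub> a = s \<odot>\<^bsub>A\<^esub> b \<oplus>\<^bsub>A\<^esub> t \<odot>\<^bsub>A\<^esub> a \<oplus>\<^bsub>A\<^esub> g \<odot>\<^bsub>A\<^esub> \<one>\<^bsub>A\<^esub>)"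

lemma polar_commute:
  assumes "polar s a t b" "s \<in> carrier R" "t \<in> carrier R" "a \<in> carrier A" "b \<in> carrier A"
  shows "polar t b s a"
  using assms unfolding polar_def
  by (simp add: M.a_comm[of "b \<otimes>\<^bsub>A\<^esub> a"] M.a_comm[of "t \<odot>\<^bsub>A\<^esub> a"])

lemma polar_add:
  assumes "polar s a t b" "polar s' a' t b"
    and "s \<in> carrier R" "s' \<in> carrier R" "t \<in> carrier R" "a \<in> carrier A" "a' \<in> carrier A" "b \<in> carrier A"
  shows "polar (s \<oplus> s') (a \<oplus>\<^bsub>A\<^esub> a') t b"
proof -
  obtain g g' where g: "g \<in> carrier R" "g' \<in> carrier R"
    and eq: "a \<otimes>\<^bsub>A\<^esub> b \<oplus>\<^bsub>A\<^esub> b \<otimes>\<^bsub>A\<^esub> a = s \<odot>\<^bsub>A\<^esub> b \<oplus>\<^bsub>A\<^esub> t \<odot>\<^bsub>A\<^esub> a \<oplus>\<^bsub>A\<^esub> g \<odot>\<^bsub>A\<^esub> \<one>\<^bsub>A\<^esub>"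
      "a' \<otimes>\<^bsub>A\<^esub> b \<oplus>\<^bsub>A\<^esub> b \<otimes>\<^bsub>A\<^esub> a' = s' \<odot>\<^bsub>A\<^esub> b \<oplus>\<^bsub>A\<^esub> t \<odot>\<^bsub>A\<^esub> a' \<oplus>\<^bsub>A\<^esub> g' \<odot>\<^bsub>A\<^esub> \<one>\<^bsub>A\<^esub>"
    using assms(1,2) unfolding polar_def by blast
  have "(a \<oplus>\<^bsub>A\<^esub> a') \<otimes>\<^bsub>A\<^esub> b \<oplus>\<^bsub>A\<^esub> b \<otimes>\<^bsub>A\<^esub> (a \<oplus>\<^bsub>A\<^esub> a')
      = (a \<otimes>\<^bsub>A\<^esub> b \<oplus>\<^bsub>A\<^esub> b \<otimes>\<^bsub>A\<^esub> a) \<oplus>\<^bsub>A\<^esub> (a' \<otimes>\<^bsub>A\<^esub> b \<oplus>\<^bsub>A\<^esub> b \<otimes>\<^bsub>A\<^esub> a')"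
    using assms(6-8) by algebra
  also have "\<dots> = (s \<oplus> s') \<odot>\<^bsub>A\<^esub> b \<oplus>\<^bsub>A\<^esub> t \<odot>\<^bsub>A\<^esub> (a \<oplus>\<^bsub>A\<^esub> a') \<oplus>\<^bsub>A\<^esub> (g \<oplus> g') \<odot>\<^bsub>A\<^esub> \<one>\<^bsub>A\<^esub>"
    unfolding eq using assms(3-8) g by (simp add: smult_l_distr smult_r_distr M.a_ac)
  finally show ?thesis unfolding polar_def using g by blast
qed

lemma polar_smult:
  assumes "polar s a t b" "r \<in> carrier R"
    and "s \<in> carrier R" "t \<in> carrier R" "a \<in> carrier A" "b \<in> carrier A"
  shows "polar (r \<otimes> s) (r \<odot>\<^bsub>A\<^esub> a) t b"
proof -
  obtain g where g: "g \<in> carrier R"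
    and eq: "a \<otimes>\<^bsub>A\<^esub> b \<oplus>\<^bsub>A\<^esub> b \<otimes>\<^bsub>A\<^esub> a = s \<odot>\<^bsub>A\<^esub> b \<oplus>\<^bsub>A\<^esub> t \<odot>\<^bsub>A\<^esub> a \<oplus>\<^bsub>A\<^esub> g \<odot>\<^bsub>A\<^esub> \<one>\<^bsub>A\<^esub>"
    using assms(1) unfolding polar_def by blast
  have "(r \<odot>\<^bsub>A\<^esub> a) \<otimes>\<^bsub>A\<^esub> b \<oplus>\<^bsub>A\<^esub> b \<otimes>\<^bsub>A\<^esub> (r \<odot>\<^bsub>A\<^esub> a) = r \<odot>\<^bsub>A\<^esub> (a \<otimes>\<^bsub>A\<^esub> b \<oplus>\<^bsub>A\<^esub> b \<otimes>\<^bsub>A\<^esub> a)"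
    using assms by (simp add: smult_assoc_l smult_assoc_r smult_r_distr)
  also have "\<dots> = (r \<otimes> s) \<odot>\<^bsub>A\<^esub> b \<oplus>\<^bsub>A\<^esub> t \<odot>\<^bsub>A\<^esub> (r \<odot>\<^bsub>A\<^esub> a) \<oplus>\<^bsub>A\<^esub> (r \<otimes> g) \<odot>\<^bsub>A\<^esub> \<one>\<^bsub>A\<^esub>"
    unfolding eq using assms(2-) g by (simp add: smult_r_distr smult_assoc1[symmetric] R.m_comm)
  finally show ?thesis unfolding polar_def using assms g by blast
qed

lemma polar_zero:
  assumes "t \<in> carrier R" "b \<in> carrier A"
  shows "polar \<zero> \<zero>\<^bsub>A\<^esub> t b"
  unfolding polar_def using assms by (intro bexI[of _ \<zero>]) auto

text \<open>The left side is \<open>2 b\<close>, and the right side is \<open>2 b + t + g\<close>;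
  hence the scalar \<open>- t\<close>.\<close>

lemma polar_one:
  assumes "t \<in> carrier R" "b \<in> carrier A"
  shows "polar (\<one> \<oplus> \<one>) \<one>\<^bsub>A\<^esub> t b"
proof -
  have "b \<oplus>\<^bsub>A\<^esub> b = (b \<oplus>\<^bsub>A\<^esub> b) \<oplus>\<^bsub>A\<^esub> x \<oplus>\<^bsub>A\<^esub> \<ominus>\<^bsub>A\<^esub> x" if "x \<in> carrier A" for x
    using that assms by algebra
  then show ?thesis unfolding polar_def using assms
    by (intro bexI[of _ "\<ominus> t"]) (auto simp: smult_l_distr smult_l_minus)
qed

text \<open>The element \<open>b'\<close> is the conjugate \<open>t - b\<close>, with the same trace
  \<open>t\<close>. Substituting \<open>t - b\<close> turns the scalar \<open>g\<close> into
  \<open>- g - s t\<close>.\<close>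

lemma polar_conj:
  assumes "polar s a t b" "b \<oplus>\<^bsub>A\<^esub> b' = t \<odot>\<^bsub>A\<^esub> \<one>\<^bsub>A\<^esub>"
    and "s \<in> carrier R" "t \<in> carrier R" "a \<in> carrier A" "b \<in> carrier A" "b' \<in> carrier A"
  shows "polar s a t b'"
proof -
  obtain g where g: "g \<in> carrier R"
    and eq: "a \<otimes>\<^bsub>A\<^esub> b \<oplus>\<^bsub>A\<^esub> b \<otimes>\<^bsub>A\<^esub> a = s \<odot>\<^bsub>A\<^esub> b \<oplus>\<^bsub>A\<^esub> t \<odot>\<^bsub>A\<^esub> a \<oplus>\<^bsub>A\<^esub> g \<odot>\<^bsub>A\<^esub> \<one>\<^bsub>A\<^esub>"
    using assms(1) unfolding polar_def by blast
  have b: "b \<oplus>\<^bsub>A\<^esub> b' \<oplus>\<^bsub>A\<^esub> \<ominus>\<^bsub>A\<^esub> b = b'" using assms(5-7) by algebra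
  then have b': "b' = t \<odot>\<^bsub>A\<^esub> \<one>\<^bsub>A\<^esub> \<oplus>\<^bsub>A\<^esub> \<ominus>\<^bsub>A\<^esub> b" unfolding assms(2) by simp
  define x y z w where "x = t \<odot>\<^bsub>A\<^esub> a" and "y = s \<odot>\<^bsub>A\<^esub> b" and "z = g \<odot>\<^bsub>A\<^esub> \<one>\<^bsub>A\<^esub>"
    and "w = (s \<otimes> t) \<odot>\<^bsub>A\<^esub> \<one>\<^bsub>A\<^esub>"
  have xyz: "x \<in> carrier A" "y \<in> carrier A" "z \<in> carrier A" "w \<in> carrier A"
    using assms g by (auto simp: x_def y_def z_def w_def)
  have 1: "a \<otimes>\<^bsub>A\<^esub> b' \<oplus>\<^bsub>A\<^esub> b' \<otimes>\<^bsub>A\<^esub> a = x \<oplus>\<^bsub>A\<^esub> x \<oplus>\<^bsub>A\<^esub> \<ominus>\<^bsub>A\<^esub> (a \<otimes>\<^bsub>A\<^esub> b \<oplus>\<^bsub>A\<^esub> b \<otimes>\<^bsub>A\<^esub> a)"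
  proof -
    have "a \<otimes>\<^bsub>A\<^esub> (t \<odot>\<^bsub>A\<^esub> \<one>\<^bsub>A\<^esub>) = x" "(t \<odot>\<^bsub>A\<^esub> \<one>\<^bsub>A\<^esub>) \<otimes>\<^bsub>A\<^esub> a = x"
      using assms by (auto simp: x_def smult_assoc_l smult_assoc_r)
    then have "a \<otimes>\<^bsub>A\<^esub> b' = x \<oplus>\<^bsub>A\<^esub> \<ominus>\<^bsub>A\<^esub> (a \<otimes>\<^bsub>A\<^esub> b)" "b' \<otimes>\<^bsub>A\<^esub> a = x \<oplus>\<^bsub>A\<^esub> \<ominus>\<^bsub>A\<^esub> (b \<otimes>\<^bsub>A\<^esub> a)"
      unfolding b' using assms by (simp_all add: A.r_distr A.l_distr A.r_minus A.l_minus)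
    moreover have "x \<oplus>\<^bsub>A\<^esub> \<ominus>\<^bsub>A\<^esub> (a \<otimes>\<^bsub>A\<^esub> b) \<oplus>\<^bsub>A\<^esub> (x \<oplus>\<^bsub>A\<^esub> \<ominus>\<^bsub>A\<^esub> (b \<otimes>\<^bsub>A\<^esub> a)) = x \<oplus>\<^bsub>A\<^esub> x \<oplus>\<^bsub>A\<^esub> \<ominus>\<^bsub>A\<^esub> (a \<otimes>\<^bsub>A\<^esub> b \<oplus>\<^bsub>A\<^esub> b \<otimes>\<^bsub>A\<^esub> a)"
      using xyz assms(5,6) by algebra
    ultimately show ?thesis by simp
  qed
  have 2: "s \<odot>\<^bsub>A\<^esub> b' = w \<oplus>\<^bsub>A\<^esub> \<ominus>\<^bsub>A\<^esub> y"
    unfolding b' w_def y_def using assms by (simp add: smult_r_distr smult_assoc1 smult_r_minus)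
  have 3: "(\<ominus> g \<oplus> \<ominus> (s \<otimes> t)) \<odot>\<^bsub>A\<^esub> \<one>\<^bsub>A\<^esub> = \<ominus>\<^bsub>A\<^esub> z \<oplus>\<^bsub>A\<^esub> \<ominus>\<^bsub>A\<^esub> w"
    unfolding z_def w_def using assms g by (simp add: smult_l_distr smult_l_minus)
  have "x \<oplus>\<^bsub>A\<^esub> x \<oplus>\<^bsub>A\<^esub> \<ominus>\<^bsub>A\<^esub> (y \<oplus>\<^bsub>A\<^esub> x \<oplus>\<^bsub>A\<^esub> z) = w \<oplus>\<^bsub>A\<^esub> \<ominus>\<^bsub>A\<^esub> y \<oplus>\<^bsub>A\<^esub> x \<oplus>\<^bsub>A\<^esub> (\<ominus>\<^bsub>A\<^esub> z \<oplus>\<^bsub>A\<^esub> \<ominus>\<^bsub>A\<^esub> w)"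
    using xyz by algebra
  then have "a \<otimes>\<^bsub>A\<^esub> b' \<oplus>\<^bsub>A\<^esub> b' \<otimes>\<^bsub>A\<^esub> a = s \<odot>\<^bsub>A\<^esub> b' \<oplus>\<^bsub>A\<^esub> t \<odot>\<^bsub>A\<^esub> a \<oplus>\<^bsub>A\<^esub> (\<ominus> g \<oplus> \<ominus> (s \<otimes> t)) \<odot>\<^bsub>A\<^esub> \<one>\<^bsub>A\<^esub>"
    unfolding 1 2 3 eq x_def[symmetric] y_def[symmetric] z_def[symmetric] .
  then show ?thesis unfolding polar_def using assms g by blast
qed

text \<open>The linear map with values \<open>t i\<close> on the basis satisfies the polar relation
  on pairs of basis elements, hence everywhere by bilinearity, and the diagonal gives the square
  equation. The coordinates \<open>u\<close> of the unit serve to verify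
  \<open>tr 1 = 2\<close>.\<close>

lemma quaternion_trace_of_basis:
  assumes two: "\<one> \<oplus> \<one> \<in> Units R" and e: "is_basis R A n e" and t: "t \<in> {..<n} \<rightarrow> carrier R"
    and rel: "\<And>i j. i < n \<Longrightarrow> j < n \<Longrightarrow> polar (t i) (e i) (t j) (e j)"
    and u: "u \<in> {..<n} \<rightarrow> carrier R" "\<one>\<^bsub>A\<^esub> = (\<Oplus>\<^bsub>A\<^esub>i\<in>{..<n}. u i \<odot>\<^bsub>A\<^esub> e i)"
      "(\<Oplus>i\<in>{..<n}. u i \<otimes> t i) = \<one> \<oplus> \<one>"
  shows "\<exists>tr. quaternion_trace R A tr \<and> (\<forall>i<n. tr (e i) = t i)"
proof -
  obtain tr where tr: "linear_map R A (regular_module R) tr" "\<forall>i<n. tr (e i) = t i"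
    using exists_linear_map[OF e t] by auto
  note eA = is_basisD(1)[OF e]
  have trc: "tr x \<in> carrier R" if "x \<in> carrier A" for x using that tr by (auto simp: linear_map_regular_iff)
  have tr_zero: "tr \<zero>\<^bsub>A\<^esub> = \<zero>" using linear_map_lincomb[OF tr(1), of "{}"] by simp
  \<comment> \<open>For fixed \<open>b\<close> the relation is linear in \<open>a\<close> and
    \<open>tr a\<close> together. It is extended from the basis in the first argument, then, after
    exchanging the arguments, in the second.\<close>
  have sub: "submodule {a \<in> carrier A. polar (tr a) a (tr b) b} R A" if b: "b \<in> carrier A" for b
  proof (rule submoduleI')
    show "\<zero>\<^bsub>A\<^esub> \<in> {a \<in> carrier A. polar (tr a) a (tr b) b}" using polar_zero b trc tr_zero by simp
  next
    fix x y assume "x \<in> {a \<in> carrier A. polar (tr a) a (tr b) b}" "y \<in> {a \<in> carrier A. polar (tr a) a (tr b) b}"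
    then show "x \<oplus>\<^bsub>A\<^esub> y \<in> {a \<in> carrier A. polar (tr a) a (tr b) b}"
      using tr(1) b trc polar_add[of "tr x" x "tr b" b "tr y" y] by (simp add: linear_map_regular_iff)
  next
    fix r x assume "r \<in> carrier R" "x \<in> {a \<in> carrier A. polar (tr a) a (tr b) b}"
    then show "r \<odot>\<^bsub>A\<^esub> x \<in> {a \<in> carrier A. polar (tr a) a (tr b) b}"
      using tr(1) b trc polar_smult[of "tr x" x "tr b" b r] by (simp add: linear_map_regular_iff)
  qed auto
  have span: "a \<in> N" if N: "submodule N R A" "\<And>i. i < n \<Longrightarrow> e i \<in> N" and a: "a \<in> carrier A" for a N
  proof -
    obtain c where c: "c \<in> {..<n} \<rightarrow> carrier R" "a = (\<Oplus>\<^bsub>A\<^esub>i\<in>{..<n}. c i \<odot>\<^bsub>A\<^esub> e i)"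
      using is_basisD(2)[OF e a] by (elim bexE)
    show ?thesis unfolding c(2) by (rule submodule_lincomb[OF N(1)]) (use c N in auto)
  qed
  have 1: "polar (tr a) a (t j) (e j)" if "j < n" "a \<in> carrier A" for a j
    using span[OF sub[of "e j"] _ that(2)] rel tr(2) that eA by (auto simp: Pi_iff)
  have 2: "polar (tr a) a (tr b) b" if a: "a \<in> carrier A" and b: "b \<in> carrier A" for a b
  proof -
    have "e i \<in> {a \<in> carrier A. polar (tr a) a (tr b) b}" if i: "i < n" for i
    proof -
      have ei: "e i \<in> carrier A" "t i \<in> carrier R" using i eA t by auto
      have "polar (t i) (e i) (tr b) b" by (rule polar_commute[OF 1[OF i b] trc[OF b] ei(2) b ei(1)])
      then show ?thesis using tr(2) i ei by simp
    qed
    from span[OF sub[OF b] this a] show ?thesis by simp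
  qed
  have "quaternion_trace R A tr"
  proof (rule quaternion_traceI[OF two tr(1)])
    have "tr \<one>\<^bsub>A\<^esub> = (\<Oplus>i\<in>{..<n}. u i \<otimes> tr (e i))"
      unfolding u(2) using tr(1) u(1) eA by (intro linear_map_lincomb) auto
    also have "\<dots> = (\<Oplus>i\<in>{..<n}. u i \<otimes> t i)"
      using tr(2) u(1) t by (intro R.finsum_cong') (auto simp: Pi_iff)
    finally show "tr \<one>\<^bsub>A\<^esub> = \<one> \<oplus> \<one>" unfolding u(3) .
  next
    fix a assume a: "a \<in> carrier A"
    \<comment> \<open>With equal arguments the polar relation is twice the wanted equation, so it
      only has to be halved.\<close>
    obtain g where g: "g \<in> carrier R" "a \<otimes>\<^bsub>A\<^esub> a \<oplus>\<^bsub>A\<^esub> a \<otimes>\<^bsub>A\<^esub> a = tr a \<odot>\<^bsub>A\<^esub> a \<oplus>\<^bsub>A\<^esub> tr a \<odot>\<^bsub>A\<^esub> a \<oplus>\<^bsub>A\<^esub> g \<odot>\<^bsub>A\<^esub> \<one>\<^bsub>A\<^esub>"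
      using 2[OF a a] unfolding polar_def by blast
    define x where "x = tr a \<odot>\<^bsub>A\<^esub> a"
    have x: "x \<in> carrier A" using a trc by (auto simp: x_def)
    have "a \<otimes>\<^bsub>A\<^esub> a = half R \<odot>\<^bsub>A\<^esub> (a \<otimes>\<^bsub>A\<^esub> a \<oplus>\<^bsub>A\<^esub> a \<otimes>\<^bsub>A\<^esub> a)"
      using a two by (simp add: half_smult_double)
    also have "\<dots> = half R \<odot>\<^bsub>A\<^esub> (x \<oplus>\<^bsub>A\<^esub> x) \<oplus>\<^bsub>A\<^esub> half R \<odot>\<^bsub>A\<^esub> (g \<odot>\<^bsub>A\<^esub> \<one>\<^bsub>A\<^esub>)"
      unfolding g(2) x_def[symmetric] using x g half_closed(1)[OF two] by (subst smult_r_distr) auto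
    also have "\<dots> = x \<oplus>\<^bsub>A\<^esub> (half R \<otimes> g) \<odot>\<^bsub>A\<^esub> \<one>\<^bsub>A\<^esub>"
      using x g two half_closed(1)[OF two] by (simp add: half_smult_double smult_assoc1)
    finally show "\<exists>g\<in>carrier R. a \<otimes>\<^bsub>A\<^esub> a = tr a \<odot>\<^bsub>A\<^esub> a \<oplus>\<^bsub>A\<^esub> g \<odot>\<^bsub>A\<^esub> \<one>\<^bsub>A\<^esub>"
      unfolding x_def using g half_closed(1)[OF two] by blast
  qed
  with tr(2) show ?thesis by auto
qed

end

section \<open>Algebras generated like an even Clifford algebra of rank four\<close>

text \<open>The elements \<open>p i j\<close> abstract the products \<open>e\<^sub>i e\<^sub>j\<close> of two out of three vectors, scaled to
  degree 0, and \<open>q\<close> the values of the quadratic form.\<close>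

locale ternary_even_clifford = assoc_alg +
  fixes p :: "nat \<Rightarrow> nat \<Rightarrow> 'c" and q :: "nat \<Rightarrow> nat \<Rightarrow> 'a"
  assumes two: "\<one> \<oplus> \<one> \<in> Units R"
    and p_closed: "\<lbrakk>i < 3; j < 3\<rbrakk> \<Longrightarrow> p i j \<in> carrier A"
    and q_closed: "\<lbrakk>i < 3; j < 3\<rbrakk> \<Longrightarrow> q i j \<in> carrier R"
    and q_sym: "\<lbrakk>i < 3; j < 3\<rbrakk> \<Longrightarrow> q i j = q j i"
    and p_add_swap: "\<lbrakk>i < 3; j < 3\<rbrakk> \<Longrightarrow> p i j \<oplus>\<^bsub>A\<^esub> p j i = (q i j \<oplus> q i j) \<odot>\<^bsub>A\<^esub> \<one>\<^bsub>A\<^esub>"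
    and p_mult_swap: "\<lbrakk>i < 3; j < 3; k < 3; l < 3\<rbrakk> \<Longrightarrow>
      p i j \<otimes>\<^bsub>A\<^esub> p k l \<oplus>\<^bsub>A\<^esub> p i k \<otimes>\<^bsub>A\<^esub> p j l = (q j k \<oplus> q j k) \<odot>\<^bsub>A\<^esub> p i l"
    and generated: "\<lbrakk>submodule N R A; \<one>\<^bsub>A\<^esub> \<in> N;
      \<And>i j x. \<lbrakk>i < 3; j < 3; x \<in> N\<rbrakk> \<Longrightarrow> p i j \<otimes>\<^bsub>A\<^esub> x \<in> N\<rbrakk> \<Longrightarrow> carrier A \<subseteq> N"
begin

text \<open>At equal indices the relation \<open>p_add_swap\<close> is twice the claim.\<close>

lemma p_diag:
  assumes "i < 3"
  shows "p i i = q i i \<odot>\<^bsub>A\<^esub> \<one>\<^bsub>A\<^esub>"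
  by (rule double_cancel[OF two])
    (use p_add_swap[OF assms assms] p_closed[OF assms assms] q_closed[OF assms assms]
      in \<open>simp_all add: smult_l_distr\<close>)

text \<open>For equal middle indices both summands of \<open>p_mult_swap\<close> coincide. In terms
  of vectors, \<open>e\<^sub>j e\<^sub>j\<close> is the scalar \<open>q j j\<close>.\<close>

lemma p_mult_adjacent:
  assumes "i < 3" "j < 3" "l < 3"
  shows "p i j \<otimes>\<^bsub>A\<^esub> p j l = q j j \<odot>\<^bsub>A\<^esub> p i l"
  by (rule double_cancel[OF two])
    (use p_mult_swap[of i j j l] p_closed q_closed assms in \<open>simp_all add: smult_l_distr\<close>)

lemma p_swap:
  assumes "i < 3" "j < 3"
  shows "p i j = (q i j \<oplus> q i j) \<odot>\<^bsub>A\<^esub> \<one>\<^bsub>A\<^esub> \<oplus>\<^bsub>A\<^esub> \<ominus>\<^bsub>A\<^esub> p j i"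
proof -
  have "p i j = (p i j \<oplus>\<^bsub>A\<^esub> p j i) \<oplus>\<^bsub>A\<^esub> \<ominus>\<^bsub>A\<^esub> p j i"
    using p_closed[OF assms] p_closed[OF assms(2,1)] by algebra
  then show ?thesis unfolding p_add_swap[OF assms] .
qed

text \<open>Exchanging the factors of \<open>p k j\<close> brings the two occurrences of the index
  \<open>j\<close> next to each other, where \<open>p_mult_adjacent\<close> contracts them.\<close>

lemma p_mult_shared:
  assumes i: "i < 3" and j: "j < 3" and k: "k < 3"
  shows "p i j \<otimes>\<^bsub>A\<^esub> p k j = (q k j \<oplus> q k j) \<odot>\<^bsub>A\<^esub> p i j \<oplus>\<^bsub>A\<^esub> \<ominus>\<^bsub>A\<^esub> (q j j \<odot>\<^bsub>A\<^esub> p i k)"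
proof -
  have "p i j \<otimes>\<^bsub>A\<^esub> p k j = p i j \<otimes>\<^bsub>A\<^esub> ((q k j \<oplus> q k j) \<odot>\<^bsub>A\<^esub> \<one>\<^bsub>A\<^esub>) \<oplus>\<^bsub>A\<^esub> \<ominus>\<^bsub>A\<^esub> (p i j \<otimes>\<^bsub>A\<^esub> p j k)"
    unfolding p_swap[OF k j] using p_closed[OF i j] p_closed[OF j k] q_closed[OF k j]
    by (simp add: A.r_distr A.r_minus)
  then show ?thesis
    using p_mult_adjacent[OF i j k] p_closed[OF i j] q_closed[OF k j] by (simp add: smult_assoc_r)
qed

text \<open>In the two orders of multiplication, \<open>p_mult_shared\<close> leaves the remainders
  \<open>q j j p i k\<close> and \<open>q j j p k i\<close>. Their sum is a scalar by
  \<open>p_add_swap\<close>; the other terms are those of the polar relation.\<close>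

lemma polar_shared:
  assumes i: "i < 3" and j: "j < 3" and k: "k < 3"
  shows "polar (q i j \<oplus> q i j) (p i j) (q k j \<oplus> q k j) (p k j)"
proof -
  note c = p_closed q_closed
  define a b w z where "a = (q k j \<oplus> q k j) \<odot>\<^bsub>A\<^esub> p i j" and "b = (q i j \<oplus> q i j) \<odot>\<^bsub>A\<^esub> p k j"
    and "w = q j j \<odot>\<^bsub>A\<^esub> p i k" and "z = q j j \<odot>\<^bsub>A\<^esub> p k i"
  have m: "a \<in> carrier A" "b \<in> carrier A" "w \<in> carrier A" "z \<in> carrier A"
    using assms c by (auto simp: a_def b_def w_def z_def)
  have "w \<oplus>\<^bsub>A\<^esub> z = q j j \<odot>\<^bsub>A\<^esub> (p i k \<oplus>\<^bsub>A\<^esub> p k i)"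
    using assms c by (simp add: w_def z_def smult_r_distr)
  also have "\<dots> = (q j j \<otimes> (q i k \<oplus> q i k)) \<odot>\<^bsub>A\<^esub> \<one>\<^bsub>A\<^esub>"
    unfolding p_add_swap[OF i k] using assms c by (simp add: smult_assoc1)
  finally have wz: "(\<ominus> (q j j \<otimes> (q i k \<oplus> q i k))) \<odot>\<^bsub>A\<^esub> \<one>\<^bsub>A\<^esub> = \<ominus>\<^bsub>A\<^esub> (w \<oplus>\<^bsub>A\<^esub> z)"
    using assms c by (simp add: smult_l_minus)
  have "p i j \<otimes>\<^bsub>A\<^esub> p k j \<oplus>\<^bsub>A\<^esub> p k j \<otimes>\<^bsub>A\<^esub> p i j = (a \<oplus>\<^bsub>A\<^esub> \<ominus>\<^bsub>A\<^esub> w) \<oplus>\<^bsub>A\<^esub> (b \<oplus>\<^bsub>A\<^esub> \<ominus>\<^bsub>A\<^esub> z)"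
    unfolding p_mult_shared[OF i j k] p_mult_shared[OF k j i] a_def b_def w_def z_def ..
  also have "\<dots> = b \<oplus>\<^bsub>A\<^esub> a \<oplus>\<^bsub>A\<^esub> \<ominus>\<^bsub>A\<^esub> (w \<oplus>\<^bsub>A\<^esub> z)" using m by algebra
  finally show ?thesis unfolding polar_def wz[symmetric] a_def b_def using assms c by blast
qed

text \<open>By \<open>p_add_swap\<close> the element \<open>p j i\<close> is the conjugate of
  \<open>p i j\<close> for the trace \<open>2 q i j\<close>.\<close>

lemma polar_flip_right:
  assumes "polar s a (q i j \<oplus> q i j) (p i j)" "s \<in> carrier R" "a \<in> carrier A" "i < 3" "j < 3"
  shows "polar s a (q j i \<oplus> q j i) (p j i)"
  using polar_conj[OF assms(1) p_add_swap] p_closed q_closed q_sym[of i j] assms(2-) by auto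

lemma polar_flip_left:
  assumes "polar (q i j \<oplus> q i j) (p i j) t b" "t \<in> carrier R" "b \<in> carrier A" "i < 3" "j < 3"
  shows "polar (q j i \<oplus> q j i) (p j i) t b"
  using polar_commute[OF polar_flip_right[OF polar_commute[OF assms(1)]]] p_closed q_closed assms(2-)
  by auto

text \<open>The index 3 stands for \<open>p 1 2\<close>, and so do all larger indices, which makes
  every value lie in the carrier without a bound on the index.\<close>

definition generator :: "nat \<Rightarrow> 'c" where
  "generator i = (if i = 0 then \<one>\<^bsub>A\<^esub> else if i = 1 then p 0 1 else if i = 2 then p 0 2 else p 1 2)"

definition generator_trace :: "nat \<Rightarrow> 'a" where
  "generator_trace i = (if i = 0 then \<one> \<oplus> \<one> else if i = 1 then q 0 1 \<oplus> q 0 1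
     else if i = 2 then q 0 2 \<oplus> q 0 2 else q 1 2 \<oplus> q 1 2)"

lemma generator_closed: "generator i \<in> carrier A" "generator_trace i \<in> carrier R"
  by (auto simp: generator_def generator_trace_def p_closed q_closed)

text \<open>Any two of the pairs 01, 02, 12 share an index, and flipping a pair moves the shared
  index to the second place, where \<open>polar_shared\<close> applies.\<close>

lemma polar_generators: "polar (generator_trace i) (generator i) (generator_trace j) (generator j)"
proof -
  let ?P = "\<lambda>i j k l. polar (q i j \<oplus> q i j) (p i j) (q k l \<oplus> q k l) (p k l)"
  have c: "p i j \<in> carrier A" "q i j \<oplus> q i j \<in> carrier R" if "i < 3" "j < 3" for i j
    using p_closed q_closed that by auto
  have swap: "?P k l i j" if "?P i j k l" "i < 3" "j < 3" "k < 3" "l < 3" for i j k l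
    by (rule polar_commute[OF that(1)]) (simp_all add: c that)
  have diag: "?P 0 1 0 1" "?P 0 2 0 2" "?P 1 2 1 2" by (rule polar_shared; simp)+
  have 1: "?P 0 1 1 2"
    by (rule polar_flip_right[of _ _ 2 1]) (simp_all add: c polar_shared)
  have 2: "?P 0 1 0 2"
    by (rule polar_flip_left[of 1 0], rule polar_flip_right[of _ _ 2 0]) (simp_all add: c polar_shared)
  have 3: "?P 0 2 1 2" by (rule polar_shared) simp_all
  note P = diag 1 2 3 1[THEN swap, simplified] 2[THEN swap, simplified] 3[THEN swap, simplified]
  have one: "polar (\<one> \<oplus> \<one>) \<one>\<^bsub>A\<^esub> t b" "polar t b (\<one> \<oplus> \<one>) \<one>\<^bsub>A\<^esub>"
    if "t \<in> carrier R" "b \<in> carrier A" for t b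
    using that polar_one polar_commute[of "\<one> \<oplus> \<one>" "\<one>\<^bsub>A\<^esub>" t b] by auto
  consider "i = 0 \<or> j = 0" | "i \<noteq> 0" "j \<noteq> 0" by blast
  then show ?thesis
  proof cases
    case 1
    then show ?thesis using one generator_closed by (auto simp: generator_def generator_trace_def c)
  next
    case 2
    then show ?thesis using P by (simp add: generator_def generator_trace_def)
  qed
qed

text \<open>By \<open>generated\<close> it suffices that the span contains the unit and is stable
  under left multiplication by every \<open>p i j\<close>. As the span is generated by the unit and
  three of the \<open>p k l\<close>, this amounts to a statement about products
  \<open>p i j p k l\<close>.\<close>

lemma carrier_subset_combinations: "carrier A \<subseteq> combinations generator 4"
proof -
  let ?S = "combinations generator 4"
  have gA: "generator \<in> {..<4} \<rightarrow> carrier A" using generator_closed by auto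
  have sub: "submodule ?S R A" by (rule submodule_combinations[OF gA])
  note S = submoduleE[OF sub] submodule.smult_closed[OF sub]
  have g: "generator i \<in> ?S" if "i < 4" for i using generator_in_combinations[OF gA that] .
  have one: "\<one>\<^bsub>A\<^esub> \<in> ?S" using g[of 0] by (simp add: generator_def)
  have zero: "\<zero>\<^bsub>A\<^esub> \<in> ?S" using S(7)[OF R.zero_closed one] by simp
  have scal: "r \<odot>\<^bsub>A\<^esub> \<one>\<^bsub>A\<^esub> \<in> ?S" if "r \<in> carrier R" for r using S(7) one that by blast
  have flip: "p j i \<in> ?S" if "p i j \<in> ?S" "i < 3" "j < 3" for i j
    unfolding p_swap[OF that(3,2)] using that q_closed by (intro S(5) scal S(3)) auto
  have pS: "p i j \<in> ?S" if "i < 3" "j < 3" for i j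
  proof -
    have "p 0 1 \<in> ?S" "p 0 2 \<in> ?S" "p 1 2 \<in> ?S"
      using g[of 1] g[of 2] g[of 3] by (simp_all add: generator_def)
    moreover have "p i i \<in> ?S" if "i < 3" for i
      unfolding p_diag[OF that] by (rule scal) (simp add: q_closed that)
    moreover have "i = 0 \<or> i = 1 \<or> i = 2" "j = 0 \<or> j = 1 \<or> j = 2" using that by auto
    ultimately show ?thesis using flip[of 0 1] flip[of 0 2] flip[of 1 2] by auto
  qed
  have diff: "x \<in> ?S" if "x \<oplus>\<^bsub>A\<^esub> y \<in> ?S" "y \<in> ?S" "x \<in> carrier A" for x y
  proof -
    have y: "y \<in> carrier A" using that(2) S(1) by blast
    have "x \<oplus>\<^bsub>A\<^esub> y \<oplus>\<^bsub>A\<^esub> \<ominus>\<^bsub>A\<^esub> y \<in> ?S" by (rule S(5)[OF that(1) S(3)[OF that(2)]])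
    also have "x \<oplus>\<^bsub>A\<^esub> y \<oplus>\<^bsub>A\<^esub> \<ominus>\<^bsub>A\<^esub> y = x" using that(3) y by algebra
    finally show ?thesis .
  qed
  let ?M = "\<lambda>i j k l. p i j \<otimes>\<^bsub>A\<^esub> p k l \<in> ?S"
  \<comment> \<open>The sum \<open>p i j + p j i\<close> is a scalar, so modulo the span exchanging
    the first two indices only changes the sign. \<open>M34\<close> is the same for the last
    two.\<close>
  have M12: "?M i j k l" if "?M j i k l" "i < 3" "j < 3" "k < 3" "l < 3" for i j k l
  proof (rule diff[OF _ that(1)])
    have "p i j \<otimes>\<^bsub>A\<^esub> p k l \<oplus>\<^bsub>A\<^esub> p j i \<otimes>\<^bsub>A\<^esub> p k l = (p i j \<oplus>\<^bsub>A\<^esub> p j i) \<otimes>\<^bsub>A\<^esub> p k l"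
      using that p_closed by (simp add: A.l_distr)
    also have "\<dots> = (q i j \<oplus> q i j) \<odot>\<^bsub>A\<^esub> p k l"
      unfolding p_add_swap[OF that(2,3)] using that p_closed q_closed by (simp add: smult_assoc_l)
    also have "\<dots> \<in> ?S" using that q_closed pS by (intro S(7)) auto
    finally show "p i j \<otimes>\<^bsub>A\<^esub> p k l \<oplus>\<^bsub>A\<^esub> p j i \<otimes>\<^bsub>A\<^esub> p k l \<in> ?S" .
  qed (use that p_closed in auto)
  have M34: "?M i j k l" if "?M i j l k" "i < 3" "j < 3" "k < 3" "l < 3" for i j k l
  proof (rule diff[OF _ that(1)])
    have "p i j \<otimes>\<^bsub>A\<^esub> p k l \<oplus>\<^bsub>A\<^esub> p i j \<otimes>\<^bsub>A\<^esub> p l k = p i j \<otimes>\<^bsub>A\<^esub> (p k l \<oplus>\<^bsub>A\<^esub> p l k)"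
      using that p_closed by (simp add: A.r_distr)
    also have "\<dots> = (q k l \<oplus> q k l) \<odot>\<^bsub>A\<^esub> p i j"
      unfolding p_add_swap[OF that(4,5)] using that p_closed q_closed by (simp add: smult_assoc_r)
    also have "\<dots> \<in> ?S" using that q_closed pS by (intro S(7)) auto
    finally show "p i j \<otimes>\<^bsub>A\<^esub> p k l \<oplus>\<^bsub>A\<^esub> p i j \<otimes>\<^bsub>A\<^esub> p l k \<in> ?S" .
  qed (use that p_closed in auto)
  have adj: "?M i j j l" if "i < 3" "j < 3" "l < 3" for i j l
    unfolding p_mult_adjacent[OF that] using that q_closed pS by (intro S(7)) auto
  have same: "?M i i k l" "?M k l i i" if "i < 3" "k < 3" "l < 3" for i k l
    unfolding p_diag[OF that(1)] using that q_closed pS p_closed S(7)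
    by (auto simp: smult_assoc_l smult_assoc_r)
  text \<open>Modulo \<open>?S\<close> the product is alternating in its four indices, two of which coincide.\<close>
  have prod: "?M i j k l" if "i < 3" "j < 3" "k < 3" "l < 3" for i j k l
  proof -
    have "i = j \<or> k = l \<or> j = k \<or> i = k \<or> j = l \<or> i = l" using that by linarith
    then consider "i = j" | "k = l" | "j = k" | "i = k" | "j = l" | "i = l" by blast
    then show ?thesis
    proof cases
      case 5
      then show ?thesis using M34[OF adj] that by blast
    next
      case 6
      then show ?thesis using M12[OF M34[OF adj]] that by blast
    qed (use same adj M12[OF adj] that in blast)+
  qed
  show ?thesis
  proof (rule generated[OF sub one])
    fix i j :: nat and x assume ij: "i < 3" "j < 3" and x: "x \<in> ?S"
    \<comment> \<open>The elements whose product with \<open>p i j\<close> stays in the span form a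
      submodule, so only the four generators need to be tested.\<close>
    let ?N = "{x \<in> carrier A. p i j \<otimes>\<^bsub>A\<^esub> x \<in> ?S}"
    have N: "submodule ?N R A"
      by (rule submoduleI') (use ij p_closed S zero in \<open>auto simp: A.r_distr smult_assoc_r\<close>)
    have gN: "generator k \<in> ?N" for k
      using prod[OF ij] pS[OF ij] p_closed ij by (auto simp: generator_def)
    obtain c where c: "c \<in> {..<4} \<rightarrow> carrier R" "x = (\<Oplus>\<^bsub>A\<^esub>i\<in>{..<4}. c i \<odot>\<^bsub>A\<^esub> generator i)"
      using x unfolding combinations_def by (elim imageE)
    have "x \<in> ?N" unfolding c(2) by (rule submodule_lincomb[OF N _ c(1) gN]) simp
    then show "p i j \<otimes>\<^bsub>A\<^esub> x \<in> ?S" by simp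
  qed
qed

theorem exists_quaternion_trace:
  assumes "domain R" "free_of_rank R A 4"
  shows "\<exists>tr. quaternion_trace R A tr"
proof -
  obtain f where f: "is_basis R A 4 f" using assms(2) by (auto simp: free_of_rank_def)
  have gA: "generator \<in> {..<4} \<rightarrow> carrier A" using generator_closed by auto
  have "is_basis R A 4 generator"
  proof (rule generators_are_basis[OF assms(1) f gA])
    fix x assume "x \<in> carrier A"
    then have "x \<in> combinations generator 4" using carrier_subset_combinations by blast
    then show "\<exists>c\<in>{..<4} \<rightarrow> carrier R. x = (\<Oplus>\<^bsub>A\<^esub>i\<in>{..<4}. c i \<odot>\<^bsub>A\<^esub> generator i)"
      unfolding combinations_def image_iff .
  qed
  moreover have "\<one>\<^bsub>A\<^esub> = (\<Oplus>\<^bsub>A\<^esub>i\<in>{..<4}. (if i = 0 then \<one> else \<zero>) \<odot>\<^bsub>A\<^esub> generator i)"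
    using lincomb_single[of "{..<4}" 0 generator] gA by (simp add: generator_def)
  moreover have "(\<Oplus>i\<in>{..<4::nat}. (if i = 0 then \<one> else \<zero>) \<otimes> generator_trace i) = \<one> \<oplus> \<one>"
  proof -
    have "(\<Oplus>i\<in>{..<4::nat}. (if i = 0 then \<one> else \<zero>) \<otimes> generator_trace i) =
        (\<Oplus>i\<in>{..<4::nat}. if 0 = i then generator_trace i else \<zero>)"
      by (intro R.finsum_cong') (auto simp: generator_closed)
    also have "\<dots> = generator_trace 0" by (intro R.finsum_singleton) (auto simp: generator_closed)
    finally show ?thesis by (simp add: generator_trace_def)
  qed
  ultimately obtain tr where "quaternion_trace R A tr"
    using quaternion_trace_of_basis[OF two, of 4 generator generator_trace "\<lambda>i. if i = 0 then \<one> else \<zero>"]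
      polar_generators generator_closed by auto
  then show ?thesis by blast
qed

end

section \<open>Monoid algebras and quotients\<close>

definition alg_hom ::
  "('r, 'm) ring_scheme \<Rightarrow> ('r, 'a, 'n) module_scheme \<Rightarrow> ('r, 'b, 'o) module_scheme \<Rightarrow>
   ('a \<Rightarrow> 'b) \<Rightarrow> bool" where
  "alg_hom R A B h \<longleftrightarrow> h \<in> ring_hom A B \<and>
    (\<forall>r\<in>carrier R. \<forall>x\<in>carrier A. h (r \<odot>\<^bsub>A\<^esub> x) = r \<odot>\<^bsub>B\<^esub> h x)"

lemma alg_homD:
  assumes "alg_hom R A B h"
  shows "h \<in> ring_hom A B"
    and "\<And>x. x \<in> carrier A \<Longrightarrow> h x \<in> carrier B"
    and "\<And>x y. x \<in> carrier A \<Longrightarrow> y \<in> carrier A \<Longrightarrow> h (x \<otimes>\<^bsub>A\<^esub> y) = h x \<otimes>\<^bsub>B\<^esub> h y"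
    and "\<And>x y. x \<in> carrier A \<Longrightarrow> y \<in> carrier A \<Longrightarrow> h (x \<oplus>\<^bsub>A\<^esub> y) = h x \<oplus>\<^bsub>B\<^esub> h y"
    and "h \<one>\<^bsub>A\<^esub> = \<one>\<^bsub>B\<^esub>"
    and "\<And>r x. r \<in> carrier R \<Longrightarrow> x \<in> carrier A \<Longrightarrow> h (r \<odot>\<^bsub>A\<^esub> x) = r \<odot>\<^bsub>B\<^esub> h x"
  using assms by (auto simp: alg_hom_def ring_hom_def)

lemma alg_hom_zero:
  assumes "alg_hom R A B h" "ring A" "ring B"
  shows "h \<zero>\<^bsub>A\<^esub> = \<zero>\<^bsub>B\<^esub>"
  using ring_hom_zero[OF alg_homD(1)[OF assms(1)] assms(2,3)] .

lemma alg_hom_a_inv: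
  assumes "alg_hom R A B h" "ring A" "ring B" "x \<in> carrier A"
  shows "h (\<ominus>\<^bsub>A\<^esub> x) = \<ominus>\<^bsub>B\<^esub> h x"
proof -
  interpret ring_hom_ring A B h
    using assms alg_homD(1)[OF assms(1)] by (simp add: ring_hom_ringI2)
  show ?thesis using assms by simp
qed

lemma alg_hom_minus:
  assumes "alg_hom R A B h" "ring A" "ring B" "x \<in> carrier A" "y \<in> carrier A"
  shows "h (x \<ominus>\<^bsub>A\<^esub> y) = h x \<ominus>\<^bsub>B\<^esub> h y"
proof -
  interpret A: ring A by fact
  show ?thesis
    using assms by (simp add: a_minus_def alg_homD(4)[OF assms(1)] alg_hom_a_inv[OF assms(1-3)])
qed

section \<open>Monoid algebras and their universal property\<close>

locale monoid_alg = R?: cring R + M: monoid M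
  for R :: "('r, 'm) ring_scheme" (structure) and M :: "('x, 'n) monoid_scheme" (structure)
begin

abbreviation F :: "('r, 'x \<Rightarrow> 'r) module" where "F \<equiv> monoid_algebra R M"

abbreviation supp :: "('x \<Rightarrow> 'r) \<Rightarrow> 'x set" where "supp f \<equiv> {x. f x \<noteq> \<zero>}"

lemma carrier_iff: "f \<in> carrier F \<longleftrightarrow>
    (\<forall>x. f x \<in> carrier R) \<and> (\<forall>x. x \<notin> carrier M \<longrightarrow> f x = \<zero>) \<and> finite (supp f)"
  by (simp add: monoid_algebra_def)

lemma F_simps: "zero F = (\<lambda>x. \<zero>)" "add F f g = (\<lambda>x. f x \<oplus> g x)" "smult F r f = (\<lambda>x. r \<otimes> f x)"
  "one F = delta R \<one>\<^bsub>M\<^esub>"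
  by (auto simp: monoid_algebra_def delta_def)

lemma carrierD: "f \<in> carrier F \<Longrightarrow> f x \<in> carrier R" "f \<in> carrier F \<Longrightarrow> finite (supp f)"
  "f \<in> carrier F \<Longrightarrow> supp f \<subseteq> carrier M"
  by (auto simp: carrier_iff)

lemma zero_closed': "\<zero>\<^bsub>F\<^esub> \<in> carrier F"
  by (simp add: carrier_iff F_simps)

lemma add_closed': "f \<in> carrier F \<Longrightarrow> g \<in> carrier F \<Longrightarrow> f \<oplus>\<^bsub>F\<^esub> g \<in> carrier F"
  unfolding carrier_iff F_simps
  by (auto intro: finite_subset[of _ "supp f \<union> supp g"])

lemma smult_closed': "r \<in> carrier R \<Longrightarrow> f \<in> carrier F \<Longrightarrow> r \<odot>\<^bsub>F\<^esub> f \<in> carrier F"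
  unfolding carrier_iff F_simps
  by (auto intro: finite_subset[of _ "supp f"])

lemma delta_closed: "m \<in> carrier M \<Longrightarrow> delta R m \<in> carrier F"
  by (auto simp: carrier_iff delta_def)

lemma supp_delta: "supp (delta R m) \<subseteq> {m}"
  by (auto simp: delta_def)

lemma abelian_group_F: "abelian_group F"
proof (rule abelian_groupI)
  fix f assume f: "f \<in> carrier F"
  have "(\<lambda>x. \<ominus> f x) \<in> carrier F"
    using f unfolding carrier_iff by (auto intro: finite_subset[of _ "supp f"])
  moreover have "(\<lambda>x. \<ominus> f x) \<oplus>\<^bsub>F\<^esub> f = \<zero>\<^bsub>F\<^esub>"
    using carrierD(1)[OF f] by (auto simp: F_simps l_neg)
  ultimately show "\<exists>g\<in>carrier F. g \<oplus>\<^bsub>F\<^esub> f = \<zero>\<^bsub>F\<^esub>" by blast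
qed (use zero_closed' add_closed' in \<open>auto simp: F_simps a_ac carrierD(1)\<close>)

lemma module_F: "Module.module R F"
  by (rule moduleI[OF R.is_cring abelian_group_F])
    (use smult_closed' in \<open>auto simp: F_simps carrierD(1) l_distr r_distr m_assoc\<close>)

interpretation F: module R F by (rule module_F)

text \<open>The defining sum runs over a set depending on both functions and on \<open>x\<close>.
  Over a fixed rectangle containing the supports, with zeros filled in, sums for different functions
  can be added term by term.\<close>

lemma mult_apply:
  assumes "f \<in> carrier F" "g \<in> carrier F" "finite S" "finite T" "supp f \<subseteq> S" "supp g \<subseteq> T"
  shows "(f \<otimes>\<^bsub>F\<^esub> g) x =
    (\<Oplus>p\<in>S \<times> T. if fst p \<otimes>\<^bsub>M\<^esub> snd p = x then f (fst p) \<otimes> g (snd p) else \<zero>)"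
proof -
  have "(f \<otimes>\<^bsub>F\<^esub> g) x = finsum R (\<lambda>(y, z). f y \<otimes> g z)
      {(y, z). f y \<noteq> \<zero> \<and> g z \<noteq> \<zero> \<and> y \<otimes>\<^bsub>M\<^esub> z = x}" by (simp add: monoid_algebra_def)
  also have "\<dots> = (\<Oplus>p\<in>S \<times> T. if fst p \<otimes>\<^bsub>M\<^esub> snd p = x then f (fst p) \<otimes> g (snd p) else \<zero>)"
    by (rule add.finprod_mono_neutral_cong_left)
      (use assms carrierD(1)[OF assms(1)] carrierD(1)[OF assms(2)] in \<open>auto split: if_splits\<close>)
  finally show ?thesis .
qed

lemma mult_closed':
  assumes f: "f \<in> carrier F" and g: "g \<in> carrier F"
  shows "f \<otimes>\<^bsub>F\<^esub> g \<in> carrier F"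
proof -
  note fg = mult_apply[OF f g carrierD(2)[OF f] carrierD(2)[OF g] subset_refl subset_refl]
  let ?P = "(\<lambda>p. fst p \<otimes>\<^bsub>M\<^esub> snd p) ` (supp f \<times> supp g)"
  have z: "(f \<otimes>\<^bsub>F\<^esub> g) x = \<zero>" if "x \<notin> ?P" for x
    unfolding fg using that by (intro add.finprod_one_eqI) auto
  have "?P \<subseteq> carrier M" using carrierD(3)[OF f] carrierD(3)[OF g] by (auto simp: subset_iff)
  moreover have "supp (f \<otimes>\<^bsub>F\<^esub> g) \<subseteq> ?P" using z by blast
  moreover have "finite ?P" using carrierD(2)[OF f] carrierD(2)[OF g] by blast
  moreover have "(f \<otimes>\<^bsub>F\<^esub> g) x \<in> carrier R" for x
    unfolding fg using carrierD(1)[OF f] carrierD(1)[OF g] by (intro finsum_closed) auto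
  moreover have "(f \<otimes>\<^bsub>F\<^esub> g) x = \<zero>" if "x \<notin> carrier M" for x
    using that z \<open>?P \<subseteq> carrier M\<close> by blast
  ultimately show ?thesis unfolding carrier_iff using finite_subset by blast
qed

lemma mult_l_distr:
  assumes f: "f \<in> carrier F" and g: "g \<in> carrier F" and h: "h \<in> carrier F"
  shows "(f \<oplus>\<^bsub>F\<^esub> g) \<otimes>\<^bsub>F\<^esub> h = f \<otimes>\<^bsub>F\<^esub> h \<oplus>\<^bsub>F\<^esub> g \<otimes>\<^bsub>F\<^esub> h"
proof
  fix x
  let ?S = "supp f \<union> supp g"
  have S: "finite ?S" "supp f \<subseteq> ?S" "supp g \<subseteq> ?S" "supp (f \<oplus>\<^bsub>F\<^esub> g) \<subseteq> ?S"
    using carrierD(2)[OF f] carrierD(2)[OF g] by (auto simp: F_simps)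
  note m = mult_apply[OF _ h S(1) carrierD(2)[OF h] _ subset_refl, of _ x]
  let ?t = "\<lambda>f p. if fst p \<otimes>\<^bsub>M\<^esub> snd p = x then f (fst p) \<otimes> h (snd p) else \<zero>"
  note c = carrierD(1)[OF f] carrierD(1)[OF g] carrierD(1)[OF h]
  have "(\<Oplus>p\<in>?S \<times> supp h. ?t (f \<oplus>\<^bsub>F\<^esub> g) p) = (\<Oplus>p\<in>?S \<times> supp h. ?t f p \<oplus> ?t g p)"
    using c by (intro finsum_cong') (auto simp: F_simps l_distr)
  also have "\<dots> = (\<Oplus>p\<in>?S \<times> supp h. ?t f p) \<oplus> (\<Oplus>p\<in>?S \<times> supp h. ?t g p)"
    using c by (intro finsum_addf) auto
  finally show "((f \<oplus>\<^bsub>F\<^esub> g) \<otimes>\<^bsub>F\<^esub> h) x = (f \<otimes>\<^bsub>F\<^esub> h \<oplus>\<^bsub>F\<^esub> g \<otimes>\<^bsub>F\<^esub> h) x"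
    unfolding F_simps(2)[of "f \<otimes>\<^bsub>F\<^esub> h"] m[OF f S(2)] m[OF g S(3)] m[OF add_closed'[OF f g] S(4)] .
qed

lemma mult_r_distr:
  assumes f: "f \<in> carrier F" and g: "g \<in> carrier F" and h: "h \<in> carrier F"
  shows "h \<otimes>\<^bsub>F\<^esub> (f \<oplus>\<^bsub>F\<^esub> g) = h \<otimes>\<^bsub>F\<^esub> f \<oplus>\<^bsub>F\<^esub> h \<otimes>\<^bsub>F\<^esub> g"
proof
  fix x
  let ?S = "supp f \<union> supp g"
  have S: "finite ?S" "supp f \<subseteq> ?S" "supp g \<subseteq> ?S" "supp (f \<oplus>\<^bsub>F\<^esub> g) \<subseteq> ?S"
    using carrierD(2)[OF f] carrierD(2)[OF g] by (auto simp: F_simps)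
  note m = mult_apply[OF h _ carrierD(2)[OF h] S(1) subset_refl, of _ x]
  let ?t = "\<lambda>f p. if fst p \<otimes>\<^bsub>M\<^esub> snd p = x then h (fst p) \<otimes> f (snd p) else \<zero>"
  note c = carrierD(1)[OF f] carrierD(1)[OF g] carrierD(1)[OF h]
  have "(\<Oplus>p\<in>supp h \<times> ?S. ?t (f \<oplus>\<^bsub>F\<^esub> g) p) = (\<Oplus>p\<in>supp h \<times> ?S. ?t f p \<oplus> ?t g p)"
    using c by (intro finsum_cong') (auto simp: F_simps r_distr)
  also have "\<dots> = (\<Oplus>p\<in>supp h \<times> ?S. ?t f p) \<oplus> (\<Oplus>p\<in>supp h \<times> ?S. ?t g p)"
    using c by (intro finsum_addf) auto
  finally show "(h \<otimes>\<^bsub>F\<^esub> (f \<oplus>\<^bsub>F\<^esub> g)) x = (h \<otimes>\<^bsub>F\<^esub> f \<oplus>\<^bsub>F\<^esub> h \<otimes>\<^bsub>F\<^esub> g) x"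
    unfolding F_simps(2)[of "h \<otimes>\<^bsub>F\<^esub> f"] m[OF f S(2)] m[OF g S(3)] m[OF add_closed'[OF f g] S(4)] .
qed

lemma mult_smult_l:
  assumes r: "r \<in> carrier R" and f: "f \<in> carrier F" and g: "g \<in> carrier F"
  shows "(r \<odot>\<^bsub>F\<^esub> f) \<otimes>\<^bsub>F\<^esub> g = r \<odot>\<^bsub>F\<^esub> (f \<otimes>\<^bsub>F\<^esub> g)"
proof
  fix x
  have s: "supp (r \<odot>\<^bsub>F\<^esub> f) \<subseteq> supp f" using r by (auto simp: F_simps)
  note m = mult_apply[OF _ g carrierD(2)[OF f] carrierD(2)[OF g] _ subset_refl, of _ x]
  note c = r carrierD(1)[OF f] carrierD(1)[OF g] carrierD(2)[OF f] carrierD(2)[OF g]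
  have "(\<Oplus>p\<in>supp f \<times> supp g. if fst p \<otimes>\<^bsub>M\<^esub> snd p = x then (r \<odot>\<^bsub>F\<^esub> f) (fst p) \<otimes> g (snd p) else \<zero>) =
      (\<Oplus>p\<in>supp f \<times> supp g. r \<otimes> (if fst p \<otimes>\<^bsub>M\<^esub> snd p = x then f (fst p) \<otimes> g (snd p) else \<zero>))"
    using c by (intro finsum_cong') (auto simp: F_simps m_assoc)
  also have "\<dots> = r \<otimes> (\<Oplus>p\<in>supp f \<times> supp g. if fst p \<otimes>\<^bsub>M\<^esub> snd p = x then f (fst p) \<otimes> g (snd p) else \<zero>)"
    using c by (intro finsum_rdistr[symmetric]) auto
  finally show "((r \<odot>\<^bsub>F\<^esub> f) \<otimes>\<^bsub>F\<^esub> g) x = (r \<odot>\<^bsub>F\<^esub> (f \<otimes>\<^bsub>F\<^esub> g)) x"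
    unfolding F_simps(3)[of r "f \<otimes>\<^bsub>F\<^esub> g"] m[OF f subset_refl] m[OF smult_closed'[OF r f] s] .
qed

lemma mult_smult_r:
  assumes r: "r \<in> carrier R" and f: "f \<in> carrier F" and g: "g \<in> carrier F"
  shows "f \<otimes>\<^bsub>F\<^esub> (r \<odot>\<^bsub>F\<^esub> g) = r \<odot>\<^bsub>F\<^esub> (f \<otimes>\<^bsub>F\<^esub> g)"
proof
  fix x
  have s: "supp (r \<odot>\<^bsub>F\<^esub> g) \<subseteq> supp g" using r by (auto simp: F_simps)
  note m = mult_apply[OF f _ carrierD(2)[OF f] carrierD(2)[OF g] subset_refl, of _ x]
  note c = r carrierD(1)[OF f] carrierD(1)[OF g] carrierD(2)[OF f] carrierD(2)[OF g]
  have "(\<Oplus>p\<in>supp f \<times> supp g. if fst p \<otimes>\<^bsub>M\<^esub> snd p = x then f (fst p) \<otimes> (r \<odot>\<^bsub>F\<^esub> g) (snd p) else \<zero>) =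
      (\<Oplus>p\<in>supp f \<times> supp g. r \<otimes> (if fst p \<otimes>\<^bsub>M\<^esub> snd p = x then f (fst p) \<otimes> g (snd p) else \<zero>))"
    using c by (intro finsum_cong') (auto simp: F_simps m_lcomm)
  also have "\<dots> = r \<otimes> (\<Oplus>p\<in>supp f \<times> supp g. if fst p \<otimes>\<^bsub>M\<^esub> snd p = x then f (fst p) \<otimes> g (snd p) else \<zero>)"
    using c by (intro finsum_rdistr[symmetric]) auto
  finally show "(f \<otimes>\<^bsub>F\<^esub> (r \<odot>\<^bsub>F\<^esub> g)) x = (r \<odot>\<^bsub>F\<^esub> (f \<otimes>\<^bsub>F\<^esub> g)) x"
    unfolding F_simps(3)[of r "f \<otimes>\<^bsub>F\<^esub> g"] m[OF g subset_refl] m[OF smult_closed'[OF r g] s] .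
qed

lemma mult_delta:
  assumes m: "m \<in> carrier M" and n: "n \<in> carrier M"
  shows "delta R m \<otimes>\<^bsub>F\<^esub> delta R n = delta R (m \<otimes>\<^bsub>M\<^esub> n)"
proof
  fix x
  have "{m} \<times> {n} = {(m, n)}" by simp
  then show "(delta R m \<otimes>\<^bsub>F\<^esub> delta R n) x = delta R (m \<otimes>\<^bsub>M\<^esub> n) x"
    using mult_apply[OF delta_closed[OF m] delta_closed[OF n], of "{m}" "{n}" x]
      supp_delta[of m] supp_delta[of n] by (auto simp: delta_def)
qed

text \<open>A finitely supported function is built up one monomial at a time. Identities linear in
  an argument are thereby reduced to the basis functions \<open>delta R m\<close>.\<close>

lemma carrier_induct [consumes 1, case_names zero add]:
  assumes f: "f \<in> carrier F"
    and zero: "P \<zero>\<^bsub>F\<^esub>"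
    and add: "\<And>r m f. r \<in> carrier R \<Longrightarrow> m \<in> carrier M \<Longrightarrow> f \<in> carrier F \<Longrightarrow> P f \<Longrightarrow>
      P (r \<odot>\<^bsub>F\<^esub> delta R m \<oplus>\<^bsub>F\<^esub> f)"
  shows "P f"
proof -
  have "P f" if "finite S" "f \<in> carrier F" "supp f \<subseteq> S" "S \<subseteq> carrier M" for S f
    using that
  proof (induction S arbitrary: f)
    case empty
    then have "f = \<zero>\<^bsub>F\<^esub>" by (auto simp: F_simps)
    then show ?case using zero by simp
  next
    case (insert m S)
    let ?g = "f(m := \<zero>)"
    have f: "f \<in> carrier F" by fact
    have "supp ?g \<subseteq> supp f" by auto
    then have g: "?g \<in> carrier F"
      using f unfolding carrier_iff by (auto intro: finite_subset)
    have "P ?g" using insert.prems by (intro insert.IH g) (auto split: if_splits)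
    then have "P (f m \<odot>\<^bsub>F\<^esub> delta R m \<oplus>\<^bsub>F\<^esub> ?g)"
      using insert.prems g carrierD(1)[OF f] by (intro add) auto
    also have "f m \<odot>\<^bsub>F\<^esub> delta R m \<oplus>\<^bsub>F\<^esub> ?g = f"
      using carrierD(1)[OF f] by (auto simp: F_simps delta_def fun_eq_iff)
    finally show ?case .
  qed
  from this[OF carrierD(2)[OF f] f subset_refl carrierD(3)[OF f]] show ?thesis .
qed

lemma mult_zero:
  assumes "f \<in> carrier F"
  shows "\<zero>\<^bsub>F\<^esub> \<otimes>\<^bsub>F\<^esub> f = \<zero>\<^bsub>F\<^esub>" "f \<otimes>\<^bsub>F\<^esub> \<zero>\<^bsub>F\<^esub> = \<zero>\<^bsub>F\<^esub>"
  using mult_smult_l[OF R.zero_closed zero_closed' assms] mult_smult_r[OF R.zero_closed assms zero_closed']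
    mult_closed' assms zero_closed' by auto

lemmas F_closed = mult_closed' add_closed' smult_closed' delta_closed zero_closed'

text \<open>Three nested inductions, one for each factor, reduce the claim to \<open>delta\<close>
  functions, where it is associativity in the monoid.\<close>

lemma mult_assoc':
  assumes f: "f \<in> carrier F" and g: "g \<in> carrier F" and h: "h \<in> carrier F"
  shows "(f \<otimes>\<^bsub>F\<^esub> g) \<otimes>\<^bsub>F\<^esub> h = f \<otimes>\<^bsub>F\<^esub> (g \<otimes>\<^bsub>F\<^esub> h)"
  using f
proof (induction rule: carrier_induct)
  case zero
  then show ?case using g h by (simp add: mult_zero F_closed)
next
  case (add r m f)
  have "(delta R m \<otimes>\<^bsub>F\<^esub> g) \<otimes>\<^bsub>F\<^esub> h = delta R m \<otimes>\<^bsub>F\<^esub> (g \<otimes>\<^bsub>F\<^esub> h)"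
    using g
  proof (induction rule: carrier_induct)
    case zero
    then show ?case using add h by (simp add: mult_zero F_closed)
  next
    case (add s n g)
    have "(delta R m \<otimes>\<^bsub>F\<^esub> delta R n) \<otimes>\<^bsub>F\<^esub> h = delta R m \<otimes>\<^bsub>F\<^esub> (delta R n \<otimes>\<^bsub>F\<^esub> h)"
      using h
    proof (induction rule: carrier_induct)
      case zero
      then show ?case using add \<open>m \<in> carrier M\<close> by (simp add: mult_zero F_closed)
    next
      case (add t k h)
      then show ?case using \<open>m \<in> carrier M\<close> \<open>n \<in> carrier M\<close>
        by (simp add: F_closed mult_r_distr mult_smult_r mult_delta M.m_assoc)
    qed
    then show ?case using add \<open>m \<in> carrier M\<close> h
      by (simp add: F_closed mult_r_distr mult_l_distr mult_smult_r mult_smult_l)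
  qed
  then show ?case using add g h
    by (simp add: F_closed mult_l_distr mult_smult_l)
qed

lemma mult_one':
  assumes "f \<in> carrier F"
  shows "\<one>\<^bsub>F\<^esub> \<otimes>\<^bsub>F\<^esub> f = f \<and> f \<otimes>\<^bsub>F\<^esub> \<one>\<^bsub>F\<^esub> = f"
  using assms
proof (induction rule: carrier_induct)
  case zero
  then show ?case by (simp add: mult_zero F_closed F_simps(4))
next
  case (add r m f)
  then show ?case
    by (simp add: F_closed mult_l_distr mult_r_distr mult_smult_l mult_smult_r mult_delta F_simps(4))
qed

lemma assoc_alg_F: "assoc_alg R F"
proof -
  have "ring F"
    by (rule ringI[OF abelian_group_F monoidI])
      (use mult_one' in \<open>auto simp: F_closed mult_assoc' mult_l_distr mult_r_distr F_simps(4)[THEN subst]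
        intro: delta_closed\<close>, simp add: F_simps(4) delta_closed)
  then show ?thesis
    using module_F mult_smult_l mult_smult_r unfolding assoc_alg_def assoc_alg_axioms_def by auto
qed

definition extend :: "('r, 'b, 'o) module_scheme \<Rightarrow> ('x \<Rightarrow> 'b) \<Rightarrow> ('x \<Rightarrow> 'r) \<Rightarrow> 'b" where
  "extend B \<phi> f = finsum B (\<lambda>m. f m \<odot>\<^bsub>B\<^esub> \<phi> m) (supp f)"

text \<open>The universal property of the monoid algebra: the linear extension of a monoid
  homomorphism is multiplicative, since by induction on both factors this need only hold on
  monomials.\<close>

lemma alg_hom_extend:
  assumes B: "assoc_alg R B"
    and \<phi>: "\<phi> \<in> carrier M \<rightarrow> carrier B" "\<phi> \<one>\<^bsub>M\<^esub> = \<one>\<^bsub>B\<^esub>"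
      "\<And>m n. m \<in> carrier M \<Longrightarrow> n \<in> carrier M \<Longrightarrow> \<phi> (m \<otimes>\<^bsub>M\<^esub> n) = \<phi> m \<otimes>\<^bsub>B\<^esub> \<phi> n"
  shows "alg_hom R F B (extend B \<phi>)" and "\<And>m. m \<in> carrier M \<Longrightarrow> extend B \<phi> (delta R m) = \<phi> m"
proof -
  interpret B: assoc_alg R B by fact
  let ?e = "extend B \<phi>"
  have sup: "?e f = finsum B (\<lambda>m. f m \<odot>\<^bsub>B\<^esub> \<phi> m) S"
    if "f \<in> carrier F" "finite S" "supp f \<subseteq> S" "S \<subseteq> carrier M" for f S
    unfolding extend_def
    by (rule B.add.finprod_mono_neutral_cong_left)
      (use that carrierD(1)[OF that(1)] \<phi> in \<open>auto simp: Pi_iff subset_iff\<close>)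
  have cl: "?e f \<in> carrier B" if "f \<in> carrier F" for f
    unfolding extend_def using that carrierD[OF that] \<phi>(1) by (intro B.finsum_closed) (auto simp: Pi_iff subset_iff)
  have add: "?e (f \<oplus>\<^bsub>F\<^esub> g) = ?e f \<oplus>\<^bsub>B\<^esub> ?e g" if f: "f \<in> carrier F" and g: "g \<in> carrier F" for f g
  proof -
    let ?S = "supp f \<union> supp g"
    have S: "finite ?S" "?S \<subseteq> carrier M" "supp f \<subseteq> ?S" "supp g \<subseteq> ?S" "supp (f \<oplus>\<^bsub>F\<^esub> g) \<subseteq> ?S"
      using carrierD(2,3)[OF f] carrierD(2,3)[OF g] by (auto simp: F_simps)
    have "?e (f \<oplus>\<^bsub>F\<^esub> g) = (\<Oplus>\<^bsub>B\<^esub>m\<in>?S. f m \<odot>\<^bsub>B\<^esub> \<phi> m \<oplus>\<^bsub>B\<^esub> g m \<odot>\<^bsub>B\<^esub> \<phi> m)"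
      unfolding sup[OF add_closed'[OF f g] S(1) S(5) S(2)]
      using S(2) carrierD(1)[OF f] carrierD(1)[OF g] \<phi>(1)
      by (intro B.finsum_cong') (auto simp: F_simps B.smult_l_distr Pi_iff subset_iff)
    also have "\<dots> = ?e f \<oplus>\<^bsub>B\<^esub> ?e g"
      unfolding sup[OF f S(1) S(3) S(2)] sup[OF g S(1) S(4) S(2)]
      using S(2) carrierD(1)[OF f] carrierD(1)[OF g] \<phi>(1)
      by (intro B.finsum_addf) (auto simp: Pi_iff subset_iff)
    finally show ?thesis .
  qed
  have sm: "?e (r \<odot>\<^bsub>F\<^esub> f) = r \<odot>\<^bsub>B\<^esub> ?e f" if r: "r \<in> carrier R" and f: "f \<in> carrier F" for r f
  proof -
    have s: "supp (r \<odot>\<^bsub>F\<^esub> f) \<subseteq> supp f" using r by (auto simp: F_simps)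
    have "?e (r \<odot>\<^bsub>F\<^esub> f) = (\<Oplus>\<^bsub>B\<^esub>m\<in>supp f. (r \<otimes> f m) \<odot>\<^bsub>B\<^esub> \<phi> m)"
      unfolding sup[OF smult_closed'[OF r f] carrierD(2)[OF f] s carrierD(3)[OF f]] by (simp add: F_simps)
    also have "\<dots> = r \<odot>\<^bsub>B\<^esub> ?e f"
      unfolding extend_def using r f carrierD[OF f] \<phi>(1)
      by (intro B.lincomb_smult) (auto simp: Pi_iff subset_iff)
    finally show ?thesis .
  qed
  show del: "?e (delta R m) = \<phi> m" if m: "m \<in> carrier M" for m
    using sup[OF delta_closed[OF m], of "{m}"] supp_delta[of m] m \<phi>(1) by (auto simp: delta_def Pi_iff)
  have zero: "?e \<zero>\<^bsub>F\<^esub> = \<zero>\<^bsub>B\<^esub>" by (simp add: extend_def F_simps)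
  have mult: "?e (f \<otimes>\<^bsub>F\<^esub> g) = ?e f \<otimes>\<^bsub>B\<^esub> ?e g" if f: "f \<in> carrier F" and g: "g \<in> carrier F" for f g
    using f
  proof (induction rule: carrier_induct)
    case zero
    then show ?case using g cl by (simp add: mult_zero \<open>?e \<zero>\<^bsub>F\<^esub> = \<zero>\<^bsub>B\<^esub>\<close>)
  next
    case (add r m f)
    have "?e (delta R m \<otimes>\<^bsub>F\<^esub> g) = \<phi> m \<otimes>\<^bsub>B\<^esub> ?e g"
      using g
    proof (induction rule: carrier_induct)
      case zero
      then show ?case using add \<phi>(1) by (simp add: mult_zero F_closed \<open>?e \<zero>\<^bsub>F\<^esub> = \<zero>\<^bsub>B\<^esub>\<close> Pi_iff)
    next
      case (add s n g)
      have "\<phi> m \<in> carrier B" "\<phi> n \<in> carrier B" using \<phi>(1) add \<open>m \<in> carrier M\<close> by auto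
      then show ?case using add \<open>m \<in> carrier M\<close> cl
        by (simp add: F_closed mult_r_distr mult_smult_r mult_delta
          \<open>\<And>f g. \<lbrakk>f \<in> carrier F; g \<in> carrier F\<rbrakk> \<Longrightarrow> ?e (f \<oplus>\<^bsub>F\<^esub> g) = ?e f \<oplus>\<^bsub>B\<^esub> ?e g\<close>
          sm del \<phi>(3) B.A.r_distr B.smult_assoc_r)
    qed
    moreover have "\<phi> m \<in> carrier B" using \<phi>(1) add by auto
    ultimately show ?case using add g cl
      by (simp add: F_closed mult_l_distr mult_smult_l
          \<open>\<And>f g. \<lbrakk>f \<in> carrier F; g \<in> carrier F\<rbrakk> \<Longrightarrow> ?e (f \<oplus>\<^bsub>F\<^esub> g) = ?e f \<oplus>\<^bsub>B\<^esub> ?e g\<close>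
          sm del B.A.l_distr B.smult_assoc_l)
  qed
  have "?e \<one>\<^bsub>F\<^esub> = \<one>\<^bsub>B\<^esub>" using del[of "\<one>\<^bsub>M\<^esub>"] \<phi>(2) by (simp add: F_simps(4))
  then show "alg_hom R F B ?e"
    unfolding alg_hom_def using cl mult add sm by (auto intro!: ring_hom_memI)
qed

end

section \<open>Quotients by two-sided ideals\<close>

lemma ring_with_smult:
  assumes "ring A"
  shows "ring (with_smult A s)"
proof -
  interpret ring A by fact
  show ?thesis
  proof (rule ringI[OF abelian_groupI monoidI])
    fix x assume "x \<in> carrier (with_smult A s)"
    then show "\<exists>y\<in>carrier (with_smult A s). y \<oplus>\<^bsub>with_smult A s\<^esub> x = \<zero>\<^bsub>with_smult A s\<^esub>"
      by (intro bexI[of _ "\<ominus>\<^bsub>A\<^esub> x"]) (simp_all add: with_smult_def l_neg)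
  qed (auto simp: with_smult_def m_assoc a_assoc l_distr r_distr intro: a_comm)
qed

context assoc_alg
begin

text \<open>A scalar multiple of \<open>x\<close> is the product of \<open>x\<close> with the same
  multiple of the unit.\<close>

lemma ideal_smult_closed:
  assumes "ideal I A" "r \<in> carrier R" "x \<in> I"
  shows "r \<odot>\<^bsub>A\<^esub> x \<in> I"
proof -
  interpret ideal I A by fact
  have "(r \<odot>\<^bsub>A\<^esub> \<one>\<^bsub>A\<^esub>) \<otimes>\<^bsub>A\<^esub> x \<in> I" using assms by (intro I_l_closed) auto
  then show ?thesis using assms a_subset by (simp add: smult_assoc_l subset_iff)
qed

lemma quot_simps:
  "carrier (quot_algebra A I) = carrier (A Quot I)" "mult (quot_algebra A I) = mult (A Quot I)"
  "one (quot_algebra A I) = one (A Quot I)" "zero (quot_algebra A I) = zero (A Quot I)"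
  "add (quot_algebra A I) = add (A Quot I)"
  by (simp_all add: quot_algebra_def with_smult_def)

lemma quot_class:
  assumes I: "ideal I A"
  shows "\<And>x y. x \<in> carrier A \<Longrightarrow> y \<in> carrier A \<Longrightarrow> I +>\<^bsub>A\<^esub> x = I +>\<^bsub>A\<^esub> y \<longleftrightarrow> x \<ominus>\<^bsub>A\<^esub> y \<in> I"
    and "\<And>x y. x \<in> carrier A \<Longrightarrow> y \<in> I +>\<^bsub>A\<^esub> x \<Longrightarrow> y \<in> carrier A \<and> I +>\<^bsub>A\<^esub> y = I +>\<^bsub>A\<^esub> x"
    and "\<And>x. x \<in> carrier A \<Longrightarrow> x \<in> I +>\<^bsub>A\<^esub> x"
    and "carrier (quot_algebra A I) = (\<lambda>x. I +>\<^bsub>A\<^esub> x) ` carrier A"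
proof -
  interpret I: ideal I A by fact
  show 1: "I +>\<^bsub>A\<^esub> x = I +>\<^bsub>A\<^esub> y \<longleftrightarrow> x \<ominus>\<^bsub>A\<^esub> y \<in> I" if "x \<in> carrier A" "y \<in> carrier A" for x y
    using A.quotient_eq_iff_same_a_r_cos[OF I that] by auto
  show "y \<in> carrier A \<and> I +>\<^bsub>A\<^esub> y = I +>\<^bsub>A\<^esub> x" if "x \<in> carrier A" "y \<in> I +>\<^bsub>A\<^esub> x" for x y
    using I.a_repr_independence'[OF that(2,1)] I.a_elemrcos_carrier[OF that] by simp
  show "x \<in> I +>\<^bsub>A\<^esub> x" if "x \<in> carrier A" for x by (rule I.a_rcos_self[OF that])
  show "carrier (quot_algebra A I) = (\<lambda>x. I +>\<^bsub>A\<^esub> x) ` carrier A"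
    by (auto simp: quot_simps FactRing_def A_RCOSETS_def')
qed

text \<open>The scalar multiple of a class is defined as a union over all representatives.
  Differences of representatives stay in the ideal after scaling, so the cosets in the union are all
  equal.\<close>

lemma quot_smult:
  assumes I: "ideal I A" and r: "r \<in> carrier R" and x: "x \<in> carrier A"
  shows "r \<odot>\<^bsub>quot_algebra A I\<^esub> (I +>\<^bsub>A\<^esub> x) = I +>\<^bsub>A\<^esub> (r \<odot>\<^bsub>A\<^esub> x)"
proof -
  have eq: "I +>\<^bsub>A\<^esub> (r \<odot>\<^bsub>A\<^esub> y) = I +>\<^bsub>A\<^esub> (r \<odot>\<^bsub>A\<^esub> x)" if "y \<in> I +>\<^bsub>A\<^esub> x" for y
  proof -
    have yA: "y \<in> carrier A" and "I +>\<^bsub>A\<^esub> y = I +>\<^bsub>A\<^esub> x" using quot_class(2)[OF I x that] by auto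
    then have y: "y \<in> carrier A" "y \<ominus>\<^bsub>A\<^esub> x \<in> I" using quot_class(1)[OF I yA x] by simp_all
    have "r \<odot>\<^bsub>A\<^esub> y \<ominus>\<^bsub>A\<^esub> r \<odot>\<^bsub>A\<^esub> x = r \<odot>\<^bsub>A\<^esub> (y \<ominus>\<^bsub>A\<^esub> x)"
      using y r x by (simp add: a_minus_def smult_r_distr smult_r_minus)
    also have "\<dots> \<in> I" using ideal_smult_closed[OF I r y(2)] .
    finally show ?thesis using quot_class(1)[OF I, of "r \<odot>\<^bsub>A\<^esub> y" "r \<odot>\<^bsub>A\<^esub> x"] r x yA by simp
  qed
  have "r \<odot>\<^bsub>quot_algebra A I\<^esub> (I +>\<^bsub>A\<^esub> x) = (\<Union>y\<in>I +>\<^bsub>A\<^esub> x. I +>\<^bsub>A\<^esub> (r \<odot>\<^bsub>A\<^esub> y))"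
    by (simp add: quot_algebra_def with_smult_def)
  also have "\<dots> = (\<Union>y\<in>I +>\<^bsub>A\<^esub> x. I +>\<^bsub>A\<^esub> (r \<odot>\<^bsub>A\<^esub> x))" by (rule SUP_cong[OF refl]) (rule eq)
  also have "\<dots> = I +>\<^bsub>A\<^esub> (r \<odot>\<^bsub>A\<^esub> x)" using quot_class(3)[OF I x] by (simp add: UN_constant) blast
  finally show ?thesis .
qed

lemma alg_hom_quot:
  assumes I: "ideal I A"
  shows "alg_hom R A (quot_algebra A I) (\<lambda>x. I +>\<^bsub>A\<^esub> x)"
  using ideal.rcos_ring_hom[OF I] quot_smult[OF I]
  by (auto simp: alg_hom_def ring_hom_def quot_simps)

lemma assoc_alg_quot:
  assumes I: "ideal I A"
  shows "assoc_alg R (quot_algebra A I)"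
proof -
  let ?Q = "quot_algebra A I"
  note h = alg_homD[OF alg_hom_quot[OF I]]
  have ring: "ring ?Q"
    unfolding quot_algebra_def by (rule ring_with_smult[OF ideal.quotient_is_ring[OF I]])
  interpret Q: ring ?Q by fact
  have cl: "\<exists>x\<in>carrier A. X = I +>\<^bsub>A\<^esub> x" if "X \<in> carrier ?Q" for X
    using that unfolding quot_class(4)[OF I] by blast
  note hs = h(3,4,6)[symmetric]
  have m: "module R ?Q"
  proof (rule moduleI[OF R.is_cring Q.is_abelian_group])
    fix r X assume r: "r \<in> carrier R" and "X \<in> carrier ?Q"
    then obtain x where x: "x \<in> carrier A" "X = I +>\<^bsub>A\<^esub> x" using cl by blast
    show "r \<odot>\<^bsub>?Q\<^esub> X \<in> carrier ?Q" unfolding x(2) using r x(1) h(2) by (simp add: hs)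
    fix s assume s: "s \<in> carrier R"
    show "(r \<oplus> s) \<odot>\<^bsub>?Q\<^esub> X = r \<odot>\<^bsub>?Q\<^esub> X \<oplus>\<^bsub>?Q\<^esub> s \<odot>\<^bsub>?Q\<^esub> X"
      unfolding x(2) using x(1) r s by (simp add: hs smult_l_distr)
    show "(r \<otimes> s) \<odot>\<^bsub>?Q\<^esub> X = r \<odot>\<^bsub>?Q\<^esub> (s \<odot>\<^bsub>?Q\<^esub> X)"
      unfolding x(2) using x(1) r s by (simp add: hs smult_assoc1)
  next
    fix X assume "X \<in> carrier ?Q"
    then obtain x where x: "x \<in> carrier A" "X = I +>\<^bsub>A\<^esub> x" using cl by blast
    show "\<one> \<odot>\<^bsub>?Q\<^esub> X = X" unfolding x(2) using x(1) by (simp add: hs)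
  next
    fix r X Y assume r: "r \<in> carrier R" and "X \<in> carrier ?Q" "Y \<in> carrier ?Q"
    then obtain x y where x: "x \<in> carrier A" "X = I +>\<^bsub>A\<^esub> x" and y: "y \<in> carrier A" "Y = I +>\<^bsub>A\<^esub> y"
      using cl by meson
    show "r \<odot>\<^bsub>?Q\<^esub> (X \<oplus>\<^bsub>?Q\<^esub> Y) = r \<odot>\<^bsub>?Q\<^esub> X \<oplus>\<^bsub>?Q\<^esub> r \<odot>\<^bsub>?Q\<^esub> Y"
      unfolding x(2) y(2) using x(1) y(1) r by (simp add: hs smult_r_distr)
  qed
  have "assoc_alg_axioms R ?Q"
  proof
    fix r X Y assume r: "r \<in> carrier R" and "X \<in> carrier ?Q" "Y \<in> carrier ?Q"
    then obtain x y where x: "x \<in> carrier A" "X = I +>\<^bsub>A\<^esub> x" and y: "y \<in> carrier A" "Y = I +>\<^bsub>A\<^esub> y"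
      using cl by meson
    show "(r \<odot>\<^bsub>?Q\<^esub> X) \<otimes>\<^bsub>?Q\<^esub> Y = r \<odot>\<^bsub>?Q\<^esub> (X \<otimes>\<^bsub>?Q\<^esub> Y)" "X \<otimes>\<^bsub>?Q\<^esub> (r \<odot>\<^bsub>?Q\<^esub> Y) = r \<odot>\<^bsub>?Q\<^esub> (X \<otimes>\<^bsub>?Q\<^esub> Y)"
      unfolding x(2) y(2) using x(1) y(1) r by (simp_all add: hs smult_assoc_l smult_assoc_r)
  qed
  with m ring show ?thesis unfolding assoc_alg_def by blast
qed

text \<open>The universal property of a presentation: the kernel of \<open>h\<close> is an ideal
  containing \<open>G\<close>, hence contains the ideal generated by \<open>G\<close>, and
  \<open>h\<close> is constant on classes.\<close>

lemma quot_lift: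
  assumes B: "assoc_alg R B" and h: "alg_hom R A B h" and G: "G \<subseteq> carrier A"
    and ker: "\<And>x. x \<in> G \<Longrightarrow> h x = \<zero>\<^bsub>B\<^esub>"
  shows "\<exists>h'. alg_hom R (quot_algebra A (Idl\<^bsub>A\<^esub> G)) B h' \<and> (\<forall>x\<in>carrier A. h' (Idl\<^bsub>A\<^esub> G +>\<^bsub>A\<^esub> x) = h x)"
proof -
  interpret B: assoc_alg R B by fact
  interpret h: ring_hom_ring A B h
    using alg_homD(1)[OF h] by (simp add: ring_hom_ringI2 A.ring_axioms B.A.ring_axioms)
  let ?I = "Idl\<^bsub>A\<^esub> G"
  have I: "ideal ?I A" using A.genideal_ideal[OF G] .
  note p = alg_homD[OF alg_hom_quot[OF I]]
  have "?I \<subseteq> a_kernel A B h"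
    using G ker 
    by (intro A.genideal_minimal h.kernel_is_ideal) (unfold a_kernel_def', blast)
  then have k: "h x = \<zero>\<^bsub>B\<^esub>" if "x \<in> ?I" for x using that unfolding a_kernel_def' by blast
  have eq: "h x = h y" if "x \<in> carrier A" "y \<in> carrier A" "x \<ominus>\<^bsub>A\<^esub> y \<in> ?I" for x y
    using k[OF that(3)] alg_hom_minus[OF h A.ring_axioms B.A.ring_axioms that(1,2)] that
    by (simp add: a_minus_def B.minus_unique_eq)
  \<comment> \<open>An arbitrary representative is taken; \<open>eq\<close> shows that the value
    does not depend on it.\<close>
  define h' where "h' X = h (SOME x. x \<in> X)" for X
  have h': "h' (?I +>\<^bsub>A\<^esub> x) = h x" if x: "x \<in> carrier A" for x
  proof -
    have "(SOME y. y \<in> ?I +>\<^bsub>A\<^esub> x) \<in> ?I +>\<^bsub>A\<^esub> x" using quot_class(3)[OF I x] by (rule someI)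
    note y = quot_class(2)[OF I x this]
    show ?thesis
      unfolding h'_def using quot_class(1)[OF I y[THEN conjunct1] x] y x by (intro eq) blast+
  qed
  have cl: "\<exists>x\<in>carrier A. X = ?I +>\<^bsub>A\<^esub> x" if "X \<in> carrier (quot_algebra A ?I)" for X
    using that unfolding quot_class(4)[OF I] by blast
  have "alg_hom R (quot_algebra A ?I) B h'"
    unfolding alg_hom_def
  proof (intro conjI ballI ring_hom_memI)
    fix X assume "X \<in> carrier (quot_algebra A ?I)"
    then obtain x where x: "x \<in> carrier A" "X = ?I +>\<^bsub>A\<^esub> x" using cl by blast
    show "h' X \<in> carrier B" using x by (simp add: h' alg_homD(2)[OF h])
    fix r assume "r \<in> carrier R"
    then show "h' (r \<odot>\<^bsub>quot_algebra A ?I\<^esub> X) = r \<odot>\<^bsub>B\<^esub> h' X"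
      unfolding x(2) using x(1) by (simp add: p(6)[symmetric] h' alg_homD(6)[OF h])
  next
    fix X Y assume "X \<in> carrier (quot_algebra A ?I)" "Y \<in> carrier (quot_algebra A ?I)"
    then obtain x y where x: "x \<in> carrier A" "X = ?I +>\<^bsub>A\<^esub> x" and y: "y \<in> carrier A" "Y = ?I +>\<^bsub>A\<^esub> y"
      using cl by meson
    show "h' (X \<otimes>\<^bsub>quot_algebra A ?I\<^esub> Y) = h' X \<otimes>\<^bsub>B\<^esub> h' Y" "h' (X \<oplus>\<^bsub>quot_algebra A ?I\<^esub> Y) = h' X \<oplus>\<^bsub>B\<^esub> h' Y"
      unfolding x(2) y(2) using x(1) y(1) by (simp_all add: p(3,4)[symmetric] h' alg_homD(3,4)[OF h])
  next
    show "h' \<one>\<^bsub>quot_algebra A ?I\<^esub> = \<one>\<^bsub>B\<^esub>" by (simp add: p(5)[symmetric] h' alg_homD(5)[OF h])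
  qed
  then show ?thesis using h' by blast
qed

lemma quot_rel:
  assumes "G \<subseteq> carrier A" "x \<in> carrier A" "y \<in> carrier A" "x \<ominus>\<^bsub>A\<^esub> y \<in> G"
  shows "Idl\<^bsub>A\<^esub> G +>\<^bsub>A\<^esub> x = Idl\<^bsub>A\<^esub> G +>\<^bsub>A\<^esub> y"
  using quot_class(1)[OF A.genideal_ideal[OF assms(1)] assms(2,3)] A.genideal_self[OF assms(1)] assms(4)
  by blast

text \<open>Once the linearity relations belong to the ideal, passing to classes makes
  \<open>i\<close> linear, whatever other relations \<open>G\<close> contains.\<close>

lemma quot_linear:
  assumes G: "G \<subseteq> carrier A" and i: "i \<in> carrier N \<rightarrow> carrier A"
    and lin: "linearity_relations R N A i \<subseteq> G"
    and N: "\<And>v w. v \<in> carrier N \<Longrightarrow> w \<in> carrier N \<Longrightarrow> v \<oplus>\<^bsub>N\<^esub> w \<in> carrier N"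
      "\<And>r v. r \<in> carrier R \<Longrightarrow> v \<in> carrier N \<Longrightarrow> r \<odot>\<^bsub>N\<^esub> v \<in> carrier N"
  shows "linear_map R N (quot_algebra A (Idl\<^bsub>A\<^esub> G)) (\<lambda>v. Idl\<^bsub>A\<^esub> G +>\<^bsub>A\<^esub> i v)"
proof -
  note p = alg_homD[OF alg_hom_quot[OF A.genideal_ideal[OF G]]]
  have ic: "i v \<in> carrier A" if "v \<in> carrier N" for v using i that by auto
  have "Idl\<^bsub>A\<^esub> G +>\<^bsub>A\<^esub> i (v \<oplus>\<^bsub>N\<^esub> w) = Idl\<^bsub>A\<^esub> G +>\<^bsub>A\<^esub> (i v \<oplus>\<^bsub>A\<^esub> i w)"
    if vw: "v \<in> carrier N" "w \<in> carrier N" for v w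
  proof (rule quot_rel[OF G])
    show "i (v \<oplus>\<^bsub>N\<^esub> w) \<ominus>\<^bsub>A\<^esub> (i v \<oplus>\<^bsub>A\<^esub> i w) \<in> G"
      using lin vw unfolding linearity_relations_def by blast
  qed (use vw ic N in auto)
  moreover have "Idl\<^bsub>A\<^esub> G +>\<^bsub>A\<^esub> i (r \<odot>\<^bsub>N\<^esub> v) = Idl\<^bsub>A\<^esub> G +>\<^bsub>A\<^esub> (r \<odot>\<^bsub>A\<^esub> i v)"
    if rv: "r \<in> carrier R" "v \<in> carrier N" for r v
  proof (rule quot_rel[OF G])
    show "i (r \<odot>\<^bsub>N\<^esub> v) \<ominus>\<^bsub>A\<^esub> (r \<odot>\<^bsub>A\<^esub> i v) \<in> G"
      using lin rv unfolding linearity_relations_def by blast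
  qed (use rv ic N in auto)
  ultimately show ?thesis
    unfolding linear_map_def using ic p by auto
qed

end

section \<open>Generators and relations of the Clifford algebra\<close>

lemma (in module) smult_commute:
  "\<lbrakk>r \<in> carrier R; s \<in> carrier R; x \<in> carrier M\<rbrakk> \<Longrightarrow> r \<odot>\<^bsub>M\<^esub> (s \<odot>\<^bsub>M\<^esub> x) = s \<odot>\<^bsub>M\<^esub> (r \<odot>\<^bsub>M\<^esub> x)"
  by (simp add: smult_assoc1[symmetric] R.m_comm)

lemma linear_mapD:
  assumes "linear_map R M N f"
  shows "\<And>x. x \<in> carrier M \<Longrightarrow> f x \<in> carrier N"
    and "\<And>x y. x \<in> carrier M \<Longrightarrow> y \<in> carrier M \<Longrightarrow> f (x \<oplus>\<^bsub>M\<^esub> y) = f x \<oplus>\<^bsub>N\<^esub> f y"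
    and "\<And>r x. r \<in> carrier R \<Longrightarrow> x \<in> carrier M \<Longrightarrow> f (r \<odot>\<^bsub>M\<^esub> x) = r \<odot>\<^bsub>N\<^esub> f x"
  using assms by (auto simp: linear_map_def)

lemma linear_map_compose:
  assumes "linear_map R M N f" "linear_map R N P g"
  shows "linear_map R M P (\<lambda>x. g (f x))"
  using assms by (auto simp: linear_map_def Pi_iff)

lemma alg_hom_linear: "alg_hom R A B h \<Longrightarrow> linear_map R A B h"
  by (simp add: linear_map_def alg_homD Pi_iff)

lemma assoc_alg_regular:
  assumes "cring R"
  shows "assoc_alg R (regular_module R)"
proof -
  interpret cring R by fact
  have r: "ring (regular_module R)" by (rule ring_with_smult[OF ring_axioms])
  interpret r: ring "regular_module R" by fact
  have "module R (regular_module R)"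
    by (rule moduleI[OF is_cring r.is_abelian_group])
      (auto simp: with_smult_def l_distr r_distr m_assoc)
  with r show ?thesis
    unfolding assoc_alg_def assoc_alg_axioms_def by (auto simp: with_smult_def m_assoc m_lcomm)
qed

lemma monoid_word_monoid: "monoid (word_monoid X)"
  by (rule monoidI) (auto simp: word_monoid_def)

lemma (in assoc_alg) linearity_relations_subset:
  assumes "i \<in> carrier N \<rightarrow> carrier A"
    and "\<And>v w. v \<in> carrier N \<Longrightarrow> w \<in> carrier N \<Longrightarrow> v \<oplus>\<^bsub>N\<^esub> w \<in> carrier N"
    and "\<And>r v. r \<in> carrier R \<Longrightarrow> v \<in> carrier N \<Longrightarrow> r \<odot>\<^bsub>N\<^esub> v \<in> carrier N"
  shows "linearity_relations R N A i \<subseteq> carrier A"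
  using assms by (auto simp: linearity_relations_def Pi_iff)

text \<open>A relation is mapped to the difference of two values that agree because the composite of
  \<open>h\<close> with \<open>i\<close> is linear. This is the check needed before a map descends
  to one of the quotients below.\<close>

lemma linearity_relations_kernel:
  assumes h: "alg_hom R A B h" and A: "assoc_alg R A" and B: "assoc_alg R B"
    and i: "i \<in> carrier N \<rightarrow> carrier A" and lin: "linear_map R N B (\<lambda>v. h (i v))"
    and N: "\<And>v w. v \<in> carrier N \<Longrightarrow> w \<in> carrier N \<Longrightarrow> v \<oplus>\<^bsub>N\<^esub> w \<in> carrier N"
      "\<And>r v. r \<in> carrier R \<Longrightarrow> v \<in> carrier N \<Longrightarrow> r \<odot>\<^bsub>N\<^esub> v \<in> carrier N"
    and x: "x \<in> linearity_relations R N A i"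
  shows "h x = \<zero>\<^bsub>B\<^esub>"
proof -
  interpret A: assoc_alg R A by fact
  interpret B: assoc_alg R B by fact
  note hm = alg_hom_minus[OF h A.A.ring_axioms B.A.ring_axioms]
  have ic: "i v \<in> carrier A" if "v \<in> carrier N" for v using i that by auto
  have z: "y \<ominus>\<^bsub>B\<^esub> y = \<zero>\<^bsub>B\<^esub>" if "y \<in> carrier B" for y using that by (simp add: a_minus_def B.r_neg)
  consider (add) v w where "v \<in> carrier N" "w \<in> carrier N" "x = i (v \<oplus>\<^bsub>N\<^esub> w) \<ominus>\<^bsub>A\<^esub> (i v \<oplus>\<^bsub>A\<^esub> i w)"
    | (smult) r v where "r \<in> carrier R" "v \<in> carrier N" "x = i (r \<odot>\<^bsub>N\<^esub> v) \<ominus>\<^bsub>A\<^esub> (r \<odot>\<^bsub>A\<^esub> i v)"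
    using x unfolding linearity_relations_def by blast
  then show ?thesis
  proof cases
    case add
    then show ?thesis
      using linear_mapD[OF lin] N ic by (simp add: hm alg_homD(4)[OF h] z)
  next
    case smult
    then show ?thesis
      using linear_mapD[OF lin] N ic by (simp add: hm alg_homD(6)[OF h] z)
  qed
qed

lemma (in monoid_alg) quot_delta:
  assumes G: "G \<subseteq> carrier F"
  defines "w \<equiv> \<lambda>m. Idl\<^bsub>F\<^esub> G +>\<^bsub>F\<^esub> delta R m"
  shows "\<And>m. m \<in> carrier M \<Longrightarrow> w m \<in> carrier (quot_algebra F (Idl\<^bsub>F\<^esub> G))"
    and "w \<one>\<^bsub>M\<^esub> = \<one>\<^bsub>quot_algebra F (Idl\<^bsub>F\<^esub> G)\<^esub>"
    and "\<And>m n. m \<in> carrier M \<Longrightarrow> n \<in> carrier M \<Longrightarrow>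
      w (m \<otimes>\<^bsub>M\<^esub> n) = w m \<otimes>\<^bsub>quot_algebra F (Idl\<^bsub>F\<^esub> G)\<^esub> w n"
proof -
  interpret F: assoc_alg R F by (rule assoc_alg_F)
  note h = alg_homD[OF F.alg_hom_quot[OF F.A.genideal_ideal[OF G]]]
  show "\<And>m. m \<in> carrier M \<Longrightarrow> w m \<in> carrier (quot_algebra F (Idl\<^bsub>F\<^esub> G))"
    using h(2) delta_closed by (simp add: w_def)
  show "w \<one>\<^bsub>M\<^esub> = \<one>\<^bsub>quot_algebra F (Idl\<^bsub>F\<^esub> G)\<^esub>"
    using h(5) by (simp add: w_def F_simps(4))
  show "w (m \<otimes>\<^bsub>M\<^esub> n) = w m \<otimes>\<^bsub>quot_algebra F (Idl\<^bsub>F\<^esub> G)\<^esub> w n"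
    if "m \<in> carrier M" "n \<in> carrier M" for m n
    using h(3) delta_closed that by (simp add: w_def mult_delta[symmetric])
qed

text \<open>The homomorphism from the free monoid on the letters that extends
  \<open>f\<close>.\<close>

definition word_prod :: "('b, 'm) monoid_scheme \<Rightarrow> ('x \<Rightarrow> 'b) \<Rightarrow> 'x list \<Rightarrow> 'b" where
  "word_prod B f xs = foldr (\<lambda>x y. f x \<otimes>\<^bsub>B\<^esub> y) xs \<one>\<^bsub>B\<^esub>"

lemma (in monoid) word_prod_closed: "(\<And>x. x \<in> set xs \<Longrightarrow> f x \<in> carrier G) \<Longrightarrow> word_prod G f xs \<in> carrier G"
  by (induction xs) (auto simp: word_prod_def)

lemma (in monoid) word_prod_append:
  assumes "\<And>x. x \<in> set xs \<union> set ys \<Longrightarrow> f x \<in> carrier G"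
  shows "word_prod G f (xs @ ys) = word_prod G f xs \<otimes> word_prod G f ys"
  using assms
proof (induction xs)
  case Nil
  then show ?case using word_prod_closed[of ys f] by (auto simp: word_prod_def)
next
  case (Cons x xs)
  then show ?case using word_prod_closed[of ys f] word_prod_closed[of xs f]
    by (auto simp: word_prod_def m_assoc)
qed

subsection \<open>Tensor products of algebras\<close>

locale alg_pair = A: assoc_alg R A + B: assoc_alg R B
  for R :: "('r, 'm) ring_scheme" and A :: "('r, 'a, 'n) module_scheme" and B :: "('r, 'b, 'o) module_scheme"
begin

sublocale P: monoid_alg R "A \<times>\<times> B"
  unfolding monoid_alg_def using A.R.is_cring DirProd_monoid[OF A.A.is_monoid B.A.is_monoid] by blast

sublocale PF: assoc_alg R "monoid_algebra R (A \<times>\<times> B)" by (rule P.assoc_alg_F)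

definition tensor_relations :: "('a \<times> 'b \<Rightarrow> 'r) set" where
  "tensor_relations =
    (\<Union>b\<in>carrier B. linearity_relations R A (monoid_algebra R (A \<times>\<times> B)) (\<lambda>a. delta R (a, b))) \<union>
    (\<Union>a\<in>carrier A. linearity_relations R B (monoid_algebra R (A \<times>\<times> B)) (\<lambda>b. delta R (a, b)))"

lemma bilinear_ideal_eq: "bilinear_ideal R A B = Idl\<^bsub>monoid_algebra R (A \<times>\<times> B)\<^esub> tensor_relations"
  by (simp add: bilinear_ideal_def tensor_relations_def Let_def)

lemma delta_pair_closed:
  "a \<in> carrier A \<Longrightarrow> b \<in> carrier B \<Longrightarrow> delta R (a, b) \<in> carrier (monoid_algebra R (A \<times>\<times> B))"
  by (rule P.delta_closed) simp

lemma tensor_relations_closed: "tensor_relations \<subseteq> carrier (monoid_algebra R (A \<times>\<times> B))"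
  unfolding tensor_relations_def
  by (intro Un_least UN_least PF.linearity_relations_subset) (auto intro: delta_pair_closed)

lemma assoc_alg_tensor: "assoc_alg R (algebra_tensor R A B)"
  unfolding algebra_tensor_def bilinear_ideal_eq
  by (rule PF.assoc_alg_quot[OF PF.A.genideal_ideal[OF tensor_relations_closed]])

lemma pure_tensor:
  shows pure_tensor_closed: "\<And>a b. a \<in> carrier A \<Longrightarrow> b \<in> carrier B \<Longrightarrow>
      pure_tensor R A B a b \<in> carrier (algebra_tensor R A B)"
    and pure_tensor_one: "pure_tensor R A B \<one>\<^bsub>A\<^esub> \<one>\<^bsub>B\<^esub> = \<one>\<^bsub>algebra_tensor R A B\<^esub>"
    and pure_tensor_mult: "\<And>a b a' b'. a \<in> carrier A \<Longrightarrow> b \<in> carrier B \<Longrightarrow> a' \<in> carrier A \<Longrightarrow> b' \<in> carrier B \<Longrightarrow>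
      pure_tensor R A B (a \<otimes>\<^bsub>A\<^esub> a') (b \<otimes>\<^bsub>B\<^esub> b') =
      pure_tensor R A B a b \<otimes>\<^bsub>algebra_tensor R A B\<^esub> pure_tensor R A B a' b'"
  using P.quot_delta[OF tensor_relations_closed]
  by (auto simp: pure_tensor_def algebra_tensor_def bilinear_ideal_eq)

lemma pure_tensor_linear_left:
  assumes "b \<in> carrier B"
  shows "linear_map R A (algebra_tensor R A B) (\<lambda>a. pure_tensor R A B a b)"
  unfolding pure_tensor_def algebra_tensor_def bilinear_ideal_eq
  by (rule PF.quot_linear[OF tensor_relations_closed])
    (use assms delta_pair_closed in \<open>auto simp: tensor_relations_def\<close>)

lemma pure_tensor_linear_right:
  assumes "a \<in> carrier A"
  shows "linear_map R B (algebra_tensor R A B) (\<lambda>b. pure_tensor R A B a b)"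
  unfolding pure_tensor_def algebra_tensor_def bilinear_ideal_eq
  by (rule PF.quot_linear[OF tensor_relations_closed])
    (use assms delta_pair_closed in \<open>auto simp: tensor_relations_def\<close>)

text \<open>The universal property in the case where the second factor is mapped to scalars. The
  images of the two factors then commute automatically, and multiplicativity on pure tensors
  follows.\<close>

lemma tensor_lift:
  assumes D: "assoc_alg R D" and f: "alg_hom R A D f" and g: "alg_hom R B (regular_module R) g"
  shows "\<exists>h. alg_hom R (algebra_tensor R A B) D h \<and>
    (\<forall>a\<in>carrier A. \<forall>b\<in>carrier B. h (pure_tensor R A B a b) = g b \<odot>\<^bsub>D\<^esub> f a)"
proof -
  interpret D: assoc_alg R D by fact
  note f = alg_homD[OF f]
  have g: "\<And>b. b \<in> carrier B \<Longrightarrow> g b \<in> carrier R" "g \<one>\<^bsub>B\<^esub> = \<one>\<^bsub>R\<^esub>"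
    "\<And>b b'. b \<in> carrier B \<Longrightarrow> b' \<in> carrier B \<Longrightarrow> g (b \<otimes>\<^bsub>B\<^esub> b') = g b \<otimes>\<^bsub>R\<^esub> g b'"
    "\<And>b b'. b \<in> carrier B \<Longrightarrow> b' \<in> carrier B \<Longrightarrow> g (b \<oplus>\<^bsub>B\<^esub> b') = g b \<oplus>\<^bsub>R\<^esub> g b'"
    "\<And>r b. r \<in> carrier R \<Longrightarrow> b \<in> carrier B \<Longrightarrow> g (r \<odot>\<^bsub>B\<^esub> b) = r \<otimes>\<^bsub>R\<^esub> g b"
    using alg_homD[OF g] by (simp_all add: with_smult_def)
  define \<phi> where "\<phi> = (\<lambda>p. g (snd p) \<odot>\<^bsub>D\<^esub> f (fst p))"
  have \<phi>: "\<phi> \<in> carrier (A \<times>\<times> B) \<rightarrow> carrier D" using f g by (auto simp: \<phi>_def)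
  have "\<phi> \<one>\<^bsub>A \<times>\<times> B\<^esub> = \<one>\<^bsub>D\<^esub>" using f(5) g(2) by (auto simp: \<phi>_def)
  moreover have "\<phi> (m \<otimes>\<^bsub>A \<times>\<times> B\<^esub> n) = \<phi> m \<otimes>\<^bsub>D\<^esub> \<phi> n"
    if "m \<in> carrier (A \<times>\<times> B)" "n \<in> carrier (A \<times>\<times> B)" for m n
    using that f g
    by (auto simp: \<phi>_def DirProd_def D.smult_assoc_l D.smult_assoc_r D.smult_assoc1 D.smult_commute)
  ultimately have h: "alg_hom R P.F D (P.extend D \<phi>)"
    "\<And>m. m \<in> carrier (A \<times>\<times> B) \<Longrightarrow> P.extend D \<phi> (delta R m) = \<phi> m"
    using P.alg_hom_extend[OF D \<phi>] by blast+
  have hd: "P.extend D \<phi> (delta R (a, b)) = g b \<odot>\<^bsub>D\<^esub> f a" if "a \<in> carrier A" "b \<in> carrier B" for a b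
    using h(2)[of "(a, b)"] that by (simp add: \<phi>_def)
  have ker: "P.extend D \<phi> x = \<zero>\<^bsub>D\<^esub>" if x: "x \<in> tensor_relations" for x
  proof -
    from x consider (l) b where "b \<in> carrier B" "x \<in> linearity_relations R A P.F (\<lambda>a. delta R (a, b))"
      | (r) a where "a \<in> carrier A" "x \<in> linearity_relations R B P.F (\<lambda>b. delta R (a, b))"
      unfolding tensor_relations_def by blast
    then show ?thesis
    proof cases
      case l
      have "linear_map R A D (\<lambda>a. P.extend D \<phi> (delta R (a, b)))"
        unfolding linear_map_def using f g l(1)
        by (auto simp: hd D.smult_r_distr D.smult_assoc1[symmetric] A.R.m_comm)
      then show ?thesis
        using l by (intro linearity_relations_kernel[OF h(1) P.assoc_alg_F D _ _ _ _ l(2)])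
          (auto intro: delta_pair_closed)
    next
      case r
      have "linear_map R B D (\<lambda>b. P.extend D \<phi> (delta R (a, b)))"
        unfolding linear_map_def using f g r(1)
        by (auto simp: hd D.smult_l_distr D.smult_assoc1[symmetric])
      then show ?thesis
        using r by (intro linearity_relations_kernel[OF h(1) P.assoc_alg_F D _ _ _ _ r(2)])
          (auto intro: delta_pair_closed)
    qed
  qed
  obtain h' where h': "alg_hom R (quot_algebra P.F (Idl\<^bsub>P.F\<^esub> tensor_relations)) D h'"
    "\<forall>x\<in>carrier P.F. h' (Idl\<^bsub>P.F\<^esub> tensor_relations +>\<^bsub>P.F\<^esub> x) = P.extend D \<phi> x"
    using PF.quot_lift[OF D h(1) tensor_relations_closed ker] by blast
  show ?thesis
  proof (intro exI conjI ballI)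
    show "alg_hom R (algebra_tensor R A B) D h'"
      using h'(1) by (simp add: algebra_tensor_def bilinear_ideal_eq)
    show "h' (pure_tensor R A B a b) = g b \<odot>\<^bsub>D\<^esub> f a" if "a \<in> carrier A" "b \<in> carrier B" for a b
      using h'(2) delta_pair_closed[OF that] hd[OF that] by (simp add: pure_tensor_def bilinear_ideal_eq)
  qed
qed

end

subsection \<open>The tensor algebra and the algebra of a line bundle\<close>

locale tensor_data = V: module R V for R :: "('r, 'm) ring_scheme" and V :: "('r, 'v, 'n) module_scheme"
begin

sublocale W: monoid_alg R "word_monoid (carrier V)"
  unfolding monoid_alg_def using V.R.is_cring monoid_word_monoid by blast

sublocale WF: assoc_alg R "monoid_algebra R (word_monoid (carrier V))" by (rule W.assoc_alg_F)

lemma word_simps: "carrier (word_monoid X) = lists X" "mult (word_monoid X) = (@)" "one (word_monoid X) = []"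
  by (simp_all add: word_monoid_def)

abbreviation relations where
  "relations \<equiv> linearity_relations R V (monoid_algebra R (word_monoid (carrier V))) (\<lambda>v. delta R [v])"

lemma letter_closed: "v \<in> carrier V \<Longrightarrow> delta R [v] \<in> carrier W.F"
  by (rule W.delta_closed) (simp add: word_simps)

lemma relations_closed: "relations \<subseteq> carrier W.F"
  by (rule WF.linearity_relations_subset) (auto intro: letter_closed)

lemma tensor_ideal_eq: "tensor_ideal R V = Idl\<^bsub>W.F\<^esub> relations"
  by (simp add: tensor_ideal_def Let_def)

lemma assoc_alg_tensor: "assoc_alg R (tensor_algebra R V)"
  unfolding tensor_algebra_def tensor_ideal_eq
  by (rule WF.assoc_alg_quot[OF WF.A.genideal_ideal[OF relations_closed]])

lemma tensor_word:
  shows tensor_word_closed: "\<And>vs. vs \<in> lists (carrier V) \<Longrightarrow> tensor_word R V vs \<in> carrier (tensor_algebra R V)"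
    and tensor_word_Nil: "tensor_word R V [] = \<one>\<^bsub>tensor_algebra R V\<^esub>"
    and tensor_word_append: "\<And>vs ws. vs \<in> lists (carrier V) \<Longrightarrow> ws \<in> lists (carrier V) \<Longrightarrow>
      tensor_word R V (vs @ ws) = tensor_word R V vs \<otimes>\<^bsub>tensor_algebra R V\<^esub> tensor_word R V ws"
  using W.quot_delta[OF relations_closed]
  by (auto simp: tensor_word_def tensor_algebra_def tensor_ideal_eq word_simps)

lemma tensor_word_linear: "linear_map R V (tensor_algebra R V) (\<lambda>v. tensor_word R V [v])"
  unfolding tensor_word_def tensor_algebra_def tensor_ideal_eq
  by (rule WF.quot_linear[OF relations_closed]) (auto intro: letter_closed)

text \<open>The universal property of the tensor algebra: products along words respect
  concatenation, and linearity of \<open>\<rho>\<close> takes care of the relations.\<close>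

lemma tensor_lift:
  assumes D: "assoc_alg R D" and \<rho>: "linear_map R V D \<rho>"
  shows "\<exists>h. alg_hom R (tensor_algebra R V) D h \<and>
    (\<forall>vs\<in>lists (carrier V). h (tensor_word R V vs) = word_prod D \<rho> vs)"
proof -
  interpret D: assoc_alg R D by fact
  have \<rho>c: "\<rho> v \<in> carrier D" if "v \<in> carrier V" for v using linear_mapD(1)[OF \<rho> that] .
  have "word_prod D \<rho> \<in> carrier (word_monoid (carrier V)) \<rightarrow> carrier D"
    using \<rho>c by (auto simp: word_simps intro!: D.A.word_prod_closed)
  moreover have "word_prod D \<rho> \<one>\<^bsub>word_monoid (carrier V)\<^esub> = \<one>\<^bsub>D\<^esub>" by (simp add: word_simps word_prod_def)
  moreover have "word_prod D \<rho> (m \<otimes>\<^bsub>word_monoid (carrier V)\<^esub> n) = word_prod D \<rho> m \<otimes>\<^bsub>D\<^esub> word_prod D \<rho> n"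
    if "m \<in> carrier (word_monoid (carrier V))" "n \<in> carrier (word_monoid (carrier V))" for m n
    using that \<rho>c by (auto simp: word_simps intro!: D.A.word_prod_append)
  ultimately have h: "alg_hom R W.F D (W.extend D (word_prod D \<rho>))"
    "\<And>m. m \<in> lists (carrier V) \<Longrightarrow> W.extend D (word_prod D \<rho>) (delta R m) = word_prod D \<rho> m"
    using W.alg_hom_extend[OF D, of "word_prod D \<rho>"] by (simp_all add: word_simps)
  have "linear_map R V D (\<lambda>v. W.extend D (word_prod D \<rho>) (delta R [v]))"
    using \<rho> \<rho>c unfolding linear_map_def by (simp add: h(2) word_prod_def)
  then have ker: "W.extend D (word_prod D \<rho>) x = \<zero>\<^bsub>D\<^esub>" if "x \<in> relations" for x
    using that by (intro linearity_relations_kernel[OF h(1) W.assoc_alg_F D _ _ _ _ that])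
      (auto intro: letter_closed)
  obtain h' where h': "alg_hom R (quot_algebra W.F (Idl\<^bsub>W.F\<^esub> relations)) D h'"
    "\<forall>x\<in>carrier W.F. h' (Idl\<^bsub>W.F\<^esub> relations +>\<^bsub>W.F\<^esub> x) = W.extend D (word_prod D \<rho>) x"
    using WF.quot_lift[OF D h(1) relations_closed ker] by blast
  show ?thesis
  proof (intro exI conjI ballI)
    show "alg_hom R (tensor_algebra R V) D h'"
      using h'(1) by (simp add: tensor_algebra_def tensor_ideal_eq)
    show "h' (tensor_word R V vs) = word_prod D \<rho> vs" if "vs \<in> lists (carrier V)" for vs
      using h'(2) W.delta_closed[of vs] h(2)[OF that] that
      by (simp add: tensor_word_def tensor_ideal_eq word_simps)
  qed
qed

end

text \<open>A line bundle over a local ring is free; \<open>l0\<close> is a generator and \<open>\<kappa>\<close> the coordinate.\<close>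

locale line_data = L: module R L for R :: "('r, 'm) ring_scheme" and L :: "('r, 'l, 'n) module_scheme" +
  fixes l0 :: 'l and \<kappa> :: "'l \<Rightarrow> 'r"
  assumes l0: "l0 \<in> carrier L" "\<kappa> l0 = \<one>\<^bsub>R\<^esub>"
    and \<kappa>: "linear_map R L (regular_module R) \<kappa>"
    and coordinate: "\<And>l. l \<in> carrier L \<Longrightarrow> l = \<kappa> l \<odot>\<^bsub>L\<^esub> l0"
begin

sublocale W: monoid_alg R "word_monoid (line_letters R L)"
  unfolding monoid_alg_def using L.R.is_cring monoid_word_monoid by blast

sublocale WF: assoc_alg R "monoid_algebra R (word_monoid (line_letters R L))" by (rule W.assoc_alg_F)

lemma word_simps: "carrier (word_monoid X) = lists X" "mult (word_monoid X) = (@)" "one (word_monoid X) = []"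
  by (simp_all add: word_monoid_def)

lemma \<kappa>_simps:
  "l \<in> carrier L \<Longrightarrow> \<kappa> l \<in> carrier R"
  "l \<in> carrier L \<Longrightarrow> l' \<in> carrier L \<Longrightarrow> \<kappa> (l \<oplus>\<^bsub>L\<^esub> l') = \<kappa> l \<oplus>\<^bsub>R\<^esub> \<kappa> l'"
  "r \<in> carrier R \<Longrightarrow> l \<in> carrier L \<Longrightarrow> \<kappa> (r \<odot>\<^bsub>L\<^esub> l) = r \<otimes>\<^bsub>R\<^esub> \<kappa> l"
  using \<kappa> by (auto simp: linear_map_regular_iff)

lemma dual_carrier_iff: "f \<in> carrier (dual_module R L) \<longleftrightarrow>
    f \<in> extensional (carrier L) \<and> linear_map R L (regular_module R) f"
  by (simp add: dual_module_def)

text \<open>A functional on a free module of rank one is determined by its value at the generator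
  \<open>l0\<close>.\<close>

lemma dual_simps:
  assumes "f \<in> carrier (dual_module R L)"
  shows "\<And>l. l \<in> carrier L \<Longrightarrow> f l \<in> carrier R"
    and "\<And>l. l \<in> carrier L \<Longrightarrow> f l = f l0 \<otimes>\<^bsub>R\<^esub> \<kappa> l"
proof -
  have f: "linear_map R L (regular_module R) f" using assms by (simp add: dual_carrier_iff)
  then show fc: "f l \<in> carrier R" if "l \<in> carrier L" for l using that by (auto simp: linear_map_regular_iff)
  fix l assume l: "l \<in> carrier L"
  have "f (\<kappa> l \<odot>\<^bsub>L\<^esub> l0) = \<kappa> l \<otimes>\<^bsub>R\<^esub> f l0"
    using f \<kappa>_simps(1)[OF l] l0(1) unfolding linear_map_regular_iff by blast
  then show "f l = f l0 \<otimes>\<^bsub>R\<^esub> \<kappa> l"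
    using coordinate[OF l] fc[OF l0(1)] \<kappa>_simps(1)[OF l] by (simp add: L.R.m_comm)
qed

lemma dual_add_closed:
  assumes "f \<in> carrier (dual_module R L)" "g \<in> carrier (dual_module R L)"
  shows "f \<oplus>\<^bsub>dual_module R L\<^esub> g \<in> carrier (dual_module R L)"
  using assms
  by (auto simp: dual_module_def linear_map_regular_iff L.R.a_ac L.R.r_distr Pi_iff)

lemma dual_smult_closed:
  assumes "r \<in> carrier R" "f \<in> carrier (dual_module R L)"
  shows "r \<odot>\<^bsub>dual_module R L\<^esub> f \<in> carrier (dual_module R L)"
  using assms
  by (auto simp: dual_module_def linear_map_regular_iff L.R.r_distr L.R.m_lcomm Pi_iff)

lemma dual_eval:
  "l \<in> carrier L \<Longrightarrow> (f \<oplus>\<^bsub>dual_module R L\<^esub> g) l = f l \<oplus>\<^bsub>R\<^esub> g l"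
  "l \<in> carrier L \<Longrightarrow> (r \<odot>\<^bsub>dual_module R L\<^esub> f) l = r \<otimes>\<^bsub>R\<^esub> f l"
  by (simp_all add: dual_module_def)

text \<open>The generator of the dual module. The coordinate is restricted because elements of
  \<open>dual_module\<close> are extensional.\<close>

definition f0 :: "'l \<Rightarrow> 'r" where "f0 = restrict \<kappa> (carrier L)"

lemma f0: "f0 \<in> carrier (dual_module R L)" "l \<in> carrier L \<Longrightarrow> f0 l = \<kappa> l"
  using \<kappa>_simps by (auto simp: f0_def dual_carrier_iff linear_map_regular_iff)

lemma dual_coordinate:
  assumes "f \<in> carrier (dual_module R L)"
  shows "f = f l0 \<odot>\<^bsub>dual_module R L\<^esub> f0"
proof
  fix l
  show "f l = (f l0 \<odot>\<^bsub>dual_module R L\<^esub> f0) l"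
  proof (cases "l \<in> carrier L")
    case True
    then show ?thesis using dual_simps(2)[OF assms True] by (simp add: dual_eval f0)
  next
    case False
    then show ?thesis using assms by (auto simp: dual_module_def extensional_def)
  qed
qed

definition line_relations :: "(('l + ('l \<Rightarrow> 'r)) list \<Rightarrow> 'r) set" where
  "line_relations =
       (linearity_relations R L W.F (\<lambda>l. delta R [Inl l]) \<union>
        linearity_relations R (dual_module R L) W.F (\<lambda>f. delta R [Inr f]) \<union>
        {delta R [x, y] \<ominus>\<^bsub>W.F\<^esub> delta R [y, x] | x y.
           x \<in> line_letters R L \<and> y \<in> line_letters R L} \<union>
        {delta R [Inr f, Inl l] \<ominus>\<^bsub>W.F\<^esub> (f l \<odot>\<^bsub>W.F\<^esub> \<one>\<^bsub>W.F\<^esub>) | f l.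
           f \<in> carrier (dual_module R L) \<and> l \<in> carrier L})"

lemma line_ideal_eq: "line_ideal R L = Idl\<^bsub>W.F\<^esub> line_relations"
  by (simp add: line_ideal_def line_relations_def Let_def)

lemma letters: "l \<in> carrier L \<Longrightarrow> Inl l \<in> line_letters R L"
  "f \<in> carrier (dual_module R L) \<Longrightarrow> Inr f \<in> line_letters R L"
  by (simp_all add: line_letters_def)

lemma word_closed: "ls \<in> lists (line_letters R L) \<Longrightarrow> delta R ls \<in> carrier W.F"
  by (rule W.delta_closed) (simp add: word_simps)

lemma line_relations_closed: "line_relations \<subseteq> carrier W.F"
  unfolding line_relations_def
proof (intro Un_least)
  show "linearity_relations R L W.F (\<lambda>l. delta R [Inl l]) \<subseteq> carrier W.F"
    by (rule WF.linearity_relations_subset) (auto intro!: word_closed letters)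
  show "linearity_relations R (dual_module R L) W.F (\<lambda>f. delta R [Inr f]) \<subseteq> carrier W.F"
    by (rule WF.linearity_relations_subset) (auto intro!: word_closed letters dual_add_closed dual_smult_closed)
  show "{delta R [x, y] \<ominus>\<^bsub>W.F\<^esub> delta R [y, x] | x y.
           x \<in> line_letters R L \<and> y \<in> line_letters R L} \<subseteq> carrier W.F"
    using word_closed by auto
  show "{delta R [Inr f, Inl l] \<ominus>\<^bsub>W.F\<^esub> (f l \<odot>\<^bsub>W.F\<^esub> \<one>\<^bsub>W.F\<^esub>) | f l.
           f \<in> carrier (dual_module R L) \<and> l \<in> carrier L} \<subseteq> carrier W.F"
    using word_closed letters dual_simps(1) by auto
qed

lemma assoc_alg_line: "assoc_alg R (line_algebra R L)"
  unfolding line_algebra_def line_ideal_eq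
  by (rule WF.assoc_alg_quot[OF WF.A.genideal_ideal[OF line_relations_closed]])

lemma line_word:
  shows line_word_closed: "\<And>vs. vs \<in> lists (line_letters R L) \<Longrightarrow> line_word R L vs \<in> carrier (line_algebra R L)"
    and line_word_Nil: "line_word R L [] = \<one>\<^bsub>line_algebra R L\<^esub>"
    and line_word_append: "\<And>vs ws. vs \<in> lists (line_letters R L) \<Longrightarrow> ws \<in> lists (line_letters R L) \<Longrightarrow>
      line_word R L (vs @ ws) = line_word R L vs \<otimes>\<^bsub>line_algebra R L\<^esub> line_word R L ws"
  using W.quot_delta[OF line_relations_closed]
  by (auto simp: line_word_def line_algebra_def line_ideal_eq word_simps)

lemma line_word_linear:
  "linear_map R L (line_algebra R L) (\<lambda>l. line_word R L [Inl l])"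
  "linear_map R (dual_module R L) (line_algebra R L) (\<lambda>f. line_word R L [Inr f])"
  unfolding line_word_def line_algebra_def line_ideal_eq
  by (rule WF.quot_linear[OF line_relations_closed];
    use word_closed letters dual_add_closed dual_smult_closed in \<open>auto simp: line_relations_def\<close>)+

lemma line_word_commute:
  assumes "x \<in> line_letters R L" "y \<in> line_letters R L"
  shows "line_word R L [x, y] = line_word R L [y, x]"
  unfolding line_word_def line_ideal_eq
  by (rule WF.quot_rel[OF line_relations_closed])
    (use assms word_closed in \<open>auto simp: line_relations_def\<close>)

lemma line_word_cancel:
  assumes f: "f \<in> carrier (dual_module R L)" and l: "l \<in> carrier L"
  shows "line_word R L [Inr f, Inl l] = f l \<odot>\<^bsub>line_algebra R L\<^esub> \<one>\<^bsub>line_algebra R L\<^esub>"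
proof -
  note h = alg_homD[OF WF.alg_hom_quot[OF WF.A.genideal_ideal[OF line_relations_closed]]]
  have "line_word R L [Inr f, Inl l] = Idl\<^bsub>W.F\<^esub> line_relations +>\<^bsub>W.F\<^esub> (f l \<odot>\<^bsub>W.F\<^esub> \<one>\<^bsub>W.F\<^esub>)"
    unfolding line_word_def line_ideal_eq
    by (rule WF.quot_rel[OF line_relations_closed])
      (use assms word_closed letters dual_simps(1) in \<open>auto simp: line_relations_def\<close>)
  also have "\<dots> = f l \<odot>\<^bsub>line_algebra R L\<^esub> \<one>\<^bsub>line_algebra R L\<^esub>"
    using h(5,6) dual_simps(1)[OF f l] by (simp add: line_algebra_def line_ideal_eq)
  finally show ?thesis .
qed

text \<open>The trivialisation of the graded line algebra: \<open>l0\<close> and \<open>f0\<close>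
  are both sent to 1, so the degree is forgotten.\<close>

definition \<chi> :: "'l + ('l \<Rightarrow> 'r) \<Rightarrow> 'r" where
  "\<chi> x = (case x of Inl l \<Rightarrow> \<kappa> l | Inr f \<Rightarrow> f l0)"

lemma \<chi>_closed: "x \<in> line_letters R L \<Longrightarrow> \<chi> x \<in> carrier R"
  using \<kappa>_simps(1) dual_simps(1) l0(1) by (auto simp: line_letters_def \<chi>_def)

text \<open>Of the four kinds of relations, the first two are linearity of \<open>\<chi>\<close> on
  both kinds of letters. The third holds because \<open>R\<close> is commutative, and the fourth
  because \<open>f l\<close> is \<open>f l0\<close> times the coordinate of
  \<open>l\<close>.\<close>

lemma line_lift:
  "\<exists>h. alg_hom R (line_algebra R L) (regular_module R) h \<and>
    (\<forall>ls\<in>lists (line_letters R L). h (line_word R L ls) = word_prod R \<chi> ls)"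
proof -
  let ?D = "regular_module R"
  have D: "assoc_alg R ?D" by (rule assoc_alg_regular[OF L.R.is_cring])
  interpret D: assoc_alg R ?D by fact
  have Ds: "carrier ?D = carrier R" "mult ?D = mult R" "one ?D = one R" "add ?D = add R" "zero ?D = zero R"
    "smult ?D = mult R"
    by (simp_all add: with_smult_def)
  define p where "p = word_prod R \<chi>"
  have "p \<in> carrier (word_monoid (line_letters R L)) \<rightarrow> carrier ?D"
    using \<chi>_closed by (auto simp: p_def Ds word_simps intro!: L.R.word_prod_closed)
  moreover have "p \<one>\<^bsub>word_monoid (line_letters R L)\<^esub> = \<one>\<^bsub>?D\<^esub>" by (simp add: p_def Ds word_simps word_prod_def)
  moreover have "p (m \<otimes>\<^bsub>word_monoid (line_letters R L)\<^esub> n) = p m \<otimes>\<^bsub>?D\<^esub> p n"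
    if "m \<in> carrier (word_monoid (line_letters R L))" "n \<in> carrier (word_monoid (line_letters R L))" for m n
    using that \<chi>_closed by (auto simp: p_def Ds word_simps intro!: L.R.word_prod_append)
  ultimately have h: "alg_hom R W.F ?D (W.extend ?D p)"
    "\<And>m. m \<in> lists (line_letters R L) \<Longrightarrow> W.extend ?D p (delta R m) = p m"
    using W.alg_hom_extend[OF D, of p] by (simp_all add: word_simps)
  have p1: "\<And>x. x \<in> line_letters R L \<Longrightarrow> p [x] = \<chi> x"
    "\<And>x y. x \<in> line_letters R L \<Longrightarrow> y \<in> line_letters R L \<Longrightarrow> p [x, y] = \<chi> x \<otimes>\<^bsub>R\<^esub> \<chi> y"
    using \<chi>_closed by (simp_all add: p_def word_prod_def)
  have hm: "W.extend ?D p (x \<ominus>\<^bsub>W.F\<^esub> y) = W.extend ?D p x \<ominus>\<^bsub>?D\<^esub> W.extend ?D p y"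
    if "x \<in> carrier W.F" "y \<in> carrier W.F" for x y
    using alg_hom_minus[OF h(1) WF.A.ring_axioms D.A.ring_axioms that] .
  have z: "y \<ominus>\<^bsub>?D\<^esub> y = \<zero>\<^bsub>?D\<^esub>" if "y \<in> carrier R" for y
    using that D.M.r_neg[of y] by (simp add: a_minus_def Ds)
  have lin1: "linear_map R L ?D (\<lambda>l. W.extend ?D p (delta R [Inl l]))"
    unfolding linear_map_regular_iff using \<kappa>_simps p1 letters by (auto simp: h(2) \<chi>_def)
  have lin2: "linear_map R (dual_module R L) ?D (\<lambda>f. W.extend ?D p (delta R [Inr f]))"
    unfolding linear_map_regular_iff
    using dual_simps(1) p1 letters dual_add_closed dual_smult_closed l0(1)
    by (auto simp: h(2) \<chi>_def dual_eval)
  have ker: "W.extend ?D p x = \<zero>\<^bsub>?D\<^esub>" if "x \<in> line_relations" for x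
  proof -
    consider (1) "x \<in> linearity_relations R L W.F (\<lambda>l. delta R [Inl l])"
      | (2) "x \<in> linearity_relations R (dual_module R L) W.F (\<lambda>f. delta R [Inr f])"
      | (3) y z where "y \<in> line_letters R L" "z \<in> line_letters R L" "x = delta R [y, z] \<ominus>\<^bsub>W.F\<^esub> delta R [z, y]"
      | (4) f l where "f \<in> carrier (dual_module R L)" "l \<in> carrier L"
          "x = delta R [Inr f, Inl l] \<ominus>\<^bsub>W.F\<^esub> (f l \<odot>\<^bsub>W.F\<^esub> \<one>\<^bsub>W.F\<^esub>)"
      using \<open>x \<in> line_relations\<close> unfolding line_relations_def by blast
    then show ?thesis
    proof cases
      case 1
      show ?thesis
        by (rule linearity_relations_kernel[OF h(1) W.assoc_alg_F D _ lin1 _ _ 1])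
          (auto intro!: word_closed letters)
    next
      case 2
      show ?thesis
        by (rule linearity_relations_kernel[OF h(1) W.assoc_alg_F D _ lin2 _ _ 2])
          (auto intro!: word_closed letters dual_add_closed dual_smult_closed)
    next
      case 3
      then show ?thesis using word_closed \<chi>_closed
        by (simp add: hm h(2) p1 L.R.m_comm z)
    next
      case 4
      have w: "delta R [Inr f, Inl l] \<in> carrier W.F" "f l \<in> carrier R"
        using 4 word_closed letters dual_simps(1) by auto
      have e1: "W.extend ?D p \<one>\<^bsub>W.F\<^esub> = \<one>\<^bsub>R\<^esub>" using alg_homD(5)[OF h(1)] by (simp add: Ds)
      have "W.extend ?D p (f l \<odot>\<^bsub>W.F\<^esub> \<one>\<^bsub>W.F\<^esub>) = f l"
        using alg_homD(6)[OF h(1) w(2), of "\<one>\<^bsub>W.F\<^esub>"] e1 w by (simp add: Ds)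
      moreover have "W.extend ?D p (delta R [Inr f, Inl l]) = f l"
        using 4 letters dual_simps(2)[OF 4(1,2)] by (simp add: h(2) p1 \<chi>_def)
      ultimately show ?thesis unfolding 4(3) using w by (simp add: hm z)
    qed
  qed
  obtain h' where h': "alg_hom R (quot_algebra W.F (Idl\<^bsub>W.F\<^esub> line_relations)) ?D h'"
    "\<forall>x\<in>carrier W.F. h' (Idl\<^bsub>W.F\<^esub> line_relations +>\<^bsub>W.F\<^esub> x) = W.extend ?D p x"
    using WF.quot_lift[OF D h(1) line_relations_closed ker] by blast
  show ?thesis
  proof (intro exI conjI ballI)
    show "alg_hom R (line_algebra R L) ?D h'"
      using h'(1) by (simp add: line_algebra_def line_ideal_eq)
    show "h' (line_word R L ls) = word_prod R \<chi> ls" if "ls \<in> lists (line_letters R L)" for ls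
      using h'(2) word_closed[OF that] h(2)[OF that] by (simp add: line_word_def line_ideal_eq p_def)
  qed
qed

end

subsection \<open>The Clifford algebra\<close>

locale clifford_data = V: tensor_data R V + L: line_data R L l0 \<kappa>
  for R :: "('r, 'm) ring_scheme" and V :: "('r, 'v, 'n) module_scheme"
    and L :: "('r, 'l, 'o) module_scheme" and l0 \<kappa> +
  fixes Q :: "'v \<Rightarrow> 'v \<Rightarrow> 'l"
  assumes Q: "quadratic_form R V L Q" and two: "\<one>\<^bsub>R\<^esub> \<oplus>\<^bsub>R\<^esub> \<one>\<^bsub>R\<^esub> \<in> Units R"
begin

sublocale TL: alg_pair R "tensor_algebra R V" "line_algebra R L"
  unfolding alg_pair_def using V.assoc_alg_tensor L.assoc_alg_line by blast

sublocale E: assoc_alg R "clifford_ambient R V L"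
  unfolding clifford_ambient_def by (rule TL.assoc_alg_tensor)

section \<open>Classes of words in the Clifford algebra\<close>

definition q :: "'v \<Rightarrow> 'v \<Rightarrow> 'r" where "q v w = \<kappa> (Q v w)"

lemma Q_closed: "v \<in> carrier V \<Longrightarrow> w \<in> carrier V \<Longrightarrow> Q v w \<in> carrier L"
  using Q by (auto simp: quadratic_form_def linear_map_def)

lemma q_closed: "v \<in> carrier V \<Longrightarrow> w \<in> carrier V \<Longrightarrow> q v w \<in> carrier R"
  by (simp add: q_def Q_closed L.\<kappa>_simps)

lemma q_sym: "v \<in> carrier V \<Longrightarrow> w \<in> carrier V \<Longrightarrow> q v w = q w v"
  using Q by (simp add: q_def quadratic_form_def)

lemma q_linear: "v \<in> carrier V \<Longrightarrow> linear_map R V (regular_module R) (q v)"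
  unfolding q_def using linear_map_compose[OF _ L.\<kappa>] Q by (auto simp: quadratic_form_def)

abbreviation words where "words \<equiv> lists (carrier V)"
abbreviation lines where "lines \<equiv> lists (line_letters R L)"
abbreviation Ea where "Ea \<equiv> clifford_ambient R V L"
abbreviation C where "C \<equiv> clifford_algebra R V L Q"

lemma ambient_word:
  shows ambient_closed: "\<And>vs ls. vs \<in> words \<Longrightarrow> ls \<in> lines \<Longrightarrow> ambient_word R V L vs ls \<in> carrier Ea"
    and ambient_Nil: "ambient_word R V L [] [] = \<one>\<^bsub>Ea\<^esub>"
    and ambient_append: "\<And>vs ls vs' ls'. vs \<in> words \<Longrightarrow> ls \<in> lines \<Longrightarrow> vs' \<in> words \<Longrightarrow> ls' \<in> lines \<Longrightarrow>
      ambient_word R V L (vs @ vs') (ls @ ls') = ambient_word R V L vs ls \<otimes>\<^bsub>Ea\<^esub> ambient_word R V L vs' ls'"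
  by (simp_all add: ambient_word_def clifford_ambient_def TL.pure_tensor V.tensor_word L.line_word)

definition clifford_relations where
  "clifford_relations =
    {(half R \<odot>\<^bsub>Ea\<^esub> (ambient_word R V L [v, w] [] \<oplus>\<^bsub>Ea\<^esub> ambient_word R V L [w, v] [])) \<ominus>\<^bsub>Ea\<^esub>
      ambient_word R V L [] [Inl (Q v w)] | v w. v \<in> carrier V \<and> w \<in> carrier V}"

lemma clifford_ideal_eq: "clifford_ideal R V L Q = Idl\<^bsub>Ea\<^esub> clifford_relations"
  by (simp add: clifford_ideal_def clifford_relations_def Let_def)

lemma half_closed: "half R \<in> carrier R" "half R \<otimes>\<^bsub>R\<^esub> (\<one>\<^bsub>R\<^esub> \<oplus>\<^bsub>R\<^esub> \<one>\<^bsub>R\<^esub>) = \<one>\<^bsub>R\<^esub>"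
  using E.half_closed[OF two] .

lemma clifford_relations_closed: "clifford_relations \<subseteq> carrier Ea"
  using ambient_closed Q_closed L.letters half_closed by (auto simp: clifford_relations_def)

lemma ideal_C: "ideal (clifford_ideal R V L Q) Ea"
  unfolding clifford_ideal_eq by (rule E.A.genideal_ideal[OF clifford_relations_closed])

sublocale C: assoc_alg R "clifford_algebra R V L Q"
  unfolding clifford_algebra_def by (rule E.assoc_alg_quot[OF ideal_C])

definition W :: "'v list \<Rightarrow> ('l + ('l \<Rightarrow> 'r)) list \<Rightarrow> ('r, 'v, 'l) clifford_ambient set" where
  "W vs ls = clifford_ideal R V L Q +>\<^bsub>Ea\<^esub> ambient_word R V L vs ls"

lemma proj_hom: "alg_hom R Ea C (\<lambda>x. clifford_ideal R V L Q +>\<^bsub>Ea\<^esub> x)"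
  unfolding clifford_algebra_def by (rule E.alg_hom_quot[OF ideal_C])

lemma W_closed: "vs \<in> words \<Longrightarrow> ls \<in> lines \<Longrightarrow> W vs ls \<in> carrier C"
  unfolding W_def using alg_homD(2)[OF proj_hom] ambient_closed by blast

lemma W_Nil: "W [] [] = \<one>\<^bsub>C\<^esub>"
  unfolding W_def ambient_Nil by (rule alg_homD(5)[OF proj_hom])

lemma W_append: "vs \<in> words \<Longrightarrow> ls \<in> lines \<Longrightarrow> vs' \<in> words \<Longrightarrow> ls' \<in> lines \<Longrightarrow>
    W (vs @ vs') (ls @ ls') = W vs ls \<otimes>\<^bsub>C\<^esub> W vs' ls'"
  unfolding W_def by (simp add: ambient_append alg_homD(3)[OF proj_hom] ambient_closed)

lemma W_linear_vector: "linear_map R V C (\<lambda>v. W [v] [])"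
  unfolding W_def ambient_word_def
  by (rule linear_map_compose[OF linear_map_compose[OF V.tensor_word_linear
        TL.pure_tensor_linear_left[folded clifford_ambient_def]] alg_hom_linear[OF proj_hom]])
    (simp add: L.line_word)

lemma W_linear_line: "linear_map R L C (\<lambda>l. W [] [Inl l])"
  "linear_map R (dual_module R L) C (\<lambda>f. W [] [Inr f])"
  unfolding W_def ambient_word_def
  by (rule linear_map_compose[OF linear_map_compose[OF L.line_word_linear(1)
        TL.pure_tensor_linear_right[folded clifford_ambient_def]] alg_hom_linear[OF proj_hom]],
      simp add: V.tensor_word,
      rule linear_map_compose[OF linear_map_compose[OF L.line_word_linear(2)
        TL.pure_tensor_linear_right[folded clifford_ambient_def]] alg_hom_linear[OF proj_hom]],
      simp add: V.tensor_word)

lemma W_line_commute: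
  "x \<in> line_letters R L \<Longrightarrow> y \<in> line_letters R L \<Longrightarrow> W [] [x, y] = W [] [y, x]"
  by (simp add: W_def ambient_word_def L.line_word_commute)

lemma W_line_cancel:
  assumes "f \<in> carrier (dual_module R L)" "l \<in> carrier L"
  shows "W [] [Inr f, Inl l] = f l \<odot>\<^bsub>C\<^esub> \<one>\<^bsub>C\<^esub>"
proof -
  have r: "f l \<in> carrier R" using assms by (rule L.dual_simps)
  have "ambient_word R V L [] [Inr f, Inl l] = f l \<odot>\<^bsub>Ea\<^esub> \<one>\<^bsub>Ea\<^esub>"
    unfolding ambient_word_def L.line_word_cancel[OF assms] clifford_ambient_def
    using linear_mapD(3)[OF TL.pure_tensor_linear_right r, of "tensor_word R V []" "\<one>\<^bsub>line_algebra R L\<^esub>"]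
    by (simp add: V.tensor_word TL.pure_tensor_one)
  then show ?thesis
    unfolding W_def using alg_homD(5,6)[OF proj_hom] r by simp
qed

text \<open>The defining relation equates half the left side with the class of \<open>Q v w\<close>.
  Doubling it avoids the scalar one half in all later computations.\<close>

lemma W_clifford:
  assumes v: "v \<in> carrier V" and w: "w \<in> carrier V"
  shows "W [v, w] [] \<oplus>\<^bsub>C\<^esub> W [w, v] [] = W [] [Inl (Q v w)] \<oplus>\<^bsub>C\<^esub> W [] [Inl (Q v w)]"
proof -
  let ?a = "ambient_word R V L [v, w] []" and ?b = "ambient_word R V L [w, v] []"
  let ?c = "ambient_word R V L [] [Inl (Q v w)]"
  have c: "?a \<in> carrier Ea" "?b \<in> carrier Ea" "?c \<in> carrier Ea"
    using v w by (auto intro!: ambient_closed L.letters Q_closed)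
  note h = alg_homD[OF proj_hom]
  let ?x = "W [v, w] [] \<oplus>\<^bsub>C\<^esub> W [w, v] []"
  have "clifford_ideal R V L Q +>\<^bsub>Ea\<^esub> (half R \<odot>\<^bsub>Ea\<^esub> (?a \<oplus>\<^bsub>Ea\<^esub> ?b)) = clifford_ideal R V L Q +>\<^bsub>Ea\<^esub> ?c"
    unfolding clifford_ideal_eq
    by (rule E.quot_rel[OF clifford_relations_closed])
      (use c half_closed v w in \<open>auto simp: clifford_relations_def\<close>)
  then have eq: "half R \<odot>\<^bsub>C\<^esub> ?x = W [] [Inl (Q v w)]"
    unfolding W_def using c half_closed by (simp add: h(4,6))
  have x: "?x \<in> carrier C" using v w by (auto intro!: W_closed)
  have "half R \<odot>\<^bsub>C\<^esub> ?x \<oplus>\<^bsub>C\<^esub> half R \<odot>\<^bsub>C\<^esub> ?x = half R \<odot>\<^bsub>C\<^esub> (?x \<oplus>\<^bsub>C\<^esub> ?x)"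
    using x half_closed(1) by (subst C.smult_r_distr) simp_all
  also have "\<dots> = ?x" by (rule C.half_smult_double[OF two x])
  finally show ?thesis unfolding eq by simp
qed

text \<open>The classes of the dual generator, of degree -2, and of \<open>l0\<close>, of degree 2.
  They are inverse to each other by contraction and shift degrees by two.\<close>

abbreviation \<mu> where "\<mu> \<equiv> W [] [Inr L.f0]"
abbreviation \<eta> where "\<eta> \<equiv> W [] [Inl l0]"

lemma letters0: "Inr L.f0 \<in> line_letters R L" "Inl l0 \<in> line_letters R L"
  using L.letters L.f0 L.l0 by auto

lemma \<mu>_closed: "\<mu> \<in> carrier C" "\<eta> \<in> carrier C"
  by (auto intro!: W_closed letters0)

lemma W_line_Cons:
  "x \<in> line_letters R L \<Longrightarrow> ls \<in> lines \<Longrightarrow> W [] (x # ls) = W [] [x] \<otimes>\<^bsub>C\<^esub> W [] ls"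
  using W_append[of "[]" "[x]" "[]" ls] by simp

text \<open>Together with \<open>W_split'\<close> this says that letters of the line bundle commute
  with words in \<open>V\<close>, as they come from the other factor of a tensor product.\<close>

lemma W_split: "vs \<in> words \<Longrightarrow> ls \<in> lines \<Longrightarrow> W vs ls = W vs [] \<otimes>\<^bsub>C\<^esub> W [] ls"
  using W_append[of vs "[]" "[]" ls] by simp

lemma W_split': "vs \<in> words \<Longrightarrow> ls \<in> lines \<Longrightarrow> W vs ls = W [] ls \<otimes>\<^bsub>C\<^esub> W vs []"
  using W_append[of "[]" ls vs "[]"] by simp

lemma \<eta>_\<mu>: "\<mu> \<otimes>\<^bsub>C\<^esub> \<eta> = \<one>\<^bsub>C\<^esub>" "\<eta> \<otimes>\<^bsub>C\<^esub> \<mu> = \<one>\<^bsub>C\<^esub>"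
proof -
  have 1: "W [] [Inr L.f0, Inl l0] = \<one>\<^bsub>C\<^esub>"
    using W_line_cancel[OF L.f0(1) L.l0(1)] L.f0(2)[OF L.l0(1)] L.l0(2) by simp
  then show "\<mu> \<otimes>\<^bsub>C\<^esub> \<eta> = \<one>\<^bsub>C\<^esub>" using W_line_Cons[of "Inr L.f0" "[Inl l0]"] letters0 by simp
  show "\<eta> \<otimes>\<^bsub>C\<^esub> \<mu> = \<one>\<^bsub>C\<^esub>"
    using 1 W_line_commute[OF letters0] W_line_Cons[of "Inl l0" "[Inr L.f0]"] letters0 by simp
qed

lemma W_line: 
  "l \<in> carrier L \<Longrightarrow> W [] [Inl l] = \<kappa> l \<odot>\<^bsub>C\<^esub> \<eta>"
  "f \<in> carrier (dual_module R L) \<Longrightarrow> W [] [Inr f] = f l0 \<odot>\<^bsub>C\<^esub> \<mu>"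
proof -
  assume l: "l \<in> carrier L"
  have "W [] [Inl (\<kappa> l \<odot>\<^bsub>L\<^esub> l0)] = \<kappa> l \<odot>\<^bsub>C\<^esub> \<eta>"
    using linear_mapD(3)[OF W_linear_line(1) L.\<kappa>_simps(1)[OF l] L.l0(1)] .
  then show "W [] [Inl l] = \<kappa> l \<odot>\<^bsub>C\<^esub> \<eta>" using L.coordinate[OF l] by simp
next
  assume f: "f \<in> carrier (dual_module R L)"
  have "W [] [Inr (f l0 \<odot>\<^bsub>dual_module R L\<^esub> L.f0)] = f l0 \<odot>\<^bsub>C\<^esub> \<mu>"
    using linear_mapD(3)[OF W_linear_line(2) L.dual_simps(1)[OF f L.l0(1)] L.f0(1)] .
  then show "W [] [Inr f] = f l0 \<odot>\<^bsub>C\<^esub> \<mu>" using L.dual_coordinate[OF f] by simp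
qed

text \<open>The product of two vectors has degree 2; the dual generator brings it down to degree
  0.\<close>

definition P :: "'v \<Rightarrow> 'v \<Rightarrow> ('r, 'v, 'l) clifford_ambient set" where
  "P v w = W [v, w] [Inr L.f0]"

lemma P_eq:
  assumes "v \<in> carrier V" "w \<in> carrier V"
  shows "P v w = W [v] [] \<otimes>\<^bsub>C\<^esub> (W [w] [] \<otimes>\<^bsub>C\<^esub> \<mu>)" "P v w = W [v, w] [] \<otimes>\<^bsub>C\<^esub> \<mu>"
  using W_append[of "[v]" "[]" "[w]" "[Inr L.f0]"] W_split[of "[w]" "[Inr L.f0]"]
    W_split[of "[v, w]" "[Inr L.f0]"] assms letters0
  by (simp_all add: P_def)

lemma P_closed: "v \<in> carrier V \<Longrightarrow> w \<in> carrier V \<Longrightarrow> P v w \<in> carrier C"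
  unfolding P_def by (auto intro!: W_closed letters0)

lemma P_linear:
  assumes v: "v \<in> carrier V"
  shows "linear_map R V C (P v)" "linear_map R V C (\<lambda>w. P w v)"
proof -
  note l = linear_mapD[OF W_linear_vector]
  have c: "W [w] [] \<in> carrier C" if "w \<in> carrier V" for w using that by (auto intro!: W_closed)
  show "linear_map R V C (P v)" "linear_map R V C (\<lambda>w. P w v)"
    unfolding linear_map_def
    using v P_closed by (auto simp: P_eq(1) l(2,3) c \<mu>_closed C.A.l_distr C.A.r_distr C.smult_assoc_l C.smult_assoc_r)
qed

lemma P_add_swap:
  assumes v: "v \<in> carrier V" and w: "w \<in> carrier V"
  shows "P v w \<oplus>\<^bsub>C\<^esub> P w v = (q v w \<oplus>\<^bsub>R\<^esub> q v w) \<odot>\<^bsub>C\<^esub> \<one>\<^bsub>C\<^esub>"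
proof -
  have "P v w \<oplus>\<^bsub>C\<^esub> P w v = (W [v, w] [] \<oplus>\<^bsub>C\<^esub> W [w, v] []) \<otimes>\<^bsub>C\<^esub> \<mu>"
    using v w by (simp add: P_eq(2) C.A.l_distr W_closed \<mu>_closed)
  also have "\<dots> = (q v w \<odot>\<^bsub>C\<^esub> \<eta> \<oplus>\<^bsub>C\<^esub> q v w \<odot>\<^bsub>C\<^esub> \<eta>) \<otimes>\<^bsub>C\<^esub> \<mu>"
    unfolding W_clifford[OF v w] W_line(1)[OF Q_closed[OF v w]] q_def ..
  also have "\<dots> = (q v w \<oplus>\<^bsub>R\<^esub> q v w) \<odot>\<^bsub>C\<^esub> (\<eta> \<otimes>\<^bsub>C\<^esub> \<mu>)"
    using q_closed[OF v w] \<mu>_closed by (simp add: C.smult_l_distr[symmetric] C.smult_assoc_l)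
  finally show ?thesis unfolding \<eta>_\<mu> .
qed

text \<open>Both products on the left begin with \<open>u\<close> and end with \<open>x\<close>, so
  the Clifford relation can be applied to \<open>v\<close> and \<open>w\<close> in the
  middle.\<close>

lemma P_mult_swap:
  assumes u: "u \<in> carrier V" and v: "v \<in> carrier V" and w: "w \<in> carrier V" and x: "x \<in> carrier V"
  shows "P u v \<otimes>\<^bsub>C\<^esub> P w x \<oplus>\<^bsub>C\<^esub> P u w \<otimes>\<^bsub>C\<^esub> P v x = (q v w \<oplus>\<^bsub>R\<^esub> q v w) \<odot>\<^bsub>C\<^esub> P u x"
proof -
  let ?f = "[Inr L.f0, Inr L.f0] :: ('l + ('l \<Rightarrow> 'r)) list"
  have f: "?f \<in> lines" using letters0 by simp
  have *: "P a b \<otimes>\<^bsub>C\<^esub> P c d = W [a] [] \<otimes>\<^bsub>C\<^esub> (W [b, c] [] \<otimes>\<^bsub>C\<^esub> W [d] ?f)"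
    if "a \<in> carrier V" "b \<in> carrier V" "c \<in> carrier V" "d \<in> carrier V" for a b c d
    using that W_append[of "[a, b]" "[Inr L.f0]" "[c, d]" "[Inr L.f0]"] W_append[of "[a]" "[]" "[b, c, d]" ?f]
      W_append[of "[b, c]" "[]" "[d]" ?f] letters0
    by (simp add: P_def)
  have c: "W [u] [] \<in> carrier C" "W [v, w] [] \<in> carrier C" "W [w, v] [] \<in> carrier C" "W [x] ?f \<in> carrier C"
    "W [x] [] \<in> carrier C" using assms f by (auto intro!: W_closed)
  have "P u v \<otimes>\<^bsub>C\<^esub> P w x \<oplus>\<^bsub>C\<^esub> P u w \<otimes>\<^bsub>C\<^esub> P v x =
      W [u] [] \<otimes>\<^bsub>C\<^esub> ((W [v, w] [] \<oplus>\<^bsub>C\<^esub> W [w, v] []) \<otimes>\<^bsub>C\<^esub> W [x] ?f)"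
    using assms c by (simp add: * C.A.l_distr C.A.r_distr)
  also have "\<dots> = W [u] [] \<otimes>\<^bsub>C\<^esub> ((q v w \<odot>\<^bsub>C\<^esub> \<eta> \<oplus>\<^bsub>C\<^esub> q v w \<odot>\<^bsub>C\<^esub> \<eta>) \<otimes>\<^bsub>C\<^esub> W [x] ?f)"
    unfolding W_clifford[OF v w] W_line(1)[OF Q_closed[OF v w]] q_def ..
  also have "\<dots> = (q v w \<oplus>\<^bsub>R\<^esub> q v w) \<odot>\<^bsub>C\<^esub> (W [u] [] \<otimes>\<^bsub>C\<^esub> (\<eta> \<otimes>\<^bsub>C\<^esub> W [x] ?f))"
    using q_closed[OF v w] \<mu>_closed c
    by (simp add: C.smult_l_distr[symmetric] C.smult_assoc_l C.smult_assoc_r)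
  \<comment> \<open>Each \<open>P\<close> on the left brings one factor \<open>\<mu>\<close>, and
    the Clifford relation brings one \<open>\<eta>\<close>. After cancellation a single
    \<open>\<mu>\<close> is left, as \<open>P u x\<close> requires.\<close>
  also have "\<eta> \<otimes>\<^bsub>C\<^esub> W [x] ?f = \<eta> \<otimes>\<^bsub>C\<^esub> (\<mu> \<otimes>\<^bsub>C\<^esub> (\<mu> \<otimes>\<^bsub>C\<^esub> W [x] []))"
    using x W_split'[of "[x]" ?f] W_line_Cons[OF letters0(1), of "[Inr L.f0]"] letters0 \<mu>_closed c
    by (simp add: C.A.m_assoc)
  also have "\<dots> = \<mu> \<otimes>\<^bsub>C\<^esub> W [x] []"
    using \<mu>_closed c by (simp add: C.A.m_assoc[symmetric] \<eta>_\<mu>)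
  also have "\<dots> = W [x] [] \<otimes>\<^bsub>C\<^esub> \<mu>"
    using x W_split'[of "[x]" "[Inr L.f0]"] W_split[of "[x]" "[Inr L.f0]"] letters0 by simp
  also have "W [u] [] \<otimes>\<^bsub>C\<^esub> (W [x] [] \<otimes>\<^bsub>C\<^esub> \<mu>) = P u x" using u x by (simp add: P_eq(1))
  finally show ?thesis .
qed

lemma \<mu>_commute: "vs \<in> words \<Longrightarrow> \<mu> \<otimes>\<^bsub>C\<^esub> W vs [] = W vs [] \<otimes>\<^bsub>C\<^esub> \<mu>"
  using W_split'[of vs "[Inr L.f0]"] W_split[of vs "[Inr L.f0]"] letters0 by simp

text \<open>Each letter is a multiple of \<open>\<eta>\<close> or \<open>\<mu>\<close>, and these
  commute, so only a scalar and the numbers of letters of the two kinds remain.\<close>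

lemma W_line_normal_form:
  assumes "ls \<in> lines"
  shows "\<exists>r\<in>carrier R. W [] ls = r \<odot>\<^bsub>C\<^esub> (\<eta> [^]\<^bsub>C\<^esub> length (filter isl ls) \<otimes>\<^bsub>C\<^esub>
    \<mu> [^]\<^bsub>C\<^esub> length (filter (\<lambda>x. \<not> isl x) ls))"
  using assms
proof (induction ls)
  case Nil
  then show ?case by (intro bexI[of _ "\<one>\<^bsub>R\<^esub>"]) (simp_all add: W_Nil)
next
  case (Cons x ls)
  let ?a = "length (filter isl ls)" and ?b = "length (filter (\<lambda>x. \<not> isl x) ls)"
  obtain r where r: "r \<in> carrier R" "W [] ls = r \<odot>\<^bsub>C\<^esub> (\<eta> [^]\<^bsub>C\<^esub> ?a \<otimes>\<^bsub>C\<^esub> \<mu> [^]\<^bsub>C\<^esub> ?b)"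
    using Cons by auto
  have x: "x \<in> line_letters R L" "ls \<in> lines" using Cons by auto
  note c = \<mu>_closed
  show ?case
  proof (cases x)
    case (Inl l)
    then have l: "l \<in> carrier L" using x by (auto simp: line_letters_def)
    have "W [] (x # ls) = (\<kappa> l \<odot>\<^bsub>C\<^esub> \<eta>) \<otimes>\<^bsub>C\<^esub> (r \<odot>\<^bsub>C\<^esub> (\<eta> [^]\<^bsub>C\<^esub> ?a \<otimes>\<^bsub>C\<^esub> \<mu> [^]\<^bsub>C\<^esub> ?b))"
      using W_line_Cons[OF x] Inl r(2) W_line(1)[OF l] by simp
    also have "\<dots> = (\<kappa> l \<otimes>\<^bsub>R\<^esub> r) \<odot>\<^bsub>C\<^esub> (\<eta> [^]\<^bsub>C\<^esub> Suc ?a \<otimes>\<^bsub>C\<^esub> \<mu> [^]\<^bsub>C\<^esub> ?b)"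
      using r(1) L.\<kappa>_simps(1)[OF l] c C.A.nat_pow_Suc2[OF c(2), of ?a]
      by (simp add: C.smult_assoc_l C.smult_assoc_r C.smult_assoc1 C.smult_commute C.A.m_assoc[symmetric])
    finally show ?thesis using Inl r(1) L.\<kappa>_simps(1)[OF l] by (intro bexI[of _ "\<kappa> l \<otimes>\<^bsub>R\<^esub> r"]) simp_all
  next
    case (Inr f)
    then have f: "f \<in> carrier (dual_module R L)" using x by (auto simp: line_letters_def)
    have f': "f l0 \<in> carrier R" using L.dual_simps(1)[OF f L.l0(1)] .
    have pow: "\<mu> \<otimes>\<^bsub>C\<^esub> \<eta> [^]\<^bsub>C\<^esub> ?a = \<eta> [^]\<^bsub>C\<^esub> ?a \<otimes>\<^bsub>C\<^esub> \<mu>"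
      using C.A.group_commutes_pow[of \<eta> \<mu> ?a] \<eta>_\<mu> c by simp
    have "W [] (x # ls) = (f l0 \<odot>\<^bsub>C\<^esub> \<mu>) \<otimes>\<^bsub>C\<^esub> (r \<odot>\<^bsub>C\<^esub> (\<eta> [^]\<^bsub>C\<^esub> ?a \<otimes>\<^bsub>C\<^esub> \<mu> [^]\<^bsub>C\<^esub> ?b))"
      using W_line_Cons[OF x] Inr r(2) W_line(2)[OF f] by simp
    also have "\<dots> = (f l0 \<otimes>\<^bsub>R\<^esub> r) \<odot>\<^bsub>C\<^esub> ((\<mu> \<otimes>\<^bsub>C\<^esub> \<eta> [^]\<^bsub>C\<^esub> ?a) \<otimes>\<^bsub>C\<^esub> \<mu> [^]\<^bsub>C\<^esub> ?b)"
      using r(1) f' c by (simp add: C.smult_assoc_l C.smult_assoc_r C.smult_assoc1 C.smult_commute C.A.m_assoc)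
    also have "\<dots> = (f l0 \<otimes>\<^bsub>R\<^esub> r) \<odot>\<^bsub>C\<^esub> (\<eta> [^]\<^bsub>C\<^esub> ?a \<otimes>\<^bsub>C\<^esub> \<mu> [^]\<^bsub>C\<^esub> Suc ?b)"
      unfolding pow using c C.A.nat_pow_Suc2[OF c(1), of ?b] by (simp add: C.A.m_assoc)
    finally show ?thesis using Inr r(1) f' by (intro bexI[of _ "f l0 \<otimes>\<^bsub>R\<^esub> r"]) simp_all
  qed
qed

text \<open>Only the case of at least as many \<open>\<mu>\<close> as \<open>\<eta>\<close> occurs
  in degree 0, where the letters from \<open>V\<close> contribute a nonnegative degree.\<close>

lemma \<eta>_\<mu>_pow: "\<eta> [^]\<^bsub>C\<^esub> (a::nat) \<otimes>\<^bsub>C\<^esub> \<mu> [^]\<^bsub>C\<^esub> (a + m) = \<mu> [^]\<^bsub>C\<^esub> m"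
proof (induction a)
  case 0
  then show ?case using \<mu>_closed by simp
next
  case (Suc a)
  have "\<eta> [^]\<^bsub>C\<^esub> Suc a \<otimes>\<^bsub>C\<^esub> \<mu> [^]\<^bsub>C\<^esub> (Suc a + m) = (\<eta> [^]\<^bsub>C\<^esub> a \<otimes>\<^bsub>C\<^esub> \<eta>) \<otimes>\<^bsub>C\<^esub> (\<mu> \<otimes>\<^bsub>C\<^esub> \<mu> [^]\<^bsub>C\<^esub> (a + m))"
    using C.A.nat_pow_Suc2[OF \<mu>_closed(1), of "a + m"] by simp
  also have "\<dots> = \<eta> [^]\<^bsub>C\<^esub> a \<otimes>\<^bsub>C\<^esub> ((\<eta> \<otimes>\<^bsub>C\<^esub> \<mu>) \<otimes>\<^bsub>C\<^esub> \<mu> [^]\<^bsub>C\<^esub> (a + m))"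
    using \<mu>_closed by (simp add: C.A.m_assoc del: \<eta>_\<mu>)
  finally show ?case using Suc \<mu>_closed by (simp add: \<eta>_\<mu>)
qed

text \<open>Every word of degree 0 is a scalar multiple of a product of the elements \<open>P v w\<close>.\<close>

lemma clifford_part_0_subset:
  assumes N: "submodule N R C" and one: "\<one>\<^bsub>C\<^esub> \<in> N"
    and P: "\<And>v w x. v \<in> carrier V \<Longrightarrow> w \<in> carrier V \<Longrightarrow> x \<in> N \<Longrightarrow> P v w \<otimes>\<^bsub>C\<^esub> x \<in> N"
  shows "clifford_part R V L Q 0 \<subseteq> N"
proof -
  \<comment> \<open>Since \<open>\<mu>\<close> commutes with words in \<open>V\<close>, two vectors
    and one \<open>\<mu>\<close> can be split off at the front as a factor
    \<open>P v w\<close>.\<close>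
  have even: "W vs [] \<otimes>\<^bsub>C\<^esub> \<mu> [^]\<^bsub>C\<^esub> m \<in> N" if "vs \<in> words" "length vs = 2 * m" for vs m
    using that
  proof (induction m arbitrary: vs)
    case 0
    then show ?case using one by (simp add: W_Nil)
  next
    case (Suc m)
    then obtain v w ws where vs: "vs = v # w # ws"
      by (metis Suc_length_conv mult_Suc_right add_2_eq_Suc)
    have vw: "v \<in> carrier V" "w \<in> carrier V" "ws \<in> words" "length ws = 2 * m" using Suc.prems vs by auto
    have c: "W [v, w] [] \<in> carrier C" "W ws [] \<in> carrier C" using vw by (auto intro!: W_closed)
    have "W vs [] \<otimes>\<^bsub>C\<^esub> \<mu> [^]\<^bsub>C\<^esub> Suc m = (W [v, w] [] \<otimes>\<^bsub>C\<^esub> W ws []) \<otimes>\<^bsub>C\<^esub> (\<mu> \<otimes>\<^bsub>C\<^esub> \<mu> [^]\<^bsub>C\<^esub> m)"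
      using W_append[of "[v, w]" "[]" ws "[]"] vw C.A.nat_pow_Suc2[OF \<mu>_closed(1), of m] by (simp add: vs)
    also have "\<dots> = W [v, w] [] \<otimes>\<^bsub>C\<^esub> ((W ws [] \<otimes>\<^bsub>C\<^esub> \<mu>) \<otimes>\<^bsub>C\<^esub> \<mu> [^]\<^bsub>C\<^esub> m)"
      using c \<mu>_closed by (simp add: C.A.m_assoc)
    also have "\<dots> = P v w \<otimes>\<^bsub>C\<^esub> (W ws [] \<otimes>\<^bsub>C\<^esub> \<mu> [^]\<^bsub>C\<^esub> m)"
      unfolding \<mu>_commute[OF vw(3), symmetric] P_eq(2)[OF vw(1,2)] using c \<mu>_closed by (simp add: C.A.m_assoc)
    also have "\<dots> \<in> N" using Suc.IH[OF vw(3,4)] P vw by blast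
    finally show ?case .
  qed
  have "W vs ls \<in> N" if vs: "vs \<in> words" and ls: "ls \<in> lines" and deg: "word_degree vs ls = 0" for vs ls
  proof -
    let ?a = "length (filter isl ls)" and ?b = "length (filter (\<lambda>x. \<not> isl x) ls)"
    have "(\<Sum>x\<leftarrow>ls. case x of Inl _ \<Rightarrow> 2 | Inr _ \<Rightarrow> - 2) = 2 * int ?a - 2 * int ?b"
      by (induction ls) (auto split: sum.splits)
    then have "int (length vs) + 2 * int ?a = 2 * int ?b" using deg by (simp add: word_degree_def)
    \<comment> \<open>Degree 0 forces \<open>?b\<close> to be at least \<open>?a\<close>, so the
      truncated subtraction is an honest one.\<close>
    then have m: "length vs = 2 * (?b - ?a)" "?b = ?a + (?b - ?a)" by linarith+
    obtain r where r: "r \<in> carrier R" "W [] ls = r \<odot>\<^bsub>C\<^esub> (\<eta> [^]\<^bsub>C\<^esub> ?a \<otimes>\<^bsub>C\<^esub> \<mu> [^]\<^bsub>C\<^esub> ?b)"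
      using W_line_normal_form[OF ls] by blast
    have "W [] ls = r \<odot>\<^bsub>C\<^esub> \<mu> [^]\<^bsub>C\<^esub> (?b - ?a)"
      using r(2) \<eta>_\<mu>_pow[of ?a "?b - ?a"] m(2) by simp
    then have "W vs ls = r \<odot>\<^bsub>C\<^esub> (W vs [] \<otimes>\<^bsub>C\<^esub> \<mu> [^]\<^bsub>C\<^esub> (?b - ?a))"
      using W_split[OF vs ls] r(1) vs \<mu>_closed by (simp add: C.smult_assoc_r W_closed)
    also have "\<dots> \<in> N" using even[OF vs m(1)] r(1) submodule.smult_closed[OF N] by blast
    finally show ?thesis .
  qed
  then show ?thesis unfolding clifford_part_def W_def using N by blast
qed

lemma W_in_part:
  assumes "vs \<in> words" "ls \<in> lines" "word_degree vs ls = d"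
  shows "W vs ls \<in> clifford_part R V L Q d"
  using assms unfolding clifford_part_def W_def by blast

lemma P_in_part: "v \<in> carrier V \<Longrightarrow> w \<in> carrier V \<Longrightarrow> P v w \<in> clifford_part R V L Q 0"
  unfolding P_def by (rule W_in_part) (auto simp: word_degree_def letters0)

lemma part_subset: "clifford_part R V L Q 0 \<subseteq> carrier C"
proof -
  have "submodule (carrier C) R C" by (rule C.submoduleI') simp_all
  then show ?thesis by (rule clifford_part_0_subset) (simp_all add: P_closed)
qed

text \<open>The tensor algebra is mapped by \<open>\<rho>\<close> and the line algebra by
  \<open>\<chi>\<close>. The generators \<open>l0\<close> and \<open>f0\<close> become 1, so the
  grading is lost, and \<open>P v w\<close> becomes the plain product of the images of
  \<open>v\<close> and \<open>w\<close>.\<close>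

lemma clifford_lift:
  assumes D: "assoc_alg R D" and \<rho>: "linear_map R V D \<rho>"
    and rel: "\<And>v w. v \<in> carrier V \<Longrightarrow> w \<in> carrier V \<Longrightarrow>
      \<rho> v \<otimes>\<^bsub>D\<^esub> \<rho> w \<oplus>\<^bsub>D\<^esub> \<rho> w \<otimes>\<^bsub>D\<^esub> \<rho> v = (q v w \<oplus>\<^bsub>R\<^esub> q v w) \<odot>\<^bsub>D\<^esub> \<one>\<^bsub>D\<^esub>"
  shows "\<exists>h. alg_hom R C D h \<and> (\<forall>v\<in>carrier V. \<forall>w\<in>carrier V. h (P v w) = \<rho> v \<otimes>\<^bsub>D\<^esub> \<rho> w)"
proof -
  interpret D: assoc_alg R D by fact
  have \<rho>c: "\<rho> v \<in> carrier D" if "v \<in> carrier V" for v using linear_mapD(1)[OF \<rho> that] .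
  obtain f where f: "alg_hom R (tensor_algebra R V) D f"
    "\<forall>vs\<in>words. f (tensor_word R V vs) = word_prod D \<rho> vs" using V.tensor_lift[OF D \<rho>] by blast
  obtain g where g: "alg_hom R (line_algebra R L) (regular_module R) g"
    "\<forall>ls\<in>lines. g (line_word R L ls) = word_prod R L.\<chi> ls" using L.line_lift by blast
  obtain h where h: "alg_hom R Ea D h"
    "\<forall>a\<in>carrier (tensor_algebra R V). \<forall>b\<in>carrier (line_algebra R L).
      h (pure_tensor R (tensor_algebra R V) (line_algebra R L) a b) = g b \<odot>\<^bsub>D\<^esub> f a"
    using TL.tensor_lift[OF D f(1) g(1)] unfolding clifford_ambient_def by blast
  have hw: "h (ambient_word R V L vs ls) = word_prod R L.\<chi> ls \<odot>\<^bsub>D\<^esub> word_prod D \<rho> vs"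
    if "vs \<in> words" "ls \<in> lines" for vs ls
    using that h(2) f(2) g(2) by (simp add: ambient_word_def V.tensor_word L.line_word)
  note hm = alg_hom_minus[OF h(1) E.A.ring_axioms D.A.ring_axioms]
  have ker: "h x = \<zero>\<^bsub>D\<^esub>" if xr: "x \<in> clifford_relations" for x
  proof -
    obtain v w where vw: "v \<in> carrier V" "w \<in> carrier V" and
      x: "x = (half R \<odot>\<^bsub>Ea\<^esub> (ambient_word R V L [v, w] [] \<oplus>\<^bsub>Ea\<^esub> ambient_word R V L [w, v] [])) \<ominus>\<^bsub>Ea\<^esub>
        ambient_word R V L [] [Inl (Q v w)]"
      using xr unfolding clifford_relations_def by blast
    have c: "ambient_word R V L [v, w] [] \<in> carrier Ea" "ambient_word R V L [w, v] [] \<in> carrier Ea"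
      "ambient_word R V L [] [Inl (Q v w)] \<in> carrier Ea"
      using vw by (auto intro!: ambient_closed L.letters Q_closed)
    have \<chi>: "L.\<chi> (Inl (Q v w)) = q v w" by (simp add: L.\<chi>_def q_def)
    have qd: "q v w \<odot>\<^bsub>D\<^esub> \<one>\<^bsub>D\<^esub> \<in> carrier D" using q_closed vw by auto
    have "h (half R \<odot>\<^bsub>Ea\<^esub> (ambient_word R V L [v, w] [] \<oplus>\<^bsub>Ea\<^esub> ambient_word R V L [w, v] [])) =
        half R \<odot>\<^bsub>D\<^esub> (\<rho> v \<otimes>\<^bsub>D\<^esub> \<rho> w \<oplus>\<^bsub>D\<^esub> \<rho> w \<otimes>\<^bsub>D\<^esub> \<rho> v)"
      using c half_closed(1) vw \<rho>c
      by (simp add: alg_homD(4,6)[OF h(1)] hw word_prod_def)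
    also have "\<dots> = half R \<odot>\<^bsub>D\<^esub> (q v w \<odot>\<^bsub>D\<^esub> \<one>\<^bsub>D\<^esub> \<oplus>\<^bsub>D\<^esub> q v w \<odot>\<^bsub>D\<^esub> \<one>\<^bsub>D\<^esub>)"
      unfolding rel[OF vw] using q_closed vw by (simp add: D.smult_l_distr)
    also have "\<dots> = q v w \<odot>\<^bsub>D\<^esub> \<one>\<^bsub>D\<^esub>" by (rule D.half_smult_double[OF two qd])
    finally have 1: "h (half R \<odot>\<^bsub>Ea\<^esub> (ambient_word R V L [v, w] [] \<oplus>\<^bsub>Ea\<^esub> ambient_word R V L [w, v] [])) =
      q v w \<odot>\<^bsub>D\<^esub> \<one>\<^bsub>D\<^esub>" .
    have 2: "h (ambient_word R V L [] [Inl (Q v w)]) = q v w \<odot>\<^bsub>D\<^esub> \<one>\<^bsub>D\<^esub>"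
      using vw q_closed by (simp add: hw word_prod_def \<chi> L.letters Q_closed)
    have "h x = q v w \<odot>\<^bsub>D\<^esub> \<one>\<^bsub>D\<^esub> \<ominus>\<^bsub>D\<^esub> q v w \<odot>\<^bsub>D\<^esub> \<one>\<^bsub>D\<^esub>"
      unfolding x by (subst hm) (use c half_closed(1) in \<open>simp_all add: 1 2\<close>)
    then show ?thesis using D.M.r_neg[OF qd] by (simp add: a_minus_def)
  qed
  obtain h' where h': "alg_hom R (quot_algebra Ea (Idl\<^bsub>Ea\<^esub> clifford_relations)) D h'"
    "\<forall>x\<in>carrier Ea. h' (Idl\<^bsub>Ea\<^esub> clifford_relations +>\<^bsub>Ea\<^esub> x) = h x"
    using E.quot_lift[OF D h(1) clifford_relations_closed ker] by blast
  show ?thesis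
  proof (intro exI conjI ballI)
    show "alg_hom R C D h'" using h'(1) by (simp add: clifford_algebra_def clifford_ideal_eq)
    fix v w assume vw: "v \<in> carrier V" "w \<in> carrier V"
    have "h' (P v w) = h (ambient_word R V L [v, w] [Inr L.f0])"
      unfolding P_def W_def clifford_ideal_eq using h'(2) vw letters0 by (simp add: ambient_closed)
    also have "\<dots> = \<rho> v \<otimes>\<^bsub>D\<^esub> \<rho> w"
      using vw letters0 \<rho>c by (simp add: hw word_prod_def L.\<chi>_def L.f0(2)[OF L.l0(1)] L.l0(2))
    finally show "h' (P v w) = \<rho> v \<otimes>\<^bsub>D\<^esub> \<rho> w" .
  qed
qed

end

section \<open>A representation of the Clifford algebra\<close>

text \<open>Operators are extensional, so that two of them are equal once they agree on the
  carrier.\<close>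

definition endomorphism_algebra ::
  "('r, 'm) ring_scheme \<Rightarrow> ('r, 'a, 'n) module_scheme \<Rightarrow> ('r, 'a \<Rightarrow> 'a) module" where
  "endomorphism_algebra R M =
    \<lparr>carrier = {T \<in> extensional (carrier M). linear_map R M M T},
     mult = (\<lambda>S T. \<lambda>x\<in>carrier M. S (T x)),
     one = (\<lambda>x\<in>carrier M. x),
     zero = (\<lambda>x\<in>carrier M. \<zero>\<^bsub>M\<^esub>),
     add = (\<lambda>S T. \<lambda>x\<in>carrier M. S x \<oplus>\<^bsub>M\<^esub> T x),
     smult = (\<lambda>r T. \<lambda>x\<in>carrier M. r \<odot>\<^bsub>M\<^esub> T x)\<rparr>"

section \<open>Endomorphisms of a module as an associative algebra\<close>

context module
begin

abbreviation "End \<equiv> endomorphism_algebra R M"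

lemma End_simps:
  "mult End S T = (\<lambda>x\<in>carrier M. S (T x))" "one End = (\<lambda>x\<in>carrier M. x)"
  "zero End = (\<lambda>x\<in>carrier M. \<zero>\<^bsub>M\<^esub>)" "add End S T = (\<lambda>x\<in>carrier M. S x \<oplus>\<^bsub>M\<^esub> T x)"
  "smult End r T = (\<lambda>x\<in>carrier M. r \<odot>\<^bsub>M\<^esub> T x)"
  by (simp_all add: endomorphism_algebra_def)

lemma End_eval:
  "x \<in> carrier M \<Longrightarrow> (S \<otimes>\<^bsub>End\<^esub> T) x = S (T x)" "x \<in> carrier M \<Longrightarrow> \<one>\<^bsub>End\<^esub> x = x"
  "x \<in> carrier M \<Longrightarrow> \<zero>\<^bsub>End\<^esub> x = \<zero>\<^bsub>M\<^esub>" "x \<in> carrier M \<Longrightarrow> (S \<oplus>\<^bsub>End\<^esub> T) x = S x \<oplus>\<^bsub>M\<^esub> T x"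
  "x \<in> carrier M \<Longrightarrow> (r \<odot>\<^bsub>End\<^esub> T) x = r \<odot>\<^bsub>M\<^esub> T x"
  by (simp_all add: End_simps)

lemma End_carrier: "T \<in> carrier End \<longleftrightarrow> T \<in> extensional (carrier M) \<and> linear_map R M M T"
  by (simp add: endomorphism_algebra_def)

lemma End_I:
  assumes "linear_map R M M T"
  shows "restrict T (carrier M) \<in> carrier End"
  using linear_mapD[OF assms] by (auto simp: End_carrier linear_map_def)

lemma End_eqI:
  assumes "S \<in> carrier End" "T \<in> carrier End" "\<And>x. x \<in> carrier M \<Longrightarrow> S x = T x"
  shows "S = T"
  using assms unfolding End_carrier by (auto intro: extensionalityI)

lemma End_apply:
  assumes "T \<in> carrier End"
  shows "\<And>x. x \<in> carrier M \<Longrightarrow> T x \<in> carrier M"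
    and "\<And>x y. x \<in> carrier M \<Longrightarrow> y \<in> carrier M \<Longrightarrow> T (x \<oplus>\<^bsub>M\<^esub> y) = T x \<oplus>\<^bsub>M\<^esub> T y"
    and "\<And>r x. r \<in> carrier R \<Longrightarrow> x \<in> carrier M \<Longrightarrow> T (r \<odot>\<^bsub>M\<^esub> x) = r \<odot>\<^bsub>M\<^esub> T x"
  using assms linear_mapD[of R M M T] unfolding End_carrier by blast+

lemma End_closed:
  shows "\<And>S T. S \<in> carrier End \<Longrightarrow> T \<in> carrier End \<Longrightarrow> S \<otimes>\<^bsub>End\<^esub> T \<in> carrier End"
    and "\<And>S T. S \<in> carrier End \<Longrightarrow> T \<in> carrier End \<Longrightarrow> S \<oplus>\<^bsub>End\<^esub> T \<in> carrier End"
    and "\<And>r T. r \<in> carrier R \<Longrightarrow> T \<in> carrier End \<Longrightarrow> r \<odot>\<^bsub>End\<^esub> T \<in> carrier End"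
    and "\<one>\<^bsub>End\<^esub> \<in> carrier End" "\<zero>\<^bsub>End\<^esub> \<in> carrier End"
  unfolding End_simps
  by (rule End_I; auto simp: linear_map_def End_apply smult_r_distr M.a_ac smult_assoc1[symmetric] R.m_comm)+

lemma assoc_alg_End: "assoc_alg R End"
proof -
  note [simp] = End_eval End_apply End_closed
  have ag: "abelian_group End"
  proof (rule abelian_groupI)
    fix T assume T: "T \<in> carrier End"
    have "\<ominus> \<one> \<odot>\<^bsub>End\<^esub> T \<oplus>\<^bsub>End\<^esub> T = \<zero>\<^bsub>End\<^esub>"
      by (rule End_eqI) (use T in \<open>simp_all add: smult_l_minus M.l_neg\<close>)
    then show "\<exists>S\<in>carrier End. S \<oplus>\<^bsub>End\<^esub> T = \<zero>\<^bsub>End\<^esub>"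
      using T by (intro bexI[of _ "\<ominus> \<one> \<odot>\<^bsub>End\<^esub> T"]) simp_all
  next
    fix S T U assume c: "S \<in> carrier End" "T \<in> carrier End" "U \<in> carrier End"
    show "S \<oplus>\<^bsub>End\<^esub> T \<oplus>\<^bsub>End\<^esub> U = S \<oplus>\<^bsub>End\<^esub> (T \<oplus>\<^bsub>End\<^esub> U)"
      by (rule End_eqI) (use c in \<open>simp_all add: M.a_ac\<close>)
  next
    fix S T assume c: "S \<in> carrier End" "T \<in> carrier End"
    show "S \<oplus>\<^bsub>End\<^esub> T = T \<oplus>\<^bsub>End\<^esub> S"
      by (rule End_eqI) (use c in \<open>simp_all add: M.a_ac\<close>)
  next
    fix S assume c: "S \<in> carrier End"
    show "\<zero>\<^bsub>End\<^esub> \<oplus>\<^bsub>End\<^esub> S = S"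
      by (rule End_eqI) (use c in simp_all)
  qed simp_all
  have "ring End"
  proof (rule ringI[OF ag monoidI])
    fix S T U assume c: "S \<in> carrier End" "T \<in> carrier End" "U \<in> carrier End"
    show "S \<otimes>\<^bsub>End\<^esub> T \<otimes>\<^bsub>End\<^esub> U = S \<otimes>\<^bsub>End\<^esub> (T \<otimes>\<^bsub>End\<^esub> U)"
      by (rule End_eqI) (use c in simp_all)
    show "(S \<oplus>\<^bsub>End\<^esub> T) \<otimes>\<^bsub>End\<^esub> U = S \<otimes>\<^bsub>End\<^esub> U \<oplus>\<^bsub>End\<^esub> T \<otimes>\<^bsub>End\<^esub> U"
      by (rule End_eqI) (use c in simp_all)
    show "U \<otimes>\<^bsub>End\<^esub> (S \<oplus>\<^bsub>End\<^esub> T) = U \<otimes>\<^bsub>End\<^esub> S \<oplus>\<^bsub>End\<^esub> U \<otimes>\<^bsub>End\<^esub> T"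
      by (rule End_eqI) (use c in simp_all)
  next
    fix S assume c: "S \<in> carrier End"
    show "\<one>\<^bsub>End\<^esub> \<otimes>\<^bsub>End\<^esub> S = S" by (rule End_eqI) (use c in simp_all)
    show "S \<otimes>\<^bsub>End\<^esub> \<one>\<^bsub>End\<^esub> = S" by (rule End_eqI) (use c in simp_all)
  qed simp_all
  moreover have "module R End"
  proof (rule moduleI[OF R.is_cring ag])
    fix r s T assume c: "r \<in> carrier R" "s \<in> carrier R" "T \<in> carrier End"
    show "(r \<oplus> s) \<odot>\<^bsub>End\<^esub> T = r \<odot>\<^bsub>End\<^esub> T \<oplus>\<^bsub>End\<^esub> s \<odot>\<^bsub>End\<^esub> T"
      by (rule End_eqI) (use c in \<open>simp_all add: smult_l_distr\<close>)
    show "(r \<otimes> s) \<odot>\<^bsub>End\<^esub> T = r \<odot>\<^bsub>End\<^esub> (s \<odot>\<^bsub>End\<^esub> T)"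
      by (rule End_eqI) (use c in \<open>simp_all add: smult_assoc1\<close>)
  next
    fix T assume c: "T \<in> carrier End"
    show "\<one> \<odot>\<^bsub>End\<^esub> T = T" by (rule End_eqI) (use c in simp_all)
  next
    fix r S T assume c: "r \<in> carrier R" "S \<in> carrier End" "T \<in> carrier End"
    show "r \<odot>\<^bsub>End\<^esub> (S \<oplus>\<^bsub>End\<^esub> T) = r \<odot>\<^bsub>End\<^esub> S \<oplus>\<^bsub>End\<^esub> r \<odot>\<^bsub>End\<^esub> T"
      by (rule End_eqI) (use c in \<open>simp_all add: smult_r_distr\<close>)
  qed simp_all
  moreover have "assoc_alg_axioms R End"
  proof
    fix r S T assume c: "r \<in> carrier R" "S \<in> carrier End" "T \<in> carrier End"
    show "(r \<odot>\<^bsub>End\<^esub> S) \<otimes>\<^bsub>End\<^esub> T = r \<odot>\<^bsub>End\<^esub> (S \<otimes>\<^bsub>End\<^esub> T)"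
      by (rule End_eqI) (use c in simp_all)
    show "S \<otimes>\<^bsub>End\<^esub> (r \<odot>\<^bsub>End\<^esub> T) = r \<odot>\<^bsub>End\<^esub> (S \<otimes>\<^bsub>End\<^esub> T)"
      by (rule End_eqI) (use c in simp_all)
  qed
  ultimately show ?thesis unfolding assoc_alg_def by blast
qed

end

text \<open>All indices are allowed, not only those below a power of two. The same module then
  serves every stage of the recursion, as it is isomorphic to two copies of itself by even and odd
  indices.\<close>

definition function_module :: "('r, 'm) ring_scheme \<Rightarrow> ('r, nat \<Rightarrow> 'r) module" where
  "function_module R =
    \<lparr>carrier = {f. \<forall>s. f s \<in> carrier R}, mult = undefined, one = undefined,
     zero = (\<lambda>s. \<zero>\<^bsub>R\<^esub>), add = (\<lambda>f g s. f s \<oplus>\<^bsub>R\<^esub> g s), smult = (\<lambda>r f s. r \<otimes>\<^bsub>R\<^esub> f s)\<rparr>"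

lemma function_module_simps:
  "f \<in> carrier (function_module R) \<longleftrightarrow> (\<forall>s. f s \<in> carrier R)"
  "zero (function_module R) = (\<lambda>s. \<zero>\<^bsub>R\<^esub>)" "add (function_module R) f g = (\<lambda>s. f s \<oplus>\<^bsub>R\<^esub> g s)"
  "smult (function_module R) r f = (\<lambda>s. r \<otimes>\<^bsub>R\<^esub> f s)"
  by (simp_all add: function_module_def)

lemma module_function_module:
  assumes "cring R"
  shows "Module.module R (function_module R)"
proof -
  interpret cring R by fact
  show ?thesis
  proof (rule moduleI[OF is_cring abelian_groupI])
    fix f assume f: "f \<in> carrier (function_module R)"
    show "\<exists>g\<in>carrier (function_module R). g \<oplus>\<^bsub>function_module R\<^esub> f = \<zero>\<^bsub>function_module R\<^esub>"
      by (rule bexI[of _ "\<lambda>s. \<ominus>\<^bsub>R\<^esub> f s"]) (use f in \<open>auto simp: function_module_simps l_neg\<close>)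
  qed (auto simp: function_module_simps a_ac l_distr r_distr m_assoc)
qed

text \<open>The module \<open>function_module R\<close> plays the role of an exterior algebra, a subset of
  generators being encoded by the binary digits of an index, with the last generator in the lowest
  digit. If \<open>x\<close> acts on the span of the first \<open>n\<close> generators with \<open>x\<^sup>2 = q x\<close>, then on two copies of it
  the matrix \<open>[[x, c], [y, -x]]\<close> with scalars \<open>c\<close>, \<open>y\<close> has square \<open>q x + c y\<close>. Here \<open>y\<close> is the last
  coordinate of the vector.\<close>

locale clifford_action = cring R for R :: "('r, 'm) ring_scheme" (structure) +
  fixes c :: "nat \<Rightarrow> (nat \<Rightarrow> 'r) \<Rightarrow> 'r"
  assumes c_closed: "(\<And>i. a i \<in> carrier R) \<Longrightarrow> c n a \<in> carrier R"
    and c_add: "(\<And>i. a i \<in> carrier R) \<Longrightarrow> (\<And>i. b i \<in> carrier R) \<Longrightarrow>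
      c n (\<lambda>i. a i \<oplus> b i) = c n a \<oplus> c n b"
    and c_smult: "r \<in> carrier R \<Longrightarrow> (\<And>i. a i \<in> carrier R) \<Longrightarrow> c n (\<lambda>i. r \<otimes> a i) = r \<otimes> c n a"
    and c_zero: "(\<And>i. a i \<in> carrier R) \<Longrightarrow> (\<And>i. i \<le> n \<Longrightarrow> a i = \<zero>) \<Longrightarrow> c n a = \<zero>"
begin

text \<open>Even indices form the first copy of the module and odd ones the second;
  \<open>s div 2\<close> is the place within a copy. For odd \<open>s\<close> the corresponding
  place of the first copy is \<open>s - 1\<close>, and for even \<open>s\<close> that of the second
  is \<open>Suc s\<close>. The two branches are thus the rows \<open>[y, -x]\<close> and
  \<open>[x, c]\<close> of the matrix.\<close>

primrec act :: "nat \<Rightarrow> (nat \<Rightarrow> 'r) \<Rightarrow> (nat \<Rightarrow> 'r) \<Rightarrow> nat \<Rightarrow> 'r" where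
  "act 0 a f s = \<zero>"
| "act (Suc n) a f s = (if odd s
     then a n \<otimes> f (s - 1) \<ominus> act n a (\<lambda>t. f (Suc (2 * t))) (s div 2)
     else act n a (\<lambda>t. f (2 * t)) (s div 2) \<oplus> c n a \<otimes> f (Suc s))"

text \<open>The polar form of the quadratic form that is the sum of the products of
  \<open>c m a\<close> and \<open>a m\<close> over \<open>m < n\<close>. There is no factor one
  half.\<close>

primrec polarization :: "nat \<Rightarrow> (nat \<Rightarrow> 'r) \<Rightarrow> (nat \<Rightarrow> 'r) \<Rightarrow> 'r" where
  "polarization 0 a b = \<zero>"
| "polarization (Suc n) a b = polarization n a b \<oplus> (c n a \<otimes> b n \<oplus> c n b \<otimes> a n)"

text \<open>The ring arithmetic of the two rows, with the recursive values replaced by letters: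
  additivity and homogeneity in the function, then in the vector.\<close>

lemma act_algebra:
  assumes "x \<in> carrier R" "y \<in> carrier R" "z \<in> carrier R" "u \<in> carrier R" "v \<in> carrier R"
  shows "x \<otimes> (y \<oplus> z) \<ominus> (u \<oplus> v) = (x \<otimes> y \<ominus> u) \<oplus> (x \<otimes> z \<ominus> v)"
    and "(u \<oplus> v) \<oplus> x \<otimes> (y \<oplus> z) = (u \<oplus> x \<otimes> y) \<oplus> (v \<oplus> x \<otimes> z)"
    and "x \<otimes> (z \<otimes> y) \<ominus> z \<otimes> u = z \<otimes> (x \<otimes> y \<ominus> u)"
    and "z \<otimes> u \<oplus> x \<otimes> (z \<otimes> y) = z \<otimes> (u \<oplus> x \<otimes> y)"
    and "(y \<oplus> z) \<otimes> x \<ominus> (u \<oplus> v) = (y \<otimes> x \<ominus> u) \<oplus> (z \<otimes> x \<ominus> v)"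
    and "(u \<oplus> v) \<oplus> (y \<oplus> z) \<otimes> x = (u \<oplus> y \<otimes> x) \<oplus> (v \<oplus> z \<otimes> x)"
    and "(z \<otimes> x) \<otimes> y \<ominus> z \<otimes> u = z \<otimes> (x \<otimes> y \<ominus> u)"
    and "z \<otimes> u \<oplus> (z \<otimes> x) \<otimes> y = z \<otimes> (u \<oplus> x \<otimes> y)"
  using assms by (algebra, algebra, algebra, algebra, algebra, algebra, algebra, algebra)

text \<open>The second row of the anticommutator of two block matrices. The mixed terms in
  \<open>u\<close> and \<open>v\<close> cancel; what remains is the smaller anticommutator and the
  new summand of the polarisation. The next lemma is the first row.\<close>

lemma act_clifford_odd:
  assumes "x \<in> carrier R" "y \<in> carrier R" "u \<in> carrier R" "v \<in> carrier R" "z \<in> carrier R"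
    "a \<in> carrier R" "b \<in> carrier R" "w \<in> carrier R" "d \<in> carrier R"
  shows "(a \<otimes> (v \<oplus> d \<otimes> z) \<ominus> (b \<otimes> u \<oplus> \<ominus> \<one> \<otimes> x)) \<oplus> (b \<otimes> (u \<oplus> w \<otimes> z) \<ominus> (a \<otimes> v \<oplus> \<ominus> \<one> \<otimes> y)) =
    (x \<oplus> y) \<oplus> (w \<otimes> b \<oplus> d \<otimes> a) \<otimes> z"
  using assms by algebra

lemma act_clifford_even:
  assumes "x \<in> carrier R" "y \<in> carrier R" "u \<in> carrier R" "v \<in> carrier R" "z \<in> carrier R"
    "a \<in> carrier R" "b \<in> carrier R" "w \<in> carrier R" "d \<in> carrier R"
  shows "(x \<oplus> d \<otimes> u \<oplus> w \<otimes> (b \<otimes> z \<ominus> v)) \<oplus> (y \<oplus> w \<otimes> v \<oplus> d \<otimes> (a \<otimes> z \<ominus> u)) =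
    (x \<oplus> y) \<oplus> (w \<otimes> b \<oplus> d \<otimes> a) \<otimes> z"
  using assms by algebra

section \<open>Linearity and the Clifford relation of the action\<close>

lemma act_closed: "(\<And>i. a i \<in> carrier R) \<Longrightarrow> (\<And>s. f s \<in> carrier R) \<Longrightarrow> act n a f s \<in> carrier R"
  by (induction n arbitrary: f s) (auto simp: c_closed)

lemma polarization_closed:
  "(\<And>i. a i \<in> carrier R) \<Longrightarrow> (\<And>i. b i \<in> carrier R) \<Longrightarrow> polarization n a b \<in> carrier R"
  by (induction n) (auto simp: c_closed)

lemma act_add:
  assumes a: "\<And>i. a i \<in> carrier R" and f: "\<And>s. f s \<in> carrier R" and g: "\<And>s. g s \<in> carrier R"
  shows "act n a (\<lambda>s. f s \<oplus> g s) s = act n a f s \<oplus> act n a g s"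
  using f g
proof (induction n arbitrary: f g s)
  case 0
  then show ?case by simp
next
  case (Suc n)
  note IH = Suc.IH[of "\<lambda>t. f (2 * t)" "\<lambda>t. g (2 * t)"] Suc.IH[of "\<lambda>t. f (Suc (2 * t))" "\<lambda>t. g (Suc (2 * t))"]
  show ?case
    using Suc.prems a c_closed[of a n] by (simp add: IH act_closed act_algebra)
qed

lemma act_smult:
  assumes a: "\<And>i. a i \<in> carrier R" and f: "\<And>s. f s \<in> carrier R" and r: "r \<in> carrier R"
  shows "act n a (\<lambda>s. r \<otimes> f s) s = r \<otimes> act n a f s"
  using f
proof (induction n arbitrary: f s)
  case 0
  then show ?case using r by simp
next
  case (Suc n)
  note IH = Suc.IH[of "\<lambda>t. f (2 * t)"] Suc.IH[of "\<lambda>t. f (Suc (2 * t))"]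
  show ?case
    using Suc.prems a c_closed[of a n] r by (simp add: IH act_closed act_algebra)
qed

lemma act_zero:
  assumes a: "\<And>i. a i \<in> carrier R"
  shows "act n a (\<lambda>s. \<zero>) s = \<zero>"
  using act_smult[of a "\<lambda>s. \<zero>" \<zero> n s] act_closed[of a "\<lambda>s. \<zero>"] a by simp

lemma act_add_vector:
  assumes a: "\<And>i. a i \<in> carrier R" and b: "\<And>i. b i \<in> carrier R" and f: "\<And>s. f s \<in> carrier R"
  shows "act n (\<lambda>i. a i \<oplus> b i) f s = act n a f s \<oplus> act n b f s"
  using f
proof (induction n arbitrary: f s)
  case 0
  then show ?case by simp
next
  case (Suc n)
  note IH = Suc.IH[of "\<lambda>t. f (2 * t)"] Suc.IH[of "\<lambda>t. f (Suc (2 * t))"]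
  show ?case
    using Suc.prems a b c_closed[of a n] c_closed[of b n] by (simp add: IH c_add act_closed act_algebra)
qed

lemma act_smult_vector:
  assumes a: "\<And>i. a i \<in> carrier R" and f: "\<And>s. f s \<in> carrier R" and r: "r \<in> carrier R"
  shows "act n (\<lambda>i. r \<otimes> a i) f s = r \<otimes> act n a f s"
  using f
proof (induction n arbitrary: f s)
  case 0
  then show ?case using r by simp
next
  case (Suc n)
  note IH = Suc.IH[of "\<lambda>t. f (2 * t)"] Suc.IH[of "\<lambda>t. f (Suc (2 * t))"]
  show ?case
    using Suc.prems a c_closed[of a n] r by (simp add: IH c_smult act_closed act_algebra)
qed

lemma act_clifford:
  assumes a: "\<And>i. a i \<in> carrier R" and b: "\<And>i. b i \<in> carrier R" and f: "\<And>s. f s \<in> carrier R"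
  shows "act n a (act n b f) s \<oplus> act n b (act n a f) s = polarization n a b \<otimes> f s"
  using f
proof (induction n arbitrary: f s)
  case 0
  then show ?case by simp
next
  case (Suc n)
  let ?e = "\<lambda>t. f (2 * t)" and ?o = "\<lambda>t. f (Suc (2 * t))"
  have e: "\<And>t. ?e t \<in> carrier R" and o: "\<And>t. ?o t \<in> carrier R" using Suc.prems by auto
  have cab: "c n a \<in> carrier R" "c n b \<in> carrier R" using c_closed a b by auto
  have cl: "act n a h s \<in> carrier R" "act n b h s \<in> carrier R" if "\<And>s. h s \<in> carrier R" for h s
    using act_closed a b that by blast+
  have pe: "(\<lambda>t. act (Suc n) d f (2 * t)) = (\<lambda>t. act n d ?e t \<oplus> c n d \<otimes> ?o t)" for d by auto
  \<comment> \<open>The difference in the odd row is written as a sum with a multiple by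
    \<open>\<ominus> \<one>\<close>, so that \<open>act_add\<close> and \<open>act_smult\<close>
    apply to it.\<close>
  have po: "(\<lambda>t. act (Suc n) d f (Suc (2 * t))) = (\<lambda>t. d n \<otimes> ?e t \<oplus> \<ominus> \<one> \<otimes> act n d ?o t)"
    if "\<And>i. d i \<in> carrier R" for d
    using act_closed[of d] that o by (auto simp: a_minus_def l_minus)
  have le: "act n d (\<lambda>t. act (Suc n) d' f (2 * t)) s = act n d (act n d' ?e) s \<oplus> c n d' \<otimes> act n d ?o s"
    if "\<And>i. d i \<in> carrier R" "\<And>i. d' i \<in> carrier R" for d d' s
    unfolding pe using that e o act_closed[of d'] c_closed[of d']
    by (simp add: act_add act_smult)
  have lo: "act n d (\<lambda>t. act (Suc n) d' f (Suc (2 * t))) s =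
      d' n \<otimes> act n d ?e s \<oplus> \<ominus> \<one> \<otimes> act n d (act n d' ?o) s"
    if "\<And>i. d i \<in> carrier R" "\<And>i. d' i \<in> carrier R" for d d' s
    unfolding po[OF that(2)] using that e o act_closed[of d'] act_closed[of d]
    by (simp add: act_add act_smult del: l_minus)
  have P: "polarization n a b \<in> carrier R" using polarization_closed a b by auto
  show ?case
  proof (cases "odd s")
    case True
    then obtain t where s: "s = Suc (2 * t)" by (metis oddE Suc_eq_plus1)
    have IH: "act n a (act n b ?o) t \<oplus> act n b (act n a ?o) t = polarization n a b \<otimes> ?o t"
      by (rule Suc.IH) (use o in auto)
    define x y where "x = act n a (act n b ?o) t" and "y = act n b (act n a ?o) t"
    define u v where "u = act n a ?e t" and "v = act n b ?e t"
    define z where "z = ?o t"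
    have m: "x \<in> carrier R" "y \<in> carrier R" "u \<in> carrier R" "v \<in> carrier R" "z \<in> carrier R"
      "a n \<in> carrier R" "b n \<in> carrier R"
      using cl e o a b by (auto simp: x_def y_def u_def v_def z_def)
    have "act (Suc n) a (act (Suc n) b f) s \<oplus> act (Suc n) b (act (Suc n) a f) s =
      (a n \<otimes> (v \<oplus> c n b \<otimes> z) \<ominus> (b n \<otimes> u \<oplus> \<ominus> \<one> \<otimes> x)) \<oplus>
      (b n \<otimes> (u \<oplus> c n a \<otimes> z) \<ominus> (a n \<otimes> v \<oplus> \<ominus> \<one> \<otimes> y))"
      using lo[of a b t] lo[of b a t] a b unfolding act.simps(2)[of n _ "act (Suc n) _ f"] s
      by (simp add: x_def y_def u_def v_def z_def)
    also have "\<dots> = (x \<oplus> y) \<oplus> (c n a \<otimes> b n \<oplus> c n b \<otimes> a n) \<otimes> z"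
      using m cab by (intro act_clifford_odd)
    also have "\<dots> = polarization (Suc n) a b \<otimes> f s"
      unfolding x_def y_def IH using P m cab by (simp add: s z_def l_distr)
    finally show ?thesis .
  next
    case False
    then obtain t where s: "s = 2 * t" by (metis evenE)
    have IH: "act n a (act n b ?e) t \<oplus> act n b (act n a ?e) t = polarization n a b \<otimes> ?e t"
      by (rule Suc.IH) (use e in auto)
    define x y where "x = act n a (act n b ?e) t" and "y = act n b (act n a ?e) t"
    define u v where "u = act n a ?o t" and "v = act n b ?o t"
    define z where "z = ?e t"
    have m: "x \<in> carrier R" "y \<in> carrier R" "u \<in> carrier R" "v \<in> carrier R" "z \<in> carrier R"
      "a n \<in> carrier R" "b n \<in> carrier R"
      using cl e o a b by (auto simp: x_def y_def u_def v_def z_def)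
    have "act (Suc n) a (act (Suc n) b f) s \<oplus> act (Suc n) b (act (Suc n) a f) s =
      (x \<oplus> c n b \<otimes> u \<oplus> c n a \<otimes> (b n \<otimes> z \<ominus> v)) \<oplus> (y \<oplus> c n a \<otimes> v \<oplus> c n b \<otimes> (a n \<otimes> z \<ominus> u))"
      using le[of a b t] le[of b a t] a b unfolding act.simps(2)[of n _ "act (Suc n) _ f"] s
      by (simp add: x_def y_def u_def v_def z_def)
    also have "\<dots> = (x \<oplus> y) \<oplus> (c n a \<otimes> b n \<oplus> c n b \<otimes> a n) \<otimes> z"
      using m cab by (intro act_clifford_even)
    also have "\<dots> = polarization (Suc n) a b \<otimes> f s"
      unfolding x_def y_def IH using P m cab by (simp add: s z_def l_distr)
    finally show ?thesis .
  qed
qed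

text \<open>The diagonal blocks vanish by induction and the entry \<open>a n\<close> by assumption;
  the remaining entry \<open>c n a\<close> vanishes because it depends only on the coordinates up to
  \<open>n\<close>, which is \<open>c_zero\<close>.\<close>

lemma act_vanish:
  assumes a: "\<And>i. a i \<in> carrier R" and "\<And>i. i < n \<Longrightarrow> a i = \<zero>" and f: "\<And>s. f s \<in> carrier R"
  shows "act n a f s = \<zero>"
  using assms(2) f
proof (induction n arbitrary: f s)
  case 0
  then show ?case by simp
next
  case (Suc n)
  have "c n a = \<zero>" using a Suc.prems by (intro c_zero) auto
  then show ?case using Suc by (simp add: a_minus_def)
qed

text \<open>Used in two roles: as the coefficients of the basis vector \<open>e j\<close>, and as
  the basis vector of the module at index \<open>j\<close>, the vacuum being index 0.\<close>

definition unit_vector :: "nat \<Rightarrow> nat \<Rightarrow> 'r" where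
  "unit_vector j i = (if i = j then \<one> else \<zero>)"

lemma unit_vector_closed: "unit_vector j i \<in> carrier R"
  by (simp add: unit_vector_def)

text \<open>A function on the first copy stays there, since the entry leading to the second copy is
  the last coordinate, here 0. It is acted on by the upper left block, which carries no
  sign.\<close>

lemma act_unit_vector_less:
  assumes "j < n" and f: "\<And>s. f s \<in> carrier R"
  shows "act (Suc n) (unit_vector j) (\<lambda>s. if odd s then \<zero> else f (s div 2)) s =
    (if odd s then \<zero> else act n (unit_vector j) f (s div 2))"
  using assms act_zero[OF unit_vector_closed] act_closed[OF unit_vector_closed] f
    c_closed[OF unit_vector_closed]
  by (simp add: unit_vector_def[of j n] a_minus_def)

text \<open>The diagonal blocks vanish by \<open>act_vanish\<close>, so the first copy is carried
  unchanged to the second by the entry 1: a creation operator.\<close>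

lemma act_unit_vector_last:
  assumes f: "\<And>s. f s \<in> carrier R"
  shows "act (Suc n) (unit_vector n) (\<lambda>s. if odd s then \<zero> else f (s div 2)) s =
    (if odd s then f (s div 2) else \<zero>)"
proof -
  have "act n (unit_vector n) f t = \<zero>" for t
    using f unit_vector_closed by (intro act_vanish) (auto simp: unit_vector_def)
  then show ?thesis
    using act_zero[OF unit_vector_closed] f c_closed[OF unit_vector_closed]
    by (auto simp: unit_vector_def[of n n] a_minus_def elim!: oddE)
qed

lemma unit_vector_double: "unit_vector (2 * k) = (\<lambda>s. if odd s then \<zero> else unit_vector k (s div 2))"
  by (auto simp: unit_vector_def fun_eq_iff elim!: evenE)

text \<open>At its own stage, generator \<open>j\<close> sets the lowest digit; each of the
  \<open>n - 1 - j\<close> later stages shifts the digits by one place.\<close>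

lemma act_vacuum: "j < n \<Longrightarrow> act n (unit_vector j) (unit_vector 0) = unit_vector (2 ^ (n - 1 - j))"
proof (induction n)
  case 0
  then show ?case by simp
next
  case (Suc n)
  note z = unit_vector_double[of 0, simplified]
  show ?case
  proof (cases "j = n")
    case True
    have "act (Suc n) (unit_vector n) (unit_vector 0) s = unit_vector 1 s" for s
      by (subst z, subst act_unit_vector_last) (auto simp: unit_vector_closed, auto simp: unit_vector_def elim!: oddE)
    then show ?thesis using True by auto
  next
    case False
    then have j: "j < n" "Suc n - 1 - j = Suc (n - 1 - j)" using Suc.prems by auto
    have "act (Suc n) (unit_vector j) (unit_vector 0) s = unit_vector (2 * 2 ^ (n - 1 - j)) s" for s
      unfolding unit_vector_double[of "2 ^ (n - 1 - j)"]
      by (subst z, subst act_unit_vector_less[OF j(1)]) (auto simp: unit_vector_closed Suc.IH[OF j(1)])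
    then show ?thesis using j(2) by auto
  qed
qed

text \<open>When \<open>j\<close> enters, the vector created by \<open>i < j\<close> still lies in
  the first copy. Neither the sign of the lower right block nor the contraction entry
  \<open>c\<close> is met, so the result is a single basis vector.\<close>

lemma act_act_vacuum:
  "i < j \<Longrightarrow> j < n \<Longrightarrow> act n (unit_vector j) (unit_vector (2 ^ (n - 1 - i))) =
    unit_vector (2 ^ (n - 1 - i) + 2 ^ (n - 1 - j))"
proof (induction n)
  case 0
  then show ?case by simp
next
  case (Suc n)
  have i: "i < n" "2 ^ (Suc n - 1 - i) = 2 * (2 ^ (n - 1 - i) :: nat)"
    using Suc.prems by (auto simp: Suc_diff_Suc power_Suc[symmetric] simp del: power_Suc)
  show ?case
  proof (cases "j = n")
    case True
    have "act (Suc n) (unit_vector n) (unit_vector (2 * 2 ^ (n - 1 - i))) s =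
        unit_vector (Suc (2 * 2 ^ (n - 1 - i))) s" for s
      unfolding unit_vector_double
      by (subst act_unit_vector_last) (auto simp: unit_vector_closed, auto simp: unit_vector_def elim!: oddE)
    then show ?thesis using True i(2) by auto
  next
    case False
    then have j: "j < n" "2 ^ (Suc n - 1 - j) = 2 * (2 ^ (n - 1 - j) :: nat)"
      using Suc.prems by (auto simp: Suc_diff_Suc power_Suc[symmetric] simp del: power_Suc)
    have "act (Suc n) (unit_vector j) (unit_vector (2 * 2 ^ (n - 1 - i))) s =
        unit_vector (2 * (2 ^ (n - 1 - i) + 2 ^ (n - 1 - j))) s" for s
      unfolding unit_vector_double
      by (subst act_unit_vector_less[OF j(1)])
        (auto simp: unit_vector_closed Suc.IH[OF Suc.prems(1) j(1), simplified])
    then show ?thesis unfolding i(2) j(2) by (auto simp: distrib_left)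
  qed
qed

lemma act_linear_map:
  assumes a: "\<And>i. a i \<in> carrier R"
  shows "linear_map R (function_module R) (function_module R) (act n a)"
  unfolding linear_map_def using a
  by (auto simp: function_module_simps act_closed act_add act_smult)

end

section \<open>Even Clifford algebras of rank four\<close>

text \<open>The dual basis. The functionals are indexed by all natural numbers, those from
  \<open>n\<close> on vanishing on the basis, because \<open>act\<close> takes coefficients defined
  at every index.\<close>

lemma (in module) exists_coordinates:
  assumes e: "is_basis R M n e"
  shows "\<exists>k. (\<forall>j. linear_map R M (regular_module R) (k j)) \<and>
    (\<forall>i<n. \<forall>j. k j (e i) = (if i = j then \<one> else \<zero>)) \<and>
    (\<forall>v\<in>carrier M. v = (\<Oplus>\<^bsub>M\<^esub>j\<in>{..<n}. k j v \<odot>\<^bsub>M\<^esub> e j))"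
proof -
  note eM = is_basisD(1)[OF e]
  have "\<exists>f. linear_map R M (regular_module R) f \<and> (\<forall>i<n. f (e i) = (if i = j then \<one> else \<zero>))" for j
    by (rule exists_linear_map[OF e]) auto
  then have "\<forall>j. \<exists>f. linear_map R M (regular_module R) f \<and> (\<forall>i<n. f (e i) = (if i = j then \<one> else \<zero>))" by blast
  from choice[OF this] obtain k where k: "\<forall>j. linear_map R M (regular_module R) (k j) \<and>
    (\<forall>i<n. k j (e i) = (if i = j then \<one> else \<zero>))" ..
  then have lin: "linear_map R M (regular_module R) (k j)" for j by blast
  have "v = (\<Oplus>\<^bsub>M\<^esub>j\<in>{..<n}. k j v \<odot>\<^bsub>M\<^esub> e j)" if v: "v \<in> carrier M" for v
  proof -
    obtain c where c: "c \<in> {..<n} \<rightarrow> carrier R" "v = (\<Oplus>\<^bsub>M\<^esub>i\<in>{..<n}. c i \<odot>\<^bsub>M\<^esub> e i)"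
      using is_basisD(2)[OF e v] by (elim bexE)
    have "k j v = c j" if j: "j < n" for j
    proof -
      have "k j v = (\<Oplus>i\<in>{..<n}. c i \<otimes> k j (e i))"
        unfolding c(2) using c(1) eM by (intro linear_map_lincomb[OF lin]) auto
      also have "\<dots> = (\<Oplus>i\<in>{..<n}. if j = i then c i else \<zero>)"
        using k c(1) by (intro R.finsum_cong') (auto simp: Pi_iff)
      also have "\<dots> = c j" using c(1) j by (intro R.finsum_singleton) auto
      finally show ?thesis .
    qed
    then have "(\<Oplus>\<^bsub>M\<^esub>j\<in>{..<n}. k j v \<odot>\<^bsub>M\<^esub> e j) = (\<Oplus>\<^bsub>M\<^esub>j\<in>{..<n}. c j \<odot>\<^bsub>M\<^esub> e j)"
      using c(1) eM by (intro M.finsum_cong') (auto simp: Pi_iff)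
    then show ?thesis using c(2) by simp
  qed
  with k show ?thesis by blast
qed

locale based_clifford_data = clifford_data R V L l0 \<kappa> Q
  for R :: "('r, 'm) ring_scheme" and V :: "('r, 'v, 'n) module_scheme"
    and L :: "('r, 'l, 'o) module_scheme" and l0 \<kappa> Q +
  fixes n :: nat and e :: "nat \<Rightarrow> 'v"
  assumes basis: "is_basis R V n e"
begin

lemma e_closed: "i < n \<Longrightarrow> e i \<in> carrier V"
  using V.V.is_basisD(1)[OF basis] by auto

lemma q_simps:
  assumes "v \<in> carrier V"
  shows "\<And>w w'. w \<in> carrier V \<Longrightarrow> w' \<in> carrier V \<Longrightarrow> q v (w \<oplus>\<^bsub>V\<^esub> w') = q v w \<oplus>\<^bsub>R\<^esub> q v w'"
    and "\<And>w w'. w \<in> carrier V \<Longrightarrow> w' \<in> carrier V \<Longrightarrow> q (w \<oplus>\<^bsub>V\<^esub> w') v = q w v \<oplus>\<^bsub>R\<^esub> q w' v"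
    and "\<And>r w. r \<in> carrier R \<Longrightarrow> w \<in> carrier V \<Longrightarrow> q v (r \<odot>\<^bsub>V\<^esub> w) = r \<otimes>\<^bsub>R\<^esub> q v w"
    and "\<And>r w. r \<in> carrier R \<Longrightarrow> w \<in> carrier V \<Longrightarrow> q (r \<odot>\<^bsub>V\<^esub> w) v = r \<otimes>\<^bsub>R\<^esub> q w v"
    and "q v \<zero>\<^bsub>V\<^esub> = \<zero>\<^bsub>R\<^esub>" "q \<zero>\<^bsub>V\<^esub> v = \<zero>\<^bsub>R\<^esub>"
proof -
  have l: "\<And>w w'. w \<in> carrier V \<Longrightarrow> w' \<in> carrier V \<Longrightarrow> q v (w \<oplus>\<^bsub>V\<^esub> w') = q v w \<oplus>\<^bsub>R\<^esub> q v w'"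
    "\<And>r w. r \<in> carrier R \<Longrightarrow> w \<in> carrier V \<Longrightarrow> q v (r \<odot>\<^bsub>V\<^esub> w) = r \<otimes>\<^bsub>R\<^esub> q v w"
    using q_linear[OF assms] unfolding linear_map_regular_iff by blast+
  note s = q_sym[OF _ assms]
  show "\<And>w w'. w \<in> carrier V \<Longrightarrow> w' \<in> carrier V \<Longrightarrow> q v (w \<oplus>\<^bsub>V\<^esub> w') = q v w \<oplus>\<^bsub>R\<^esub> q v w'" by (rule l)
  show "\<And>r w. r \<in> carrier R \<Longrightarrow> w \<in> carrier V \<Longrightarrow> q v (r \<odot>\<^bsub>V\<^esub> w) = r \<otimes>\<^bsub>R\<^esub> q v w" by (rule l)
  show "\<And>w w'. w \<in> carrier V \<Longrightarrow> w' \<in> carrier V \<Longrightarrow> q (w \<oplus>\<^bsub>V\<^esub> w') v = q w v \<oplus>\<^bsub>R\<^esub> q w' v" by (simp add: s l)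
  show "\<And>r w. r \<in> carrier R \<Longrightarrow> w \<in> carrier V \<Longrightarrow> q (r \<odot>\<^bsub>V\<^esub> w) v = r \<otimes>\<^bsub>R\<^esub> q w v" by (simp add: s l)
  have "q v (\<zero>\<^bsub>R\<^esub> \<odot>\<^bsub>V\<^esub> \<zero>\<^bsub>V\<^esub>) = \<zero>\<^bsub>R\<^esub> \<otimes>\<^bsub>R\<^esub> q v \<zero>\<^bsub>V\<^esub>" by (rule l) auto
  then show z: "q v \<zero>\<^bsub>V\<^esub> = \<zero>\<^bsub>R\<^esub>" using q_closed[OF assms V.V.M.zero_closed] by simp
  show "q \<zero>\<^bsub>V\<^esub> v = \<zero>\<^bsub>R\<^esub>" using z s by simp
qed

definition vec :: "nat \<Rightarrow> (nat \<Rightarrow> 'r) \<Rightarrow> 'v" where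
  "vec m a = (\<Oplus>\<^bsub>V\<^esub>i\<in>{..<m}. a i \<odot>\<^bsub>V\<^esub> e i)"

text \<open>With \<open>v = vec m a\<close>, adding \<open>a m\<close> times \<open>e m\<close> to
  \<open>v\<close> changes the value of the form by \<open>a m\<close> times this expression. It is
  the linear factor of the triangular expansion. The value 0 for \<open>m \<ge> n\<close>, where no
  \<open>e m\<close> exists, makes the assumptions of \<open>clifford_action\<close> hold at every
  index.\<close>

definition last_pairing :: "nat \<Rightarrow> (nat \<Rightarrow> 'r) \<Rightarrow> 'r" where
  "last_pairing m a = (if m < n then (q (vec m a) (e m) \<oplus>\<^bsub>R\<^esub> q (vec m a) (e m)) \<oplus>\<^bsub>R\<^esub> a m \<otimes>\<^bsub>R\<^esub> q (e m) (e m)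
     else \<zero>\<^bsub>R\<^esub>)"

lemma vec_closed: "(\<And>i. a i \<in> carrier R) \<Longrightarrow> m \<le> n \<Longrightarrow> vec m a \<in> carrier V"
  unfolding vec_def by (rule V.V.lincomb_closed) (auto simp: e_closed)

lemma vec_Suc:
  assumes "\<And>i. a i \<in> carrier R" "m < n"
  shows "vec (Suc m) a = vec m a \<oplus>\<^bsub>V\<^esub> a m \<odot>\<^bsub>V\<^esub> e m"
  unfolding vec_def lessThan_Suc using assms
  by (subst V.V.M.finsum_insert) (auto simp: e_closed V.V.M.a_comm intro!: V.V.lincomb_closed)

sublocale act: clifford_action R last_pairing
proof
  fix a b :: "nat \<Rightarrow> 'r" and m r
  assume a: "\<And>i. a i \<in> carrier R"
  have va: "vec m a \<in> carrier V" if "m < n" using vec_closed a that by simp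
  show "last_pairing m a \<in> carrier R"
    using a va by (simp add: last_pairing_def q_closed e_closed)
  show "last_pairing m a = \<zero>\<^bsub>R\<^esub>" if "\<And>i. i \<le> m \<Longrightarrow> a i = \<zero>\<^bsub>R\<^esub>"
  proof (cases "m < n")
    case True
    have "vec m a = \<zero>\<^bsub>V\<^esub>"
      unfolding vec_def using that True by (intro V.V.lincomb_zero) (auto simp: e_closed)
    then show ?thesis using that True by (simp add: last_pairing_def q_simps e_closed q_closed)
  qed (simp add: last_pairing_def)
  {
    assume b: "\<And>i. b i \<in> carrier R"
    have "vec m (\<lambda>i. a i \<oplus>\<^bsub>R\<^esub> b i) = vec m a \<oplus>\<^bsub>V\<^esub> vec m b" if "m < n"
      unfolding vec_def using a b that by (intro V.V.lincomb_add) (auto simp: e_closed)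
    moreover have "(x \<oplus>\<^bsub>R\<^esub> y \<oplus>\<^bsub>R\<^esub> (x \<oplus>\<^bsub>R\<^esub> y)) \<oplus>\<^bsub>R\<^esub> (z \<oplus>\<^bsub>R\<^esub> w) \<otimes>\<^bsub>R\<^esub> u = (x \<oplus>\<^bsub>R\<^esub> x \<oplus>\<^bsub>R\<^esub> z \<otimes>\<^bsub>R\<^esub> u) \<oplus>\<^bsub>R\<^esub> (y \<oplus>\<^bsub>R\<^esub> y \<oplus>\<^bsub>R\<^esub> w \<otimes>\<^bsub>R\<^esub> u)"
      if "x \<in> carrier R" "y \<in> carrier R" "z \<in> carrier R" "w \<in> carrier R" "u \<in> carrier R" for x y z w u
      using that by (simp add: V.V.R.a_ac V.V.R.l_distr)
    ultimately show "last_pairing m (\<lambda>i. a i \<oplus>\<^bsub>R\<^esub> b i) = last_pairing m a \<oplus>\<^bsub>R\<^esub> last_pairing m b"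
      using a b va vec_closed[OF b, of m] by (simp add: last_pairing_def q_simps e_closed q_closed)
  }
  assume r: "r \<in> carrier R"
  have "vec m (\<lambda>i. r \<otimes>\<^bsub>R\<^esub> a i) = r \<odot>\<^bsub>V\<^esub> vec m a" if "m < n"
    unfolding vec_def using a r that by (intro V.V.lincomb_smult) (auto simp: e_closed)
  then show "last_pairing m (\<lambda>i. r \<otimes>\<^bsub>R\<^esub> a i) = r \<otimes>\<^bsub>R\<^esub> last_pairing m a"
    using a r va by (simp add: last_pairing_def q_simps e_closed q_closed V.V.R.r_distr V.V.R.m_assoc)
qed

text \<open>The increments described by \<open>last_pairing\<close> add up to the quadratic form on
  \<open>vec m a\<close>; polarised, they add up to twice the bilinear form. The induction step
  expands \<open>q\<close> in the last basis vector on both sides.\<close>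

lemma polarization_eq:
  assumes a: "\<And>i. a i \<in> carrier R" and b: "\<And>i. b i \<in> carrier R" and "m \<le> n"
  shows "act.polarization m a b = q (vec m a) (vec m b) \<oplus>\<^bsub>R\<^esub> q (vec m a) (vec m b)"
  using assms(3)
proof (induction m)
  case 0
  then show ?case by (simp add: vec_def q_simps)
next
  case (Suc m)
  then have m: "m < n" by simp
  have v: "vec m a \<in> carrier V" "vec m b \<in> carrier V" "e m \<in> carrier V"
    using vec_closed a b m e_closed by auto
  define x y z u where "x = q (vec m a) (vec m b)" and "y = q (vec m a) (e m)" and "z = q (vec m b) (e m)"
    and "u = q (e m) (e m)"
  have c: "x \<in> carrier R" "y \<in> carrier R" "z \<in> carrier R" "u \<in> carrier R"
    using v q_closed by (auto simp: x_def y_def z_def u_def)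
  have ez: "q (e m) (vec m b) = z" using v q_sym by (simp add: z_def)
  have "q (vec (Suc m) a) (vec (Suc m) b) = (x \<oplus>\<^bsub>R\<^esub> b m \<otimes>\<^bsub>R\<^esub> y) \<oplus>\<^bsub>R\<^esub> (a m \<otimes>\<^bsub>R\<^esub> z \<oplus>\<^bsub>R\<^esub> b m \<otimes>\<^bsub>R\<^esub> (a m \<otimes>\<^bsub>R\<^esub> u))"
    unfolding vec_Suc[OF a m] vec_Suc[OF b m] using v a b q_closed
    by (simp add: q_simps ez x_def[symmetric] y_def[symmetric] u_def[symmetric] V.V.R.a_ac)
      (simp add: V.V.R.r_distr V.V.R.a_ac c)
  moreover have "x \<oplus>\<^bsub>R\<^esub> x \<oplus>\<^bsub>R\<^esub> (((y \<oplus>\<^bsub>R\<^esub> y) \<oplus>\<^bsub>R\<^esub> s \<otimes>\<^bsub>R\<^esub> u) \<otimes>\<^bsub>R\<^esub> t \<oplus>\<^bsub>R\<^esub> ((z \<oplus>\<^bsub>R\<^esub> z) \<oplus>\<^bsub>R\<^esub> t \<otimes>\<^bsub>R\<^esub> u) \<otimes>\<^bsub>R\<^esub> s) =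
      ((x \<oplus>\<^bsub>R\<^esub> t \<otimes>\<^bsub>R\<^esub> y) \<oplus>\<^bsub>R\<^esub> (s \<otimes>\<^bsub>R\<^esub> z \<oplus>\<^bsub>R\<^esub> t \<otimes>\<^bsub>R\<^esub> (s \<otimes>\<^bsub>R\<^esub> u))) \<oplus>\<^bsub>R\<^esub> ((x \<oplus>\<^bsub>R\<^esub> t \<otimes>\<^bsub>R\<^esub> y) \<oplus>\<^bsub>R\<^esub> (s \<otimes>\<^bsub>R\<^esub> z \<oplus>\<^bsub>R\<^esub> t \<otimes>\<^bsub>R\<^esub> (s \<otimes>\<^bsub>R\<^esub> u)))"
    if "s \<in> carrier R" "t \<in> carrier R" for s t
    using that c by (simp add: V.V.R.l_distr V.V.R.r_distr V.V.R.a_ac V.V.R.m_ac)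
  moreover have "act.polarization m a b = x \<oplus>\<^bsub>R\<^esub> x" using Suc m by (simp add: x_def)
  moreover have "last_pairing m a = (y \<oplus>\<^bsub>R\<^esub> y) \<oplus>\<^bsub>R\<^esub> a m \<otimes>\<^bsub>R\<^esub> u" "last_pairing m b = (z \<oplus>\<^bsub>R\<^esub> z) \<oplus>\<^bsub>R\<^esub> b m \<otimes>\<^bsub>R\<^esub> u"
    using m by (simp_all add: last_pairing_def y_def z_def u_def)
  ultimately show ?case
    using a b by (simp only: act.polarization.simps)
qed

abbreviation Fock where "Fock \<equiv> function_module R"

sublocale Fock: module R "function_module R" by (rule module_function_module[OF V.V.R.is_cring])

text \<open>A vector acts through its coordinates. By \<open>act_clifford\<close> the anticommutator
  is multiplication by the polarisation, which \<open>polarization_eq\<close> identifies with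
  \<open>2 q v w\<close>.\<close>

lemma exists_representation:
  "\<exists>\<rho>. linear_map R V (endomorphism_algebra R Fock) \<rho> \<and>
    (\<forall>v\<in>carrier V. \<forall>w\<in>carrier V. \<rho> v \<otimes>\<^bsub>endomorphism_algebra R Fock\<^esub> \<rho> w \<oplus>\<^bsub>endomorphism_algebra R Fock\<^esub>
      \<rho> w \<otimes>\<^bsub>endomorphism_algebra R Fock\<^esub> \<rho> v =
      (q v w \<oplus>\<^bsub>R\<^esub> q v w) \<odot>\<^bsub>endomorphism_algebra R Fock\<^esub> \<one>\<^bsub>endomorphism_algebra R Fock\<^esub>) \<and>
    (\<forall>j<n. \<forall>f\<in>carrier Fock. \<rho> (e j) f = act.act n (act.unit_vector j) f)"
proof -
  obtain k where k: "\<forall>j. linear_map R V (regular_module R) (k j)"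
    "\<forall>i<n. \<forall>j. k j (e i) = (if i = j then \<one>\<^bsub>R\<^esub> else \<zero>\<^bsub>R\<^esub>)"
    "\<forall>v\<in>carrier V. v = (\<Oplus>\<^bsub>V\<^esub>j\<in>{..<n}. k j v \<odot>\<^bsub>V\<^esub> e j)"
    using V.V.exists_coordinates[OF basis] by (elim exE conjE)
  have kc: "k j v \<in> carrier R" if "v \<in> carrier V" for j v
    using k(1) that by (auto simp: linear_map_regular_iff)
  have ka: "k j (v \<oplus>\<^bsub>V\<^esub> w) = k j v \<oplus>\<^bsub>R\<^esub> k j w" if "v \<in> carrier V" "w \<in> carrier V" for j v w
    using k(1) that by (auto simp: linear_map_regular_iff)
  have km: "k j (r \<odot>\<^bsub>V\<^esub> v) = r \<otimes>\<^bsub>R\<^esub> k j v" if "v \<in> carrier V" "r \<in> carrier R" for j v r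
    using k(1) that by (auto simp: linear_map_regular_iff)
  have kv: "vec n (\<lambda>j. k j v) = v" if "v \<in> carrier V" for v
    using k(3) that unfolding vec_def by simp
  define \<rho> where "\<rho> = (\<lambda>v. restrict (act.act n (\<lambda>j. k j v)) (carrier Fock))"
  have \<rho>c: "\<rho> v \<in> carrier Fock.End" if "v \<in> carrier V" for v
    unfolding \<rho>_def by (rule Fock.End_I[OF act.act_linear_map]) (rule kc[OF that])
  have \<rho>f: "\<rho> v f = act.act n (\<lambda>j. k j v) f" if "f \<in> carrier Fock" for v f
    using that by (simp add: \<rho>_def)
  note F = function_module_simps
  have "linear_map R V Fock.End \<rho>"
    unfolding linear_map_def
  proof (intro conjI ballI)
    show "\<rho> \<in> carrier V \<rightarrow> carrier Fock.End" using \<rho>c by auto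
    fix v w assume v: "v \<in> carrier V" and w: "w \<in> carrier V"
    show "\<rho> (v \<oplus>\<^bsub>V\<^esub> w) = \<rho> v \<oplus>\<^bsub>Fock.End\<^esub> \<rho> w"
    proof (rule Fock.End_eqI)
      fix f assume f: "f \<in> carrier Fock"
      show "\<rho> (v \<oplus>\<^bsub>V\<^esub> w) f = (\<rho> v \<oplus>\<^bsub>Fock.End\<^esub> \<rho> w) f"
        using v w f by (auto simp: \<rho>f Fock.End_eval F ka kc act.act_add_vector)
    qed (use v w \<rho>c in \<open>auto intro!: Fock.End_closed\<close>)
  next
    fix r v assume r: "r \<in> carrier R" and v: "v \<in> carrier V"
    show "\<rho> (r \<odot>\<^bsub>V\<^esub> v) = r \<odot>\<^bsub>Fock.End\<^esub> \<rho> v"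
    proof (rule Fock.End_eqI)
      fix f assume f: "f \<in> carrier Fock"
      show "\<rho> (r \<odot>\<^bsub>V\<^esub> v) f = (r \<odot>\<^bsub>Fock.End\<^esub> \<rho> v) f"
        using v r f by (auto simp: \<rho>f Fock.End_eval F km kc act.act_smult_vector)
    qed (use v r \<rho>c in \<open>auto intro!: Fock.End_closed\<close>)
  qed
  moreover have "\<rho> v \<otimes>\<^bsub>Fock.End\<^esub> \<rho> w \<oplus>\<^bsub>Fock.End\<^esub> \<rho> w \<otimes>\<^bsub>Fock.End\<^esub> \<rho> v =
      (q v w \<oplus>\<^bsub>R\<^esub> q v w) \<odot>\<^bsub>Fock.End\<^esub> \<one>\<^bsub>Fock.End\<^esub>" if v: "v \<in> carrier V" and w: "w \<in> carrier V" for v w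
  proof (rule Fock.End_eqI)
    fix f assume f: "f \<in> carrier Fock"
    have cl: "act.act n (\<lambda>j. k j v) f \<in> carrier Fock" "act.act n (\<lambda>j. k j w) f \<in> carrier Fock"
      using f v w kc by (auto simp: F act.act_closed)
    have "act.act n (\<lambda>j. k j v) (act.act n (\<lambda>j. k j w) f) s \<oplus>\<^bsub>R\<^esub> act.act n (\<lambda>j. k j w) (act.act n (\<lambda>j. k j v) f) s =
      (q v w \<oplus>\<^bsub>R\<^esub> q v w) \<otimes>\<^bsub>R\<^esub> f s" for s
      using act.act_clifford[of "\<lambda>j. k j v" "\<lambda>j. k j w" f n s] polarization_eq[of "\<lambda>j. k j v" "\<lambda>j. k j w" n]
        f v w kc by (simp add: F kv)
    then show "(\<rho> v \<otimes>\<^bsub>Fock.End\<^esub> \<rho> w \<oplus>\<^bsub>Fock.End\<^esub> \<rho> w \<otimes>\<^bsub>Fock.End\<^esub> \<rho> v) f =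
        ((q v w \<oplus>\<^bsub>R\<^esub> q v w) \<odot>\<^bsub>Fock.End\<^esub> \<one>\<^bsub>Fock.End\<^esub>) f"
      using f cl by (simp add: Fock.End_eval \<rho>f F(3,4))
  qed (use v w \<rho>c q_closed in \<open>auto intro!: Fock.End_closed\<close>)
  moreover have "\<rho> (e j) f = act.act n (act.unit_vector j) f" if "j < n" "f \<in> carrier Fock" for j f
  proof -
    have "(\<lambda>i. k i (e j)) = act.unit_vector j" using k(2) that by (auto simp: act.unit_vector_def)
    then show ?thesis using \<rho>f[OF that(2), of "e j"] by simp
  qed
  ultimately show ?thesis by blast
qed

text \<open>Applied to the vacuum, the monomials \<open>1\<close> and \<open>e\<^sub>j e\<^sub>i\<close> with \<open>i < j\<close> give distinct basis
  vectors of the representation.\<close>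

lemma exists_functionals:
  "\<exists>\<phi>. (\<forall>s. linear_map R C (regular_module R) (\<phi> s)) \<and> (\<forall>s. \<phi> s \<one>\<^bsub>C\<^esub> = act.unit_vector 0 s) \<and>
    (\<forall>i j s. i < j \<longrightarrow> j < n \<longrightarrow> \<phi> s (P (e j) (e i)) = act.unit_vector (2 ^ (n - 1 - i) + 2 ^ (n - 1 - j)) s)"
proof -
  obtain \<rho> where \<rho>: "linear_map R V Fock.End \<rho>"
    "\<forall>v\<in>carrier V. \<forall>w\<in>carrier V. \<rho> v \<otimes>\<^bsub>Fock.End\<^esub> \<rho> w \<oplus>\<^bsub>Fock.End\<^esub> \<rho> w \<otimes>\<^bsub>Fock.End\<^esub> \<rho> v =
      (q v w \<oplus>\<^bsub>R\<^esub> q v w) \<odot>\<^bsub>Fock.End\<^esub> \<one>\<^bsub>Fock.End\<^esub>"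
    "\<forall>j<n. \<forall>f\<in>carrier Fock. \<rho> (e j) f = act.act n (act.unit_vector j) f"
    using exists_representation by (elim exE conjE)
  obtain h where h: "alg_hom R C Fock.End h"
    "\<forall>v\<in>carrier V. \<forall>w\<in>carrier V. h (P v w) = \<rho> v \<otimes>\<^bsub>Fock.End\<^esub> \<rho> w"
    using clifford_lift[OF Fock.assoc_alg_End \<rho>(1)] \<rho>(2) by blast
  let ?\<Omega> = "act.unit_vector 0"
  have u: "act.unit_vector i \<in> carrier Fock" for i by (simp add: function_module_simps act.unit_vector_closed)
  note hD = alg_homD[OF h(1)]
  \<comment> \<open>The functional with index \<open>s\<close> reads off the coefficient at
    \<open>s\<close> of the image of the vacuum.\<close>
  show ?thesis
  proof (intro exI[of _ "\<lambda>s x. h x ?\<Omega> s"] conjI allI impI)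
    show "linear_map R C (regular_module R) (\<lambda>x. h x ?\<Omega> s)" for s
      unfolding linear_map_regular_iff
      using hD(2) Fock.End_apply(1)[OF hD(2) u]
      by (auto simp: hD(4,6) Fock.End_eval[OF u] function_module_simps)
    show "h \<one>\<^bsub>C\<^esub> ?\<Omega> s = ?\<Omega> s" for s unfolding hD(5) by (simp add: Fock.End_eval[OF u])
    fix i j s assume ij: "i < j" "j < n"
    have "h (P (e j) (e i)) ?\<Omega> = \<rho> (e j) (\<rho> (e i) ?\<Omega>)"
      using h(2) ij by (simp add: e_closed Fock.End_eval[OF u])
    also have "\<dots> = act.unit_vector (2 ^ (n - 1 - i) + 2 ^ (n - 1 - j))"
      using \<rho>(3) ij u act.act_vacuum[of i n] act.act_act_vacuum[OF ij] by simp
    finally show "h (P (e j) (e i)) ?\<Omega> s = act.unit_vector (2 ^ (n - 1 - i) + 2 ^ (n - 1 - j)) s" by simp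
  qed
qed

end

text \<open>\<open>h\<close> is an isomorphism onto the even part, regarded as a map into the whole Clifford algebra.\<close>

locale even_clifford_iso = based_clifford_data R V L l0 \<kappa> Q n e + A: assoc_alg R A
  for R :: "('r, 'm) ring_scheme" and V :: "('r, 'v, 'n) module_scheme"
    and L :: "('r, 'l, 'o) module_scheme" and l0 \<kappa> Q n e and A :: "('r, 'a, 'p) module_scheme" +
  fixes h
  assumes h: "alg_hom R A C h" and h_inj: "inj_on h (carrier A)"
    and h_image: "h ` carrier A = clifford_part R V L Q 0"
begin

definition pre :: "('r, 'v, 'l) clifford_ambient set \<Rightarrow> 'a" where
  "pre = inv_into (carrier A) h"

lemma pre:
  assumes "x \<in> clifford_part R V L Q 0"
  shows "pre x \<in> carrier A" "h (pre x) = x"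
  using assms inv_into_into[of x h "carrier A"] f_inv_into_f[of x h "carrier A"]
  unfolding h_image[symmetric] pre_def by blast+

lemma h_eqI: "x \<in> carrier A \<Longrightarrow> y \<in> carrier A \<Longrightarrow> h x = h y \<Longrightarrow> x = y"
  using h_inj by (auto dest: inj_onD)

lemma rank_gt_3_contradiction:
  assumes "domain R" "free_of_rank R A 4" "n \<ge> 4"
  shows False
proof -
  interpret domain R by fact
  obtain f where f: "is_basis R A 4 f" using assms(2) by (auto simp: free_of_rank_def)
  obtain \<phi> where \<phi>: "\<forall>s. linear_map R C (regular_module R) (\<phi> s)" "\<forall>s. \<phi> s \<one>\<^bsub>C\<^esub> = act.unit_vector 0 s"
    "\<forall>i j s. i < j \<longrightarrow> j < n \<longrightarrow> \<phi> s (P (e j) (e i)) = act.unit_vector (2 ^ (n - 1 - i) + 2 ^ (n - 1 - j)) s"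
    using exists_functionals by (elim exE conjE)
  \<comment> \<open>Four of the pairs of distinct indices below 4; with the unit, entered at
    \<open>t = 4\<close>, this gives five elements, one more than the rank.\<close>
  define I where "I = [(0 :: nat, 1 :: nat), (0, 2), (0, 3), (1, 2)]"
  define x where "x = (\<lambda>t :: nat. if t = 4 then \<one>\<^bsub>A\<^esub> else pre (P (e (snd (I ! t))) (e (fst (I ! t)))))"
  define N where "N = (\<lambda>t :: nat. if t = 4 then 0 else (2::nat) ^ (n - 1 - fst (I ! t)) + 2 ^ (n - 1 - snd (I ! t)))"
  have I: "fst (I ! t) < snd (I ! t)" "snd (I ! t) < n" if "t \<in> {..<5}" "t \<noteq> 4" for t
  proof -
    have "t = 0 \<or> t = 1 \<or> t = 2 \<or> t = 3" using that by auto
    then show "fst (I ! t) < snd (I ! t)" "snd (I ! t) < n" using assms(3) by (auto simp: I_def)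
  qed
  have Pp: "P (e (snd (I ! t))) (e (fst (I ! t))) \<in> clifford_part R V L Q 0" if "t \<in> {..<5}" "t \<noteq> 4" for t
    using I[OF that] by (intro P_in_part e_closed) auto
  have xA: "x t \<in> carrier A" if "t \<in> {..<5}" for t
    using pre(1)[OF Pp[OF that]] by (auto simp: x_def)
  have "\<phi> s (h (x t)) = act.unit_vector (N t) s" if "t \<in> {..<5}" for s t
    using \<phi>(2,3) I[OF that] pre(2)[OF Pp[OF that]] alg_homD(5)[OF h] by (auto simp: x_def N_def)
  moreover have "N t = N t' \<longleftrightarrow> t = t'" if "t \<in> {..<5}" "t' \<in> {..<5}" for t t'
  proof -
    obtain m where m: "n = m + 4" using assms(3) by (metis add.commute le_Suc_ex)
    define k :: nat where "k = 2 ^ m"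
    have k: "k > 0" by (simp add: k_def)
    \<comment> \<open>With \<open>n = m + 4\<close> the first four generators correspond to the
      digits of weight \<open>8 k\<close>, \<open>4 k\<close>, \<open>2 k\<close> and
      \<open>k\<close>, so each pair has its own sum.\<close>
    have N: "N 0 = 12 * k" "N 1 = 10 * k" "N 2 = 9 * k" "N 3 = 6 * k" "N 4 = 0"
      by (simp_all add: N_def I_def m k_def power_add numeral_nat)
    have "t = 0 \<or> t = 1 \<or> t = 2 \<or> t = 3 \<or> t = 4" "t' = 0 \<or> t' = 1 \<or> t' = 2 \<or> t' = 3 \<or> t' = 4"
      using that by auto
    then show ?thesis using k N by (elim disjE) simp_all
  qed
  \<comment> \<open>The functionals are dual to the five elements; applied to a linear relation they
    show that every coefficient is 0.\<close>
  ultimately have \<phi>x: "\<phi> (N t) (h (x t')) = (if t = t' then \<one>\<^bsub>R\<^esub> else \<zero>\<^bsub>R\<^esub>)" if "t \<in> {..<5}" "t' \<in> {..<5}" for t t'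
    using that by (simp add: act.unit_vector_def)
  have "\<exists>c\<in>{..<5::nat} \<rightarrow> carrier R. (\<exists>t\<in>{..<5}. c t \<noteq> \<zero>\<^bsub>R\<^esub>) \<and> (\<Oplus>\<^bsub>A\<^esub>t\<in>{..<5}. c t \<odot>\<^bsub>A\<^esub> x t) = \<zero>\<^bsub>A\<^esub>"
    by (rule A.exists_linear_relation_basis[OF assms(1) f]) (use xA in auto)
  then obtain c where c1: "c \<in> {..<5::nat} \<rightarrow> carrier R" and
    c2: "(\<exists>t\<in>{..<5}. c t \<noteq> \<zero>\<^bsub>R\<^esub>) \<and> (\<Oplus>\<^bsub>A\<^esub>t\<in>{..<5}. c t \<odot>\<^bsub>A\<^esub> x t) = \<zero>\<^bsub>A\<^esub>"
    by (rule bexE)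
  have "c t = \<zero>\<^bsub>R\<^esub>" if t: "t \<in> {..<5}" for t
  proof -
    have lin: "linear_map R A (regular_module R) (\<lambda>a. \<phi> (N t) (h a))"
      by (rule linear_map_compose[OF alg_hom_linear[OF h]]) (use \<phi>(1) in blast)
    have "\<phi> (N t) (h (\<Oplus>\<^bsub>A\<^esub>t\<in>{..<5}. c t \<odot>\<^bsub>A\<^esub> x t)) = (\<Oplus>\<^bsub>R\<^esub>t'\<in>{..<5}. c t' \<otimes>\<^bsub>R\<^esub> \<phi> (N t) (h (x t')))"
      by (rule A.linear_map_lincomb[OF lin]) (use c1 xA in auto)
    also have "\<dots> = (\<Oplus>\<^bsub>R\<^esub>t'\<in>{..<5}. if t = t' then c t' else \<zero>\<^bsub>R\<^esub>)"
      using c1 t by (intro V.V.R.finsum_cong') (auto simp: \<phi>x Pi_iff)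
    also have "\<dots> = c t" using c1 t by (intro V.V.R.finsum_singleton) auto
    finally have "\<phi> (N t) (h \<zero>\<^bsub>A\<^esub>) = c t" using c2 by simp
    moreover have "\<phi> (N t) (h \<zero>\<^bsub>A\<^esub>) = \<zero>\<^bsub>R\<^esub>"
      using A.linear_map_lincomb[OF lin, of "{}" "\<lambda>_. \<zero>\<^bsub>R\<^esub>" "\<lambda>_. \<zero>\<^bsub>A\<^esub>"] by simp
    ultimately show ?thesis by simp
  qed
  with c2 show False by blast
qed

section \<open>Forms in at most three variables\<close>

definition vector :: "nat \<Rightarrow> 'v" where
  "vector i = (if i < n then e i else \<zero>\<^bsub>V\<^esub>)"

lemma vector_closed: "vector i \<in> carrier V"
  by (simp add: vector_def e_closed)

text \<open>The relations hold for the elements \<open>P\<close> in the Clifford algebra and are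
  pulled back along the injective map \<open>h\<close>. For generation, the image of a stable
  submodule \<open>N\<close> is shown to contain the degree 0 part, through
  \<open>clifford_part_0_subset\<close>.\<close>

lemma ternary:
  assumes n: "n \<le> 3"
  shows "ternary_even_clifford R A (\<lambda>i j. pre (P (vector i) (vector j))) (\<lambda>i j. q (vector i) (vector j))"
proof -
  let ?p = "\<lambda>i j. pre (P (vector i) (vector j))" and ?q = "\<lambda>i j. q (vector i) (vector j)"
  note vc = vector_closed and hD = alg_homD[OF h]
  have p: "?p i j \<in> carrier A" "h (?p i j) = P (vector i) (vector j)" for i j
    using pre[OF P_in_part[OF vc vc]] by auto
  have gen: "carrier A \<subseteq> N" if N: "submodule N R A" and one: "\<one>\<^bsub>A\<^esub> \<in> N"
    and mult: "\<And>i j x. i < 3 \<Longrightarrow> j < 3 \<Longrightarrow> x \<in> N \<Longrightarrow> ?p i j \<otimes>\<^bsub>A\<^esub> x \<in> N" for N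
  proof -
    note NE = A.submoduleE[OF N] and Ns = submodule.smult_closed[OF N]
    have zeroN: "\<zero>\<^bsub>A\<^esub> \<in> N" using Ns[OF V.V.R.zero_closed one] by simp
    have hN: "submodule (h ` N) R C"
    proof (rule C.submoduleI')
      show "h ` N \<subseteq> carrier C" using NE(1) hD(2) by blast
      show "\<zero>\<^bsub>C\<^esub> \<in> h ` N" using zeroN alg_hom_zero[OF h A.A.ring_axioms C.A.ring_axioms] by (metis imageI)
    next
      fix x y assume "x \<in> h ` N" "y \<in> h ` N"
      then obtain a b where "a \<in> N" "b \<in> N" "x = h a" "y = h b" by blast
      then show "x \<oplus>\<^bsub>C\<^esub> y \<in> h ` N" using NE(1,5) hD(4)[of a b] by (metis imageI subsetD)
    next
      fix r x assume r: "r \<in> carrier R" "x \<in> h ` N"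
      then obtain a where "a \<in> N" "x = h a" by blast
      then show "r \<odot>\<^bsub>C\<^esub> x \<in> h ` N" using NE(1) Ns hD(6)[of r a] r by (metis imageI subsetD)
    qed
    note hE = C.submoduleE[OF hN] and hs = submodule.smult_closed[OF hN]
    have zero: "\<zero>\<^bsub>C\<^esub> \<in> h ` N" using hs[OF V.V.R.zero_closed imageI[OF one]] hD(2) by simp
    have 1: "P (e i) (e j) \<otimes>\<^bsub>C\<^esub> y \<in> h ` N" if ij: "i < n" "j < n" and y: "y \<in> h ` N" for i j y
    proof -
      obtain x where x: "x \<in> N" "y = h x" using y by blast
      have "h (?p i j \<otimes>\<^bsub>A\<^esub> x) = P (e i) (e j) \<otimes>\<^bsub>C\<^esub> y"
        using hD(3)[OF p(1)[of i j], of x] p(2)[of i j] x NE(1) ij by (simp add: vector_def subset_iff)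
      moreover have "?p i j \<otimes>\<^bsub>A\<^esub> x \<in> N" using mult ij n x by auto
      ultimately show ?thesis by (metis imageI)
    qed
    have span: "v \<in> S" if S: "submodule S R V" "\<And>i. i < n \<Longrightarrow> e i \<in> S" and v: "v \<in> carrier V" for v S
    proof -
      obtain c where c: "c \<in> {..<n} \<rightarrow> carrier R" "v = (\<Oplus>\<^bsub>V\<^esub>i\<in>{..<n}. c i \<odot>\<^bsub>V\<^esub> e i)"
        using V.V.is_basisD(2)[OF basis v] by (elim bexE)
      show ?thesis unfolding c(2) by (rule V.V.submodule_lincomb[OF S(1)]) (use c S in auto)
    qed
    \<comment> \<open>Stability is given only for products of basis vectors. The vectors
      \<open>u\<close> for which \<open>f u\<close> maps \<open>y\<close> into the image of
      \<open>N\<close> form a submodule, so the two arguments of \<open>P\<close> are freed one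
      after the other.\<close>
    have sub: "submodule {u \<in> carrier V. f u \<otimes>\<^bsub>C\<^esub> y \<in> h ` N} R V"
      if f: "linear_map R V C f" and y: "y \<in> h ` N" for f y
    proof (rule V.V.submoduleI')
      note l = linear_mapD[OF f]
      have yC: "y \<in> carrier C" using y hE(1) by blast
      have "f (\<zero>\<^bsub>R\<^esub> \<odot>\<^bsub>V\<^esub> \<zero>\<^bsub>V\<^esub>) = \<zero>\<^bsub>R\<^esub> \<odot>\<^bsub>C\<^esub> f \<zero>\<^bsub>V\<^esub>" by (rule l(3)) simp_all
      then have "f \<zero>\<^bsub>V\<^esub> = \<zero>\<^bsub>C\<^esub>" using l(1)[OF V.V.M.zero_closed] by simp
      then show "\<zero>\<^bsub>V\<^esub> \<in> {u \<in> carrier V. f u \<otimes>\<^bsub>C\<^esub> y \<in> h ` N}" using zero yC by simp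
      show "u \<oplus>\<^bsub>V\<^esub> u' \<in> {u \<in> carrier V. f u \<otimes>\<^bsub>C\<^esub> y \<in> h ` N}"
        if "u \<in> {u \<in> carrier V. f u \<otimes>\<^bsub>C\<^esub> y \<in> h ` N}" "u' \<in> {u \<in> carrier V. f u \<otimes>\<^bsub>C\<^esub> y \<in> h ` N}" for u u'
        using that hE(5) yC l by (simp add: C.A.l_distr)
      show "r \<odot>\<^bsub>V\<^esub> u \<in> {u \<in> carrier V. f u \<otimes>\<^bsub>C\<^esub> y \<in> h ` N}"
        if "r \<in> carrier R" "u \<in> {u \<in> carrier V. f u \<otimes>\<^bsub>C\<^esub> y \<in> h ` N}" for r u
        using that hs yC l by (simp add: C.smult_assoc_l)
    qed auto
    have 2: "P (e i) v \<otimes>\<^bsub>C\<^esub> y \<in> h ` N" if "i < n" "v \<in> carrier V" "y \<in> h ` N" for i v y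
      using span[OF sub[OF P_linear(1)[OF e_closed[OF that(1)]] that(3)] _ that(2)] 1 that e_closed by blast
    have 3: "P u v \<otimes>\<^bsub>C\<^esub> y \<in> h ` N" if "u \<in> carrier V" "v \<in> carrier V" "y \<in> h ` N" for u v y
      using span[OF sub[OF P_linear(2)[OF that(2)] that(3)] _ that(1)] 2 that e_closed by blast
    have "\<one>\<^bsub>C\<^esub> \<in> h ` N" using one hD(5) by (metis imageI)
    from clifford_part_0_subset[OF hN this 3] have "h ` carrier A \<subseteq> h ` N" unfolding h_image .
    then show ?thesis using inj_on_image_mem_iff[OF h_inj _ NE(1)] by blast
  qed
  show ?thesis
  proof (intro ternary_even_clifford.intro[OF A.assoc_alg_axioms] ternary_even_clifford_axioms.intro)
    show "\<one>\<^bsub>R\<^esub> \<oplus>\<^bsub>R\<^esub> \<one>\<^bsub>R\<^esub> \<in> Units R" by (rule two)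
    fix i j :: nat
    show "?p i j \<in> carrier A" by (rule p)
    show "?q i j \<in> carrier R" by (rule q_closed[OF vc vc])
    show "?q i j = ?q j i" by (rule q_sym[OF vc vc])
    have "h (?p i j \<oplus>\<^bsub>A\<^esub> ?p j i) = h ((?q i j \<oplus>\<^bsub>R\<^esub> ?q i j) \<odot>\<^bsub>A\<^esub> \<one>\<^bsub>A\<^esub>)"
      using P_add_swap[OF vc vc] q_closed[OF vc vc] by (simp add: hD(4,5,6) p)
    then show "?p i j \<oplus>\<^bsub>A\<^esub> ?p j i = (?q i j \<oplus>\<^bsub>R\<^esub> ?q i j) \<odot>\<^bsub>A\<^esub> \<one>\<^bsub>A\<^esub>"
      using p(1) q_closed[OF vc vc] by (intro h_eqI) simp_all
    fix k l :: nat
    have "h (?p i j \<otimes>\<^bsub>A\<^esub> ?p k l \<oplus>\<^bsub>A\<^esub> ?p i k \<otimes>\<^bsub>A\<^esub> ?p j l) = h ((?q j k \<oplus>\<^bsub>R\<^esub> ?q j k) \<odot>\<^bsub>A\<^esub> ?p i l)"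
      using P_mult_swap[OF vc vc vc vc] q_closed[OF vc vc] by (simp add: hD(3,4,6) p)
    then show "?p i j \<otimes>\<^bsub>A\<^esub> ?p k l \<oplus>\<^bsub>A\<^esub> ?p i k \<otimes>\<^bsub>A\<^esub> ?p j l = (?q j k \<oplus>\<^bsub>R\<^esub> ?q j k) \<odot>\<^bsub>A\<^esub> ?p i l"
      using p(1) q_closed[OF vc vc] by (intro h_eqI) simp_all
  qed (use gen in blast)
qed

lemma exists_trace:
  assumes "domain R" "free_of_rank R A 4"
  shows "\<exists>tr. quaternion_trace R A tr"
proof -
  have "\<not> n \<ge> 4" using rank_gt_3_contradiction[OF assms] by blast
  then have "n \<le> 3" by linarith
  from ternary_even_clifford.exists_quaternion_trace[OF ternary[OF this] assms] show ?thesis .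
qed

end

lemma (in module) exists_line_data:
  assumes "free_of_rank R M 1"
  shows "\<exists>l0 \<kappa>. line_data R M l0 \<kappa>"
proof -
  obtain e where e: "is_basis R M 1 e" using assms by (auto simp: free_of_rank_def)
  obtain k where k: "\<forall>j. linear_map R M (regular_module R) (k j)"
    "\<forall>i<1. \<forall>j. k j (e i) = (if i = j then \<one> else \<zero>)"
    "\<forall>v\<in>carrier M. v = (\<Oplus>\<^bsub>M\<^esub>j\<in>{..<1}. k j v \<odot>\<^bsub>M\<^esub> e j)"
    using exists_coordinates[OF e] by (elim exE conjE)
  have e0: "e 0 \<in> carrier M" using is_basisD(1)[OF e] by auto
  have "line_data R M (e 0) (k 0)"
  proof (intro line_data.intro line_data_axioms.intro)
    show "module R M" by (rule module_axioms)
    show "e 0 \<in> carrier M" by (rule e0)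
    show "k 0 (e 0) = \<one>" using k(2) by simp
    show "linear_map R M (regular_module R) (k 0)" using k(1) by blast
    fix l assume l: "l \<in> carrier M"
    then have "k 0 l \<in> carrier R" using k(1) by (auto simp: linear_map_regular_iff)
    then have "(\<Oplus>\<^bsub>M\<^esub>j\<in>{..<1}. k j l \<odot>\<^bsub>M\<^esub> e j) = k 0 l \<odot>\<^bsub>M\<^esub> e 0"
      using e0 by (simp add: lessThan_Suc One_nat_def)
    then show "l = k 0 l \<odot>\<^bsub>M\<^esub> e 0" using k(3) l by metis
  qed
  then show ?thesis by blast
qed

theorem even_clifford_quaternion_trace:
  fixes R :: "('r, 'm) ring_scheme" and A :: "('r, 'a, 'n) module_scheme"
  assumes "domain R" "\<one>\<^bsub>R\<^esub> \<oplus>\<^bsub>R\<^esub> \<one>\<^bsub>R\<^esub> \<in> Units R"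
    and "even_clifford_algebra R A" "free_of_rank R A 4"
  shows "\<exists>tr. quaternion_trace R A tr"
proof -
  obtain V :: "('r, nat \<Rightarrow> 'r) module" and n and L :: "('r, nat \<Rightarrow> 'r) module" and Q where
    A: "assoc_algebra R A" and V: "Module.module R V" "free_of_rank R V n"
    and L: "Module.module R L" "free_of_rank R L 1" and Q: "quadratic_form R V L Q"
    and iso: "algebra_iso R A (even_clifford R V L Q)"
    using assms(3) unfolding even_clifford_algebra_def by (elim exE conjE)
  obtain e where e: "is_basis R V n e" using V(2) by (auto simp: free_of_rank_def)
  obtain l0 \<kappa> where l: "line_data R L l0 \<kappa>" using module.exists_line_data[OF L] by (elim exE)
  interpret clifford_data R V L l0 \<kappa> Q
    unfolding clifford_data_def clifford_data_axioms_def tensor_data_def using V(1) l Q assms(2) by blast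
  obtain h where h: "h \<in> ring_iso A (even_clifford R V L Q)"
    "\<forall>r\<in>carrier R. \<forall>x\<in>carrier A. h (r \<odot>\<^bsub>A\<^esub> x) = r \<odot>\<^bsub>even_clifford R V L Q\<^esub> h x"
    using iso unfolding algebra_iso_def by (elim bexE)
  have "alg_hom R A C h"
    using h part_subset by (auto simp: alg_hom_def ring_iso_def ring_hom_def even_clifford_def Pi_iff)
  moreover have "bij_betw h (carrier A) (clifford_part R V L Q 0)"
    using h(1) by (simp add: ring_iso_def even_clifford_def)
  ultimately interpret even_clifford_iso R V L l0 \<kappa> Q n e A h
    unfolding even_clifford_iso_def even_clifford_iso_axioms_def based_clifford_data_def based_clifford_data_axioms_def
    using clifford_data_axioms e A by (auto simp: assoc_algebra_iff bij_betw_def)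
  show ?thesis using exists_trace assms by blast
qed

section \<open>Sheaves of rings and their stalks\<close>

lemma ring_hom_finsum:
  assumes h: "h \<in> ring_hom A B" and A: "ring A" and B: "ring B" and f: "f \<in> I \<rightarrow> carrier A"
  shows "h (finsum A f I) = finsum B (\<lambda>i. h (f i)) I"
proof -
  interpret A: ring A by fact
  interpret B: ring B by fact
  have hc: "h x \<in> carrier B" if "x \<in> carrier A" for x using ring_hom_closed[OF h that] .
  show ?thesis
    using f
  proof (induction I rule: infinite_finite_induct)
    case (insert i I)
    then have "finsum A f (insert i I) = f i \<oplus>\<^bsub>A\<^esub> finsum A f I" by (intro A.finsum_insert) auto
    then have "h (finsum A f (insert i I)) = h (f i) \<oplus>\<^bsub>B\<^esub> finsum B (\<lambda>i. h (f i)) I"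
      using insert ring_hom_add[OF h, of "f i" "finsum A f I"] by (simp add: Pi_iff A.finsum_closed)
    also have "\<dots> = finsum B (\<lambda>i. h (f i)) (insert i I)"
      using insert hc by (intro B.finsum_insert[symmetric]) auto
    finally show ?case .
  qed (simp_all add: ring_hom_zero[OF h A B])
qed

lemma two_unit_hom:
  assumes h: "h \<in> ring_hom A B" and A: "ring A" and B: "ring B"
    and two: "\<one>\<^bsub>A\<^esub> \<oplus>\<^bsub>A\<^esub> \<one>\<^bsub>A\<^esub> \<in> Units A"
  shows "\<one>\<^bsub>B\<^esub> \<oplus>\<^bsub>B\<^esub> \<one>\<^bsub>B\<^esub> \<in> Units B"
proof -
  interpret A: ring A by fact
  interpret B: ring B by fact
  let ?t = "\<one>\<^bsub>A\<^esub> \<oplus>\<^bsub>A\<^esub> \<one>\<^bsub>A\<^esub>"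
  have t: "h ?t = \<one>\<^bsub>B\<^esub> \<oplus>\<^bsub>B\<^esub> \<one>\<^bsub>B\<^esub>" by (simp add: ring_hom_add[OF h] ring_hom_one[OF h])
  have i: "inv\<^bsub>A\<^esub> ?t \<in> carrier A" "?t \<otimes>\<^bsub>A\<^esub> inv\<^bsub>A\<^esub> ?t = \<one>\<^bsub>A\<^esub>" "inv\<^bsub>A\<^esub> ?t \<otimes>\<^bsub>A\<^esub> ?t = \<one>\<^bsub>A\<^esub>"
    using two by (rule A.Units_inv_closed, rule A.Units_r_inv, rule A.Units_l_inv)
  have "h ?t \<otimes>\<^bsub>B\<^esub> h (inv\<^bsub>A\<^esub> ?t) = \<one>\<^bsub>B\<^esub>" "h (inv\<^bsub>A\<^esub> ?t) \<otimes>\<^bsub>B\<^esub> h ?t = \<one>\<^bsub>B\<^esub>"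
    using ring_hom_mult[OF h, of ?t "inv\<^bsub>A\<^esub> ?t"] ring_hom_mult[OF h, of "inv\<^bsub>A\<^esub> ?t" ?t] i ring_hom_one[OF h] by simp_all
  then show ?thesis using ring_hom_closed[OF h i(1)] unfolding Units_def t by auto
qed

text \<open>A ring homomorphism of base rings together with a compatible one of algebras: restriction to
  a smaller open set, or passage to the stalk.\<close>

locale alg_map = A: assoc_alg R A + B: assoc_alg S B for R A S B +
  fixes f g
  assumes f: "f \<in> ring_hom R S" and g: "g \<in> ring_hom A B"
    and g_smult: "\<And>r x. r \<in> carrier R \<Longrightarrow> x \<in> carrier A \<Longrightarrow> g (r \<odot>\<^bsub>A\<^esub> x) = f r \<odot>\<^bsub>B\<^esub> g x"
begin

lemma f_simps: "\<And>x. x \<in> carrier R \<Longrightarrow> f x \<in> carrier S"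
  "\<And>x y. x \<in> carrier R \<Longrightarrow> y \<in> carrier R \<Longrightarrow> f (x \<oplus>\<^bsub>R\<^esub> y) = f x \<oplus>\<^bsub>S\<^esub> f y"
  "\<And>x y. x \<in> carrier R \<Longrightarrow> y \<in> carrier R \<Longrightarrow> f (x \<otimes>\<^bsub>R\<^esub> y) = f x \<otimes>\<^bsub>S\<^esub> f y"
  "f \<one>\<^bsub>R\<^esub> = \<one>\<^bsub>S\<^esub>" "f \<zero>\<^bsub>R\<^esub> = \<zero>\<^bsub>S\<^esub>"
  using f ring_hom_zero[OF f A.R.ring_axioms B.R.ring_axioms] by (auto simp: ring_hom_def)

lemma g_simps: "\<And>x. x \<in> carrier A \<Longrightarrow> g x \<in> carrier B"
  "\<And>x y. x \<in> carrier A \<Longrightarrow> y \<in> carrier A \<Longrightarrow> g (x \<oplus>\<^bsub>A\<^esub> y) = g x \<oplus>\<^bsub>B\<^esub> g y"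
  "\<And>x y. x \<in> carrier A \<Longrightarrow> y \<in> carrier A \<Longrightarrow> g (x \<otimes>\<^bsub>A\<^esub> y) = g x \<otimes>\<^bsub>B\<^esub> g y"
  "g \<one>\<^bsub>A\<^esub> = \<one>\<^bsub>B\<^esub>" "g \<zero>\<^bsub>A\<^esub> = \<zero>\<^bsub>B\<^esub>"
  using g ring_hom_zero[OF g A.A.ring_axioms B.A.ring_axioms] by (auto simp: ring_hom_def)

lemma g_lincomb:
  assumes "c \<in> I \<rightarrow> carrier R" "b \<in> I \<rightarrow> carrier A"
  shows "g (\<Oplus>\<^bsub>A\<^esub>i\<in>I. c i \<odot>\<^bsub>A\<^esub> b i) = (\<Oplus>\<^bsub>B\<^esub>i\<in>I. f (c i) \<odot>\<^bsub>B\<^esub> g (b i))"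
proof -
  have "g (\<Oplus>\<^bsub>A\<^esub>i\<in>I. c i \<odot>\<^bsub>A\<^esub> b i) = (\<Oplus>\<^bsub>B\<^esub>i\<in>I. g (c i \<odot>\<^bsub>A\<^esub> b i))"
    using assms by (intro ring_hom_finsum[OF g A.A.ring_axioms B.A.ring_axioms]) auto
  also have "\<dots> = (\<Oplus>\<^bsub>B\<^esub>i\<in>I. f (c i) \<odot>\<^bsub>B\<^esub> g (b i))"
    using assms by (intro B.M.finsum_cong') (auto simp: g_smult f_simps g_simps Pi_iff)
  finally show ?thesis .
qed

lemma f_sum_mult:
  assumes "c \<in> I \<rightarrow> carrier R" "d \<in> I \<rightarrow> carrier R"
  shows "f (\<Oplus>\<^bsub>R\<^esub>i\<in>I. c i \<otimes>\<^bsub>R\<^esub> d i) = (\<Oplus>\<^bsub>S\<^esub>i\<in>I. f (c i) \<otimes>\<^bsub>S\<^esub> f (d i))"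
proof -
  have "f (\<Oplus>\<^bsub>R\<^esub>i\<in>I. c i \<otimes>\<^bsub>R\<^esub> d i) = (\<Oplus>\<^bsub>S\<^esub>i\<in>I. f (c i \<otimes>\<^bsub>R\<^esub> d i))"
    using assms by (intro ring_hom_finsum[OF f A.R.ring_axioms B.R.ring_axioms]) auto
  also have "\<dots> = (\<Oplus>\<^bsub>S\<^esub>i\<in>I. f (c i) \<otimes>\<^bsub>S\<^esub> f (d i))"
    using assms by (intro B.R.finsum_cong') (auto simp: f_simps Pi_iff)
  finally show ?thesis .
qed

end

section \<open>Sheaf axioms in pointwise form\<close>

locale ring_sheaf =
  fixes X :: "'p topology" and F :: "'p set \<Rightarrow> ('a, 'm) ring_scheme" and res
  assumes sheaf: "sheaf_of_rings X F res"
begin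

lemmas sheaf_axioms = sheaf[unfolded sheaf_of_rings_def]

lemma ring_F: "openin X U \<Longrightarrow> ring (F U)"
  using sheaf_axioms[THEN conjunct1] by blast

lemma res_hom: "openin X U \<Longrightarrow> openin X V \<Longrightarrow> V \<subseteq> U \<Longrightarrow> res U V \<in> ring_hom (F U) (F V)"
  using sheaf_axioms[THEN conjunct2, THEN conjunct1] by blast

lemma res_closed: "openin X U \<Longrightarrow> openin X V \<Longrightarrow> V \<subseteq> U \<Longrightarrow> s \<in> carrier (F U) \<Longrightarrow> res U V s \<in> carrier (F V)"
  using ring_hom_closed[OF res_hom] .

lemma res_id: "openin X U \<Longrightarrow> s \<in> carrier (F U) \<Longrightarrow> res U U s = s"
  using sheaf_axioms[THEN conjunct2, THEN conjunct2, THEN conjunct1] by blast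

lemma res_res: "openin X U \<Longrightarrow> openin X V \<Longrightarrow> openin X W \<Longrightarrow> W \<subseteq> V \<Longrightarrow> V \<subseteq> U \<Longrightarrow>
    s \<in> carrier (F U) \<Longrightarrow> res V W (res U V s) = res U W s"
  using sheaf_axioms[THEN conjunct2, THEN conjunct2, THEN conjunct2, THEN conjunct1] by blast

text \<open>The separation axiom is applied to the family of all open subsets on which the two
  sections agree; by \<open>loc\<close> it covers \<open>U\<close>.\<close>

lemma locality:
  assumes U: "openin X U" and s: "s \<in> carrier (F U)" and t: "t \<in> carrier (F U)"
    and loc: "\<And>x. x \<in> U \<Longrightarrow> \<exists>W. openin X W \<and> x \<in> W \<and> W \<subseteq> U \<and> res U W s = res U W t"
  shows "s = t"
proof -
  define C where "C = {W. openin X W \<and> W \<subseteq> U \<and> res U W s = res U W t}"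
  have C: "\<Union>C = U"
  proof
    show "U \<subseteq> \<Union>C"
    proof
      fix x assume "x \<in> U"
      from loc[OF this] show "x \<in> \<Union>C" unfolding C_def by blast
    qed
  qed (auto simp: C_def)
  have "\<forall>\<U>. (\<forall>V\<in>\<U>. openin X V) \<longrightarrow>
       (\<forall>s\<in>carrier (F (\<Union>\<U>)). \<forall>t\<in>carrier (F (\<Union>\<U>)).
          (\<forall>V\<in>\<U>. res (\<Union>\<U>) V s = res (\<Union>\<U>) V t) \<longrightarrow> s = t)"
    by (rule sheaf_axioms[THEN conjunct2, THEN conjunct2, THEN conjunct2, THEN conjunct2, THEN conjunct1])
  moreover have "\<forall>V\<in>C. openin X V" by (simp add: C_def)
  ultimately have "\<forall>s\<in>carrier (F (\<Union>C)). \<forall>t\<in>carrier (F (\<Union>C)).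
      (\<forall>V\<in>C. res (\<Union>C) V s = res (\<Union>C) V t) \<longrightarrow> s = t" by blast
  moreover have "\<forall>V\<in>C. res U V s = res U V t" by (simp add: C_def)
  ultimately show ?thesis using s t unfolding C by blast
qed

text \<open>The sections to be glued are described by a property \<open>P\<close> with at most one
  solution on each open set. Arbitrary choices of solutions then agree on overlaps automatically,
  and no compatible family has to be exhibited.\<close>

lemma glue:
  assumes U: "openin X U"
    and stable: "\<And>V W s. openin X V \<Longrightarrow> openin X W \<Longrightarrow> W \<subseteq> V \<Longrightarrow> V \<subseteq> U \<Longrightarrow> s \<in> carrier (F V) \<Longrightarrow>
      P V s \<Longrightarrow> P W (res V W s)"
    and uniq: "\<And>V s t. openin X V \<Longrightarrow> V \<subseteq> U \<Longrightarrow> s \<in> carrier (F V) \<Longrightarrow> t \<in> carrier (F V) \<Longrightarrow>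
      P V s \<Longrightarrow> P V t \<Longrightarrow> s = t"
    and loc: "\<And>x. x \<in> U \<Longrightarrow> \<exists>V. openin X V \<and> x \<in> V \<and> V \<subseteq> U \<and> (\<exists>s\<in>carrier (F V). P V s)"
  shows "\<exists>s\<in>carrier (F U). \<forall>V. openin X V \<longrightarrow> V \<subseteq> U \<longrightarrow> (\<forall>t\<in>carrier (F V). P V t \<longrightarrow> res U V s = t)"
proof -
  define C where "C = {V. openin X V \<and> V \<subseteq> U \<and> (\<exists>s\<in>carrier (F V). P V s)}"
  have C: "\<Union>C = U"
  proof
    show "U \<subseteq> \<Union>C"
    proof
      fix x assume "x \<in> U"
      from loc[OF this] show "x \<in> \<Union>C" unfolding C_def by blast
    qed
  qed (auto simp: C_def)
  define f where "f V = (SOME s. s \<in> carrier (F V) \<and> P V s)" for V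
  have f: "f V \<in> carrier (F V)" "P V (f V)" if "V \<in> C" for V
  proof -
    have "\<exists>s. s \<in> carrier (F V) \<and> P V s" using that unfolding C_def by blast
    from someI_ex[OF this] show "f V \<in> carrier (F V)" "P V (f V)" unfolding f_def by blast+
  qed
  have Co: "openin X V" "V \<subseteq> U" if "V \<in> C" for V using that by (auto simp: C_def)
  have compat: "res V (V \<inter> W) (f V) = res W (V \<inter> W) (f W)" if "V \<in> C" "W \<in> C" for V W
  proof (rule uniq)
    show "openin X (V \<inter> W)" "V \<inter> W \<subseteq> U" using Co that by auto
    then show "res V (V \<inter> W) (f V) \<in> carrier (F (V \<inter> W))" "res W (V \<inter> W) (f W) \<in> carrier (F (V \<inter> W))"
      "P (V \<inter> W) (res V (V \<inter> W) (f V))" "P (V \<inter> W) (res W (V \<inter> W) (f W))"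
      using Co that f by (auto intro!: res_closed stable)
  qed
  have "\<forall>\<U> f. (\<forall>V\<in>\<U>. openin X V \<and> f V \<in> carrier (F V)) \<and>
       (\<forall>V\<in>\<U>. \<forall>W\<in>\<U>. res V (V \<inter> W) (f V) = res W (V \<inter> W) (f W)) \<longrightarrow>
       (\<exists>s\<in>carrier (F (\<Union>\<U>)). \<forall>V\<in>\<U>. res (\<Union>\<U>) V s = f V)"
    by (rule sheaf_axioms[THEN conjunct2, THEN conjunct2, THEN conjunct2, THEN conjunct2, THEN conjunct2])
  from this[rule_format, of C f] obtain s where s: "s \<in> carrier (F U)" "\<forall>V\<in>C. res U V s = f V"
    using Co f compat unfolding C by blast
  have "res U V s = t" if "openin X V" "V \<subseteq> U" "t \<in> carrier (F V)" "P V t" for V t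
  proof -
    have "V \<in> C" using that by (auto simp: C_def)
    then show ?thesis using s(2) f that by (metis uniq)
  qed
  then show ?thesis using s(1) by blast
qed

section \<open>Germs and stalks\<close>

abbreviation gm where "gm \<equiv> germ X F res"

lemma germ_mem_iff: "(V, t) \<in> gm z U s \<longleftrightarrow>
     openin X U \<and> z \<in> U \<and> s \<in> carrier (F U) \<and> openin X V \<and> z \<in> V \<and> t \<in> carrier (F V) \<and>
     (\<exists>W. openin X W \<and> z \<in> W \<and> W \<subseteq> U \<inter> V \<and> res U W s = res V W t)"
  by (simp add: germ_def germ_rel_def)

text \<open>Germs are images under a relation, so equality needs that relation to be transitive: two
  witnessing neighbourhoods are intersected.\<close>

lemma germ_eq_iff:
  assumes U: "openin X U" "z \<in> U" "s \<in> carrier (F U)" and V: "openin X V" "z \<in> V" "t \<in> carrier (F V)"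
  shows "gm z U s = gm z V t \<longleftrightarrow> (\<exists>W. openin X W \<and> z \<in> W \<and> W \<subseteq> U \<inter> V \<and> res U W s = res V W t)"
proof
  assume "gm z U s = gm z V t"
  moreover have "(V, t) \<in> gm z V t" using V by (auto simp: germ_mem_iff)
  ultimately have "(V, t) \<in> gm z U s" by simp
  then show "\<exists>W. openin X W \<and> z \<in> W \<and> W \<subseteq> U \<inter> V \<and> res U W s = res V W t" unfolding germ_mem_iff by blast
next
  assume "\<exists>W. openin X W \<and> z \<in> W \<and> W \<subseteq> U \<inter> V \<and> res U W s = res V W t"
  then obtain W where W: "openin X W" "z \<in> W" "W \<subseteq> U \<inter> V" "res U W s = res V W t" by blast
  have aux: "(Y, r) \<in> gm z V' t'"
    if "(Y, r) \<in> gm z U' s'" and W: "openin X W" "z \<in> W" "W \<subseteq> U' \<inter> V'" "res U' W s' = res V' W t'"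
      and V: "openin X V'" "z \<in> V'" "t' \<in> carrier (F V')" for Y r U' s' V' t'
  proof -
    from that(1) obtain W' where U: "openin X U'" "z \<in> U'" "s' \<in> carrier (F U')"
      and Y: "openin X Y" "z \<in> Y" "r \<in> carrier (F Y)"
      and W': "openin X W'" "z \<in> W'" "W' \<subseteq> U' \<inter> Y" "res U' W' s' = res Y W' r"
      unfolding germ_mem_iff by blast
    have o: "openin X (W \<inter> W')" using W W' by auto
    have "res V' (W \<inter> W') t' = res W (W \<inter> W') (res V' W t')"
      using res_res[OF V(1) W(1) o _ _ V(3)] W by auto
    also have "\<dots> = res U' (W \<inter> W') s'" unfolding W(4)[symmetric] using res_res[OF U(1) W(1) o _ _ U(3)] W by auto
    also have "\<dots> = res W' (W \<inter> W') (res U' W' s')" using res_res[OF U(1) W'(1) o _ _ U(3)] W' by auto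
    also have "\<dots> = res Y (W \<inter> W') r" unfolding W'(4) using res_res[OF Y(1) W'(1) o _ _ Y(3)] W' by auto
    finally show ?thesis unfolding germ_mem_iff using V Y W W' o by blast
  qed
  have "gm z U s \<subseteq> gm z V t" using aux[OF _ W V] by auto
  moreover have "gm z V t \<subseteq> gm z U s"
    using aux[OF _ W(1,2) _ W(4)[symmetric] U] W(3) by auto
  ultimately show "gm z U s = gm z V t" by blast
qed

lemma germ_res:
  assumes "openin X U" "openin X V" "z \<in> V" "V \<subseteq> U" "s \<in> carrier (F U)"
  shows "gm z V (res U V s) = gm z U s"
proof -
  have "res V V (res U V s) = res U V s" using assms by (intro res_id res_closed)
  then show ?thesis using assms by (subst germ_eq_iff) (auto intro: res_closed)
qed

abbreviation St where "St \<equiv> stalk X F res"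

lemma stalk_carrierE:
  assumes "x \<in> carrier (St z)"
  obtains U s where "openin X U" "z \<in> U" "s \<in> carrier (F U)" "x = gm z U s"
  using assms by (auto simp: stalk_def)

lemma germ_closed: "openin X U \<Longrightarrow> z \<in> U \<Longrightarrow> s \<in> carrier (F U) \<Longrightarrow> gm z U s \<in> carrier (St z)"
  by (auto simp: stalk_def)

end

text \<open>The operations on stalks are unions over all representatives; these unions are constant.\<close>

lemma germ_operation:
  fixes F1 :: "'p set \<Rightarrow> ('a, 'm) ring_scheme" and F2 :: "'p set \<Rightarrow> ('b, 'n) ring_scheme"
    and F3 :: "'p set \<Rightarrow> ('c, 'o) ring_scheme"
  assumes 1: "ring_sheaf X F1 res1" and 2: "ring_sheaf X F2 res2" and 3: "ring_sheaf X F3 res3"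
    and op_closed: "\<And>U s t. openin X U \<Longrightarrow> s \<in> carrier (F1 U) \<Longrightarrow> t \<in> carrier (F2 U) \<Longrightarrow> op U s t \<in> carrier (F3 U)"
    and op_res: "\<And>U V s t. openin X U \<Longrightarrow> openin X V \<Longrightarrow> V \<subseteq> U \<Longrightarrow> s \<in> carrier (F1 U) \<Longrightarrow> t \<in> carrier (F2 U) \<Longrightarrow>
      res3 U V (op U s t) = op V (res1 U V s) (res2 U V t)"
    and U: "openin X U" "z \<in> U" and s: "s \<in> carrier (F1 U)" and t: "t \<in> carrier (F2 U)"
  shows "(\<Union>(U1, s1)\<in>germ X F1 res1 z U s. \<Union>(U2, s2)\<in>germ X F2 res2 z U t.
      germ X F3 res3 z (U1 \<inter> U2) (op (U1 \<inter> U2) (res1 U1 (U1 \<inter> U2) s1) (res2 U2 (U1 \<inter> U2) s2))) =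
    germ X F3 res3 z U (op U s t)" (is "?L = ?R")
proof -
  interpret S1: ring_sheaf X F1 res1 by fact
  interpret S2: ring_sheaf X F2 res2 by fact
  interpret S3: ring_sheaf X F3 res3 by fact
  have eq: "germ X F3 res3 z (U1 \<inter> U2) (op (U1 \<inter> U2) (res1 U1 (U1 \<inter> U2) s1) (res2 U2 (U1 \<inter> U2) s2)) = ?R"
    if m: "(U1, s1) \<in> germ X F1 res1 z U s" "(U2, s2) \<in> germ X F2 res2 z U t" for U1 s1 U2 s2
  proof -
    from m obtain W1 W2 where a: "openin X U1" "z \<in> U1" "s1 \<in> carrier (F1 U1)" "openin X U2" "z \<in> U2" "s2 \<in> carrier (F2 U2)"
      and W1: "openin X W1" "z \<in> W1" "W1 \<subseteq> U \<inter> U1" "res1 U W1 s = res1 U1 W1 s1"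
      and W2: "openin X W2" "z \<in> W2" "W2 \<subseteq> U \<inter> U2" "res2 U W2 t = res2 U2 W2 s2"
      unfolding S1.germ_mem_iff S2.germ_mem_iff by blast
    let ?I = "U1 \<inter> U2" and ?W = "W1 \<inter> W2"
    have o: "openin X ?I" "openin X ?W" "z \<in> ?I" "z \<in> ?W" "?W \<subseteq> ?I" "?W \<subseteq> U" using a W1 W2 by auto
    have c: "res1 U1 ?I s1 \<in> carrier (F1 ?I)" "res2 U2 ?I s2 \<in> carrier (F2 ?I)"
      using a o by (auto intro!: S1.res_closed S2.res_closed)
    have e1: "res1 U1 ?W s1 = res1 U ?W s"
      using S1.res_res[OF a(1) W1(1) o(2) _ _ a(3)] S1.res_res[OF U(1) W1(1) o(2) _ _ s] W1 by auto
    have e2: "res2 U2 ?W s2 = res2 U ?W t"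
      using S2.res_res[OF a(4) W2(1) o(2) _ _ a(6)] S2.res_res[OF U(1) W2(1) o(2) _ _ t] W2 by auto
    have "res3 ?I ?W (op ?I (res1 U1 ?I s1) (res2 U2 ?I s2)) = res3 U ?W (op U s t)"
      unfolding op_res[OF o(1,2,5) c] op_res[OF U(1) o(2,6) s t]
      using S1.res_res[OF a(1) o(1,2,5) _ a(3)] S2.res_res[OF a(4) o(1,2,5) _ a(6)] e1 e2 by auto
    then show ?thesis
      using o U op_closed c s t by (subst S3.germ_eq_iff) auto
  qed
  have m: "(U, s) \<in> germ X F1 res1 z U s" "(U, t) \<in> germ X F2 res2 z U t"
    using U s t by (auto simp: S1.germ_mem_iff S2.germ_mem_iff)
  show ?thesis
  proof
    show "?L \<subseteq> ?R" using eq by blast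
    show "?R \<subseteq> ?L"
    proof
      fix y assume "y \<in> ?R"
      then show "y \<in> ?L" unfolding eq[OF m, symmetric] using m by blast
    qed
  qed
qed

context ring_sheaf
begin

lemma ring_sheaf: "ring_sheaf X F res"
  by unfold_locales

lemma stalk_simps:
  assumes U: "openin X U" "z \<in> U" and s: "s \<in> carrier (F U)" and t: "t \<in> carrier (F U)"
  shows "gm z U s \<oplus>\<^bsub>St z\<^esub> gm z U t = gm z U (s \<oplus>\<^bsub>F U\<^esub> t)"
    and "gm z U s \<otimes>\<^bsub>St z\<^esub> gm z U t = gm z U (s \<otimes>\<^bsub>F U\<^esub> t)"
proof -
  have "(\<Union>(U1, s1)\<in>gm z U s. \<Union>(U2, s2)\<in>gm z U t.
      gm z (U1 \<inter> U2) (res U1 (U1 \<inter> U2) s1 \<oplus>\<^bsub>F (U1 \<inter> U2)\<^esub> res U2 (U1 \<inter> U2) s2)) = gm z U (s \<oplus>\<^bsub>F U\<^esub> t)"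
    by (rule germ_operation[OF ring_sheaf ring_sheaf ring_sheaf, of "\<lambda>U. add (F U)"])
      (use U s t ring_hom_add[OF res_hom] ring.ring_simprules(1)[OF ring_F] in auto)
  then show "gm z U s \<oplus>\<^bsub>St z\<^esub> gm z U t = gm z U (s \<oplus>\<^bsub>F U\<^esub> t)" by (simp add: stalk_def)
  have "(\<Union>(U1, s1)\<in>gm z U s. \<Union>(U2, s2)\<in>gm z U t.
      gm z (U1 \<inter> U2) (res U1 (U1 \<inter> U2) s1 \<otimes>\<^bsub>F (U1 \<inter> U2)\<^esub> res U2 (U1 \<inter> U2) s2)) = gm z U (s \<otimes>\<^bsub>F U\<^esub> t)"
    by (rule germ_operation[OF ring_sheaf ring_sheaf ring_sheaf, of "\<lambda>U. mult (F U)"])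
      (use U s t ring_hom_mult[OF res_hom] monoid.m_closed[OF ring.is_monoid[OF ring_F]] in auto)
  then show "gm z U s \<otimes>\<^bsub>St z\<^esub> gm z U t = gm z U (s \<otimes>\<^bsub>F U\<^esub> t)" by (simp add: stalk_def)
qed

lemma one_closed: "openin X U \<Longrightarrow> \<one>\<^bsub>F U\<^esub> \<in> carrier (F U)"
  by (rule ring.ring_simprules(6)[OF ring_F])

lemma zero_closed: "openin X U \<Longrightarrow> \<zero>\<^bsub>F U\<^esub> \<in> carrier (F U)"
  by (rule ring.ring_simprules(2)[OF ring_F])

lemma germ_one: "openin X U \<Longrightarrow> z \<in> U \<Longrightarrow> gm z U \<one>\<^bsub>F U\<^esub> = \<one>\<^bsub>St z\<^esub>"
  using germ_res[of "topspace X" U z "\<one>\<^bsub>F (topspace X)\<^esub>"] openin_subset[of X U] one_closed[of "topspace X"]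
    ring_hom_one[OF res_hom[of "topspace X" U]]
  by (simp add: stalk_def)

lemma germ_zero: "openin X U \<Longrightarrow> z \<in> U \<Longrightarrow> gm z U \<zero>\<^bsub>F U\<^esub> = \<zero>\<^bsub>St z\<^esub>"
  using germ_res[of "topspace X" U z "\<zero>\<^bsub>F (topspace X)\<^esub>"] openin_subset[of X U] zero_closed[of "topspace X"]
    ring_hom_zero[OF res_hom[of "topspace X" U] ring_F ring_F]
  by (simp add: stalk_def)

lemma germ_hom: "openin X U \<Longrightarrow> z \<in> U \<Longrightarrow> gm z U \<in> ring_hom (F U) (St z)"
  by (rule ring_hom_memI) (simp_all add: germ_closed stalk_simps germ_one)

text \<open>Finitely many germs have representatives on one common neighbourhood, obtained by
  intersecting.\<close>

lemma lift_family:
  assumes "finite I" "x \<in> I \<rightarrow> carrier (St z)" "openin X U0" "z \<in> U0"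
  shows "\<exists>U s. openin X U \<and> z \<in> U \<and> U \<subseteq> U0 \<and> s \<in> I \<rightarrow> carrier (F U) \<and> (\<forall>i\<in>I. x i = gm z U (s i))"
  using assms(1,2)
proof (induction I)
  case empty
  then show ?case using assms(3,4) by blast
next
  case (insert i I)
  obtain U s where U: "openin X U" "z \<in> U" "U \<subseteq> U0" "s \<in> I \<rightarrow> carrier (F U)" "\<forall>i\<in>I. x i = gm z U (s i)"
    using insert by auto
  obtain V t where V: "openin X V" "z \<in> V" "t \<in> carrier (F V)" "x i = gm z V t"
    using insert.prems stalk_carrierE[of "x i" z] by auto
  let ?W = "U \<inter> V" and ?r = "\<lambda>j. if j = i then res V (U \<inter> V) t else res U (U \<inter> V) (s j)"
  have W: "openin X ?W" "z \<in> ?W" "?W \<subseteq> U0" using U V by auto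
  moreover have "?r \<in> insert i I \<rightarrow> carrier (F ?W)" using U V W by (auto intro!: res_closed)
  moreover have "x j = gm z ?W (?r j)" if "j \<in> insert i I" for j
    using that U V W germ_res[OF U(1) W(1,2), of "s j"] germ_res[OF V(1) W(1,2), of t] by (auto simp: Pi_iff)
  ultimately show ?case by blast
qed

text \<open>Finitely many equalities of germs hold together near the point. The quantifier over all
  smaller \<open>V\<close> is what later allows the equalities to be used on each subset of a
  chart.\<close>

lemma spread_equalities:
  assumes "finite I" and U: "openin X U" "z \<in> U"
    and "s \<in> I \<rightarrow> carrier (F U)" "t \<in> I \<rightarrow> carrier (F U)" "\<And>i. i \<in> I \<Longrightarrow> gm z U (s i) = gm z U (t i)"
  shows "\<exists>W. openin X W \<and> z \<in> W \<and> W \<subseteq> U \<and> (\<forall>V. openin X V \<longrightarrow> V \<subseteq> W \<longrightarrow> (\<forall>i\<in>I. res U V (s i) = res U V (t i)))"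
  using assms(1,4-6)
proof (induction I)
  case empty
  then show ?case using U by blast
next
  case (insert i I)
  obtain W where W: "openin X W" "z \<in> W" "W \<subseteq> U"
    "\<forall>V. openin X V \<longrightarrow> V \<subseteq> W \<longrightarrow> (\<forall>i\<in>I. res U V (s i) = res U V (t i))"
    using insert by auto
  have st: "s i \<in> carrier (F U)" "t i \<in> carrier (F U)" using insert.prems by auto
  obtain Y where Y: "openin X Y" "z \<in> Y" "Y \<subseteq> U" "res U Y (s i) = res U Y (t i)"
    using insert.prems(3)[of i] germ_eq_iff[OF U st(1) U st(2)] by auto
  have "res U V (s i) = res U V (t i)" if V: "openin X V" "V \<subseteq> Y" for V
    using res_res[OF U(1) Y(1) V(1,2) Y(3) st(1)] res_res[OF U(1) Y(1) V(1,2) Y(3) st(2)] Y(4) by simp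
  then have "\<forall>V. openin X V \<longrightarrow> V \<subseteq> W \<inter> Y \<longrightarrow> (\<forall>j\<in>insert i I. res U V (s j) = res U V (t j))"
    using W(4) by blast
  moreover have "openin X (W \<inter> Y)" "z \<in> W \<inter> Y" "W \<inter> Y \<subseteq> U" using W Y by auto
  ultimately show ?case by blast
qed

text \<open>If a product of germs is zero, it is already zero as a section on some neighbourhood of
  \<open>z\<close>, which is nonempty; its ring of sections is a domain, so one factor vanishes
  there.\<close>

lemma domain_stalk:
  assumes dom: "\<And>U. openin X U \<Longrightarrow> U \<noteq> {} \<Longrightarrow> domain (F U)" and cring: "cring (St z)" and z: "z \<in> topspace X"
  shows "domain (St z)"
proof (intro domain.intro[OF cring] domain_axioms.intro)
  show "\<one>\<^bsub>St z\<^esub> \<noteq> \<zero>\<^bsub>St z\<^esub>"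
  proof
    assume eq: "\<one>\<^bsub>St z\<^esub> = \<zero>\<^bsub>St z\<^esub>"
    let ?T = "topspace X"
    have "gm z ?T \<one>\<^bsub>F ?T\<^esub> = gm z ?T \<zero>\<^bsub>F ?T\<^esub>" using eq germ_one[of ?T z] germ_zero[of ?T z] z by simp
    then obtain W where W: "openin X W" "z \<in> W" "W \<subseteq> ?T" "res ?T W \<one>\<^bsub>F ?T\<^esub> = res ?T W \<zero>\<^bsub>F ?T\<^esub>"
      using germ_eq_iff[of ?T z "\<one>\<^bsub>F ?T\<^esub>" ?T "\<zero>\<^bsub>F ?T\<^esub>"] z one_closed zero_closed by auto
    have "res ?T W \<one>\<^bsub>F ?T\<^esub> = \<one>\<^bsub>F W\<^esub>" "res ?T W \<zero>\<^bsub>F ?T\<^esub> = \<zero>\<^bsub>F W\<^esub>"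
      using ring_hom_one[OF res_hom[of ?T W]] ring_hom_zero[OF res_hom[of ?T W] ring_F ring_F] W by auto
    then show False using W(4) domain.one_not_zero[OF dom[of W]] W by auto
  qed
  fix a b assume ab: "a \<otimes>\<^bsub>St z\<^esub> b = \<zero>\<^bsub>St z\<^esub>" "a \<in> carrier (St z)" "b \<in> carrier (St z)"
  obtain U1 s1 where 1: "openin X U1" "z \<in> U1" "s1 \<in> carrier (F U1)" "a = gm z U1 s1" using ab(2) by (rule stalk_carrierE)
  obtain U2 s2 where 2: "openin X U2" "z \<in> U2" "s2 \<in> carrier (F U2)" "b = gm z U2 s2" using ab(3) by (rule stalk_carrierE)
  let ?U = "U1 \<inter> U2"
  define s t where "s = res U1 ?U s1" and "t = res U2 ?U s2"
  have U: "openin X ?U" "z \<in> ?U" using 1 2 by auto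
  have s: "s \<in> carrier (F ?U)" "a = gm z ?U s" and t: "t \<in> carrier (F ?U)" "b = gm z ?U t"
    using 1 2 U germ_res[OF 1(1) U _ 1(3)] germ_res[OF 2(1) U _ 2(3)] by (auto simp: s_def t_def intro!: res_closed)
  have stc: "s \<otimes>\<^bsub>F ?U\<^esub> t \<in> carrier (F ?U)" using s t ring_F[OF U(1)] by (simp add: monoid.m_closed ring.is_monoid)
  have "gm z ?U (s \<otimes>\<^bsub>F ?U\<^esub> t) = gm z ?U \<zero>\<^bsub>F ?U\<^esub>"
    using ab(1) s t U by (simp add: stalk_simps germ_zero)
  then obtain W where W: "openin X W" "z \<in> W" "W \<subseteq> ?U" "res ?U W (s \<otimes>\<^bsub>F ?U\<^esub> t) = res ?U W \<zero>\<^bsub>F ?U\<^esub>"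
    using germ_eq_iff[OF U stc U zero_closed[OF U(1)]] by auto
  interpret W: domain "F W" using dom[of W] W by auto
  have c: "res ?U W s \<in> carrier (F W)" "res ?U W t \<in> carrier (F W)" using s t U W by (auto intro!: res_closed)
  have "res ?U W s \<otimes>\<^bsub>F W\<^esub> res ?U W t = \<zero>\<^bsub>F W\<^esub>"
    using W(4) ring_hom_mult[OF res_hom[OF U(1) W(1,3)] s(1) t(1)]
      ring_hom_zero[OF res_hom[OF U(1) W(1,3)] ring_F[OF U(1)] ring_F[OF W(1)]] by simp
  then have "res ?U W s = \<zero>\<^bsub>F W\<^esub> \<or> res ?U W t = \<zero>\<^bsub>F W\<^esub>" using W.integral c by blast
  moreover have "a = gm z W (res ?U W s)" "b = gm z W (res ?U W t)"
    using germ_res[OF U(1) W(1,2,3)] s t by auto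
  ultimately show "a = \<zero>\<^bsub>St z\<^esub> \<or> b = \<zero>\<^bsub>St z\<^esub>" using germ_zero[OF W(1,2)] by metis
qed

end

section \<open>Spreading out bases and gluing traces\<close>

text \<open>Expand the square of \<open>x + y\<close> by its own quadratic equation and subtract the
  equations of \<open>x\<close> and \<open>y\<close>; additivity of the trace leaves the mixed terms
  and a scalar.\<close>

lemma (in assoc_alg) polar_of_trace:
  assumes tr: "quaternion_trace R A tr" and two: "\<one> \<oplus> \<one> \<in> Units R"
    and x: "x \<in> carrier A" and y: "y \<in> carrier A"
  shows "polar (tr x) x (tr y) y"
proof -
  note D = quaternion_traceD[OF tr two]
  have T: "tr x \<in> carrier R" "tr y \<in> carrier R" "tr (x \<oplus>\<^bsub>A\<^esub> y) = tr x \<oplus> tr y"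
    using D(1) x y by (auto simp: linear_map_regular_iff)
  have xy: "x \<oplus>\<^bsub>A\<^esub> y \<in> carrier A" using x y by simp
  from D(3)[OF x] obtain g1 where 1: "g1 \<in> carrier R" "x \<otimes>\<^bsub>A\<^esub> x = tr x \<odot>\<^bsub>A\<^esub> x \<oplus>\<^bsub>A\<^esub> g1 \<odot>\<^bsub>A\<^esub> \<one>\<^bsub>A\<^esub>" by blast
  from D(3)[OF y] obtain g2 where 2: "g2 \<in> carrier R" "y \<otimes>\<^bsub>A\<^esub> y = tr y \<odot>\<^bsub>A\<^esub> y \<oplus>\<^bsub>A\<^esub> g2 \<odot>\<^bsub>A\<^esub> \<one>\<^bsub>A\<^esub>" by blast
  from D(3)[OF xy] obtain g3 where 3: "g3 \<in> carrier R" "(x \<oplus>\<^bsub>A\<^esub> y) \<otimes>\<^bsub>A\<^esub> (x \<oplus>\<^bsub>A\<^esub> y) =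
      (tr x \<oplus> tr y) \<odot>\<^bsub>A\<^esub> (x \<oplus>\<^bsub>A\<^esub> y) \<oplus>\<^bsub>A\<^esub> g3 \<odot>\<^bsub>A\<^esub> \<one>\<^bsub>A\<^esub>" unfolding T(3) by blast
  define a b c d where "a = tr x \<odot>\<^bsub>A\<^esub> x" and "b = tr x \<odot>\<^bsub>A\<^esub> y" and "c = tr y \<odot>\<^bsub>A\<^esub> x" and "d = tr y \<odot>\<^bsub>A\<^esub> y"
  define s1 s2 s3 where "s1 = g1 \<odot>\<^bsub>A\<^esub> \<one>\<^bsub>A\<^esub>" and "s2 = g2 \<odot>\<^bsub>A\<^esub> \<one>\<^bsub>A\<^esub>" and "s3 = g3 \<odot>\<^bsub>A\<^esub> \<one>\<^bsub>A\<^esub>"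
  have m: "a \<in> carrier A" "b \<in> carrier A" "c \<in> carrier A" "d \<in> carrier A"
    "s1 \<in> carrier A" "s2 \<in> carrier A" "s3 \<in> carrier A"
    using x y T 1 2 3 by (auto simp: a_def b_def c_def d_def s1_def s2_def s3_def)
  have sq: "(tr x \<oplus> tr y) \<odot>\<^bsub>A\<^esub> (x \<oplus>\<^bsub>A\<^esub> y) = (a \<oplus>\<^bsub>A\<^esub> b) \<oplus>\<^bsub>A\<^esub> (c \<oplus>\<^bsub>A\<^esub> d)"
    using x y T unfolding a_def b_def c_def d_def by (subst smult_l_distr) (simp_all add: smult_r_distr)
  have "x \<otimes>\<^bsub>A\<^esub> y \<oplus>\<^bsub>A\<^esub> y \<otimes>\<^bsub>A\<^esub> x = (x \<oplus>\<^bsub>A\<^esub> y) \<otimes>\<^bsub>A\<^esub> (x \<oplus>\<^bsub>A\<^esub> y) \<oplus>\<^bsub>A\<^esub> \<ominus>\<^bsub>A\<^esub> (x \<otimes>\<^bsub>A\<^esub> x) \<oplus>\<^bsub>A\<^esub> \<ominus>\<^bsub>A\<^esub> (y \<otimes>\<^bsub>A\<^esub> y)"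
    using x y by algebra
  also have "\<dots> = (a \<oplus>\<^bsub>A\<^esub> b) \<oplus>\<^bsub>A\<^esub> (c \<oplus>\<^bsub>A\<^esub> d) \<oplus>\<^bsub>A\<^esub> s3 \<oplus>\<^bsub>A\<^esub> \<ominus>\<^bsub>A\<^esub> (a \<oplus>\<^bsub>A\<^esub> s1) \<oplus>\<^bsub>A\<^esub> \<ominus>\<^bsub>A\<^esub> (d \<oplus>\<^bsub>A\<^esub> s2)"
    unfolding 3(2) sq 1(2) 2(2) a_def d_def s1_def s2_def s3_def ..
  also have "\<dots> = b \<oplus>\<^bsub>A\<^esub> c \<oplus>\<^bsub>A\<^esub> (s3 \<oplus>\<^bsub>A\<^esub> \<ominus>\<^bsub>A\<^esub> s1 \<oplus>\<^bsub>A\<^esub> \<ominus>\<^bsub>A\<^esub> s2)" using m by algebra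
  also have "s3 \<oplus>\<^bsub>A\<^esub> \<ominus>\<^bsub>A\<^esub> s1 \<oplus>\<^bsub>A\<^esub> \<ominus>\<^bsub>A\<^esub> s2 = (g3 \<oplus> \<ominus> g1 \<oplus> \<ominus> g2) \<odot>\<^bsub>A\<^esub> \<one>\<^bsub>A\<^esub>"
    unfolding s1_def s2_def s3_def using 1 2 3 by (simp add: smult_l_distr smult_l_minus)
  finally show ?thesis unfolding polar_def b_def c_def using 1(1) 2(1) 3(1) by blast
qed

text \<open>The common situation to which both assertions are reduced: every stalk is free of rank
  four and has a trace. The assumption \<open>dom\<close> excludes the empty set, where the ring of
  sections is zero.\<close>

locale quaternion_stalks =
  fixes Z :: "('p, 'r) ringed_space" and A :: "('p, 'r, 'a) sheaf_algebra"
  assumes ringed: "ringed_space Z" and alg: "structure_sheaf_algebra Z A" and ft: "finite_type Z A"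
    and dom: "\<And>U. openin (topo Z) U \<Longrightarrow> U \<noteq> {} \<Longrightarrow> domain (sect Z U)"
    and two_top: "\<one>\<^bsub>sect Z (topspace (topo Z))\<^esub> \<oplus>\<^bsub>sect Z (topspace (topo Z))\<^esub> \<one>\<^bsub>sect Z (topspace (topo Z))\<^esub>
      \<in> Units (sect Z (topspace (topo Z)))"
    and stalks: "\<And>z. z \<in> topspace (topo Z) \<Longrightarrow> assoc_algebra (local_ring_at Z z) (stalk_algebra Z A z)"
      "\<And>z. z \<in> topspace (topo Z) \<Longrightarrow> free_of_rank (local_ring_at Z z) (stalk_algebra Z A z) 4"
      "\<And>z. z \<in> topspace (topo Z) \<Longrightarrow> \<exists>tr. quaternion_trace (local_ring_at Z z) (stalk_algebra Z A z) tr"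
begin

sublocale B: ring_sheaf "topo Z" "sect Z" "rest Z"
  using ringed by unfold_locales (simp add: ringed_space_def)

sublocale S: ring_sheaf "topo Z" "asect A" "arest A"
  using alg by unfold_locales (simp add: structure_sheaf_algebra_def)

section \<open>Compatibility of restriction and germs with the algebra structure\<close>

abbreviation opn where "opn \<equiv> openin (topo Z)"
abbreviation Bs where "Bs \<equiv> sect Z"
abbreviation As where "As \<equiv> asect A"
abbreviation br where "br \<equiv> rest Z"
abbreviation ar where "ar \<equiv> arest A"
abbreviation Bz where "Bz \<equiv> local_ring_at Z"
abbreviation Az where "Az \<equiv> stalk_algebra Z A"

lemma alg_sections: "opn U \<Longrightarrow> assoc_alg (Bs U) (As U)"
  using alg unfolding structure_sheaf_algebra_def assoc_algebra_iff by blast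

lemma alg_stalk: "z \<in> topspace (topo Z) \<Longrightarrow> assoc_alg (Bz z) (Az z)"
  using stalks(1) unfolding assoc_algebra_iff .

lemma res_smult:
  "opn U \<Longrightarrow> opn V \<Longrightarrow> V \<subseteq> U \<Longrightarrow> r \<in> carrier (Bs U) \<Longrightarrow> x \<in> carrier (As U) \<Longrightarrow>
    ar U V (r \<odot>\<^bsub>As U\<^esub> x) = br U V r \<odot>\<^bsub>As V\<^esub> ar U V x"
  using alg unfolding structure_sheaf_algebra_def by blast

lemma res_map: "opn U \<Longrightarrow> opn V \<Longrightarrow> V \<subseteq> U \<Longrightarrow> alg_map (Bs U) (As U) (Bs V) (As V) (br U V) (ar U V)"
  unfolding alg_map_def alg_map_axioms_def
  by (simp add: alg_sections B.res_hom S.res_hom res_smult)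

lemma in_topspace: "opn U \<Longrightarrow> z \<in> U \<Longrightarrow> z \<in> topspace (topo Z)"
  using openin_subset by blast

lemma Az_simps: "carrier (Az z) = carrier (S.St z)" "mult (Az z) = mult (S.St z)"
  "add (Az z) = add (S.St z)" "one (Az z) = one (S.St z)" "zero (Az z) = zero (S.St z)"
  by (simp_all add: stalk_algebra_def with_smult_def)

lemma germ_smult:
  assumes U: "opn U" "z \<in> U" and r: "r \<in> carrier (Bs U)" and x: "x \<in> carrier (As U)"
  shows "S.gm z U (r \<odot>\<^bsub>As U\<^esub> x) = B.gm z U r \<odot>\<^bsub>Az z\<^esub> S.gm z U x"
proof -
  have cl: "s \<odot>\<^bsub>As V\<^esub> y \<in> carrier (As V)" if "opn V" "s \<in> carrier (Bs V)" "y \<in> carrier (As V)" for V s y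
  proof -
    interpret assoc_alg "Bs V" "As V" by (rule alg_sections[OF that(1)])
    show ?thesis using that by simp
  qed
  have "(\<Union>(U1, s1)\<in>B.gm z U r. \<Union>(U2, s2)\<in>S.gm z U x.
      S.gm z (U1 \<inter> U2) (br U1 (U1 \<inter> U2) s1 \<odot>\<^bsub>As (U1 \<inter> U2)\<^esub> ar U2 (U1 \<inter> U2) s2)) = S.gm z U (r \<odot>\<^bsub>As U\<^esub> x)"
    by (rule germ_operation[OF B.ring_sheaf S.ring_sheaf S.ring_sheaf, of "\<lambda>U. smult (As U)"])
      (use U r x cl res_smult in auto)
  then show ?thesis by (simp add: stalk_algebra_def with_smult_def)
qed

lemma germ_map:
  assumes "opn U" "z \<in> U"
  shows "alg_map (Bs U) (As U) (Bz z) (Az z) (B.gm z U) (S.gm z U)"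
proof -
  have "S.gm z U \<in> ring_hom (As U) (Az z)"
    using S.germ_hom[OF assms] by (simp add: ring_hom_def Az_simps)
  then show ?thesis
    unfolding alg_map_def alg_map_axioms_def
    using alg_sections[OF assms(1)] alg_stalk[OF in_topspace[OF assms]] B.germ_hom[OF assms] germ_smult[OF assms]
    by simp
qed

lemma two: "opn U \<Longrightarrow> \<one>\<^bsub>Bs U\<^esub> \<oplus>\<^bsub>Bs U\<^esub> \<one>\<^bsub>Bs U\<^esub> \<in> Units (Bs U)"
  by (rule two_unit_hom[OF B.res_hom[OF openin_topspace _ openin_subset] B.ring_F B.ring_F two_top]) auto

lemma two_stalk: 
  assumes "z \<in> topspace (topo Z)"
  shows "\<one>\<^bsub>Bz z\<^esub> \<oplus>\<^bsub>Bz z\<^esub> \<one>\<^bsub>Bz z\<^esub> \<in> Units (Bz z)"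
proof -
  interpret assoc_alg "Bz z" "Az z" by (rule alg_stalk[OF assms])
  show ?thesis
    by (rule two_unit_hom[OF B.germ_hom[OF openin_topspace assms] B.ring_F[OF openin_topspace] R.ring_axioms two_top])
qed

lemma domain_stalk:
  assumes "z \<in> topspace (topo Z)"
  shows "domain (Bz z)"
proof -
  interpret assoc_alg "Bz z" "Az z" by (rule alg_stalk[OF assms])
  show ?thesis by (rule B.domain_stalk[OF dom R.is_cring assms])
qed

text \<open>Surjectivity, as a map of sheaves, of the map from four copies of the structure sheaf
  given by \<open>e\<close>. Coefficients are required only locally; they become global once they
  are known to be unique.\<close>

definition generates :: "'p set \<Rightarrow> (nat \<Rightarrow> 'a) \<Rightarrow> bool" where
  "generates W e \<longleftrightarrow> opn W \<and> e \<in> {..<4} \<rightarrow> carrier (As W) \<and>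
    (\<forall>V x y. opn V \<longrightarrow> V \<subseteq> W \<longrightarrow> x \<in> carrier (As V) \<longrightarrow> y \<in> V \<longrightarrow>
      (\<exists>Y c. opn Y \<and> y \<in> Y \<and> Y \<subseteq> V \<and> c \<in> {..<4} \<rightarrow> carrier (Bs Y) \<and>
        ar V Y x = (\<Oplus>\<^bsub>As Y\<^esub>i\<in>{..<4}. c i \<odot>\<^bsub>As Y\<^esub> ar W Y (e i))))"

lemma ar_family_closed:
  "opn W \<Longrightarrow> e \<in> I \<rightarrow> carrier (As W) \<Longrightarrow> opn V \<Longrightarrow> V \<subseteq> W \<Longrightarrow> (\<lambda>i. ar W V (e i)) \<in> I \<rightarrow> carrier (As V)"
  by (auto intro!: S.res_closed)

lemma br_family_closed:
  "opn W \<Longrightarrow> e \<in> I \<rightarrow> carrier (Bs W) \<Longrightarrow> opn V \<Longrightarrow> V \<subseteq> W \<Longrightarrow> (\<lambda>i. br W V (e i)) \<in> I \<rightarrow> carrier (Bs V)"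
  by (auto intro!: B.res_closed)

lemma ar_lincomb:
  assumes V: "opn V" "opn Y" "Y \<subseteq> V" and W: "opn W" "V \<subseteq> W"
    and c: "c \<in> I \<rightarrow> carrier (Bs V)" and e: "e \<in> I \<rightarrow> carrier (As W)"
  shows "ar V Y (\<Oplus>\<^bsub>As V\<^esub>i\<in>I. c i \<odot>\<^bsub>As V\<^esub> ar W V (e i)) =
    (\<Oplus>\<^bsub>As Y\<^esub>i\<in>I. br V Y (c i) \<odot>\<^bsub>As Y\<^esub> ar W Y (e i))"
proof -
  interpret alg_map "Bs V" "As V" "Bs Y" "As Y" "br V Y" "ar V Y" by (rule res_map[OF V])
  have "ar V Y (\<Oplus>\<^bsub>As V\<^esub>i\<in>I. c i \<odot>\<^bsub>As V\<^esub> ar W V (e i)) =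
      (\<Oplus>\<^bsub>As Y\<^esub>i\<in>I. br V Y (c i) \<odot>\<^bsub>As Y\<^esub> ar V Y (ar W V (e i)))"
    by (rule g_lincomb[OF c ar_family_closed[OF W(1) e V(1) W(2)]])
  also have "\<dots> = (\<Oplus>\<^bsub>As Y\<^esub>i\<in>I. br V Y (c i) \<odot>\<^bsub>As Y\<^esub> ar W Y (e i))"
  proof (rule B.M.finsum_cong')
    have "ar W Y (e i) \<in> carrier (As Y)" if "i \<in> I" for i
      using ar_family_closed[OF W(1) e V(2)] V W that by auto
    then show "(\<lambda>i. br V Y (c i) \<odot>\<^bsub>As Y\<^esub> ar W Y (e i)) \<in> I \<rightarrow> carrier (As Y)"
      using c f_simps(1) by auto
    show "br V Y (c i) \<odot>\<^bsub>As Y\<^esub> ar V Y (ar W V (e i)) = br V Y (c i) \<odot>\<^bsub>As Y\<^esub> ar W Y (e i)" if "i \<in> I" for i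
    proof -
      have "e i \<in> carrier (As W)" using e that by auto
      then show ?thesis using S.res_res[OF W(1) V(1,2,3) W(2)] by simp
    qed
  qed simp
  finally show ?thesis .
qed

text \<open>The four germs generate the stalk at \<open>y\<close>, which is free of rank four over a
  domain, so they form a basis by \<open>generators_are_basis\<close>. This holds at every point of
  \<open>W\<close>, not just at the point where the generators were found.\<close>

lemma stalk_basis:
  assumes g: "generates W e" and y: "y \<in> W"
  shows "is_basis (Bz y) (Az y) 4 (\<lambda>i. S.gm y W (e i))"
proof -
  have W: "opn W" "e \<in> {..<4} \<rightarrow> carrier (As W)" using g by (auto simp: generates_def)
  note yt = in_topspace[OF W(1) y]
  interpret z: assoc_alg "Bz y" "Az y" by (rule alg_stalk[OF yt])
  obtain f where f: "is_basis (Bz y) (Az y) 4 f" using stalks(2)[OF yt] by (auto simp: free_of_rank_def)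
  have ec: "(\<lambda>i. S.gm y W (e i)) \<in> {..<4} \<rightarrow> carrier (Az y)"
    using W y S.germ_closed by (auto simp: Az_simps)
  show ?thesis
  proof (rule z.generators_are_basis[OF domain_stalk[OF yt] f ec])
    fix a assume "a \<in> carrier (Az y)"
    then obtain U x where U: "opn U" "y \<in> U" "x \<in> carrier (As U)" "a = S.gm y U x"
      unfolding Az_simps by (rule S.stalk_carrierE)
    let ?V = "U \<inter> W"
    have V: "opn ?V" "y \<in> ?V" "?V \<subseteq> W" "?V \<subseteq> U" using U W y by auto
    have xV: "ar U ?V x \<in> carrier (As ?V)" by (rule S.res_closed[OF U(1) V(1,4) U(3)])
    obtain Y c where Y: "opn Y" "y \<in> Y" "Y \<subseteq> ?V" and c: "c \<in> {..<4} \<rightarrow> carrier (Bs Y)"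
      and eq: "ar ?V Y (ar U ?V x) = (\<Oplus>\<^bsub>As Y\<^esub>i\<in>{..<4}. c i \<odot>\<^bsub>As Y\<^esub> ar W Y (e i))"
      using g V xV unfolding generates_def by meson
    have YW: "Y \<subseteq> W" using Y by blast
    interpret m: alg_map "Bs Y" "As Y" "Bz y" "Az y" "B.gm y Y" "S.gm y Y" by (rule germ_map[OF Y(1,2)])
    have ge: "S.gm y Y (ar W Y (e i)) = S.gm y W (e i)" if "i < 4" for i
      using S.germ_res[OF W(1) Y(1,2) YW] W(2) that by auto
    have "a = S.gm y Y (ar ?V Y (ar U ?V x))"
      using S.germ_res[OF V(1) Y(1,2,3) xV] S.germ_res[OF U(1) V(1,2,4) U(3)] U(4) by simp
    also have "\<dots> = (\<Oplus>\<^bsub>Az y\<^esub>i\<in>{..<4}. B.gm y Y (c i) \<odot>\<^bsub>Az y\<^esub> S.gm y Y (ar W Y (e i)))"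
      unfolding eq by (rule m.g_lincomb[OF c ar_family_closed[OF W Y(1) YW]])
    also have "\<dots> = (\<Oplus>\<^bsub>Az y\<^esub>i\<in>{..<4}. B.gm y Y (c i) \<odot>\<^bsub>Az y\<^esub> S.gm y W (e i))"
      by (rule z.M.finsum_cong') (use c ec m.f_simps(1) in \<open>auto simp: ge Pi_iff\<close>)
    finally have "a = (\<Oplus>\<^bsub>Az y\<^esub>i\<in>{..<4}. B.gm y Y (c i) \<odot>\<^bsub>Az y\<^esub> S.gm y W (e i))" .
    moreover have "(\<lambda>i. B.gm y Y (c i)) \<in> {..<4} \<rightarrow> carrier (Bz y)" using c m.f_simps(1) by auto
    ultimately show "\<exists>c\<in>{..<4} \<rightarrow> carrier (Bz y). a = (\<Oplus>\<^bsub>Az y\<^esub>i\<in>{..<4}. c i \<odot>\<^bsub>Az y\<^esub> S.gm y W (e i))"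
      by (rule bexI)
  qed
qed

text \<open>The germs of the coefficients agree at every point, because the germs of
  \<open>e\<close> form a basis there; hence the sections agree.\<close>

lemma coefficients_unique:
  assumes g: "generates W e" and V: "opn V" "V \<subseteq> W"
    and c: "c \<in> {..<4} \<rightarrow> carrier (Bs V)" and d: "d \<in> {..<4} \<rightarrow> carrier (Bs V)"
    and eq: "(\<Oplus>\<^bsub>As V\<^esub>i\<in>{..<4}. c i \<odot>\<^bsub>As V\<^esub> ar W V (e i)) = (\<Oplus>\<^bsub>As V\<^esub>i\<in>{..<4}. d i \<odot>\<^bsub>As V\<^esub> ar W V (e i))"
    and i: "i < 4"
  shows "c i = d i"
proof (rule B.locality[OF V(1)])
  have W: "opn W" "e \<in> {..<4} \<rightarrow> carrier (As W)" using g by (auto simp: generates_def)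
  show ci: "c i \<in> carrier (Bs V)" "d i \<in> carrier (Bs V)" using c d i by auto
  fix y assume y: "y \<in> V"
  then have yW: "y \<in> W" using V by blast
  interpret m: alg_map "Bs V" "As V" "Bz y" "Az y" "B.gm y V" "S.gm y V" by (rule germ_map[OF V(1) y])
  have ge: "S.gm y V (ar W V (e i)) = S.gm y W (e i)" "S.gm y W (e i) \<in> carrier (Az y)" if "i < 4" for i
    using S.germ_res[OF W(1) V(1) y V(2)] W that S.germ_closed[OF W(1) yW] by (auto simp: Az_simps)
  have gl: "S.gm y V (\<Oplus>\<^bsub>As V\<^esub>i\<in>{..<4}. k i \<odot>\<^bsub>As V\<^esub> ar W V (e i)) =
      (\<Oplus>\<^bsub>Az y\<^esub>i\<in>{..<4}. B.gm y V (k i) \<odot>\<^bsub>Az y\<^esub> S.gm y W (e i))"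
    if k: "k \<in> {..<4} \<rightarrow> carrier (Bs V)" for k
  proof -
    have "S.gm y V (\<Oplus>\<^bsub>As V\<^esub>i\<in>{..<4}. k i \<odot>\<^bsub>As V\<^esub> ar W V (e i)) =
        (\<Oplus>\<^bsub>Az y\<^esub>i\<in>{..<4}. B.gm y V (k i) \<odot>\<^bsub>Az y\<^esub> S.gm y V (ar W V (e i)))"
      by (rule m.g_lincomb[OF k ar_family_closed[OF W V]])
    also have "\<dots> = (\<Oplus>\<^bsub>Az y\<^esub>i\<in>{..<4}. B.gm y V (k i) \<odot>\<^bsub>Az y\<^esub> S.gm y W (e i))"
      by (rule m.B.M.finsum_cong') (use k m.f_simps(1) ge in \<open>auto simp: Pi_iff\<close>)
    finally show ?thesis .
  qed
  have "B.gm y V (c i) = B.gm y V (d i)"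
  proof (rule m.B.is_basisD(3)[OF stalk_basis[OF g yW] _ _ _ i])
    show "(\<lambda>i. B.gm y V (c i)) \<in> {..<4} \<rightarrow> carrier (Bz y)" "(\<lambda>i. B.gm y V (d i)) \<in> {..<4} \<rightarrow> carrier (Bz y)"
      using c d m.f_simps(1) by auto
    show "(\<Oplus>\<^bsub>Az y\<^esub>i\<in>{..<4}. B.gm y V (c i) \<odot>\<^bsub>Az y\<^esub> S.gm y W (e i)) =
        (\<Oplus>\<^bsub>Az y\<^esub>i\<in>{..<4}. B.gm y V (d i) \<odot>\<^bsub>Az y\<^esub> S.gm y W (e i))"
      unfolding gl[OF c, symmetric] gl[OF d, symmetric] eq ..
  qed
  then show "\<exists>Y. opn Y \<and> y \<in> Y \<and> Y \<subseteq> V \<and> br V Y (c i) = br V Y (d i)"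
    using B.germ_eq_iff[OF V(1) y ci(1) V(1) y ci(2)] by auto
qed

text \<open>Local coefficients of a section are unique, so each of the four can be glued
  separately.\<close>

lemma sections_basis:
  assumes g: "generates W e" and V: "opn V" "V \<subseteq> W"
  shows "is_basis (Bs V) (As V) 4 (\<lambda>i. ar W V (e i))"
proof -
  have W: "opn W" "e \<in> {..<4} \<rightarrow> carrier (As W)" using g by (auto simp: generates_def)
  interpret V: assoc_alg "Bs V" "As V" by (rule alg_sections[OF V(1)])
  have eV: "(\<lambda>i. ar W V (e i)) \<in> {..<4} \<rightarrow> carrier (As V)" by (rule ar_family_closed[OF W V])
  show ?thesis
  proof (rule V.is_basisI[OF eV])
    fix c i assume c: "c \<in> {..<4} \<rightarrow> carrier (Bs V)" and "i < (4::nat)"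
      and eq: "(\<Oplus>\<^bsub>As V\<^esub>i\<in>{..<4}. c i \<odot>\<^bsub>As V\<^esub> ar W V (e i)) = \<zero>\<^bsub>As V\<^esub>"
    have z: "(\<Oplus>\<^bsub>As V\<^esub>i\<in>{..<4}. \<zero>\<^bsub>Bs V\<^esub> \<odot>\<^bsub>As V\<^esub> ar W V (e i)) = \<zero>\<^bsub>As V\<^esub>"
      by (rule V.lincomb_zero[OF _ eV]) simp
    show "c i = \<zero>\<^bsub>Bs V\<^esub>"
      by (rule coefficients_unique[OF g V c _ trans[OF eq z[symmetric]] \<open>i < 4\<close>]) simp
  next
    fix x assume x: "x \<in> carrier (As V)"
    \<comment> \<open>The property glued for a fixed index \<open>i\<close> is that of being the
      \<open>i\<close>-th entry of a coefficient family representing \<open>x\<close>.\<close>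
    define rep where "rep Y c \<longleftrightarrow> c \<in> {..<4} \<rightarrow> carrier (Bs Y) \<and>
      ar V Y x = (\<Oplus>\<^bsub>As Y\<^esub>i\<in>{..<4}. c i \<odot>\<^bsub>As Y\<^esub> ar W Y (e i))" for Y c
    have rep_res: "rep T (\<lambda>j. br Y T (c j))" if "opn Y" "opn T" "T \<subseteq> Y" "Y \<subseteq> V" "rep Y c" for Y T c
    proof -
      have c: "c \<in> {..<4} \<rightarrow> carrier (Bs Y)" and eq: "ar V Y x = (\<Oplus>\<^bsub>As Y\<^esub>i\<in>{..<4}. c i \<odot>\<^bsub>As Y\<^esub> ar W Y (e i))"
        using that(5) by (auto simp: rep_def)
      have YW: "Y \<subseteq> W" using that V by blast
      have "ar V T x = ar Y T (ar V Y x)" using S.res_res[OF V(1) that(1,2,3,4) x] ..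
      also have "\<dots> = (\<Oplus>\<^bsub>As T\<^esub>i\<in>{..<4}. br Y T (c i) \<odot>\<^bsub>As T\<^esub> ar W T (e i))"
        unfolding eq by (rule ar_lincomb[OF that(1,2,3) W(1) YW c W(2)])
      finally show ?thesis using br_family_closed[OF that(1) c that(2,3)] by (simp add: rep_def)
    qed
    have rep_uniq: "c i = d i" if "opn Y" "Y \<subseteq> V" "rep Y c" "rep Y d" "i < 4" for Y c d i
      by (rule coefficients_unique[OF g that(1) _ _ _ _ that(5)]) (use that V in \<open>auto simp: rep_def\<close>)
    have rep_loc: "\<exists>Y. opn Y \<and> y \<in> Y \<and> Y \<subseteq> V \<and> (\<exists>c. rep Y c)" if "y \<in> V" for y
      using g V x that unfolding generates_def rep_def by meson
    have "\<exists>s\<in>carrier (Bs V). \<forall>Y. opn Y \<longrightarrow> Y \<subseteq> V \<longrightarrow> (\<forall>t\<in>carrier (Bs Y). (\<exists>c. rep Y c \<and> c i = t) \<longrightarrow> br V Y s = t)"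
      if i: "i < 4" for i
    proof (rule B.glue[OF V(1)])
      fix Y T s assume "opn Y" "opn T" "T \<subseteq> Y" "Y \<subseteq> V" "\<exists>c. rep Y c \<and> c i = s"
      then show "\<exists>c. rep T c \<and> c i = br Y T s" using rep_res by blast
    next
      fix Y s t assume "opn Y" "Y \<subseteq> V" "\<exists>c. rep Y c \<and> c i = s" "\<exists>c. rep Y c \<and> c i = t"
      then show "s = t" using rep_uniq i by blast
    next
      fix y assume "y \<in> V"
      from rep_loc[OF this] obtain Y c where Y: "opn Y" "y \<in> Y" "Y \<subseteq> V" "rep Y c" by blast
      moreover have "c i \<in> carrier (Bs Y)" using Y(4) i by (auto simp: rep_def)
      ultimately show "\<exists>Y. opn Y \<and> y \<in> Y \<and> Y \<subseteq> V \<and> (\<exists>s\<in>carrier (Bs Y). \<exists>c. rep Y c \<and> c i = s)" by blast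
    qed
    then have "\<forall>i\<in>{..<4}. \<exists>s. s \<in> carrier (Bs V) \<and>
        (\<forall>Y. opn Y \<longrightarrow> Y \<subseteq> V \<longrightarrow> (\<forall>t\<in>carrier (Bs Y). (\<exists>c. rep Y c \<and> c i = t) \<longrightarrow> br V Y s = t))"
      by (simp add: Bex_def)
    from bchoice[OF this] obtain s where s: "\<forall>i\<in>{..<4::nat}. s i \<in> carrier (Bs V) \<and>
        (\<forall>Y. opn Y \<longrightarrow> Y \<subseteq> V \<longrightarrow> (\<forall>t\<in>carrier (Bs Y). (\<exists>c. rep Y c \<and> c i = t) \<longrightarrow> br V Y (s i) = t))" ..
    have sc: "s \<in> {..<4} \<rightarrow> carrier (Bs V)" using s by blast
    have "x = (\<Oplus>\<^bsub>As V\<^esub>i\<in>{..<4}. s i \<odot>\<^bsub>As V\<^esub> ar W V (e i))"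
    proof (rule S.locality[OF V(1) x V.lincomb_closed[OF sc eV]])
      fix y assume "y \<in> V"
      from rep_loc[OF this] obtain Y c where Y: "opn Y" "y \<in> Y" "Y \<subseteq> V" "rep Y c" by blast
      interpret Y: assoc_alg "Bs Y" "As Y" by (rule alg_sections[OF Y(1)])
      have YW: "Y \<subseteq> W" using Y V by blast
      have c: "c \<in> {..<4} \<rightarrow> carrier (Bs Y)" and eq: "ar V Y x = (\<Oplus>\<^bsub>As Y\<^esub>i\<in>{..<4}. c i \<odot>\<^bsub>As Y\<^esub> ar W Y (e i))"
        using Y(4) by (auto simp: rep_def)
      have si: "br V Y (s i) = c i" if "i < 4" for i
      proof -
        have "c i \<in> carrier (Bs Y)" using c that by auto
        then show ?thesis using s Y that by blast
      qed
      have "ar V Y (\<Oplus>\<^bsub>As V\<^esub>i\<in>{..<4}. s i \<odot>\<^bsub>As V\<^esub> ar W V (e i)) =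
          (\<Oplus>\<^bsub>As Y\<^esub>i\<in>{..<4}. br V Y (s i) \<odot>\<^bsub>As Y\<^esub> ar W Y (e i))"
        by (rule ar_lincomb[OF V(1) Y(1,3) W(1) V(2) sc W(2)])
      also have "\<dots> = ar V Y x"
        unfolding eq using ar_family_closed[OF W Y(1) YW] c
        by (intro Y.M.finsum_cong') (auto simp: si Pi_iff)
      finally show "\<exists>Y. opn Y \<and> y \<in> Y \<and> Y \<subseteq> V \<and>
          ar V Y x = ar V Y (\<Oplus>\<^bsub>As V\<^esub>i\<in>{..<4}. s i \<odot>\<^bsub>As V\<^esub> ar W V (e i))" using Y by metis
    qed
    with sc show "\<exists>c\<in>{..<4} \<rightarrow> carrier (Bs V). x = (\<Oplus>\<^bsub>As V\<^esub>i\<in>{..<4}. c i \<odot>\<^bsub>As V\<^esub> ar W V (e i))"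
      by (intro bexI[of _ s])
  qed
qed

text \<open>Traces are demanded on every smaller open set, with values on the generators restricted
  from the same \<open>t\<close>. This common origin is what makes traces on nested sets
  comparable.\<close>

definition trace_chart :: "'p set \<Rightarrow> (nat \<Rightarrow> 'a) \<Rightarrow> (nat \<Rightarrow> 'r) \<Rightarrow> bool" where
  "trace_chart W e t \<longleftrightarrow> generates W e \<and> t \<in> {..<4} \<rightarrow> carrier (Bs W) \<and>
    (\<forall>V. opn V \<longrightarrow> V \<subseteq> W \<longrightarrow> (\<exists>tr. quaternion_trace (Bs V) (As V) tr \<and>
      (\<forall>i<4. tr (ar W V (e i)) = br W V (t i))))"

text \<open>Local expressions in the finite-type generators \<open>s\<close> are combined with those
  of \<open>s\<close> in \<open>e\<close>: the span of \<open>e\<close> is a submodule containing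
  all \<open>s j\<close>.\<close>

lemma generates_of_generators:
  assumes U: "opn U" and s: "s \<in> {..<n::nat} \<rightarrow> carrier (As U)"
    and gen: "\<And>V x y. opn V \<Longrightarrow> V \<subseteq> U \<Longrightarrow> x \<in> carrier (As V) \<Longrightarrow> y \<in> V \<Longrightarrow>
      \<exists>W c. opn W \<and> y \<in> W \<and> W \<subseteq> V \<and> c \<in> {..<n} \<rightarrow> carrier (Bs W) \<and>
        ar V W x = (\<Oplus>\<^bsub>As W\<^esub>i\<in>{..<n}. c i \<odot>\<^bsub>As W\<^esub> ar U W (s i))"
    and W: "opn W" "W \<subseteq> U" and e: "e \<in> {..<4} \<rightarrow> carrier (As W)"
    and k: "\<And>j. j < n \<Longrightarrow> k j \<in> {..<4} \<rightarrow> carrier (Bs W)"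
      "\<And>j. j < n \<Longrightarrow> ar U W (s j) = (\<Oplus>\<^bsub>As W\<^esub>i\<in>{..<4}. k j i \<odot>\<^bsub>As W\<^esub> e i)"
  shows "generates W e"
  unfolding generates_def
proof (intro conjI W e allI impI)
  fix V x y assume V: "opn V" "V \<subseteq> W" and x: "x \<in> carrier (As V)" and y: "y \<in> V"
  have VU: "V \<subseteq> U" using V W by blast
  from gen[OF V(1) VU x y] obtain Y c where Y: "opn Y" "y \<in> Y" "Y \<subseteq> V" and c: "c \<in> {..<n} \<rightarrow> carrier (Bs Y)"
    and eq: "ar V Y x = (\<Oplus>\<^bsub>As Y\<^esub>i\<in>{..<n}. c i \<odot>\<^bsub>As Y\<^esub> ar U Y (s i))" by blast
  have YW: "Y \<subseteq> W" using Y V by blast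
  interpret Y: assoc_alg "Bs Y" "As Y" by (rule alg_sections[OF Y(1)])
  let ?e = "\<lambda>i. ar W Y (e i)"
  have eY: "?e \<in> {..<4} \<rightarrow> carrier (As Y)" by (rule ar_family_closed[OF W(1) e Y(1) YW])
  have WW: "ar W W (e i) = e i" if "i < 4" for i using S.res_id[OF W(1)] e that by auto
  have "ar U Y (s j) \<in> Y.combinations ?e 4" if "j \<in> {..<n}" for j
  proof -
    have j: "j < n" "s j \<in> carrier (As U)" using s that by auto
    interpret W: assoc_alg "Bs W" "As W" by (rule alg_sections[OF W(1)])
    have "ar U Y (s j) = ar W Y (ar U W (s j))" using S.res_res[OF U W(1) Y(1) YW W(2) j(2)] ..
    also have "\<dots> = ar W Y (\<Oplus>\<^bsub>As W\<^esub>i\<in>{..<4}. k j i \<odot>\<^bsub>As W\<^esub> ar W W (e i))"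
      unfolding k(2)[OF j(1)] using k(1)[OF j(1)] e
      by (intro arg_cong[of _ _ "ar W Y"] W.M.finsum_cong') (auto simp: WW Pi_iff)
    also have "\<dots> = (\<Oplus>\<^bsub>As Y\<^esub>i\<in>{..<4}. br W Y (k j i) \<odot>\<^bsub>As Y\<^esub> ar W Y (e i))"
      by (rule ar_lincomb[OF W(1) Y(1) YW W(1) subset_refl k(1)[OF j(1)] e])
    finally show ?thesis
      unfolding Y.combinations_def
      by (rule image_eqI[where x = "\<lambda>i. br W Y (k j i)"]) (rule br_family_closed[OF W(1) k(1)[OF j(1)] Y(1) YW])
  qed
  then have "ar V Y x \<in> Y.combinations ?e 4"
    unfolding eq by (intro Y.submodule_lincomb[OF Y.submodule_combinations[OF eY] _ c]) auto
  then obtain d where "d \<in> {..<4} \<rightarrow> carrier (Bs Y)" "ar V Y x = (\<Oplus>\<^bsub>As Y\<^esub>i\<in>{..<4}. d i \<odot>\<^bsub>As Y\<^esub> ?e i)"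
    unfolding Y.combinations_def by (elim imageE)
  then show "\<exists>Y c. opn Y \<and> y \<in> Y \<and> Y \<subseteq> V \<and> c \<in> {..<4} \<rightarrow> carrier (Bs Y) \<and>
      ar V Y x = (\<Oplus>\<^bsub>As Y\<^esub>i\<in>{..<4}. c i \<odot>\<^bsub>As Y\<^esub> ar W Y (e i))"
    using Y by (intro exI[of _ Y] exI[of _ d]) simp
qed

text \<open>The hypotheses of \<open>quaternion_trace_of_basis\<close>, and the expressions of the
  finite-type generators in the basis, are finitely many identities in the stalk at
  \<open>z\<close>. They are lifted to sections and hold on some neighbourhood, where the sections
  then form a basis by \<open>sections_basis\<close>.\<close>

lemma exists_trace_chart:
  assumes z: "z \<in> topspace (topo Z)"
  shows "\<exists>W e t. z \<in> W \<and> trace_chart W e t"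
proof -
  interpret z: assoc_alg "Bz z" "Az z" by (rule alg_stalk[OF z])
  obtain U n s where U: "opn U" "z \<in> U" and s: "s \<in> {..<n::nat} \<rightarrow> carrier (As U)"
    and gen: "\<And>V x y. opn V \<Longrightarrow> V \<subseteq> U \<Longrightarrow> x \<in> carrier (As V) \<Longrightarrow> y \<in> V \<Longrightarrow>
      \<exists>W c. opn W \<and> y \<in> W \<and> W \<subseteq> V \<and> c \<in> {..<n} \<rightarrow> carrier (Bs W) \<and>
        ar V W x = (\<Oplus>\<^bsub>As W\<^esub>i\<in>{..<n}. c i \<odot>\<^bsub>As W\<^esub> ar U W (s i))"
    using ft z unfolding finite_type_def by meson
  obtain f where f: "is_basis (Bz z) (Az z) 4 f" using stalks(2)[OF z] by (auto simp: free_of_rank_def)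
  note fz = z.is_basisD(1)[OF f]
  obtain tr where tr: "quaternion_trace (Bz z) (Az z) tr" using stalks(3)[OF z] by blast
  note trD = z.quaternion_traceD[OF tr two_stalk[OF z]]
  have trc: "tr x \<in> carrier (Bz z)" if "x \<in> carrier (Az z)" for x
    using trD(1) that by (auto simp: linear_map_regular_iff)
  have tr_add: "tr (x \<oplus>\<^bsub>Az z\<^esub> y) = tr x \<oplus>\<^bsub>Bz z\<^esub> tr y" if "x \<in> carrier (Az z)" "y \<in> carrier (Az z)" for x y
    using trD(1) that by (auto simp: linear_map_regular_iff)
  have fc: "f i \<in> carrier (Az z)" if "i < 4" for i using fz that by auto
  have polar: "z.polar (tr x) x (tr y) y" if x: "x \<in> carrier (Az z)" and y: "y \<in> carrier (Az z)" for x y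
    by (rule z.polar_of_trace[OF tr two_stalk[OF z] x y])
  text \<open>All the data at \<open>z\<close> involve finitely many germs.\<close>
  have "\<exists>k. \<forall>j\<in>{..<n}. k j \<in> {..<4} \<rightarrow> carrier (Bz z) \<and>
      S.gm z U (s j) = (\<Oplus>\<^bsub>Az z\<^esub>i\<in>{..<4}. k j i \<odot>\<^bsub>Az z\<^esub> f i)"
  proof (rule bchoice, rule ballI)
    fix j assume "j \<in> {..<n}"
    then have "S.gm z U (s j) \<in> carrier (Az z)" using s S.germ_closed[OF U] by (auto simp: Az_simps)
    from z.is_basisD(2)[OF f this]
    show "\<exists>k. k \<in> {..<4} \<rightarrow> carrier (Bz z) \<and> S.gm z U (s j) = (\<Oplus>\<^bsub>Az z\<^esub>i\<in>{..<4}. k i \<odot>\<^bsub>Az z\<^esub> f i)"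
      unfolding Bex_def .
  qed
  then obtain k where k: "\<And>j. j < n \<Longrightarrow> k j \<in> {..<4} \<rightarrow> carrier (Bz z)"
    "\<And>j. j < n \<Longrightarrow> S.gm z U (s j) = (\<Oplus>\<^bsub>Az z\<^esub>i\<in>{..<4}. k j i \<odot>\<^bsub>Az z\<^esub> f i)" by auto
  have "\<exists>g. \<forall>p\<in>{..<4} \<times> {..<4}. g p \<in> carrier (Bz z) \<and>
      f (fst p) \<otimes>\<^bsub>Az z\<^esub> f (snd p) \<oplus>\<^bsub>Az z\<^esub> f (snd p) \<otimes>\<^bsub>Az z\<^esub> f (fst p) =
      tr (f (fst p)) \<odot>\<^bsub>Az z\<^esub> f (snd p) \<oplus>\<^bsub>Az z\<^esub> tr (f (snd p)) \<odot>\<^bsub>Az z\<^esub> f (fst p) \<oplus>\<^bsub>Az z\<^esub> g p \<odot>\<^bsub>Az z\<^esub> \<one>\<^bsub>Az z\<^esub>"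
  proof (rule bchoice, rule ballI)
    fix p :: "nat \<times> nat" assume "p \<in> {..<4} \<times> {..<4}"
    then have "z.polar (tr (f (fst p))) (f (fst p)) (tr (f (snd p))) (f (snd p))"
      using fc by (intro polar) auto
    then show "\<exists>r. r \<in> carrier (Bz z) \<and>
      f (fst p) \<otimes>\<^bsub>Az z\<^esub> f (snd p) \<oplus>\<^bsub>Az z\<^esub> f (snd p) \<otimes>\<^bsub>Az z\<^esub> f (fst p) =
      tr (f (fst p)) \<odot>\<^bsub>Az z\<^esub> f (snd p) \<oplus>\<^bsub>Az z\<^esub> tr (f (snd p)) \<odot>\<^bsub>Az z\<^esub> f (fst p) \<oplus>\<^bsub>Az z\<^esub> r \<odot>\<^bsub>Az z\<^esub> \<one>\<^bsub>Az z\<^esub>"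
      unfolding z.polar_def Bex_def .
  qed
  then obtain g where g': "\<forall>p\<in>{..<4} \<times> {..<4}. g p \<in> carrier (Bz z) \<and>
      f (fst p) \<otimes>\<^bsub>Az z\<^esub> f (snd p) \<oplus>\<^bsub>Az z\<^esub> f (snd p) \<otimes>\<^bsub>Az z\<^esub> f (fst p) =
      tr (f (fst p)) \<odot>\<^bsub>Az z\<^esub> f (snd p) \<oplus>\<^bsub>Az z\<^esub> tr (f (snd p)) \<odot>\<^bsub>Az z\<^esub> f (fst p) \<oplus>\<^bsub>Az z\<^esub> g p \<odot>\<^bsub>Az z\<^esub> \<one>\<^bsub>Az z\<^esub>"
    by (elim exE)
  have g: "g (i, j) \<in> carrier (Bz z)"
    "f i \<otimes>\<^bsub>Az z\<^esub> f j \<oplus>\<^bsub>Az z\<^esub> f j \<otimes>\<^bsub>Az z\<^esub> f i =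
      tr (f i) \<odot>\<^bsub>Az z\<^esub> f j \<oplus>\<^bsub>Az z\<^esub> tr (f j) \<odot>\<^bsub>Az z\<^esub> f i \<oplus>\<^bsub>Az z\<^esub> g (i, j) \<odot>\<^bsub>Az z\<^esub> \<one>\<^bsub>Az z\<^esub>"
    if "i < 4" "j < 4" for i j
    using bspec[OF g', of "(i, j)"] that by simp_all
  obtain u where u: "u \<in> {..<4} \<rightarrow> carrier (Bz z)" "\<one>\<^bsub>Az z\<^esub> = (\<Oplus>\<^bsub>Az z\<^esub>i\<in>{..<4}. u i \<odot>\<^bsub>Az z\<^esub> f i)"
    using z.is_basisD(2)[OF f z.A.one_closed] by (elim bexE)
  have ut: "(\<Oplus>\<^bsub>Bz z\<^esub>i\<in>{..<4}. u i \<otimes>\<^bsub>Bz z\<^esub> tr (f i)) = \<one>\<^bsub>Bz z\<^esub> \<oplus>\<^bsub>Bz z\<^esub> \<one>\<^bsub>Bz z\<^esub>"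
    using z.linear_map_lincomb[OF trD(1) finite_lessThan u(1) fz] trD(2) u(2) by simp
  obtain U1 e1 where U1: "opn U1" "z \<in> U1" "U1 \<subseteq> U" "e1 \<in> {..<4::nat} \<rightarrow> carrier (As U1)"
    "\<forall>i\<in>{..<4}. f i = S.gm z U1 (e1 i)"
    using S.lift_family[of "{..<4::nat}" f z U] fz U by (auto simp: Az_simps)
  \<comment> \<open>All scalars are packed into one family over a sum type, so that they are lifted
    to a common neighbourhood at once. In order: coefficients \<open>k\<close> of the generators,
    scalars \<open>g\<close> of the polar relations, traces of the basis, coordinates
    \<open>u\<close> of the unit.\<close>
  define x where "x = case_sum (\<lambda>(j, i). k j i) (case_sum g (case_sum (\<lambda>i. tr (f i)) u))"
  let ?I = "({..<n} \<times> {..<4}) <+> (({..<4} \<times> {..<4}) <+> ({..<4::nat} <+> {..<4::nat}))"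
  have xI: "x \<in> ?I \<rightarrow> carrier (Bz z)"
    using k(1) g(1) trc fc u(1) by (auto simp: x_def Pi_iff)
  obtain U2 d where U2: "opn U2" "z \<in> U2" "U2 \<subseteq> U1" "d \<in> ?I \<rightarrow> carrier (Bs U2)"
    "\<forall>i\<in>?I. x i = B.gm z U2 (d i)"
    using B.lift_family[OF _ xI U1(1,2)] by auto
  define K G T Y where "K = (\<lambda>j i. d (Inl (j, i)))" and "G = (\<lambda>i j. d (Inr (Inl (i, j))))"
    and "T = (\<lambda>i. d (Inr (Inr (Inl i))))" and "Y = (\<lambda>i. d (Inr (Inr (Inr i))))"
  have d: "d i \<in> carrier (Bs U2) \<and> x i = B.gm z U2 (d i)" if "i \<in> ?I" for i
    using U2(4,5) that by blast
  have KGTY: "\<And>i j. j < n \<Longrightarrow> i < 4 \<Longrightarrow> K j i \<in> carrier (Bs U2) \<and> k j i = B.gm z U2 (K j i)"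
    "\<And>i j. i < 4 \<Longrightarrow> j < 4 \<Longrightarrow> G i j \<in> carrier (Bs U2) \<and> g (i, j) = B.gm z U2 (G i j)"
    "\<And>i. i < 4 \<Longrightarrow> T i \<in> carrier (Bs U2) \<and> tr (f i) = B.gm z U2 (T i)"
    "\<And>i. i < 4 \<Longrightarrow> Y i \<in> carrier (Bs U2) \<and> u i = B.gm z U2 (Y i)"
    subgoal for i j using d[OF InlI, of "(j, i)"] by (simp add: K_def x_def)
    subgoal for i j using d[OF InrI[OF InlI], of "(i, j)"] by (simp add: G_def x_def)
    subgoal for i using d[OF InrI[OF InrI[OF InlI]], of i] by (simp add: T_def x_def)
    subgoal for i using d[OF InrI[OF InrI[OF InrI]], of i] by (simp add: Y_def x_def)
    done
  have U2U: "U2 \<subseteq> U" using U1 U2 by blast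
  define e where "e = (\<lambda>i. ar U1 U2 (e1 i))"
  have e: "e \<in> {..<4} \<rightarrow> carrier (As U2)" unfolding e_def by (rule ar_family_closed[OF U1(1,4) U2(1,3)])
  have ec: "e i \<in> carrier (As U2)" if "i < 4" for i using e that by auto
  have fe: "f i = S.gm z U2 (e i)" if "i < 4" for i
    using S.germ_res[OF U1(1) U2(1,2,3)] U1(4,5) that by (auto simp: e_def)
  interpret U2: assoc_alg "Bs U2" "As U2" by (rule alg_sections[OF U2(1)])
  interpret m: alg_map "Bs U2" "As U2" "Bz z" "Az z" "B.gm z U2" "S.gm z U2" by (rule germ_map[OF U2(1,2)])
  have gl: "S.gm z U2 (\<Oplus>\<^bsub>As U2\<^esub>i\<in>{..<4}. c i \<odot>\<^bsub>As U2\<^esub> e i) = (\<Oplus>\<^bsub>Az z\<^esub>i\<in>{..<4}. c' i \<odot>\<^bsub>Az z\<^esub> f i)"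
    if "c \<in> {..<4} \<rightarrow> carrier (Bs U2)" "\<And>i. i < 4 \<Longrightarrow> c' i = B.gm z U2 (c i)" for c c'
    unfolding m.g_lincomb[OF that(1) e]
    by (rule z.M.finsum_cong') (use that fe fz m.f_simps(1) in \<open>auto simp: Pi_iff\<close>)
  have Kf: "K j \<in> {..<4} \<rightarrow> carrier (Bs U2)" if "j < n" for j using KGTY(1) that by auto
  have Yf: "Y \<in> {..<4} \<rightarrow> carrier (Bs U2)" and Tf: "T \<in> {..<4} \<rightarrow> carrier (Bs U2)" using KGTY(3,4) by auto
  \<comment> \<open>\<open>L\<close> and \<open>H\<close> are the two sides of all identities
    between sections of the algebra: \<open>Inl j\<close> for the finite-type generators,
    \<open>None\<close> for the unit, \<open>Some (i, j)\<close> for the polar relations.\<close>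
  define L where "L = (\<lambda>x. case x of Inl j \<Rightarrow> ar U U2 (s j) | Inr None \<Rightarrow> \<one>\<^bsub>As U2\<^esub>
    | Inr (Some (i, j)) \<Rightarrow> e i \<otimes>\<^bsub>As U2\<^esub> e j \<oplus>\<^bsub>As U2\<^esub> e j \<otimes>\<^bsub>As U2\<^esub> e i)"
  define H where "H = (\<lambda>x. case x of Inl j \<Rightarrow> (\<Oplus>\<^bsub>As U2\<^esub>i\<in>{..<4}. K j i \<odot>\<^bsub>As U2\<^esub> e i)
    | Inr None \<Rightarrow> (\<Oplus>\<^bsub>As U2\<^esub>i\<in>{..<4}. Y i \<odot>\<^bsub>As U2\<^esub> e i)
    | Inr (Some (i, j)) \<Rightarrow> T i \<odot>\<^bsub>As U2\<^esub> e j \<oplus>\<^bsub>As U2\<^esub> T j \<odot>\<^bsub>As U2\<^esub> e i \<oplus>\<^bsub>As U2\<^esub> G i j \<odot>\<^bsub>As U2\<^esub> \<one>\<^bsub>As U2\<^esub>)"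
  let ?J = "Inl ` {..<n} \<union> Inr ` (insert None (Some ` ({..<4::nat} \<times> {..<4::nat})))"
  have sU2: "ar U U2 (s j) \<in> carrier (As U2)" if "j < n" for j
    using S.res_closed[OF U(1) U2(1) U2U] s that by auto
  have LJ: "L \<in> ?J \<rightarrow> carrier (As U2)" using sU2 ec by (auto simp: L_def)
  have HJ: "H \<in> ?J \<rightarrow> carrier (As U2)"
    using ec KGTY U2.lincomb_closed[OF Kf e] U2.lincomb_closed[OF Yf e] by (auto simp: H_def)
  have eqJ: "S.gm z U2 (L x) = S.gm z U2 (H x)" if "x \<in> ?J" for x
  proof -
    from that consider (1) j where "x = Inl j" "j < n" | (2) "x = Inr None"
      | (3) i j where "x = Inr (Some (i, j))" "i < 4" "j < 4" by auto
    then show ?thesis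
    proof cases
      case 1
      have "S.gm z U2 (ar U U2 (s j)) = S.gm z U (s j)" using S.germ_res[OF U(1) U2(1,2) U2U] s 1 by auto
      then show ?thesis using gl[OF Kf[OF 1(2)], of "k j"] KGTY(1) k(2) 1 by (simp add: L_def H_def)
    next
      case 2
      then show ?thesis using gl[OF Yf, of u] KGTY(4) u(2) m.g_simps(4) by (simp add: L_def H_def)
    next
      case 3
      then show ?thesis
        using g(2)[OF 3(2,3)] ec KGTY(2,3)
        by (simp add: L_def H_def m.g_simps m.g_smult fe[symmetric])
    qed
  qed
  have fin: "finite ?J" by auto
  obtain W1 where W1: "opn W1" "z \<in> W1" "W1 \<subseteq> U2"
    "\<forall>V. opn V \<longrightarrow> V \<subseteq> W1 \<longrightarrow> (\<forall>x\<in>?J. ar U2 V (L x) = ar U2 V (H x))"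
    using S.spread_equalities[OF fin U2(1,2) LJ HJ eqJ] by blast
  \<comment> \<open>The identity behind \<open>tr 1 = 2\<close> lies in the structure sheaf, not in
    the algebra, and is spread out separately; this yields the second neighbourhood
    \<open>W2\<close>.\<close>
  let ?l = "\<Oplus>\<^bsub>Bs U2\<^esub>i\<in>{..<4}. Y i \<otimes>\<^bsub>Bs U2\<^esub> T i" and ?r = "\<one>\<^bsub>Bs U2\<^esub> \<oplus>\<^bsub>Bs U2\<^esub> \<one>\<^bsub>Bs U2\<^esub>"
  have lr: "?l \<in> carrier (Bs U2)" "?r \<in> carrier (Bs U2)" using Yf Tf by (auto intro!: U2.R.finsum_closed)
  have "B.gm z U2 ?l = (\<Oplus>\<^bsub>Bz z\<^esub>i\<in>{..<4}. u i \<otimes>\<^bsub>Bz z\<^esub> tr (f i))"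
    unfolding m.f_sum_mult[OF Yf Tf]
    by (rule z.R.finsum_cong') (use KGTY(3,4) m.f_simps(1) in \<open>auto simp: Pi_iff\<close>)
  then have "B.gm z U2 ?l = B.gm z U2 ?r" unfolding ut by (simp add: m.f_simps)
  then obtain W2 where W2: "opn W2" "z \<in> W2" "W2 \<subseteq> U2" "br U2 W2 ?l = br U2 W2 ?r"
    using B.germ_eq_iff[OF U2(1,2) lr(1) U2(1,2) lr(2)] by auto
  let ?W = "W1 \<inter> W2"
  have W: "opn ?W" "z \<in> ?W" "?W \<subseteq> U2" "?W \<subseteq> U" using W1 W2 U2U by auto
  let ?e = "\<lambda>i. ar U2 ?W (e i)"
  have eW: "?e \<in> {..<4} \<rightarrow> carrier (As ?W)" by (rule ar_family_closed[OF U2(1) e W(1,3)])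
  have genW: "generates ?W ?e"
  proof (rule generates_of_generators[OF U(1) s gen W(1,4) eW])
    fix j assume j: "j < n"
    show "(\<lambda>i. br U2 ?W (K j i)) \<in> {..<4} \<rightarrow> carrier (Bs ?W)" by (rule br_family_closed[OF U2(1) Kf[OF j] W(1,3)])
    interpret r: alg_map "Bs U2" "As U2" "Bs ?W" "As ?W" "br U2 ?W" "ar U2 ?W" by (rule res_map[OF U2(1) W(1,3)])
    have "s j \<in> carrier (As U)" using s j by auto
    then have "ar U ?W (s j) = ar U2 ?W (L (Inl j))" using S.res_res[OF U(1) U2(1) W(1,3) U2U] by (simp add: L_def)
    also have "\<dots> = ar U2 ?W (H (Inl j))" using W1(4) W(1) j by blast
    also have "\<dots> = (\<Oplus>\<^bsub>As ?W\<^esub>i\<in>{..<4}. br U2 ?W (K j i) \<odot>\<^bsub>As ?W\<^esub> ar U2 ?W (e i))"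
      unfolding H_def sum.case by (rule r.g_lincomb[OF Kf[OF j] e])
    finally show "ar U ?W (s j) = (\<Oplus>\<^bsub>As ?W\<^esub>i\<in>{..<4}. br U2 ?W (K j i) \<odot>\<^bsub>As ?W\<^esub> ar U2 ?W (e i))" .
  qed
  let ?t = "\<lambda>i. br U2 ?W (T i)"
  have tW: "?t \<in> {..<4} \<rightarrow> carrier (Bs ?W)" by (rule br_family_closed[OF U2(1) Tf W(1,3)])
  have "\<exists>tr. quaternion_trace (Bs V) (As V) tr \<and> (\<forall>i<4. tr (ar ?W V (?e i)) = br ?W V (?t i))"
    if V: "opn V" "V \<subseteq> ?W" for V
  proof -
    have VU2: "V \<subseteq> U2" using V W by blast
    interpret V: assoc_alg "Bs V" "As V" by (rule alg_sections[OF V(1)])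
    interpret r: alg_map "Bs U2" "As U2" "Bs V" "As V" "br U2 V" "ar U2 V" by (rule res_map[OF U2(1) V(1) VU2])
    have eV: "ar ?W V (?e i) = ar U2 V (e i)" and tV: "br ?W V (?t i) = br U2 V (T i)" if "i < 4" for i
      using S.res_res[OF U2(1) W(1) V W(3) ec[OF that]] B.res_res[OF U2(1) W(1) V W(3)] KGTY(3) that by auto
    have basis: "is_basis (Bs V) (As V) 4 (\<lambda>i. ar ?W V (?e i))" by (rule sections_basis[OF genW V])
    have LH: "ar U2 V (L x) = ar U2 V (H x)" if "x \<in> ?J" for x using W1(4) V that by blast
    show ?thesis
    proof (rule V.quaternion_trace_of_basis[OF two[OF V(1)] basis, of "\<lambda>i. br ?W V (?t i)" "\<lambda>i. br U2 V (Y i)"])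
      show "(\<lambda>i. br ?W V (?t i)) \<in> {..<4} \<rightarrow> carrier (Bs V)" by (rule br_family_closed[OF W(1) tW V])
      show Yc: "(\<lambda>i. br U2 V (Y i)) \<in> {..<4} \<rightarrow> carrier (Bs V)" by (rule br_family_closed[OF U2(1) Yf V(1) VU2])
      have "\<one>\<^bsub>As V\<^esub> = ar U2 V (L (Inr None))" by (simp add: L_def r.g_simps)
      also have "\<dots> = ar U2 V (H (Inr None))" by (rule LH) simp
      also have "\<dots> = (\<Oplus>\<^bsub>As V\<^esub>i\<in>{..<4}. br U2 V (Y i) \<odot>\<^bsub>As V\<^esub> ar U2 V (e i))"
        unfolding H_def sum.case option.case by (rule r.g_lincomb[OF Yf e])
      also have "\<dots> = (\<Oplus>\<^bsub>As V\<^esub>i\<in>{..<4}. br U2 V (Y i) \<odot>\<^bsub>As V\<^esub> ar ?W V (?e i))"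
        using Yc r.g_simps(1)[OF ec] by (intro V.M.finsum_cong') (auto simp: eV Pi_iff)
      finally show "\<one>\<^bsub>As V\<^esub> = (\<Oplus>\<^bsub>As V\<^esub>i\<in>{..<4}. br U2 V (Y i) \<odot>\<^bsub>As V\<^esub> ar ?W V (?e i))" .
      have "(\<Oplus>\<^bsub>Bs V\<^esub>i\<in>{..<4}. br U2 V (Y i) \<otimes>\<^bsub>Bs V\<^esub> br ?W V (?t i)) =
          (\<Oplus>\<^bsub>Bs V\<^esub>i\<in>{..<4}. br U2 V (Y i) \<otimes>\<^bsub>Bs V\<^esub> br U2 V (T i))"
        using Yc r.f_simps(1) KGTY(3) by (intro V.R.finsum_cong') (auto simp: tV Pi_iff)
      also have "\<dots> = br U2 V ?l" by (rule r.f_sum_mult[OF Yf Tf, symmetric])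
      also have "\<dots> = br W2 V (br U2 W2 ?l)" using B.res_res[OF U2(1) W2(1) V(1) _ W2(3) lr(1)] V by auto
      also have "\<dots> = br U2 V ?r" unfolding W2(4) using B.res_res[OF U2(1) W2(1) V(1) _ W2(3) lr(2)] V by auto
      finally show "(\<Oplus>\<^bsub>Bs V\<^esub>i\<in>{..<4}. br U2 V (Y i) \<otimes>\<^bsub>Bs V\<^esub> br ?W V (?t i)) = \<one>\<^bsub>Bs V\<^esub> \<oplus>\<^bsub>Bs V\<^esub> \<one>\<^bsub>Bs V\<^esub>"
        by (simp add: r.f_simps)
      fix i j :: nat assume ij: "i < 4" "j < 4"
      have "ar U2 V (L (Inr (Some (i, j)))) = ar U2 V (H (Inr (Some (i, j))))" by (rule LH) (use ij in simp)
      then have "V.polar (br U2 V (T i)) (ar U2 V (e i)) (br U2 V (T j)) (ar U2 V (e j))"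
        unfolding V.polar_def using ij ec KGTY(2,3) r.f_simps(1)
        by (intro bexI[of _ "br U2 V (G i j)"]) (simp_all add: L_def H_def r.g_simps r.g_smult)
      then show "V.polar (br ?W V (?t i)) (ar ?W V (?e i)) (br ?W V (?t j)) (ar ?W V (?e j))"
        using ij by (simp add: eV tV)
    qed
  qed
  then have "trace_chart ?W ?e ?t" unfolding trace_chart_def using genW tW by blast
  then show ?thesis using W(2) by blast
qed

lemma locally_free: "locally_free Z A 4"
  unfolding locally_free_def
proof
  fix z assume "z \<in> topspace (topo Z)"
  then obtain W e t where W: "z \<in> W" "trace_chart W e t" using exists_trace_chart by blast
  then have g: "generates W e" by (simp add: trace_chart_def)
  have "opn W" "e \<in> {..<4} \<rightarrow> carrier (As W)" using g by (simp_all add: generates_def)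
  then show "\<exists>U e. opn U \<and> z \<in> U \<and> e \<in> {..<4} \<rightarrow> carrier (As U) \<and>
      (\<forall>V. opn V \<and> V \<subseteq> U \<longrightarrow> is_basis (Bs V) (As V) 4 (\<lambda>i. ar U V (e i)))"
    using W(1) sections_basis[OF g] by blast
qed

section \<open>Gluing the local traces\<close>

definition small :: "'p set \<Rightarrow> bool" where
  "small V \<longleftrightarrow> opn V \<and> (\<exists>W e t. trace_chart W e t \<and> V \<subseteq> W)"

text \<open>An arbitrary choice, harmless on small sets because the trace is unique there.\<close>

definition local_trace :: "'p set \<Rightarrow> 'a \<Rightarrow> 'r" where
  "local_trace V = (SOME tr. quaternion_trace (Bs V) (As V) tr)"

lemma small_subset: "small V \<Longrightarrow> opn V' \<Longrightarrow> V' \<subseteq> V \<Longrightarrow> small V'"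
  unfolding small_def by blast

lemma small_neighbourhood:
  assumes "opn U" "z \<in> U"
  shows "\<exists>V. small V \<and> z \<in> V \<and> V \<subseteq> U"
proof -
  obtain W e t where W: "z \<in> W" "trace_chart W e t" using exists_trace_chart[OF in_topspace[OF assms]] by blast
  have "opn W" using W(2) by (simp add: trace_chart_def generates_def)
  then have "small (U \<inter> W)" unfolding small_def using W assms by blast
  then show ?thesis using W assms by blast
qed

lemma local_trace:
  assumes "small V"
  shows "quaternion_trace (Bs V) (As V) (local_trace V)"
proof -
  have "\<exists>tr. quaternion_trace (Bs V) (As V) tr" using assms unfolding small_def trace_chart_def by blast
  then show ?thesis unfolding local_trace_def by (rule someI_ex)
qed

lemma local_trace_unique:
  assumes V: "small V" and tr: "quaternion_trace (Bs V) (As V) tr" and a: "a \<in> carrier (As V)"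
  shows "local_trace V a = tr a"
proof -
  have o: "opn V" using V by (simp add: small_def)
  interpret V: assoc_alg "Bs V" "As V" by (rule alg_sections[OF o])
  show ?thesis
  proof (cases "V = {}")
    \<comment> \<open>Over the empty set the ring of sections is not a domain; there
      \<open>locality\<close>, with no point to check, already identifies all sections.\<close>
    case True
    have "local_trace V a \<in> carrier (Bs V)" "tr a \<in> carrier (Bs V)"
      using V.quaternion_traceD(1)[OF local_trace[OF V] two[OF o]] V.quaternion_traceD(1)[OF tr two[OF o]] a
      by (auto simp: linear_map_regular_iff)
    then show ?thesis using True by (intro B.locality[OF o]) auto
  next
    case False
    then show ?thesis
      using V.quaternion_trace_unique[OF dom[OF o] two[OF o] local_trace[OF V] tr a] by blast
  qed
qed

lemma local_trace_simps:
  assumes V: "small V"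
  shows "\<And>a. a \<in> carrier (As V) \<Longrightarrow> local_trace V a \<in> carrier (Bs V)"
    and "\<And>a b. a \<in> carrier (As V) \<Longrightarrow> b \<in> carrier (As V) \<Longrightarrow>
      local_trace V (a \<oplus>\<^bsub>As V\<^esub> b) = local_trace V a \<oplus>\<^bsub>Bs V\<^esub> local_trace V b"
    and "\<And>r a. r \<in> carrier (Bs V) \<Longrightarrow> a \<in> carrier (As V) \<Longrightarrow>
      local_trace V (r \<odot>\<^bsub>As V\<^esub> a) = r \<otimes>\<^bsub>Bs V\<^esub> local_trace V a"
    and "local_trace V \<one>\<^bsub>As V\<^esub> = \<one>\<^bsub>Bs V\<^esub> \<oplus>\<^bsub>Bs V\<^esub> \<one>\<^bsub>Bs V\<^esub>"
    and "\<And>a. a \<in> carrier (As V) \<Longrightarrow> \<exists>g\<in>carrier (Bs V).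
      a \<otimes>\<^bsub>As V\<^esub> a = local_trace V a \<odot>\<^bsub>As V\<^esub> a \<oplus>\<^bsub>As V\<^esub> g \<odot>\<^bsub>As V\<^esub> \<one>\<^bsub>As V\<^esub>"
proof -
  have o: "opn V" using V by (simp add: small_def)
  interpret V: assoc_alg "Bs V" "As V" by (rule alg_sections[OF o])
  note D = V.quaternion_traceD[OF local_trace[OF V] two[OF o]]
  show "\<And>a. a \<in> carrier (As V) \<Longrightarrow> local_trace V a \<in> carrier (Bs V)"
    "\<And>a b. a \<in> carrier (As V) \<Longrightarrow> b \<in> carrier (As V) \<Longrightarrow>
      local_trace V (a \<oplus>\<^bsub>As V\<^esub> b) = local_trace V a \<oplus>\<^bsub>Bs V\<^esub> local_trace V b"
    "\<And>r a. r \<in> carrier (Bs V) \<Longrightarrow> a \<in> carrier (As V) \<Longrightarrow>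
      local_trace V (r \<odot>\<^bsub>As V\<^esub> a) = r \<otimes>\<^bsub>Bs V\<^esub> local_trace V a"
    using D(1) by (auto simp: linear_map_regular_iff)
  show "local_trace V \<one>\<^bsub>As V\<^esub> = \<one>\<^bsub>Bs V\<^esub> \<oplus>\<^bsub>Bs V\<^esub> \<one>\<^bsub>Bs V\<^esub>" by (rule D(2))
  show "\<And>a. a \<in> carrier (As V) \<Longrightarrow> \<exists>g\<in>carrier (Bs V).
      a \<otimes>\<^bsub>As V\<^esub> a = local_trace V a \<odot>\<^bsub>As V\<^esub> a \<oplus>\<^bsub>As V\<^esub> g \<odot>\<^bsub>As V\<^esub> \<one>\<^bsub>As V\<^esub>" by (rule D(3))
qed

text \<open>Uniqueness alone does not compare the two traces, since not every section over
  \<open>Y\<close> is a restriction from \<open>V\<close>. Both are computed on the basis of a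
  common chart, where their values come from the same \<open>t\<close>.\<close>

lemma local_trace_res:
  assumes V: "small V" and Y: "opn Y" "Y \<subseteq> V" and a: "a \<in> carrier (As V)"
  shows "local_trace Y (ar V Y a) = br V Y (local_trace V a)"
proof -
  obtain W e t where W: "trace_chart W e t" "V \<subseteq> W" and o: "opn V" using V by (auto simp: small_def)
  have g: "generates W e" and t: "t \<in> {..<4} \<rightarrow> carrier (Bs W)" using W(1) by (auto simp: trace_chart_def)
  have We: "opn W" "e \<in> {..<4} \<rightarrow> carrier (As W)" using g by (auto simp: generates_def)
  have YW: "Y \<subseteq> W" using Y W by blast
  have sY: "small Y" by (rule small_subset[OF V Y])
  obtain tr where tr: "quaternion_trace (Bs V) (As V) tr" "\<forall>i<4. tr (ar W V (e i)) = br W V (t i)"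
    using W o unfolding trace_chart_def by blast
  obtain tr' where tr': "quaternion_trace (Bs Y) (As Y) tr'" "\<forall>i<4. tr' (ar W Y (e i)) = br W Y (t i)"
    using W(1) Y(1) YW unfolding trace_chart_def by blast
  interpret r: alg_map "Bs V" "As V" "Bs Y" "As Y" "br V Y" "ar V Y" by (rule res_map[OF o Y])
  have eV: "(\<lambda>i. ar W V (e i)) \<in> {..<4} \<rightarrow> carrier (As V)" by (rule ar_family_closed[OF We o W(2)])
  have eY: "(\<lambda>i. ar W Y (e i)) \<in> {..<4} \<rightarrow> carrier (As Y)" by (rule ar_family_closed[OF We Y(1) YW])
  have tV: "(\<lambda>i. br W V (t i)) \<in> {..<4} \<rightarrow> carrier (Bs V)" by (rule br_family_closed[OF We(1) t o W(2)])
  have tY: "br V Y (br W V (t i)) = br W Y (t i)" if "i < 4" for i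
    using B.res_res[OF We(1) o Y(1,2) W(2)] t that by auto
  obtain c where c: "c \<in> {..<4} \<rightarrow> carrier (Bs V)" and ac: "a = (\<Oplus>\<^bsub>As V\<^esub>i\<in>{..<4}. c i \<odot>\<^bsub>As V\<^esub> ar W V (e i))"
    using r.A.is_basisD(2)[OF sections_basis[OF g o W(2)] a] by (elim bexE)
  have cY: "(\<lambda>i. br V Y (c i)) \<in> {..<4} \<rightarrow> carrier (Bs Y)" by (rule br_family_closed[OF o c Y])
  note lV = r.A.quaternion_traceD(1)[OF tr(1) two[OF o]] and lY = r.B.quaternion_traceD(1)[OF tr'(1) two[OF Y(1)]]
  have "local_trace V a = (\<Oplus>\<^bsub>Bs V\<^esub>i\<in>{..<4}. c i \<otimes>\<^bsub>Bs V\<^esub> tr (ar W V (e i)))"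
    unfolding local_trace_unique[OF V tr(1) a] unfolding ac by (rule r.A.linear_map_lincomb[OF lV _ c eV]) simp
  also have "\<dots> = (\<Oplus>\<^bsub>Bs V\<^esub>i\<in>{..<4}. c i \<otimes>\<^bsub>Bs V\<^esub> br W V (t i))"
    using c tV tr(2) by (intro r.A.R.finsum_cong') (auto simp: Pi_iff)
  finally have "br V Y (local_trace V a) = (\<Oplus>\<^bsub>Bs Y\<^esub>i\<in>{..<4}. br V Y (c i) \<otimes>\<^bsub>Bs Y\<^esub> br V Y (br W V (t i)))"
    using r.f_sum_mult[OF c tV] by simp
  also have "\<dots> = (\<Oplus>\<^bsub>Bs Y\<^esub>i\<in>{..<4}. br V Y (c i) \<otimes>\<^bsub>Bs Y\<^esub> tr' (ar W Y (e i)))"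
    using cY br_family_closed[OF We(1) t Y(1) YW] tr'(2) by (intro r.B.R.finsum_cong') (auto simp: Pi_iff tY)
  also have "\<dots> = tr' (\<Oplus>\<^bsub>As Y\<^esub>i\<in>{..<4}. br V Y (c i) \<odot>\<^bsub>As Y\<^esub> ar W Y (e i))"
    by (rule r.B.linear_map_lincomb[OF lY _ cY eY, symmetric]) simp
  also have "\<dots> = tr' (ar V Y a)" unfolding ac ar_lincomb[OF o Y We(1) W(2) c We(2)] ..
  also have "\<dots> = local_trace Y (ar V Y a)"
    by (rule local_trace_unique[OF sY tr'(1) r.g_simps(1)[OF a], symmetric])
  finally show ?thesis ..
qed

text \<open>The section is prescribed on small sets only; these cover \<open>U\<close> and determine
  it.\<close>

definition glued_trace :: "'p set \<Rightarrow> 'a \<Rightarrow> 'r" where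
  "glued_trace U a = (SOME s. s \<in> carrier (Bs U) \<and>
     (\<forall>V. small V \<longrightarrow> V \<subseteq> U \<longrightarrow> br U V s = local_trace V (ar U V a)))"

lemma glued_trace:
  assumes U: "opn U" and a: "a \<in> carrier (As U)"
  shows "glued_trace U a \<in> carrier (Bs U)"
    and "\<And>V. small V \<Longrightarrow> V \<subseteq> U \<Longrightarrow> br U V (glued_trace U a) = local_trace V (ar U V a)"
proof -
  have aV: "ar U V a \<in> carrier (As V)" if "opn V" "V \<subseteq> U" for V using S.res_closed[OF U that a] .
  have "\<exists>s\<in>carrier (Bs U). \<forall>V. opn V \<longrightarrow> V \<subseteq> U \<longrightarrow>
      (\<forall>t\<in>carrier (Bs V). small V \<and> t = local_trace V (ar U V a) \<longrightarrow> br U V s = t)"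
  proof (rule B.glue[OF U])
    fix V Y s assume V: "opn V" "V \<subseteq> U" and Y: "opn Y" "Y \<subseteq> V" and s: "small V \<and> s = local_trace V (ar U V a)"
    have "ar V Y (ar U V a) = ar U Y a" by (rule S.res_res[OF U V(1) Y V(2) a])
    then show "small Y \<and> br V Y s = local_trace Y (ar U Y a)"
      using s local_trace_res[OF _ Y aV[OF V]] small_subset[OF _ Y] by simp
  next
    fix z assume "z \<in> U"
    from small_neighbourhood[OF U this] obtain V where V: "small V" "z \<in> V" "V \<subseteq> U" by blast
    moreover have "opn V" using V by (simp add: small_def)
    moreover have "local_trace V (ar U V a) \<in> carrier (Bs V)"
      by (rule local_trace_simps(1)[OF V(1) aV[OF \<open>opn V\<close> V(3)]])
    ultimately show "\<exists>V. opn V \<and> z \<in> V \<and> V \<subseteq> U \<and>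
        (\<exists>s\<in>carrier (Bs V). small V \<and> s = local_trace V (ar U V a))" by blast
  qed simp
  then obtain s where s: "s \<in> carrier (Bs U)" and s': "\<forall>V. opn V \<longrightarrow> V \<subseteq> U \<longrightarrow>
      (\<forall>t\<in>carrier (Bs V). small V \<and> t = local_trace V (ar U V a) \<longrightarrow> br U V s = t)" by blast
  have "br U V s = local_trace V (ar U V a)" if "small V" "V \<subseteq> U" for V
  proof -
    have o: "opn V" using that by (simp add: small_def)
    show ?thesis using s' o that local_trace_simps(1)[OF that(1) aV[OF o that(2)]] by blast
  qed
  then have "\<exists>s. s \<in> carrier (Bs U) \<and> (\<forall>V. small V \<longrightarrow> V \<subseteq> U \<longrightarrow> br U V s = local_trace V (ar U V a))"
    using s by blast
  from someI_ex[OF this] show "glued_trace U a \<in> carrier (Bs U)"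
    "\<And>V. small V \<Longrightarrow> V \<subseteq> U \<Longrightarrow> br U V (glued_trace U a) = local_trace V (ar U V a)"
    unfolding glued_trace_def by blast+
qed

text \<open>Small sets are a basis of the topology. All properties of the glued trace are checked on
  them through this lemma.\<close>

lemma equal_on_small:
  assumes U: "opn U" and s: "s \<in> carrier (Bs U)" and t: "t \<in> carrier (Bs U)"
    and eq: "\<And>V. small V \<Longrightarrow> opn V \<Longrightarrow> V \<subseteq> U \<Longrightarrow> br U V s = br U V t"
  shows "s = t"
proof (rule B.locality[OF U s t])
  fix z assume "z \<in> U"
  from small_neighbourhood[OF U this] show "\<exists>V. opn V \<and> z \<in> V \<and> V \<subseteq> U \<and> br U V s = br U V t"
    using eq small_def by blast
qed

lemma glued_trace_linear:
  assumes U: "opn U"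
  shows "linear_map (Bs U) (As U) (regular_module (Bs U)) (glued_trace U)"
  unfolding linear_map_regular_iff
proof (intro conjI ballI)
  interpret U: assoc_alg "Bs U" "As U" by (rule alg_sections[OF U])
  show "glued_trace U \<in> carrier (As U) \<rightarrow> carrier (Bs U)" using glued_trace(1)[OF U] by blast
  fix a assume a: "a \<in> carrier (As U)"
  note Ta = glued_trace[OF U a]
  {
    fix b assume b: "b \<in> carrier (As U)"
    note Tb = glued_trace[OF U b]
    have ab: "a \<oplus>\<^bsub>As U\<^esub> b \<in> carrier (As U)" using a b by simp
    show "glued_trace U (a \<oplus>\<^bsub>As U\<^esub> b) = glued_trace U a \<oplus>\<^bsub>Bs U\<^esub> glued_trace U b"
    proof (rule equal_on_small[OF U glued_trace(1)[OF U ab]])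
      show "glued_trace U a \<oplus>\<^bsub>Bs U\<^esub> glued_trace U b \<in> carrier (Bs U)" using Ta Tb by simp
      fix V assume V: "small V" "opn V" "V \<subseteq> U"
      interpret r: alg_map "Bs U" "As U" "Bs V" "As V" "br U V" "ar U V" by (rule res_map[OF U V(2,3)])
      show "br U V (glued_trace U (a \<oplus>\<^bsub>As U\<^esub> b)) = br U V (glued_trace U a \<oplus>\<^bsub>Bs U\<^esub> glued_trace U b)"
        using Ta Tb a b glued_trace(2)[OF U ab V(1,3)] V
        by (simp add: r.f_simps r.g_simps local_trace_simps[OF V(1)])
    qed
  }
  fix r assume r: "r \<in> carrier (Bs U)"
  have ra: "r \<odot>\<^bsub>As U\<^esub> a \<in> carrier (As U)" using a r by simp
  show "glued_trace U (r \<odot>\<^bsub>As U\<^esub> a) = r \<otimes>\<^bsub>Bs U\<^esub> glued_trace U a"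
  proof (rule equal_on_small[OF U glued_trace(1)[OF U ra]])
    show "r \<otimes>\<^bsub>Bs U\<^esub> glued_trace U a \<in> carrier (Bs U)" using Ta r by simp
    fix V assume V: "small V" "opn V" "V \<subseteq> U"
    interpret r: alg_map "Bs U" "As U" "Bs V" "As V" "br U V" "ar U V" by (rule res_map[OF U V(2,3)])
    show "br U V (glued_trace U (r \<odot>\<^bsub>As U\<^esub> a)) = br U V (r \<otimes>\<^bsub>Bs U\<^esub> glued_trace U a)"
      using Ta a r glued_trace(2)[OF U ra V(1,3)] V
      by (simp add: r.f_simps r.g_simps r.g_smult local_trace_simps[OF V(1)])
  qed
qed

lemma glued_trace_one:
  assumes U: "opn U"
  shows "glued_trace U \<one>\<^bsub>As U\<^esub> = \<one>\<^bsub>Bs U\<^esub> \<oplus>\<^bsub>Bs U\<^esub> \<one>\<^bsub>Bs U\<^esub>"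
proof -
  interpret U: assoc_alg "Bs U" "As U" by (rule alg_sections[OF U])
  show ?thesis
  proof (rule equal_on_small[OF U glued_trace(1)[OF U U.A.one_closed]])
    fix V assume V: "small V" "opn V" "V \<subseteq> U"
    interpret r: alg_map "Bs U" "As U" "Bs V" "As V" "br U V" "ar U V" by (rule res_map[OF U V(2,3)])
    show "br U V (glued_trace U \<one>\<^bsub>As U\<^esub>) = br U V (\<one>\<^bsub>Bs U\<^esub> \<oplus>\<^bsub>Bs U\<^esub> \<one>\<^bsub>Bs U\<^esub>)"
      using glued_trace(2)[OF U U.A.one_closed V(1,3)]
      by (simp add: r.f_simps r.g_simps local_trace_simps[OF V(1)])
  qed simp
qed

lemma glued_trace_res:
  assumes U: "opn U" and V: "opn V" "V \<subseteq> U" and a: "a \<in> carrier (As U)"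
  shows "glued_trace V (ar U V a) = br U V (glued_trace U a)"
proof -
  have aV: "ar U V a \<in> carrier (As V)" by (rule S.res_closed[OF U V a])
  show ?thesis
  proof (rule equal_on_small[OF V(1) glued_trace(1)[OF V(1) aV] B.res_closed[OF U V glued_trace(1)[OF U a]]])
    fix Y assume Y: "small Y" "opn Y" "Y \<subseteq> V"
    have YU: "Y \<subseteq> U" using Y V by blast
    show "br V Y (glued_trace V (ar U V a)) = br V Y (br U V (glued_trace U a))"
      unfolding B.res_res[OF U V(1) Y(2,3) V(2) glued_trace(1)[OF U a]] glued_trace(2)[OF U a Y(1) YU]
        glued_trace(2)[OF V(1) aV Y(1,3)] S.res_res[OF U V(1) Y(2,3) V(2) a] ..
  qed
qed

text \<open>A scalar is half the trace of its multiple of the unit, so it can be recovered from that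
  multiple.\<close>

lemma scalar_unique:
  assumes U: "opn U" and g: "g \<in> carrier (Bs U)" and h: "h \<in> carrier (Bs U)"
    and eq: "g \<odot>\<^bsub>As U\<^esub> \<one>\<^bsub>As U\<^esub> = h \<odot>\<^bsub>As U\<^esub> \<one>\<^bsub>As U\<^esub>"
  shows "g = h"
proof -
  interpret U: assoc_alg "Bs U" "As U" by (rule alg_sections[OF U])
  have "g \<otimes>\<^bsub>Bs U\<^esub> (\<one>\<^bsub>Bs U\<^esub> \<oplus>\<^bsub>Bs U\<^esub> \<one>\<^bsub>Bs U\<^esub>) = h \<otimes>\<^bsub>Bs U\<^esub> (\<one>\<^bsub>Bs U\<^esub> \<oplus>\<^bsub>Bs U\<^esub> \<one>\<^bsub>Bs U\<^esub>)"
    using glued_trace_linear[OF U] eq g h glued_trace_one[OF U] unfolding linear_map_regular_iff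
    by (metis U.A.one_closed)
  moreover have "x = half (Bs U) \<otimes>\<^bsub>Bs U\<^esub> (x \<otimes>\<^bsub>Bs U\<^esub> (\<one>\<^bsub>Bs U\<^esub> \<oplus>\<^bsub>Bs U\<^esub> \<one>\<^bsub>Bs U\<^esub>))" if x: "x \<in> carrier (Bs U)" for x
  proof -
    have "half (Bs U) \<otimes>\<^bsub>Bs U\<^esub> (x \<otimes>\<^bsub>Bs U\<^esub> (\<one>\<^bsub>Bs U\<^esub> \<oplus>\<^bsub>Bs U\<^esub> \<one>\<^bsub>Bs U\<^esub>)) =
        x \<otimes>\<^bsub>Bs U\<^esub> (half (Bs U) \<otimes>\<^bsub>Bs U\<^esub> (\<one>\<^bsub>Bs U\<^esub> \<oplus>\<^bsub>Bs U\<^esub> \<one>\<^bsub>Bs U\<^esub>))"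
      using x U.half_closed(1)[OF two[OF U]] by (intro U.R.m_lcomm) simp_all
    then show ?thesis unfolding U.half_closed(2)[OF two[OF U]] using x by simp
  qed
  ultimately show ?thesis using g h by metis
qed

text \<open>On small sets the quadratic equation holds with some scalar, which is unique by
  \<open>scalar_unique\<close>. These scalars glue to a section over \<open>U\<close>, and the
  equation then holds locally, hence on \<open>U\<close>.\<close>

lemma glued_trace_square:
  assumes U: "opn U" and a: "a \<in> carrier (As U)"
  shows "\<exists>g\<in>carrier (Bs U). a \<otimes>\<^bsub>As U\<^esub> a = glued_trace U a \<odot>\<^bsub>As U\<^esub> a \<oplus>\<^bsub>As U\<^esub> g \<odot>\<^bsub>As U\<^esub> \<one>\<^bsub>As U\<^esub>"
proof -
  interpret U: assoc_alg "Bs U" "As U" by (rule alg_sections[OF U])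
  note Ta = glued_trace[OF U a]
  define P where "P = (\<lambda>V g. ar U V (a \<otimes>\<^bsub>As U\<^esub> a) =
    ar U V (glued_trace U a \<odot>\<^bsub>As U\<^esub> a) \<oplus>\<^bsub>As V\<^esub> g \<odot>\<^bsub>As V\<^esub> \<one>\<^bsub>As V\<^esub>)"
  have aa: "a \<otimes>\<^bsub>As U\<^esub> a \<in> carrier (As U)" and ta: "glued_trace U a \<odot>\<^bsub>As U\<^esub> a \<in> carrier (As U)"
    using a Ta by auto
  have "\<exists>g\<in>carrier (Bs U). \<forall>V. opn V \<longrightarrow> V \<subseteq> U \<longrightarrow> (\<forall>t\<in>carrier (Bs V). P V t \<longrightarrow> br U V g = t)"
  proof (rule B.glue[OF U])
    fix V Y s assume V: "opn V" "V \<subseteq> U" and Y: "opn Y" "Y \<subseteq> V" and s: "s \<in> carrier (Bs V)" "P V s"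
    interpret r: alg_map "Bs V" "As V" "Bs Y" "As Y" "br V Y" "ar V Y" by (rule res_map[OF V(1) Y])
    have c: "ar U V (glued_trace U a \<odot>\<^bsub>As U\<^esub> a) \<in> carrier (As V)" by (rule S.res_closed[OF U V ta])
    have "ar U Y (a \<otimes>\<^bsub>As U\<^esub> a) = ar V Y (ar U V (glued_trace U a \<odot>\<^bsub>As U\<^esub> a) \<oplus>\<^bsub>As V\<^esub> s \<odot>\<^bsub>As V\<^esub> \<one>\<^bsub>As V\<^esub>)"
      using s(2) S.res_res[OF U V(1) Y V(2) aa] by (simp add: P_def)
    also have "\<dots> = ar U Y (glued_trace U a \<odot>\<^bsub>As U\<^esub> a) \<oplus>\<^bsub>As Y\<^esub> br V Y s \<odot>\<^bsub>As Y\<^esub> \<one>\<^bsub>As Y\<^esub>"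
      using c s(1) S.res_res[OF U V(1) Y V(2) ta] by (simp add: r.g_simps r.g_smult)
    finally show "P Y (br V Y s)" by (simp add: P_def)
  next
    fix V s t assume V: "opn V" "V \<subseteq> U" and st: "s \<in> carrier (Bs V)" "t \<in> carrier (Bs V)" "P V s" "P V t"
    interpret V: assoc_alg "Bs V" "As V" by (rule alg_sections[OF V(1)])
    have c: "ar U V (glued_trace U a \<odot>\<^bsub>As U\<^esub> a) \<in> carrier (As V)" by (rule S.res_closed[OF U V ta])
    have "s \<odot>\<^bsub>As V\<^esub> \<one>\<^bsub>As V\<^esub> = t \<odot>\<^bsub>As V\<^esub> \<one>\<^bsub>As V\<^esub>"
      using st c by (simp add: P_def)
    then show "s = t" by (rule scalar_unique[OF V(1) st(1,2)])
  next
    fix z assume "z \<in> U"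
    from small_neighbourhood[OF U this] obtain V where V: "small V" "z \<in> V" "V \<subseteq> U" by blast
    have o: "opn V" using V by (simp add: small_def)
    interpret r: alg_map "Bs U" "As U" "Bs V" "As V" "br U V" "ar U V" by (rule res_map[OF U o V(3)])
    from local_trace_simps(5)[OF V(1) r.g_simps(1)[OF a]] obtain g where g: "g \<in> carrier (Bs V)"
      "ar U V a \<otimes>\<^bsub>As V\<^esub> ar U V a = local_trace V (ar U V a) \<odot>\<^bsub>As V\<^esub> ar U V a \<oplus>\<^bsub>As V\<^esub> g \<odot>\<^bsub>As V\<^esub> \<one>\<^bsub>As V\<^esub>" by blast
    then have "P V g" using a Ta(1) Ta(2)[OF V(1,3)] by (simp add: P_def r.g_simps r.g_smult)
    then show "\<exists>V. opn V \<and> z \<in> V \<and> V \<subseteq> U \<and> (\<exists>s\<in>carrier (Bs V). P V s)" using V o g(1) by blast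
  qed
  then obtain g where g: "g \<in> carrier (Bs U)"
    "\<forall>V. opn V \<longrightarrow> V \<subseteq> U \<longrightarrow> (\<forall>t\<in>carrier (Bs V). P V t \<longrightarrow> br U V g = t)" by blast
  have "a \<otimes>\<^bsub>As U\<^esub> a = glued_trace U a \<odot>\<^bsub>As U\<^esub> a \<oplus>\<^bsub>As U\<^esub> g \<odot>\<^bsub>As U\<^esub> \<one>\<^bsub>As U\<^esub>"
  proof (rule S.locality[OF U aa])
    show "glued_trace U a \<odot>\<^bsub>As U\<^esub> a \<oplus>\<^bsub>As U\<^esub> g \<odot>\<^bsub>As U\<^esub> \<one>\<^bsub>As U\<^esub> \<in> carrier (As U)" using ta g(1) by simp
    fix z assume "z \<in> U"
    from small_neighbourhood[OF U this] obtain V where V: "small V" "z \<in> V" "V \<subseteq> U" by blast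
    have o: "opn V" using V by (simp add: small_def)
    interpret r: alg_map "Bs U" "As U" "Bs V" "As V" "br U V" "ar U V" by (rule res_map[OF U o V(3)])
    from local_trace_simps(5)[OF V(1) r.g_simps(1)[OF a]] obtain h where h: "h \<in> carrier (Bs V)"
      "ar U V a \<otimes>\<^bsub>As V\<^esub> ar U V a = local_trace V (ar U V a) \<odot>\<^bsub>As V\<^esub> ar U V a \<oplus>\<^bsub>As V\<^esub> h \<odot>\<^bsub>As V\<^esub> \<one>\<^bsub>As V\<^esub>" by blast
    then have Ph: "P V h" using a Ta(1) Ta(2)[OF V(1,3)] by (simp add: P_def r.g_simps r.g_smult)
    then have "br U V g = h" using g(2) o V(3) h(1) by blast
    then have "ar U V (a \<otimes>\<^bsub>As U\<^esub> a) = ar U V (glued_trace U a \<odot>\<^bsub>As U\<^esub> a \<oplus>\<^bsub>As U\<^esub> g \<odot>\<^bsub>As U\<^esub> \<one>\<^bsub>As U\<^esub>)"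
      using Ph ta g(1) by (simp add: P_def r.g_simps(2,4) r.g_smult)
    then show "\<exists>V. opn V \<and> z \<in> V \<and> V \<subseteq> U \<and> ar U V (a \<otimes>\<^bsub>As U\<^esub> a) =
        ar U V (glued_trace U a \<odot>\<^bsub>As U\<^esub> a \<oplus>\<^bsub>As U\<^esub> g \<odot>\<^bsub>As U\<^esub> \<one>\<^bsub>As U\<^esub>)" using V o by blast
  qed
  with g(1) show ?thesis by blast
qed

theorem quaternion: "quaternion Z A"
proof -
  have "quaternion_trace (Bs U) (As U) (glued_trace U)" if U: "opn U" for U
  proof -
    interpret U: assoc_alg "Bs U" "As U" by (rule alg_sections[OF U])
    show ?thesis
      by (rule U.quaternion_traceI[OF two[OF U] glued_trace_linear[OF U] glued_trace_one[OF U] glued_trace_square[OF U]])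
  qed
  then show ?thesis
    unfolding quaternion_def using alg locally_free glued_trace_res by blast
qed

end

lemma two_unit_in_field:
  assumes "field k" "\<one>\<^bsub>k\<^esub> \<oplus>\<^bsub>k\<^esub> \<one>\<^bsub>k\<^esub> \<noteq> \<zero>\<^bsub>k\<^esub>"
  shows "\<one>\<^bsub>k\<^esub> \<oplus>\<^bsub>k\<^esub> \<one>\<^bsub>k\<^esub> \<in> Units k"
proof -
  interpret field k by fact
  show ?thesis using assms(2) by (simp add: field_Units)
qed

theorem proposition4p7:
  fixes k :: "'k ring" and c :: "'k \<Rightarrow> 'r"
    and Z :: "('p, 'r) ringed_space" and A :: "('p, 'r, 'a) sheaf_algebra"
  assumes "field k" and "\<one>\<^bsub>k\<^esub> \<oplus>\<^bsub>k\<^esub> \<one>\<^bsub>k\<^esub> \<noteq> \<zero>\<^bsub>k\<^esub>"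
    and "noetherian_scheme Z" and "scheme_over k Z c" and "integral_scheme Z"
    and "structure_sheaf_algebra Z A" and "finite_type Z A"
  shows "(locally_quaternion Z A \<longrightarrow> quaternion Z A) \<and>
    (locally_even_clifford Z A \<and> has_rank Z A 4 \<longrightarrow> quaternion Z A)"
proof -
  let ?T = "topspace (topo Z)"
  have ringed: "ringed_space Z" using assms(5) by (simp add: integral_scheme_def scheme_def)
  have dom: "domain (sect Z U)" if "openin (topo Z) U" "U \<noteq> {}" for U
    using assms(5) that by (simp add: integral_scheme_def)
  interpret B: ring_sheaf "topo Z" "sect Z" "rest Z"
    using ringed by unfold_locales (simp add: ringed_space_def)
  have c: "c \<in> ring_hom k (sect Z ?T)" using assms(4) by (simp add: scheme_over_def)
  interpret k: field k by fact
  have two: "\<one>\<^bsub>sect Z ?T\<^esub> \<oplus>\<^bsub>sect Z ?T\<^esub> \<one>\<^bsub>sect Z ?T\<^esub> \<in> Units (sect Z ?T)"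
    by (rule two_unit_hom[OF c k.ring_axioms B.ring_F[OF openin_topspace] two_unit_in_field[OF assms(1,2)]])
  have two_stalk: "\<one>\<^bsub>local_ring_at Z z\<^esub> \<oplus>\<^bsub>local_ring_at Z z\<^esub> \<one>\<^bsub>local_ring_at Z z\<^esub> \<in> Units (local_ring_at Z z)"
    if "z \<in> ?T" "cring (local_ring_at Z z)" for z
    by (rule two_unit_hom[OF B.germ_hom[OF openin_topspace that(1)] B.ring_F[OF openin_topspace] _ two])
      (rule cring.axioms(1)[OF that(2)])
  have main: "quaternion Z A"
    if "\<And>z. z \<in> ?T \<Longrightarrow> assoc_algebra (local_ring_at Z z) (stalk_algebra Z A z)"
      "\<And>z. z \<in> ?T \<Longrightarrow> free_of_rank (local_ring_at Z z) (stalk_algebra Z A z) 4"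
      "\<And>z. z \<in> ?T \<Longrightarrow> \<exists>tr. quaternion_trace (local_ring_at Z z) (stalk_algebra Z A z) tr"
    by (rule quaternion_stalks.quaternion, rule quaternion_stalks.intro[OF ringed assms(6,7) dom two that])
  show ?thesis
  proof (intro conjI impI)
    assume "locally_quaternion Z A"
    then show "quaternion Z A"
      by (intro main) (simp_all add: locally_quaternion_def quaternion_algebra_def)
  next
    assume cl: "locally_even_clifford Z A \<and> has_rank Z A 4"
    show "quaternion Z A"
    proof (rule main)
      fix z assume z: "z \<in> ?T"
      have e: "even_clifford_algebra (local_ring_at Z z) (stalk_algebra Z A z)"
        using cl z by (simp add: locally_even_clifford_def)
      show a: "assoc_algebra (local_ring_at Z z) (stalk_algebra Z A z)"
        using e by (simp add: even_clifford_algebra_def)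
      show f: "free_of_rank (local_ring_at Z z) (stalk_algebra Z A z) 4" using cl z by (simp add: has_rank_def)
      \<comment> \<open>Commutativity of the local ring is read off from the module structure of the
        stalk.\<close>
      have cr: "cring (local_ring_at Z z)" using a by (simp add: assoc_algebra_def module_def)
      show "\<exists>tr. quaternion_trace (local_ring_at Z z) (stalk_algebra Z A z) tr"
        by (rule even_clifford_quaternion_trace[OF B.domain_stalk[OF dom cr z] two_stalk[OF z cr] e f])
    qed
  qed
qed

end
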